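(* Let $\mathcal T$ be a finite simplicial complex of dimension $n$, let $\mathcal P=(\mathcal P_T)_{T\in\mathcal T}$ be a family of admissible sequence types satisfying the hierarchy condition and containing the Whitney forms, with local extension operators and a smooth Riemannian metric $g$ on each simplex, and let $I^k_{\mathcal P}:C^\infty\Lambda^k(\mathcal T)\to\mathcal P\Lambda^k(\mathcal T)$ be the canonical interpolant, all as described in the context. Then for every $k$ and every $\omega\in C^\infty\Lambda^k(\mathcal T)$, $$d^k I^k_{\mathcal P}\omega=I^{k+1}_{\mathcal P}d^k\omega.$$
   Context: **Simplices and polynomial forms.** Simplices are closed nondegenerate simplices in some $\mathbb R^N$, each with a fixed orientation. For a simplex $T$ of dimension $n_T$, $\Delta(T)$ is the set of its nonempty subsimplices (including $T$). $C^\infty\Lambda^k(T)$ is the space of smooth differential $k$-forms on $T$ (pullbacks of smooth forms on the ambient space; zero for $k\notin\{0,\dots,n_T\}$), $d^k$ is the exterior derivative, and for $F\in\Delta(T)$, $\operatorname{tr}^k_{T,F}$ is pullback of $k$-forms along the inclusion $F\to T$. With barycentric coordinates $\lambda_0,\dots,\lambda_{n_T}$ of $T$ and $r\in\mathbb Z$: $\mathcal P_r\Lambda^k(T)$ is spanned by $\lambda^\alpha d\lambda_{\sigma(1)}\wedge\dots\wedge d\lambda_{\sigma(k)}$ with $\alpha\in\mathbb N_0^{n_T+1}$, $|\alpha|=r$, $0\le\sigma(1)<\dots<\sigma(k)\le n_T$; $\mathcal P^-_r\Lambda^k(T)$ is spanned by $\lambda^\alpha\phi_\rho$ with $|\alpha|=r-1$,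 $0\le\rho(0)<\dots<\rho(k)\le n_T$, where $\phi_\rho=\sum_{i=0}^k(-1)^i\lambda_{\rho(i)}\,d\lambda_{\rho(0)}\wedge\dots\widehat{d\lambda_{\rho(i)}}\dots\wedge d\lambda_{\rho(k)}$. (So $\mathcal P_r\Lambda^k=0$ for $r<0$ and $\mathcal P_r^-\Lambda^k=0$ for $r\le0$.) **Types.** $\mathscr S=\{\dots,\mathcal P_{r-1},\mathcal P_r^-,\mathcal P_r,\mathcal P_{r+1}^-,\dots\}$ ($r\in\mathbb Z$) is a set of formal symbols, totally ordered by $\mathcal P_r^-\le\mathcal P_r\le\mathcal P_{r+1}^-$. An admissible sequence type is a map $\mathcal P:\mathbb Z\to\mathscr S$ such that $\mathcal P(k)\in\{\mathcal P_r^-,\mathcal P_r\}$ implies $\mathcal P(k+1)\in\{\mathcal P_r^-,\mathcal P_{r-1}\}$; $\mathcal P\le\mathcal S$ means $\mathcal P(k)\le\mathcal S(k)$ for all $k$. $\mathcal P\Lambda^k(T)$ is $\mathcal P_r\Lambda^k(T)$ or $\mathcal P_r^-\Lambda^k(T)$ according to $\mathcal P(k)=\mathcal P_r$ or $\mathcal P_r^-$. $\mathring{\mathcal P}\Lambda^k(T)$ is the subspace of forms whose traces on all proper subsimplices of $T$ vanish; $\underline{\mathring{\mathcal P}}\Lambda^k(T)=\mathring{\mathcal P}\Lambda^k(T)$ if $k\ne\dim T$, and $=\mathring{\mathcal P}\Lambda^k(T)\cap\ker\int_T$ if $k=\dim T$. **Triangulation.** A simplicial complex $\mathcal T$ is a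 set of simplices closed under taking subsimplices such that two members intersect in the empty set or in a member of $\mathcal T$; it is assumed finite, $n$ is the maximal dimension of its simplices, and $\mathcal T^m$ is its set of $m$-simplices. $C^\infty\Lambda^k(\mathcal T)$ is the space of families $\omega=(\omega_T)_{T\in\mathcal T}$, $\omega_T\in C^\infty\Lambda^k(T)$, with $\operatorname{tr}^k_{T,F}\omega_T=\omega_F$ for all $F\in\Delta(T)$; write $\operatorname{tr}^k_T\omega:=\omega_T$; $d^k$ acts componentwise. To each $T\in\mathcal T$ an admissible sequence type $\mathcal P_T$ is assigned; write $\mathcal P\Lambda^k(T):=\mathcal P_T\Lambda^k(T)$ and similarly for the other spaces. Hierarchy condition: $\mathcal P_F\le\mathcal P_T$ whenever $F\in\Delta(T)$. Containing the Whitney forms: $\mathcal P_1^-\Lambda^k(T)\subseteq\mathcal P\Lambda^k(T)$ for all $T$, $k$. $\mathcal P\Lambda^k(\mathcal T)=\{\omega\in C^\infty\Lambda^k(\mathcal T):\omega_T\in\mathcal P\Lambda^k(T)\ \forall T\}$. **Extension operators.** For all $k$, $T\in\mathcal T$, $F\in\Delta(T)$, linear maps $\operatorname{ext}^k_{F,T}:\mathring{\mathcal P}\Lambda^k(F)\to\mathcal P\Lambda^k(T)$ are given with: $\operatorname{ext}^k_{F,F}=\mathrm{id}$; $\operatorname{tr}^k_{T,F}\operatorname{ext}^k_{f,T}=\operatorname{ext}^k_{f,F}$ for $F\in\Delta(T)$, $f\in\Delta(F)$; $\operatorname{tr}^k_{T,G}\operatorname{ext}^k_{F,T}=0$ for $F,G\in\Delta(T)$,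 $F\notin\Delta(G)$. The global operator $\operatorname{Ext}^k_F:\mathring{\mathcal P}\Lambda^k(F)\to\mathcal P\Lambda^k(\mathcal T)$ sends $\eta$ to the family with $T$-component $\operatorname{ext}^k_{F,T}\eta$ if $F\in\Delta(T)$ and $0$ otherwise. **Canonical interpolant.** For $F\in\mathcal T^k$, $\operatorname{vol}(F)$ is its $k$-dimensional volume and $\operatorname{vol}_F$ the constant $k$-form on $F$ with $\int_F\operatorname{vol}_F=\operatorname{vol}(F)$. On each simplex $F$ a smooth Riemannian metric $g$ is fixed (the same for all form degrees), and $\int_F\langle\cdot,\cdot\rangle_g$ denotes the induced $L^2$ inner product of forms on $F$. For $\omega\in C^\infty\Lambda^k(\mathcal T)$ set $J^k_{\mathcal W}\omega=\sum_{F\in\mathcal T^k}\operatorname{vol}(F)^{-1}\big(\int_F\operatorname{tr}^k_F\omega\big)\operatorname{Ext}^k_F\operatorname{vol}_F$, and recursively for $m=k,\dots,n$: $J^k_m\omega=\sum_{F\in\mathcal T^m}\operatorname{Ext}^k_FJ^k_F\omega$, where for $F\in\mathcal T^m$, $J^k_F\omega\in\underline{\mathring{\mathcal P}}\Lambda^k(F)$ is the unique solution of $\int_F\langle J^k_F\omega,d^{k-1}\rho\rangle_g=\int_F\langle\operatorname{tr}^k_F(\omega-J^k_{\mathcal W}\omega-\sum_{l=k}^{m-1}J^k_l\omega),d^{k-1}\rho\rangle_g$ for all $\rho\in\underline{\mathring{\mathcal P}}\Lambda^{k-1}(F)$, and $\int_F\langle d^kJ^k_F\omega,d^k\beta\rangle_g=\int_F\langle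 d^k\operatorname{tr}^k_F(\omega-J^k_{\mathcal W}\omega-\sum_{l=k}^{m-1}J^k_l\omega),d^k\beta\rangle_g$ for all $\beta\in\underline{\mathring{\mathcal P}}\Lambda^k(F)$. Then $I^k_{\mathcal P}\omega:=J^k_{\mathcal W}\omega+J^k_k\omega+\dots+J^k_n\omega$. *)

theory Defs
  imports
    "HOL-Analysis.Analysis"
    "HOL-Library.Function_Algebras"
    "Jordan_Normal_Form.Determinant"
begin

section \<open>Differential forms on simplices\<close>

text \<open>
  Pointwise vector space structure, so that forms and families of forms can be
  summed and have a linear span.
\<close>

instantiation "fun" :: (type, scaleR) scaleR
begin

definition scaleR_fun :: "real \<Rightarrow> ('a \<Rightarrow> 'b) \<Rightarrow> 'a \<Rightarrow> 'b"
  where "scaleR_fun c f = (\<lambda>x. c *\<^sub>R f x)"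

instance ..

end

instance "fun" :: (type, real_vector) real_vector
  by standard (simp_all add: scaleR_fun_def plus_fun_def fun_eq_iff
      scaleR_add_left scaleR_add_right)

text \<open>
  A form assigns to a point and a list of tangent vectors a real number. Forms on a simplex
  are extended by \<open>0\<close> to all other points and vectors, and a \<open>k\<close>-form is \<open>0\<close> on all lists
  whose length is not \<open>k\<close>; hence equality of forms is equality of functions, and there is
  only the zero \<open>k\<close>-form if \<open>k < 0\<close>.
\<close>

type_synonym 'a form = "'a \<Rightarrow> 'a list \<Rightarrow> real"

definition is_simplex :: "'a::euclidean_space set \<Rightarrow> bool"
  where "is_simplex T \<longleftrightarrow> (\<exists>m::nat. int m simplex T)"

definition subsimplices :: "'a::euclidean_space set \<Rightarrow> 'a set set"
  where "subsimplices T = {F. F face_of T \<and> F \<noteq> {}}"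

definition tangent_space :: "'a::euclidean_space set \<Rightarrow> 'a set"
  where "tangent_space T = span {x - y |x y. x \<in> T \<and> y \<in> T}"

fun iter_deriv :: "('a::euclidean_space \<Rightarrow> real) \<Rightarrow> 'a list \<Rightarrow> 'a \<Rightarrow> real"
  where
    "iter_deriv f [] = f"
  | "iter_deriv f (v # vs) = (\<lambda>x. frechet_derivative (iter_deriv f vs) (at x) v)"

definition smooth :: "('a::euclidean_space \<Rightarrow> real) \<Rightarrow> bool"
  where "smooth f \<longleftrightarrow> (\<forall>vs x. iter_deriv f vs differentiable (at x))"

definition alternating :: "int \<Rightarrow> ('a::euclidean_space list \<Rightarrow> real) \<Rightarrow> bool"
  where "alternating k \<alpha> \<longleftrightarrow>
    (\<forall>vs. int (length vs) \<noteq> k \<longrightarrow> \<alpha> vs = 0) \<and>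
    (\<forall>vs. \<forall>i<length vs. linear (\<lambda>v. \<alpha> (vs[i := v]))) \<and>
    (\<forall>vs. \<not> distinct vs \<longrightarrow> \<alpha> vs = 0)"

definition ambient_forms :: "int \<Rightarrow> 'a::euclidean_space form set"
  where "ambient_forms k =
    {\<omega>. (\<forall>x. alternating k (\<omega> x)) \<and> (\<forall>vs. smooth (\<lambda>x. \<omega> x vs))}"

text \<open>
  Pullback along the inclusion of \<open>F\<close>, both from the ambient space and from a simplex that
  has \<open>F\<close> as a subsimplex.
\<close>

definition pullback :: "'a::euclidean_space set \<Rightarrow> 'a form \<Rightarrow> 'a form"
  where "pullback F \<omega> =
    (\<lambda>x vs. if x \<in> F \<and> set vs \<subseteq> tangent_space F then \<omega> x vs else 0)"

definition smooth_forms :: "int \<Rightarrow> 'a::euclidean_space set \<Rightarrow> 'a form set"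
  where "smooth_forms k T = pullback T ` ambient_forms k"

definition remove_nth :: "nat \<Rightarrow> 'b list \<Rightarrow> 'b list"
  where "remove_nth i xs = take i xs @ drop (Suc i) xs"

text \<open>
  The derivative within \<open>T\<close> is determined only on the tangent space of \<open>T\<close>, which is where
  it is evaluated.
\<close>

definition ext_deriv :: "'a::euclidean_space set \<Rightarrow> 'a form \<Rightarrow> 'a form"
  where "ext_deriv T \<omega> = pullback T (\<lambda>x vs. \<Sum>i<length vs.
    (-1) ^ i * frechet_derivative (\<lambda>y. \<omega> y (remove_nth i vs)) (at x within T) (vs ! i))"


section \<open>Polynomial forms\<close>

text \<open>A reference enumeration of the vertices.\<close>

definition verts :: "'a::euclidean_space set \<Rightarrow> 'a list"
  where "verts T = (SOME vs. distinct vs \<and> set vs = {v. v extreme_point_of T})"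

definition bary :: "'a::euclidean_space set \<Rightarrow> nat \<Rightarrow> 'a \<Rightarrow> real"
  where "bary T i x = (THE u. (\<forall>j\<ge>length (verts T). u j = 0) \<and>
    (\<Sum>j<length (verts T). u j) = 1 \<and> (\<Sum>j<length (verts T). u j *\<^sub>R verts T ! j) = x) i"

definition function_form :: "('a \<Rightarrow> real) \<Rightarrow> 'a form"
  where "function_form f = (\<lambda>x vs. if vs = [] then f x else 0)"

definition d_bary :: "'a::euclidean_space set \<Rightarrow> nat \<Rightarrow> 'a form"
  where "d_bary T i = ext_deriv T (function_form (bary T i))"

definition wedge :: "'a form list \<Rightarrow> 'a form"
  where "wedge \<eta>s = (\<lambda>x vs. if length vs = length \<eta>s
    then Determinant.det (Matrix.mat (length \<eta>s) (length \<eta>s) (\<lambda>(i, j). (\<eta>s ! i) x [vs ! j]))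
    else 0)"

definition bary_monom :: "'a::euclidean_space set \<Rightarrow> (nat \<Rightarrow> nat) \<Rightarrow> 'a \<Rightarrow> real"
  where "bary_monom T a x = (\<Prod>i<length (verts T). bary T i x ^ a i)"

definition increasing_lists :: "nat \<Rightarrow> nat list set"
  where "increasing_lists m = {\<sigma>. sorted_wrt (<) \<sigma> \<and> set \<sigma> \<subseteq> {..<m}}"

definition full_poly_forms :: "int \<Rightarrow> int \<Rightarrow> 'a::euclidean_space set \<Rightarrow> 'a form set"
  where "full_poly_forms r k T = span
    {pullback T (\<lambda>x vs. bary_monom T a x * wedge (map (d_bary T) \<sigma>) x vs) |a \<sigma>.
      (\<Sum>i<length (verts T). int (a i)) = r \<and>
      \<sigma> \<in> increasing_lists (length (verts T)) \<and> int (length \<sigma>) = k}"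

definition whitney_form :: "'a::euclidean_space set \<Rightarrow> nat list \<Rightarrow> 'a form"
  where "whitney_form T \<rho> = (\<lambda>x vs. \<Sum>i<length \<rho>.
    (-1) ^ i * bary T (\<rho> ! i) x * wedge (map (d_bary T) (remove_nth i \<rho>)) x vs)"

definition trimmed_poly_forms :: "int \<Rightarrow> int \<Rightarrow> 'a::euclidean_space set \<Rightarrow> 'a form set"
  where "trimmed_poly_forms r k T = span
    {pullback T (\<lambda>x vs. bary_monom T a x * whitney_form T \<rho> x vs) |a \<rho>.
      (\<Sum>i<length (verts T). int (a i)) = r - 1 \<and>
      \<rho> \<in> increasing_lists (length (verts T)) \<and> int (length \<rho>) = k + 1}"

text \<open>\<open>Trimmed r\<close> and \<open>Full r\<close> are the symbols $\mathcal P_r^-$ and $\mathcal P_r$.\<close>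

datatype poly_type = Trimmed int | Full int

instantiation poly_type :: linorder
begin

fun less_eq_poly_type :: "poly_type \<Rightarrow> poly_type \<Rightarrow> bool"
  where
    "Trimmed r \<le> Trimmed s \<longleftrightarrow> r \<le> s"
  | "Trimmed r \<le> Full s \<longleftrightarrow> r \<le> s"
  | "Full r \<le> Full s \<longleftrightarrow> r \<le> s"
  | "Full r \<le> Trimmed s \<longleftrightarrow> r < s"

definition less_poly_type :: "poly_type \<Rightarrow> poly_type \<Rightarrow> bool"
  where "x < y \<longleftrightarrow> x \<le> y \<and> \<not> y \<le> (x :: poly_type)"

instance
proof
  fix x y z :: poly_type
  show "x < y \<longleftrightarrow> x \<le> y \<and> \<not> y \<le> x"
    by (rule less_poly_type_def)
  show "x \<le> x"
    by (cases x) auto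
  show "x \<le> z" if "x \<le> y" "y \<le> z"
    using that by (cases x; cases y; cases z) auto
  show "x = y" if "x \<le> y" "y \<le> x"
    using that by (cases x; cases y) auto
  show "x \<le> y \<or> y \<le> x"
    by (cases x; cases y) auto
qed

end

definition admissible :: "(int \<Rightarrow> poly_type) \<Rightarrow> bool"
  where "admissible S \<longleftrightarrow>
    (\<forall>k r. S k \<in> {Trimmed r, Full r} \<longrightarrow> S (k + 1) \<in> {Trimmed r, Full (r - 1)})"

fun poly_type_forms :: "poly_type \<Rightarrow> int \<Rightarrow> 'a::euclidean_space set \<Rightarrow> 'a form set"
  where
    "poly_type_forms (Trimmed r) k T = trimmed_poly_forms r k T"
  | "poly_type_forms (Full r) k T = full_poly_forms r k T"


section \<open>Integration\<close>

definition std_simplex_set :: "nat \<Rightarrow> (nat \<Rightarrow> real) set"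
  where "std_simplex_set m = {t. (\<forall>i<m. 0 \<le> t i) \<and> (\<Sum>i<m. t i) \<le> 1}"

definition edges :: "'a::euclidean_space set \<Rightarrow> 'a list"
  where "edges T = map (\<lambda>v. v - hd (verts T)) (tl (verts T))"

definition param :: "'a::euclidean_space set \<Rightarrow> (nat \<Rightarrow> real) \<Rightarrow> 'a"
  where "param T t = hd (verts T) + (\<Sum>i<length (edges T). t i *\<^sub>R edges T ! i)"

text \<open>
  The integral over \<open>T\<close> with respect to the coordinates of \<^const>\<open>param\<close>.
\<close>

definition coord_integral :: "'a::euclidean_space set \<Rightarrow> ('a \<Rightarrow> real) \<Rightarrow> real"
  where "coord_integral T f = (LINT t:std_simplex_set (length (edges T))
    |Pi\<^sub>M {..<length (edges T)} (\<lambda>_. lborel). f (param T t))"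

text \<open>
  An orientation of \<open>T\<close> is given by its sign \<open>ori T \<in> {1, -1}\<close> relative to the orientation by
  the basis \<^term>\<open>edges T\<close> of the tangent space; this includes both orientations of a point.
\<close>

definition form_integral :: "('a set \<Rightarrow> real) \<Rightarrow> 'a::euclidean_space set \<Rightarrow> 'a form \<Rightarrow> real"
  where "form_integral ori T \<omega> = ori T * coord_integral T (\<lambda>x. \<omega> x (edges T))"

definition orientation :: "'a::euclidean_space set set \<Rightarrow> ('a set \<Rightarrow> real) \<Rightarrow> bool"
  where "orientation \<T> ori \<longleftrightarrow> (\<forall>T\<in>\<T>. ori T \<in> {1, -1})"

text \<open>A metric assigns to a point the inner product on the tangent space.\<close>

type_synonym 'a metric = "'a \<Rightarrow> 'a \<Rightarrow> 'a \<Rightarrow> real"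

definition riemannian_metric :: "'a::euclidean_space set \<Rightarrow> 'a metric \<Rightarrow> bool"
  where "riemannian_metric T g \<longleftrightarrow>
    (\<forall>x\<in>T. \<forall>u\<in>tangent_space T. \<forall>v\<in>tangent_space T. \<forall>w\<in>tangent_space T. \<forall>c.
      g x (u + v) w = g x u w + g x v w \<and> g x (c *\<^sub>R u) w = c * g x u w \<and>
      g x u v = g x v u \<and> (u \<noteq> 0 \<longrightarrow> g x u u > 0)) \<and>
    (\<forall>u\<in>tangent_space T. \<forall>v\<in>tangent_space T. \<exists>f. smooth f \<and> (\<forall>x\<in>T. f x = g x u v))"

text \<open>Integration of functions against the Riemannian volume.\<close>

definition riemannian_integral :: "'a::euclidean_space set \<Rightarrow> 'a metric \<Rightarrow> ('a \<Rightarrow> real) \<Rightarrow> real"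
  where "riemannian_integral T g f = coord_integral T (\<lambda>x. f x *
    sqrt (Determinant.det (Matrix.mat (length (edges T)) (length (edges T))
      (\<lambda>(i, j). g x (edges T ! i) (edges T ! j)))))"

definition vol :: "'a::euclidean_space set \<Rightarrow> real"
  where "vol T = riemannian_integral T (\<lambda>x u v. inner u v) (\<lambda>x. 1)"

definition vol_form :: "('a set \<Rightarrow> real) \<Rightarrow> 'a::euclidean_space set \<Rightarrow> 'a form"
  where "vol_form ori T = (THE \<omega>. (\<exists>\<alpha>. alternating (aff_dim T) \<alpha> \<and> \<omega> = pullback T (\<lambda>x. \<alpha>)) \<and>
    form_integral ori T \<omega> = vol T)"

definition orthonormal_basis ::
    "'a::euclidean_space set \<Rightarrow> ('a \<Rightarrow> 'a \<Rightarrow> real) \<Rightarrow> 'a list \<Rightarrow> bool"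
  where "orthonormal_basis T h bs \<longleftrightarrow> set bs \<subseteq> tangent_space T \<and> int (length bs) = aff_dim T \<and>
    (\<forall>i<length bs. \<forall>j<length bs. h (bs ! i) (bs ! j) = (if i = j then 1 else 0))"

text \<open>
  The inner product of alternating forms induced by the inner product \<open>h\<close> on the tangent space:
  the wedge products of the covectors dual to an \<open>h\<close>-orthonormal basis are orthonormal. The value
  does not depend on the chosen basis. For \<open>k\<close>-forms only the lists of length \<open>k\<close> contribute.
\<close>

definition alt_inner ::
    "'a::euclidean_space set \<Rightarrow> ('a \<Rightarrow> 'a \<Rightarrow> real) \<Rightarrow> ('a list \<Rightarrow> real) \<Rightarrow> ('a list \<Rightarrow> real) \<Rightarrow> real"
  where "alt_inner T h \<alpha> \<beta> = (let bs = SOME bs. orthonormal_basis T h bs in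
    \<Sum>\<sigma>\<in>increasing_lists (length bs). \<alpha> (map ((!) bs) \<sigma>) * \<beta> (map ((!) bs) \<sigma>))"

definition L2_inner :: "'a::euclidean_space set \<Rightarrow> 'a metric \<Rightarrow> 'a form \<Rightarrow> 'a form \<Rightarrow> real"
  where "L2_inner T g \<alpha> \<beta> = riemannian_integral T g (\<lambda>x. alt_inner T (g x) (\<alpha> x) (\<beta> x))"


section \<open>Forms on a simplicial complex\<close>

text \<open>
  The empty simplex is not a member, in contrast to \<^const>\<open>simplicial_complex\<close>.
\<close>

definition finite_complex :: "'a::euclidean_space set set \<Rightarrow> bool"
  where "finite_complex \<T> \<longleftrightarrow> finite \<T> \<and> (\<forall>T\<in>\<T>. is_simplex T) \<and>
    (\<forall>T\<in>\<T>. subsimplices T \<subseteq> \<T>) \<and> (\<forall>S\<in>\<T>. \<forall>T\<in>\<T>. S \<inter> T = {} \<or> S \<inter> T \<in> \<T>)"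

definition complex_dim :: "'a::euclidean_space set set \<Rightarrow> int"
  where "complex_dim \<T> = Max (aff_dim ` \<T>)"

definition simplices_of_dim :: "'a::euclidean_space set set \<Rightarrow> int \<Rightarrow> 'a set set"
  where "simplices_of_dim \<T> m = {T \<in> \<T>. aff_dim T = m}"

text \<open>Families of forms are extended by \<open>0\<close> outside of \<open>\<T>\<close>.\<close>

definition complex_forms ::
    "'a::euclidean_space set set \<Rightarrow> int \<Rightarrow> ('a set \<Rightarrow> 'a form) set"
  where "complex_forms \<T> k = {\<omega>.
    (\<forall>T\<in>\<T>. \<omega> T \<in> smooth_forms k T \<and> (\<forall>F\<in>subsimplices T. pullback F (\<omega> T) = \<omega> F)) \<and>
    (\<forall>T. T \<notin> \<T> \<longrightarrow> \<omega> T = 0)}"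

definition complex_deriv ::
    "'a::euclidean_space set set \<Rightarrow> ('a set \<Rightarrow> 'a form) \<Rightarrow> 'a set \<Rightarrow> 'a form"
  where "complex_deriv \<T> \<omega> = (\<lambda>T. if T \<in> \<T> then ext_deriv T (\<omega> T) else 0)"

type_synonym 'a type_assignment = "'a set \<Rightarrow> int \<Rightarrow> poly_type"

definition poly_forms :: "'a type_assignment \<Rightarrow> int \<Rightarrow> 'a::euclidean_space set \<Rightarrow> 'a form set"
  where "poly_forms P k T = poly_type_forms (P T k) k T"

definition bubble_forms :: "'a type_assignment \<Rightarrow> int \<Rightarrow> 'a::euclidean_space set \<Rightarrow> 'a form set"
  where "bubble_forms P k T =
    {\<omega> \<in> poly_forms P k T. \<forall>F\<in>subsimplices T - {T}. pullback F \<omega> = 0}"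

definition reduced_bubble_forms ::
    "('a set \<Rightarrow> real) \<Rightarrow> 'a type_assignment \<Rightarrow> int \<Rightarrow> 'a::euclidean_space set \<Rightarrow> 'a form set"
  where "reduced_bubble_forms ori P k T =
    (if k = aff_dim T then {\<omega> \<in> bubble_forms P k T. form_integral ori T \<omega> = 0}
     else bubble_forms P k T)"

definition hierarchy :: "'a::euclidean_space set set \<Rightarrow> 'a type_assignment \<Rightarrow> bool"
  where "hierarchy \<T> P \<longleftrightarrow> (\<forall>T\<in>\<T>. \<forall>F\<in>subsimplices T. P F \<le> P T)"

definition contains_whitney :: "'a::euclidean_space set set \<Rightarrow> 'a type_assignment \<Rightarrow> bool"
  where "contains_whitney \<T> P \<longleftrightarrow> (\<forall>T\<in>\<T>. \<forall>k. trimmed_poly_forms 1 k T \<subseteq> poly_forms P k T)"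

type_synonym 'a extension = "int \<Rightarrow> 'a set \<Rightarrow> 'a set \<Rightarrow> 'a form \<Rightarrow> 'a form"

definition extension_operators ::
    "'a::euclidean_space set set \<Rightarrow> 'a type_assignment \<Rightarrow> 'a extension \<Rightarrow> bool"
  where "extension_operators \<T> P ext \<longleftrightarrow>
    (\<forall>k. \<forall>T\<in>\<T>. \<forall>F\<in>subsimplices T.
      (\<forall>\<eta>\<in>bubble_forms P k F. ext k F T \<eta> \<in> poly_forms P k T \<and>
        (\<forall>\<theta>\<in>bubble_forms P k F. ext k F T (\<eta> + \<theta>) = ext k F T \<eta> + ext k F T \<theta>) \<and>
        (\<forall>c. ext k F T (c *\<^sub>R \<eta>) = c *\<^sub>R ext k F T \<eta>))) \<and>
    (\<forall>k. \<forall>F\<in>\<T>. \<forall>\<eta>\<in>bubble_forms P k F. ext k F F \<eta> = \<eta>) \<and>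
    (\<forall>k. \<forall>T\<in>\<T>. \<forall>F\<in>subsimplices T. \<forall>f\<in>subsimplices F. \<forall>\<eta>\<in>bubble_forms P k f.
      pullback F (ext k f T \<eta>) = ext k f F \<eta>) \<and>
    (\<forall>k. \<forall>T\<in>\<T>. \<forall>F\<in>subsimplices T. \<forall>G\<in>subsimplices T. F \<notin> subsimplices G \<longrightarrow>
      (\<forall>\<eta>\<in>bubble_forms P k F. pullback G (ext k F T \<eta>) = 0))"

definition global_ext ::
    "'a::euclidean_space set set \<Rightarrow> 'a extension \<Rightarrow> int \<Rightarrow> 'a set \<Rightarrow> 'a form \<Rightarrow> 'a set \<Rightarrow> 'a form"
  where "global_ext \<T> ext k F \<eta> =
    (\<lambda>T. if T \<in> \<T> \<and> F \<in> subsimplices T then ext k F T \<eta> else 0)"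


section \<open>The canonical interpolant\<close>

context
  fixes \<T> :: "'a::euclidean_space set set"
    and ori :: "'a set \<Rightarrow> real"
    and P :: "'a type_assignment"
    and ext :: "'a extension"
    and g :: "'a set \<Rightarrow> 'a metric"
    and k :: int
begin

definition whitney_interpolant :: "('a set \<Rightarrow> 'a form) \<Rightarrow> 'a set \<Rightarrow> 'a form"
  where "whitney_interpolant \<omega> = (\<Sum>F\<in>simplices_of_dim \<T> k.
    (form_integral ori F (\<omega> F) / vol F) *\<^sub>R global_ext \<T> ext k F (vol_form ori F))"

text \<open>
  The form on \<open>F\<close> determined by a right-hand side \<open>\<tau>\<close> on \<open>F\<close>, which is the trace of what
  remains to be interpolated.
\<close>

definition local_projection :: "'a set \<Rightarrow> 'a form \<Rightarrow> 'a form"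
  where "local_projection F \<tau> = (THE \<eta>. \<eta> \<in> reduced_bubble_forms ori P k F \<and>
    (\<forall>\<rho>\<in>reduced_bubble_forms ori P (k - 1) F.
      L2_inner F (g F) \<eta> (ext_deriv F \<rho>) = L2_inner F (g F) \<tau> (ext_deriv F \<rho>)) \<and>
    (\<forall>\<beta>\<in>reduced_bubble_forms ori P k F.
      L2_inner F (g F) (ext_deriv F \<eta>) (ext_deriv F \<beta>) =
      L2_inner F (g F) (ext_deriv F \<tau>) (ext_deriv F \<beta>)))"

function level_interpolant :: "('a set \<Rightarrow> 'a form) \<Rightarrow> int \<Rightarrow> 'a set \<Rightarrow> 'a form"
  where "level_interpolant \<omega> m = (\<Sum>F\<in>simplices_of_dim \<T> m. global_ext \<T> ext k F
    (local_projection F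
      ((\<omega> - whitney_interpolant \<omega> - (\<Sum>l\<in>{k..<m}. level_interpolant \<omega> l)) F)))"
  by auto
termination
  by (relation "Wellfounded.measure (\<lambda>(\<omega>, m). nat (m - k))") auto

declare level_interpolant.simps [simp del]

definition canonical_interpolant :: "('a set \<Rightarrow> 'a form) \<Rightarrow> 'a set \<Rightarrow> 'a form"
  where "canonical_interpolant \<omega> =
    whitney_interpolant \<omega> + (\<Sum>m\<in>{k..complex_dim \<T>}. level_interpolant \<omega> m)"

end

end

theory Submission
  imports Defs "HOL-Combinatorics.Multiset_Permutations"
begin

text \<open>
  Within the families of polynomial forms, the interpolant \<open>u = I\<^sup>k \<omega>\<close> is characterised by the integrals
  of \<open>u\<close> over the \<open>k\<close>-simplices and by the orthogonality of \<open>\<omega> - u\<close> to \<open>d \<rho>\<close> and of \<open>d (\<omega> - u)\<close> to \<open>d \<beta>\<close>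
  on every simplex of dimension at least \<open>k\<close>, for \<open>\<rho>\<close> and \<open>\<beta>\<close> in the reduced bubble spaces. Indeed, a
  family \<open>v\<close> with vanishing data is zero, by induction on the dimension: if it vanishes on the
  boundary of \<open>F\<close>, then \<open>v\<close> itself may be taken for \<open>\<beta>\<close> on \<open>F\<close>, so \<open>v\<close> is closed on \<open>F\<close>; as the reduced
  bubble complex on \<open>F\<close> is exact, \<open>v = d \<rho>\<close> is orthogonal to itself. The data of
  \<open>d I\<^sup>k \<omega> - I\<^sup>k\<^sup>+\<^sup>1 d \<omega>\<close> vanish by Stokes' theorem and \<open>d d = 0\<close>.

  Exactness of the bubble complexes reduces to the trimmed spaces of one fixed degree \<open>r\<close>, since an
  admissible type passes from \<open>k\<close> to \<open>k + 1\<close> through them. Let \<open>\<kappa>\<close> be the contraction with the vector field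
  \<open>x - p\<close> for a vertex \<open>p\<close>; it preserves the trimmed spaces and the vanishing of traces on faces
  through \<open>p\<close>. By Cartan's formula, \<open>d \<kappa>\<close> is injective on the closed trimmed forms that vanish on the
  proper faces through \<open>p\<close>, hence surjective by finite dimension. This yields a potential, whose trace
  on the facet opposite to \<open>p\<close> is closed; it is corrected by a potential on that facet, extended to
  the simplex by the same expression in barycentric coordinates.
\<close>

section \<open>Alternating multilinear maps\<close>

text \<open>Exactness is proved on trimmed spaces because both operators stay inside them: d maps
  P_r^- into P_(r-1), which lies in P_r^- since the barycentric coordinates sum up to 1, and
  \<kappa> turns a Whitney form into a combination of Whitney forms with one index fewer. So d
  \<kappa> is an endomorphism of a finite-dimensional space, and a potential exists without a
  homotopy operator that integrates along rays. The base point is a vertex because x - p is tangent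
  only to faces through p; on the opposite facet \<kappa> gives no control, hence the correction
  there. All computations use homogeneous coordinates (x, 1) and (v, 0): a barycentric coordinate
  and its differential are values of one covector, and a Whitney form is one determinant with first
  column (x, 1). Signs of permutations and induced orientations are never computed: it suffices that
  the constants in Stokes' theorem are nonzero and independent of the form. As the local projection
  is a definite description, solvability of its equations is proved along with uniqueness, by two
  successive orthogonal projections.\<close>

no_notation scalar_prod (infix "\<bullet>" 70)

section \<open>Removing an entry from a list\<close>

lemma length_remove_nth: "i < length xs \<Longrightarrow> length (remove_nth i xs) = length xs - 1"
  by (simp add: remove_nth_def)

lemma remove_nth_append [simp]: "remove_nth (length xs) (xs @ y # zs) = xs @ zs"
  by (simp add: remove_nth_def)

lemma remove_nth_0 [simp]: "remove_nth 0 (x # xs) = xs"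
  by (simp add: remove_nth_def)

lemma remove_nth_Suc [simp]: "remove_nth (Suc i) (x # xs) = x # remove_nth i xs"
  by (simp add: remove_nth_def)

lemma nth_remove_nth:
  "i < length xs \<Longrightarrow> j < length xs - 1 \<Longrightarrow>
    remove_nth i xs ! j = (if j < i then xs ! j else xs ! Suc j)"
  by (auto simp: remove_nth_def nth_append min_def)

lemma map_remove_nth: "map f (remove_nth i xs) = remove_nth i (map f xs)"
  by (simp add: remove_nth_def take_map drop_map)

lemma set_remove_nth_subset: "set (remove_nth i xs) \<subseteq> set xs"
  by (auto simp: remove_nth_def dest: in_set_takeD in_set_dropD)

lemma remove_nth_split:
  assumes "i < length xs"
  obtains ys zs where "xs = ys @ xs ! i # zs" "length ys = i" "remove_nth i xs = ys @ zs"
  using assms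
  by (metis remove_nth_append id_take_nth_drop length_take less_imp_le_nat min.absorb2)

text \<open>The simplicial identity that pairs off the terms of \<open>d d\<close>.\<close>

lemma remove_nth_remove_nth:
  assumes "j < i" "i < length xs"
  shows "remove_nth j (remove_nth i xs) = remove_nth (i - 1) (remove_nth j xs)"
  using assms
  by (intro nth_equalityI) (auto simp: length_remove_nth nth_remove_nth)

lemma remove_nth_update_same: "i < length xs \<Longrightarrow> remove_nth i (xs[i := v]) = remove_nth i xs"
  by (simp add: remove_nth_def)

lemma remove_nth_update:
  assumes "i < length xs" "j < length xs" "i \<noteq> j"
  shows "remove_nth i (xs[j := v]) = (remove_nth i xs)[(if j < i then j else j - 1) := v]"
  using assms
  by (intro nth_equalityI) (auto simp: length_remove_nth nth_remove_nth nth_list_update)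

lemma not_distinct_remove_nth:
  assumes "a < length xs" "b < length xs" "a \<noteq> b" "xs ! a = xs ! b" "i < length xs"
    "i \<noteq> a" "i \<noteq> b"
  shows "\<not> distinct (remove_nth i xs)"
proof -
  let ?s = "\<lambda>j. if j < i then j else j - 1"
  have "remove_nth i xs ! ?s a = xs ! a" "remove_nth i xs ! ?s b = xs ! b"
    using assms by (auto simp: nth_remove_nth)
  moreover have "?s a < length xs - 1" "?s b < length xs - 1" "?s a \<noteq> ?s b"
    using assms by auto
  moreover have "length (remove_nth i xs) = length xs - 1"
    using assms by (simp add: length_remove_nth)
  ultimately show ?thesis
    using assms(4) nth_eq_iff_index_eq[of "remove_nth i xs" "?s a" "?s b"] by auto
qed

text \<open>Adjacent transpositions generate all permutations. Which sign occurs is left open. The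
  values lie in an arbitrary abelian group so that \<Phi> may be function-valued: then one sign
  serves all arguments at once.\<close>

lemma mset_eq_sign:
  fixes \<Phi> :: "'b list \<Rightarrow> 'c::ab_group_add"
  assumes swap: "\<And>xs a b ys. \<Phi> (xs @ b # a # ys) = - \<Phi> (xs @ a # b # ys)"
    and "mset xs = mset ys"
  shows "\<Phi> ys = \<Phi> xs \<or> \<Phi> ys = - \<Phi> xs"
proof -
  \<comment> \<open>Carries \<open>a\<close> past the block \<open>us\<close>, one transposition per
    entry.\<close>
  have move: "\<Phi> (ps @ a # us @ vs) = \<Phi> (ps @ us @ a # vs) \<or>
      \<Phi> (ps @ a # us @ vs) = - \<Phi> (ps @ us @ a # vs)" for ps us vs a
  proof (induction us arbitrary: ps)
    case (Cons u us)
    have "\<Phi> (ps @ (a # (u # us) @ vs)) = - \<Phi> ((ps @ [u]) @ a # us @ vs)"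
      using swap[of ps u a "us @ vs"] by simp
    with Cons[of "ps @ [u]"] show ?case by (metis append.assoc append_Cons append_Nil minus_minus)
  qed simp
  \<comment> \<open>The prefix \<open>ps\<close> collects the entries that are already in
    place.\<close>
  have "\<Phi> (ps @ ys) = \<Phi> (ps @ xs) \<or> \<Phi> (ps @ ys) = - \<Phi> (ps @ xs)" for ps
    using assms(2)
  proof (induction xs arbitrary: ys ps)
    case (Cons a xs)
    then have "a \<in> set ys" by (metis list.set_intros(1) mset_eq_setD)
    then obtain us vs where ys: "ys = us @ a # vs" by (meson split_list)
    with Cons have "mset xs = mset (us @ vs)" by simp
    from Cons.IH[OF this, of "ps @ [a]"] move[of ps a us vs] show ?case
      unfolding ys by (metis append.assoc append_Cons append_Nil minus_minus)
  qed simp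
  from this[of "[]"] show ?thesis by simp
qed


section \<open>Calculus of alternating maps\<close>

lemma alternating_length: "alternating k \<alpha> \<Longrightarrow> int (length vs) \<noteq> k \<Longrightarrow> \<alpha> vs = 0"
  by (simp add: alternating_def)

lemma alternating_not_distinct: "alternating k \<alpha> \<Longrightarrow> \<not> distinct vs \<Longrightarrow> \<alpha> vs = 0"
  by (simp add: alternating_def)

lemma alternating_linear: "alternating k \<alpha> \<Longrightarrow> linear (\<lambda>v. \<alpha> (xs @ v # ys))"
proof -
  assume "alternating k \<alpha>"
  then have "\<And>vs i. i < length vs \<Longrightarrow> linear (\<lambda>v. \<alpha> (vs[i := v]))"
    by (simp add: alternating_def)
  from this[of "length xs" "xs @ 0 # ys"] show ?thesis by simp
qed

lemma alternating_linear_Cons: "alternating k \<alpha> \<Longrightarrow> linear (\<lambda>v. \<alpha> (v # ys))"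
  using alternating_linear[of k \<alpha> "[]" ys] by simp

lemma alternatingI:
  assumes "\<And>vs. int (length vs) \<noteq> k \<Longrightarrow> \<alpha> vs = 0"
    and "\<And>xs ys. linear (\<lambda>v. \<alpha> (xs @ v # ys))"
    and "\<And>vs. \<not> distinct vs \<Longrightarrow> \<alpha> vs = 0"
  shows "alternating k \<alpha>"
  unfolding alternating_def
proof (intro conjI allI impI)
  fix vs :: "'a list" and i assume "i < length vs"
  then show "linear (\<lambda>v. \<alpha> (vs[i := v]))"
    using assms(2)[of "take i vs" "drop (Suc i) vs"] by (simp add: upd_conv_take_nth_drop)
qed (use assms in auto)

lemma alternating_0: "alternating k (\<lambda>vs. 0)"
  by (auto simp: alternating_def intro: linearI)

lemma alternating_add:
  "alternating k \<alpha> \<Longrightarrow> alternating k \<beta> \<Longrightarrow> alternating k (\<lambda>vs. \<alpha> vs + \<beta> vs)"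
  by (auto simp: alternating_def intro: linear_compose_add)

lemma alternating_scale: "alternating k \<alpha> \<Longrightarrow> alternating k (\<lambda>vs. c * \<alpha> vs)"
  by (rule alternatingI)
    (auto simp: alternating_length alternating_not_distinct
      intro: linear_compose_scale_right[where f = "\<lambda>v. \<alpha> (_ @ v # _)", simplified]
      alternating_linear)

lemma alternating_Cons: "alternating k \<alpha> \<Longrightarrow> alternating (k - 1) (\<lambda>vs. \<alpha> (u # vs))"
  by (rule alternatingI)
    (auto simp: alternating_length alternating_not_distinct
      intro: alternating_linear[of k \<alpha> "u # _", simplified])

lemma alternating_map:
  assumes "alternating k \<alpha>" "linear f"
  shows "alternating k (\<lambda>vs. \<alpha> (map f vs))"
proof (rule alternatingI)
  show "linear (\<lambda>v. \<alpha> (map f (xs @ v # ys)))" for xs ys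
    using linear_compose[OF assms(2) alternating_linear[OF assms(1)]] by (simp add: o_def)
qed (use assms in \<open>auto simp: alternating_length alternating_not_distinct distinct_map\<close>)

lemma alternating_swap:
  assumes "alternating k \<alpha>"
  shows "\<alpha> (xs @ v # u # ys) = - \<alpha> (xs @ u # v # ys)"
proof -
  let ?f = "\<lambda>a b. \<alpha> (xs @ a # b # ys)"
  have l: "linear (\<lambda>a. ?f a b)" "linear (?f a)" for a b
    using alternating_linear[OF assms, of xs "b # ys"]
      alternating_linear[OF assms, of "xs @ [a]" ys] by auto
  have z: "?f a a = 0" for a
    by (rule alternating_not_distinct[OF assms]) simp
  have "0 = ?f (u + v) (u + v)" by (simp add: z)
  also have "\<dots> = ?f u u + ?f u v + (?f v u + ?f v v)"
    by (simp add: linear_add[OF l(1)] linear_add[OF l(2)])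
  finally show ?thesis by (simp add: z)
qed

lemma alternating_move:
  assumes "alternating k \<alpha>"
  shows "\<alpha> (xs @ u # ys @ zs) = (-1) ^ length ys * \<alpha> (xs @ ys @ u # zs)"
proof (induction ys arbitrary: xs)
  case (Cons y ys)
  have "\<alpha> (xs @ u # (y # ys) @ zs) = - \<alpha> ((xs @ [y]) @ u # ys @ zs)"
    using alternating_swap[OF assms, of xs y u] by simp
  then show ?case using Cons[of "xs @ [y]"] by simp
qed simp

lemma alternating_move_front:
  assumes "alternating k \<alpha>" "i < length vs"
  shows "\<alpha> (vs ! i # remove_nth i vs) = (-1) ^ i * \<alpha> vs"
  using assms(2)
  by (rule remove_nth_split) (use alternating_move[OF assms(1), of "[]"] in fastforce)

lemma alternating_mset_sign:
  assumes "alternating k \<alpha>" "mset xs = mset ys"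
  shows "\<alpha> ys = \<alpha> xs \<or> \<alpha> ys = - \<alpha> xs"
  using alternating_swap[OF assms(1)] assms(2) by (rule mset_eq_sign)

lemma alternating_eq_0_on_span:
  assumes "alternating k \<alpha>" "\<And>vs. set vs \<subseteq> B \<Longrightarrow> \<alpha> vs = 0" "set vs \<subseteq> span B"
  shows "\<alpha> vs = 0"
  using assms
proof (induction vs arbitrary: k \<alpha>)
  case (Cons v ws)
  have "\<alpha> (v # us) = 0" if "set us \<subseteq> B" for us
    by (rule linear_eq_0_on_span[OF alternating_linear_Cons[OF Cons.prems(1)], where b = B])
      (use Cons.prems that in auto)
  with Cons.prems show ?case
    by (intro Cons.IH[OF alternating_Cons[OF Cons.prems(1)]]) auto
qed auto

lemma alternating_eq_0_dimension:
  assumes "alternating k \<alpha>" "finite B" "int (card B) < k" "set vs \<subseteq> span B"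
  shows "\<alpha> vs = 0"
proof (rule alternating_eq_0_on_span[OF assms(1) _ assms(4)])
  fix us assume us: "set us \<subseteq> B"
  show "\<alpha> us = 0"
  proof (cases "int (length us) = k \<and> distinct us")
    case True
    with us assms show ?thesis
      using card_mono[OF assms(2) us] distinct_card[of us] by simp
  qed (use assms(1) in \<open>auto simp: alternating_length alternating_not_distinct\<close>)
qed

text \<open>A list of this length with entries in \<open>es\<close> either repeats an entry or is a
  permutation of \<open>es\<close>, so one value decides.\<close>

lemma alternating_eq_0_basis:
  assumes "alternating (int (length es)) \<alpha>" "\<alpha> es = 0" "set vs \<subseteq> span (set es)"
  shows "\<alpha> vs = 0"
proof (rule alternating_eq_0_on_span[OF assms(1) _ assms(3)])
  fix us assume us: "set us \<subseteq> set es"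
  show "\<alpha> us = 0"
  proof (cases "length us = length es \<and> distinct us")
    case True
    have "card (set us) \<le> card (set es)" "card (set es) \<le> length es"
      using us by (auto intro: card_mono card_length)
    with True have "set us = set es" "distinct es"
      using distinct_card[of us] us by (auto simp: card_subset_eq card_distinct)
    with True have "mset es = mset us" by (simp add: set_eq_iff_mset_eq_distinct)
    then show ?thesis using alternating_mset_sign[OF assms(1), of es us] assms(2) by auto
  qed (use assms(1) in \<open>auto simp: alternating_length alternating_not_distinct\<close>)
qed

lemma alternating_Cons_diff:
  assumes "alternating k \<alpha>"
  shows "\<alpha> (xs @ a # ys @ map (\<lambda>u. u - a) us) = \<alpha> (xs @ a # ys @ us)"
proof (induction us arbitrary: ys)
  case (Cons u us)
  let ?f = "\<lambda>v. \<alpha> ((xs @ a # ys) @ v # map (\<lambda>u. u - a) us)"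
  have "?f (u - a) = ?f u - ?f a"
    by (rule linear_diff[OF alternating_linear[OF assms]])
  moreover have "?f a = 0" by (rule alternating_not_distinct[OF assms]) simp
  ultimately show ?case using Cons[of "ys @ [u]"] by simp
qed simp

text \<open>In the multilinear expansion, terms with two copies of \<open>a\<close> vanish; in a
  term with a single \<open>a\<close>, moving it to the front of the block costs the sign. It
  relates the edges of a face opposite to the base point to edges starting at the base
  point.\<close>

lemma alternating_map_diff:
  assumes "alternating k \<alpha>"
  shows "\<alpha> (xs @ map (\<lambda>u. u - a) us) =
    \<alpha> (xs @ us) - (\<Sum>j<length us. (-1) ^ j * \<alpha> (xs @ a # remove_nth j us))"
proof (induction us arbitrary: xs)
  case (Cons u us)
  let ?f = "\<lambda>v. \<alpha> (xs @ v # map (\<lambda>u. u - a) us)"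
  have "\<alpha> (xs @ map (\<lambda>u. u - a) (u # us)) = ?f u - ?f a"
    using linear_diff[OF alternating_linear[OF assms], of xs u a] by simp
  also have "?f a = \<alpha> (xs @ a # us)"
    using alternating_Cons_diff[OF assms, of xs a "[]" us] by simp
  also have "?f u = \<alpha> (xs @ u # us) -
      (\<Sum>j<length us. (-1) ^ j * \<alpha> (xs @ u # a # remove_nth j us))"
    using Cons[of "xs @ [u]"] by simp
  also have "(\<Sum>j<length us. (-1) ^ j * \<alpha> (xs @ u # a # remove_nth j us)) =
      (\<Sum>j<length us. - ((-1) ^ j * \<alpha> (xs @ a # u # remove_nth j us)))"
    by (intro sum.cong refl) (simp add: alternating_swap[OF assms, of xs u a])
  finally show ?case
    by (simp add: sum.lessThan_Suc_shift sum_negf del: sum.lessThan_Suc)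
qed simp


text \<open>Skew-symmetrization over the choice of the argument that enters the separate slot. The
  exterior derivative at a point and the Laplace expansion of a determinant both have this form, so
  one lemma shows that both are alternating.\<close>

definition alternate :: "('a::euclidean_space list \<Rightarrow> 'a \<Rightarrow> real) \<Rightarrow> 'a list \<Rightarrow> real"
  where "alternate B vs = (\<Sum>i<length vs. (-1) ^ i * B (remove_nth i vs) (vs ! i))"

text \<open>If the entries at positions \<open>a < b\<close> coincide, only the two terms that take
  one of them out survive. Their lists differ by moving that entry across the
  \<open>b - a - 1\<close> entries in between, and with the factors \<open>(-1) ^ a\<close> and
  \<open>(-1) ^ b\<close> they cancel.\<close>

lemma alternating_alternate:
  assumes B: "\<And>u. alternating k (\<lambda>us. B us u)" "\<And>us. linear (B us)"
  shows "alternating (k + 1) (alternate B)"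
  unfolding alternating_def
proof (intro conjI allI impI)
  fix vs :: "'a list"
  assume "int (length vs) \<noteq> k + 1"
  then show "alternate B vs = 0"
    unfolding alternate_def
    by (intro sum.neutral) (auto simp: length_remove_nth intro!: alternating_length[OF B(1)])
next
  fix vs :: "'a list" and j assume j: "j < length vs"
  have "linear (\<lambda>v. (-1) ^ i * B (remove_nth i (vs[j := v])) (vs[j := v] ! i))"
    if i: "i < length vs" for i
  proof (cases "i = j")
    case True
    then show ?thesis
      using linear_compose_scale_right[OF B(2), of "(-1) ^ i" "remove_nth i vs"] i
      by (simp add: remove_nth_update_same)
  next
    case False
    define l where "l = (if j < i then j else j - 1)"
    have "l < length (remove_nth i vs)" using i j False by (auto simp: l_def length_remove_nth)
    then have "linear (\<lambda>v. B ((remove_nth i vs)[l := v]) (vs ! i))"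
      using B(1)[of "vs ! i"] unfolding alternating_def by blast
    from linear_compose_scale_right[OF this, of "(-1) ^ i"] show ?thesis
      using i j False by (simp add: remove_nth_update l_def)
  qed
  then have "linear (\<lambda>v. \<Sum>i<length vs. (-1) ^ i * B (remove_nth i (vs[j := v])) (vs[j := v] ! i))"
    by (intro linear_compose_sum) auto
  then show "linear (\<lambda>v. alternate B (vs[j := v]))"
    by (simp add: alternate_def)
next
  fix vs :: "'a list" assume "\<not> distinct vs"
  then obtain a b where ab: "a < b" "b < length vs" "vs ! a = vs ! b"
    by (metis distinct_conv_nth nat_neq_iff)
  let ?t = "\<lambda>i. (-1) ^ i * B (remove_nth i vs) (vs ! i)"
  have "alternate B vs = sum ?t {a, b}"
    unfolding alternate_def
  proof (rule sum.mono_neutral_right)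
    show "\<forall>i\<in>{..<length vs} - {a, b}. ?t i = 0"
      using ab alternating_not_distinct[OF B(1)] not_distinct_remove_nth[of a vs b] by simp
  qed (use ab in auto)
  also have "\<dots> = 0"
  proof -
    define u where "u = vs ! a"
    obtain zs xs' where 1: "vs = xs' @ vs ! b # zs" "length xs' = b" "remove_nth b vs = xs' @ zs"
      using ab by (meson remove_nth_split)
    then have "xs' ! a = u" using ab by (metis u_def nth_append)
    then obtain xs ys where 2: "xs' = xs @ u # ys" "length xs = a"
      using 1 ab by (metis id_take_nth_drop length_take less_imp_le_nat min.absorb2)
    have vs: "vs = xs @ u # ys @ u # zs" using 1 2 ab by (simp add: u_def)
    have "remove_nth a vs = xs @ ys @ u # zs" "remove_nth b vs = xs @ u # ys @ zs"
      using 1 2 remove_nth_append[of xs u "ys @ u # zs"] by (auto simp: vs)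
    then have "B (remove_nth b vs) u = (-1) ^ length ys * B (remove_nth a vs) u"
      using alternating_move[OF B(1)] by simp
    moreover have "b = a + Suc (length ys)" using 1 2 by simp
    ultimately show ?thesis
      using ab by (simp add: u_def power_add)
  qed
  finally show "alternate B vs = 0" .
qed

text \<open>The wedge product of the covectors \<open>c \<bullet> _\<close>. Representing covectors
  by vectors makes rows and columns interchangeable, so every rule for the arguments is also a rule
  for the factors.\<close>

definition covector_wedge :: "'a::euclidean_space list \<Rightarrow> 'a list \<Rightarrow> real"
  where "covector_wedge cs vs = (if length vs = length cs
    then Determinant.det (Matrix.mat (length cs) (length cs) (\<lambda>(i, j). cs ! i \<bullet> vs ! j)) else 0)"

lemma covector_wedge_commute: "covector_wedge cs vs = covector_wedge vs cs"
proof (cases "length vs = length cs")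
  case True
  let ?A = "Matrix.mat (length cs) (length cs) (\<lambda>(i, j). cs ! i \<bullet> vs ! j)"
  have "Determinant.det (transpose_mat ?A) = Determinant.det ?A"
    by (rule det_transpose[of _ "length cs"]) auto
  moreover have "transpose_mat ?A = Matrix.mat (length cs) (length cs) (\<lambda>(i, j). vs ! i \<bullet> cs ! j)"
    by (rule eq_matI) (auto simp: inner_commute)
  ultimately show ?thesis using True by (simp add: covector_wedge_def)
qed (auto simp: covector_wedge_def)

lemma covector_wedge_cong:
  assumes "length us = length vs" "\<And>c j. c \<in> set cs \<Longrightarrow> j < length vs \<Longrightarrow> c \<bullet> us ! j = d c \<bullet> vs ! j"
  shows "covector_wedge cs us = covector_wedge (map d cs) vs"
proof -
  have "Matrix.mat (length cs) (length cs) (\<lambda>(i, j). cs ! i \<bullet> us ! j) =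
      Matrix.mat (length cs) (length cs) (\<lambda>(i, j). map d cs ! i \<bullet> vs ! j)"
    if "length vs = length cs"
    using that assms by (intro eq_matI) auto
  then show ?thesis using assms(1) by (auto simp: covector_wedge_def)
qed

lemma covector_wedge_Cons: "covector_wedge (c # cs) = alternate (\<lambda>us u. (c \<bullet> u) * covector_wedge cs us)"
proof
  fix vs
  show "covector_wedge (c # cs) vs = alternate (\<lambda>us u. (c \<bullet> u) * covector_wedge cs us) vs"
  proof (cases "length vs = Suc (length cs)")
    case True
    let ?n = "Suc (length cs)"
    let ?A = "Matrix.mat ?n ?n (\<lambda>(i, j). (c # cs) ! i \<bullet> vs ! j)"
    have "cofactor ?A 0 j = (-1) ^ j * covector_wedge cs (remove_nth j vs)" if j: "j < ?n" for j
    proof -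
      have "mat_delete ?A 0 j =
          Matrix.mat (length cs) (length cs) (\<lambda>(i, l). cs ! i \<bullet> remove_nth j vs ! l)"
        by (rule eq_matI) (use j True in \<open>auto simp: mat_delete_def nth_remove_nth\<close>)
      then show ?thesis
        using j True by (simp add: cofactor_def covector_wedge_def length_remove_nth)
    qed
    moreover have "Determinant.det ?A = (\<Sum>j<?n. ?A $$ (0, j) * cofactor ?A 0 j)"
      by (rule laplace_expansion_row) auto
    ultimately show ?thesis
      using True by (auto simp: covector_wedge_def alternate_def intro!: sum.cong)
  next
    case False
    then have "covector_wedge cs (remove_nth i vs) = 0" if "i < length vs" for i
      using that by (auto simp: covector_wedge_def length_remove_nth)
    then show ?thesis using False by (simp add: alternate_def covector_wedge_def)
  qed
qed

lemma alternating_covector_wedge: "alternating (int (length cs)) (covector_wedge cs)"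
proof (induction cs)
  case Nil
  have "linear (\<lambda>v. covector_wedge [] (xs @ v # ys))" for xs ys :: "'a list"
    by (auto simp: covector_wedge_def intro: linearI)
  then show ?case
    by (intro alternatingI) (auto simp: covector_wedge_def)
next
  case (Cons c cs)
  have "linear (\<lambda>u. (c \<bullet> u) * covector_wedge cs us)" for us
    by (intro linearI) (auto simp: inner_add_right algebra_simps)
  with alternating_alternate[of "int (length cs)" "\<lambda>us u. (c \<bullet> u) * covector_wedge cs us"]
    alternating_scale[OF Cons]
  show ?case by (simp add: covector_wedge_Cons add.commute)
qed

lemma covector_wedge_sum:
  "(\<Sum>i\<in>I. covector_wedge (c i # cs) vs) = covector_wedge ((\<Sum>i\<in>I. c i) # cs) vs"
  by (simp add: covector_wedge_Cons alternate_def inner_sum_left sum_distrib_left sum_distrib_right)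
    (subst sum.swap, simp add: mult.assoc)

lemma covector_wedge_column:
  "covector_wedge cs (u # us) =
    (\<Sum>i<length cs. (-1) ^ i * ((cs ! i \<bullet> u) * covector_wedge (remove_nth i cs) us))"
  by (simp add: covector_wedge_commute[of cs] covector_wedge_Cons alternate_def inner_commute
      covector_wedge_commute[of us])

lemma covector_wedge_eq_0_row:
  assumes "c \<in> set cs" "\<And>v. v \<in> set vs \<Longrightarrow> c \<bullet> v = 0"
  shows "covector_wedge cs vs = 0"
proof (cases "length vs = length cs")
  case True
  from assms(1) obtain xs ys where cs: "cs = xs @ c # ys" by (meson split_list)
  have a: "alternating (int (length vs)) (\<lambda>cs. covector_wedge cs vs)"
    using alternating_covector_wedge[of vs] by (subst covector_wedge_commute)
  have "covector_wedge (c # xs @ ys) vs = 0"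
    by (simp add: covector_wedge_Cons alternate_def assms(2))
  then show ?thesis
    using alternating_move[OF a, of "[]" c xs ys] by (simp add: cs)
qed (simp add: covector_wedge_def)

lemma wedge_eq_covector_wedge:
  assumes "\<And>i v. i \<in> set \<sigma> \<Longrightarrow> v \<in> set vs \<Longrightarrow> d i x [v] = c i \<bullet> f v"
  shows "wedge (map d \<sigma>) x vs = covector_wedge (map c \<sigma>) (map f vs)"
proof -
  have "Matrix.mat (length \<sigma>) (length \<sigma>) (\<lambda>(i, j). (map d \<sigma> ! i) x [vs ! j]) =
      Matrix.mat (length \<sigma>) (length \<sigma>) (\<lambda>(i, j). map c \<sigma> ! i \<bullet> map f vs ! j)"
    if "length vs = length \<sigma>"
    using that assms by (intro eq_matI) auto
  then show ?thesis by (auto simp: wedge_def covector_wedge_def)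
qed


section \<open>Smooth forms and the exterior derivative\<close>

lemma iter_deriv_snoc:
  "iter_deriv f (vs @ [v]) = iter_deriv (\<lambda>x. frechet_derivative f (at x) v) vs"
  by (induction vs) auto

text \<open>\<open>iter_deriv\<close> applies the head of its list last; peeling the list from the
  other end exposes the derivative that is taken first.\<close>

lemma smooth_iff:
  "smooth f \<longleftrightarrow> (\<forall>x. f differentiable (at x)) \<and> (\<forall>v. smooth (\<lambda>x. frechet_derivative f (at x) v))"
proof
  assume f: "smooth f"
  have "f differentiable (at x)" for x
    using f unfolding smooth_def by (metis iter_deriv.simps(1))
  moreover have "smooth (\<lambda>x. frechet_derivative f (at x) v)" for v
    using f unfolding smooth_def by (metis iter_deriv_snoc)
  ultimately show "(\<forall>x. f differentiable (at x)) \<and> (\<forall>v. smooth (\<lambda>x. frechet_derivative f (at x) v))"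
    by blast
next
  assume r: "(\<forall>x. f differentiable (at x)) \<and> (\<forall>v. smooth (\<lambda>x. frechet_derivative f (at x) v))"
  show "smooth f"
    unfolding smooth_def
  proof (intro allI)
    fix vs x
    show "iter_deriv f vs differentiable (at x)"
      by (cases vs rule: rev_cases) (use r in \<open>auto simp: iter_deriv_snoc smooth_def\<close>)
  qed
qed

text \<open>Finite levels of smoothness make the closure properties provable by induction: the
  derivative of a product contains the factors undifferentiated, which is harmless because a level
  contains the next one.\<close>

primrec smooth_upto :: "nat \<Rightarrow> ('a::euclidean_space \<Rightarrow> real) \<Rightarrow> bool"
  where
    "smooth_upto 0 f \<longleftrightarrow> (\<forall>x. f differentiable (at x))"
  | "smooth_upto (Suc n) f \<longleftrightarrow> (\<forall>x. f differentiable (at x)) \<and>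
      (\<forall>v. smooth_upto n (\<lambda>x. frechet_derivative f (at x) v))"

lemma smooth_iff_smooth_upto: "smooth f \<longleftrightarrow> (\<forall>n. smooth_upto n f)"
proof
  show "smooth f \<Longrightarrow> \<forall>n. smooth_upto n f"
  proof
    fix n show "smooth f \<Longrightarrow> smooth_upto n f"
      by (induction n arbitrary: f) (use smooth_iff in auto)
  qed
  show "smooth f" if "\<forall>n. smooth_upto n f"
    unfolding smooth_def
  proof (intro allI)
    fix vs :: "'a list" and x
    have "smooth_upto (length vs) f" using that by blast
    then show "iter_deriv f vs differentiable (at x)"
    proof (induction vs arbitrary: f rule: rev_induct)
      case (snoc v vs)
      then show ?case by (simp add: iter_deriv_snoc)
    qed simp
  qed
qed

lemma smooth_upto_Suc_D: "smooth_upto (Suc n) f \<Longrightarrow> smooth_upto n f"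
  by (induction n arbitrary: f) auto

lemma frechet_derivative_add:
  assumes "f differentiable (at x)" "g differentiable (at x)"
  shows "frechet_derivative (\<lambda>y. f y + g y) (at x) v =
    frechet_derivative f (at x) v + frechet_derivative g (at x) v"
  using has_derivative_add[OF assms[unfolded frechet_derivative_works]]
  by (simp flip: frechet_derivative_at)

lemma frechet_derivative_mult:
  fixes f g :: "'a::euclidean_space \<Rightarrow> real"
  assumes "f differentiable (at x)" "g differentiable (at x)"
  shows "frechet_derivative (\<lambda>y. f y * g y) (at x) v =
    f x * frechet_derivative g (at x) v + frechet_derivative f (at x) v * g x"
  using has_derivative_mult[OF assms[unfolded frechet_derivative_works]]
  by (simp flip: frechet_derivative_at)

lemma frechet_derivative_const_real [simp]: "frechet_derivative (\<lambda>y. c) (at x) v = 0"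
  using has_derivative_const[of c "at x"] by (simp flip: frechet_derivative_at)

lemma frechet_derivative_cmult:
  fixes f :: "'a::euclidean_space \<Rightarrow> real"
  assumes "f differentiable (at x)"
  shows "frechet_derivative (\<lambda>y. c * f y) (at x) v = c * frechet_derivative f (at x) v"
  using frechet_derivative_mult[of "\<lambda>_. c" x f v] assms by simp

lemma frechet_derivative_affine [simp]:
  "frechet_derivative (\<lambda>y. c \<bullet> y + b) (at x) v = c \<bullet> v"
proof -
  have "((\<lambda>y. c \<bullet> y + b) has_derivative (\<lambda>v. c \<bullet> v)) (at x)"
    by (auto intro!: derivative_eq_intros)
  then show ?thesis by (simp flip: frechet_derivative_at)
qed

lemma smooth_upto_add: "smooth_upto n f \<Longrightarrow> smooth_upto n g \<Longrightarrow> smooth_upto n (\<lambda>x. f x + g x)"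
  by (induction n arbitrary: f g) (auto simp: frechet_derivative_add)

lemma smooth_upto_mult: "smooth_upto n f \<Longrightarrow> smooth_upto n g \<Longrightarrow> smooth_upto n (\<lambda>x. f x * g x)"
proof (induction n arbitrary: f g)
  case (Suc n)
  then have "smooth_upto n f" "smooth_upto n g" by (blast intro: smooth_upto_Suc_D)+
  with Suc show ?case by (auto simp: frechet_derivative_mult intro!: smooth_upto_add)
qed auto

lemma smooth_const [simp]: "smooth (\<lambda>x::'a::euclidean_space. c)"
proof -
  have "smooth_upto n (\<lambda>x::'a. c)" for n c by (induction n arbitrary: c) auto
  then show ?thesis by (simp add: smooth_iff_smooth_upto)
qed

lemma smooth_affine: "smooth (\<lambda>x. c \<bullet> x + b)"
  by (subst smooth_iff) (auto intro!: derivative_intros)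

lemma smooth_add: "smooth f \<Longrightarrow> smooth g \<Longrightarrow> smooth (\<lambda>x. f x + g x)"
  by (simp add: smooth_iff_smooth_upto smooth_upto_add)

lemma smooth_mult: "smooth f \<Longrightarrow> smooth g \<Longrightarrow> smooth (\<lambda>x. f x * g x)"
  by (simp add: smooth_iff_smooth_upto smooth_upto_mult)

lemma smooth_sum: "(\<And>i. i \<in> I \<Longrightarrow> smooth (f i)) \<Longrightarrow> smooth (\<lambda>x. \<Sum>i\<in>I. f i x)"
  by (induction I rule: infinite_finite_induct) (auto intro: smooth_add)

lemma smooth_power: "smooth f \<Longrightarrow> smooth (\<lambda>x. f x ^ n)"
  by (induction n) (auto intro: smooth_mult)

lemma smooth_prod: "(\<And>i. i \<in> I \<Longrightarrow> smooth (f i)) \<Longrightarrow> smooth (\<lambda>x. \<Prod>i\<in>I. f i x)"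
  by (induction I rule: infinite_finite_induct) (auto intro: smooth_mult)

lemma smooth_differentiable: "smooth f \<Longrightarrow> f differentiable (at x)"
  using smooth_iff by blast

lemma smooth_frechet_derivative: "smooth f \<Longrightarrow> smooth (\<lambda>x. frechet_derivative f (at x) v)"
  using smooth_iff by blast

lemma smooth_continuous_on: "smooth f \<Longrightarrow> continuous_on S f"
  by (meson continuous_at_imp_continuous_on differentiable_imp_continuous_within smooth_differentiable)

lemma smooth_has_derivative: "smooth f \<Longrightarrow> (f has_derivative frechet_derivative f (at x)) (at x within S)"
  using smooth_differentiable frechet_derivative_works has_derivative_at_withinI by blast

lemma smooth_line_has_derivative:
  assumes "smooth f"
  shows "((\<lambda>t. f (a + t *\<^sub>R v)) has_real_derivative frechet_derivative f (at (a + t *\<^sub>R v)) v) (at t within S)"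
proof -
  have "((\<lambda>t. a + t *\<^sub>R v) has_derivative (\<lambda>h. h *\<^sub>R v)) (at t within S)"
    by (auto intro!: derivative_eq_intros)
  from has_derivative_compose[OF this smooth_has_derivative[OF assms]]
  have "((\<lambda>t. f (a + t *\<^sub>R v)) has_derivative
      (\<lambda>h. frechet_derivative f (at (a + t *\<^sub>R v)) (h *\<^sub>R v))) (at t within S)" .
  moreover have lin: "linear (frechet_derivative f (at (a + t *\<^sub>R v)))"
    by (rule linear_frechet_derivative[OF smooth_differentiable[OF assms]])
  from lin have "(\<lambda>h. frechet_derivative f (at (a + t *\<^sub>R v)) (h *\<^sub>R v)) =
      (*) (frechet_derivative f (at (a + t *\<^sub>R v)) v)"
    by (simp add: linear_scale mult.commute fun_eq_iff)
  ultimately show ?thesis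
    unfolding has_field_derivative_def by simp
qed

text \<open>The mean value theorem, applied twice. Exchanging \<open>u\<close> and \<open>v\<close> gives the symmetry of second derivatives.\<close>

lemma smooth_second_difference:
  assumes f: "smooth f" and h: "0 < h"
  obtains s t where "0 < s" "s < h" "0 < t" "t < h"
    "f (x + h *\<^sub>R u + h *\<^sub>R v) - f (x + h *\<^sub>R u) - (f (x + h *\<^sub>R v) - f x) =
      h * h * frechet_derivative (\<lambda>y. frechet_derivative f (at y) u) (at (x + s *\<^sub>R u + t *\<^sub>R v)) v"
proof -
  let ?g = "\<lambda>y. frechet_derivative f (at y) u"
  let ?p = "\<lambda>s. f (x + h *\<^sub>R v + s *\<^sub>R u) - f (x + s *\<^sub>R u)"
  have "\<exists>s>0. s < h \<and> ?p h - ?p 0 = (h - 0) * (?g (x + h *\<^sub>R v + s *\<^sub>R u) - ?g (x + s *\<^sub>R u))"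
    by (rule MVT2[OF h]) (intro DERIV_diff smooth_line_has_derivative f)
  then obtain s where s: "0 < s" "s < h"
    "?p h - ?p 0 = h * (?g (x + h *\<^sub>R v + s *\<^sub>R u) - ?g (x + s *\<^sub>R u))" by auto
  have "\<exists>t>0. t < h \<and> ?g (x + s *\<^sub>R u + h *\<^sub>R v) - ?g (x + s *\<^sub>R u + 0 *\<^sub>R v) =
      (h - 0) * frechet_derivative ?g (at (x + s *\<^sub>R u + t *\<^sub>R v)) v"
    by (rule MVT2[OF h]) (intro smooth_line_has_derivative smooth_frechet_derivative f)
  then obtain t where "0 < t" "t < h"
    "?g (x + s *\<^sub>R u + h *\<^sub>R v) - ?g (x + s *\<^sub>R u) =
      h * frechet_derivative ?g (at (x + s *\<^sub>R u + t *\<^sub>R v)) v" by auto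
  with s show ?thesis by (intro that[of s t]) (auto simp: algebra_simps)
qed

lemma smooth_second_derivative_symmetric:
  assumes f: "smooth f"
  shows "frechet_derivative (\<lambda>y. frechet_derivative f (at y) u) (at x) v =
    frechet_derivative (\<lambda>y. frechet_derivative f (at y) v) (at x) u"
proof -
  let ?g = "\<lambda>u v z. frechet_derivative (\<lambda>y. frechet_derivative f (at y) u) (at z) v"
  define h where "h n = inverse (real (Suc n))" for n
  have h: "h n > 0" "h \<longlonglongrightarrow> 0" for n
    unfolding h_def by (auto simp del: of_nat_Suc intro: LIMSEQ_inverse_real_of_nat)
  \<comment> \<open>\<open>z\<close> consists of the intermediate points of the mean value theorem
    for steps of size \<open>h n\<close>; they converge to \<open>x\<close>.\<close>
  have *: "\<exists>z. z \<longlonglongrightarrow> x \<and> (\<forall>n. f (x + h n *\<^sub>R u + h n *\<^sub>R v) - f (x + h n *\<^sub>R u) -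
      (f (x + h n *\<^sub>R v) - f x) = h n * h n * ?g u v (z n))" for u v
  proof -
    have "\<exists>s t. 0 < s \<and> s < h n \<and> 0 < t \<and> t < h n \<and>
        f (x + h n *\<^sub>R u + h n *\<^sub>R v) - f (x + h n *\<^sub>R u) - (f (x + h n *\<^sub>R v) - f x) =
        h n * h n * ?g u v (x + s *\<^sub>R u + t *\<^sub>R v)" for n
      by (rule smooth_second_difference[OF f h(1), of n x u v]) blast
    then obtain s t where st: "\<And>n. 0 < s n \<and> s n < h n \<and> 0 < t n \<and> t n < h n \<and>
        f (x + h n *\<^sub>R u + h n *\<^sub>R v) - f (x + h n *\<^sub>R u) - (f (x + h n *\<^sub>R v) - f x) =
        h n * h n * ?g u v (x + s n *\<^sub>R u + t n *\<^sub>R v)" by metis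
    have "s \<longlonglongrightarrow> 0" "t \<longlonglongrightarrow> 0"
      by (rule tendsto_sandwich[OF _ _ tendsto_const h(2)]; use st in \<open>auto intro!: always_eventually less_imp_le\<close>)+
    then have "(\<lambda>n. x + s n *\<^sub>R u + t n *\<^sub>R v) \<longlonglongrightarrow> x + 0 *\<^sub>R u + 0 *\<^sub>R v"
      by (intro tendsto_intros)
    with st show ?thesis by (intro exI[of _ "\<lambda>n. x + s n *\<^sub>R u + t n *\<^sub>R v"]) auto
  qed
  obtain z where z: "z \<longlonglongrightarrow> x" "\<And>n. f (x + h n *\<^sub>R u + h n *\<^sub>R v) - f (x + h n *\<^sub>R u) -
      (f (x + h n *\<^sub>R v) - f x) = h n * h n * ?g u v (z n)" using *[of u v] by blast
  obtain w where w: "w \<longlonglongrightarrow> x" "\<And>n. f (x + h n *\<^sub>R v + h n *\<^sub>R u) - f (x + h n *\<^sub>R v) -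
      (f (x + h n *\<^sub>R u) - f x) = h n * h n * ?g v u (w n)" using *[of v u] by blast
  have eq: "?g u v (z n) = ?g v u (w n)" for n
  proof -
    have "h n * h n * ?g u v (z n) = h n * h n * ?g v u (w n)"
      unfolding z(2)[symmetric] w(2)[symmetric] by (simp add: add_ac)
    then show ?thesis using h(1)[of n] by simp
  qed
  have c: "isCont (?g u v) x" for u v
    by (intro differentiable_imp_continuous_within smooth_differentiable smooth_frechet_derivative f)
  have "(\<lambda>n. ?g u v (z n)) \<longlonglongrightarrow> ?g u v x" "(\<lambda>n. ?g v u (w n)) \<longlonglongrightarrow> ?g v u x"
    using isCont_tendsto_compose[OF c] z(1) w(1) by blast+
  then show ?thesis using eq LIMSEQ_unique by simp
qed


section \<open>The exterior derivative on the ambient space\<close>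

lemma ambient_formsD:
  assumes "\<omega> \<in> ambient_forms k"
  shows "alternating k (\<omega> x)" "smooth (\<lambda>x. \<omega> x vs)"
  using assms by (auto simp: ambient_forms_def)

lemma subspace_ambient_forms: "subspace (ambient_forms k)"
  unfolding subspace_def ambient_forms_def
  by (auto simp: plus_fun_def scaleR_fun_def zero_fun_def
      intro: alternating_0 alternating_add alternating_scale smooth_add smooth_mult)

definition ambient_deriv :: "'a::euclidean_space form \<Rightarrow> 'a form"
  where "ambient_deriv \<omega> = (\<lambda>x. alternate (\<lambda>us. frechet_derivative (\<lambda>y. \<omega> y us) (at x)))"

lemma ambient_deriv_ambient_forms:
  assumes w: "\<omega> \<in> ambient_forms k"
  shows "ambient_deriv \<omega> \<in> ambient_forms (k + 1)"
proof -
  note d = smooth_differentiable[OF ambient_formsD(2)[OF w]]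
  have 0: "\<omega> y us = 0" if "int (length us) \<noteq> k \<or> \<not> distinct us" for y us
    using ambient_formsD(1)[OF w, of y] that by (auto simp: alternating_def)
  have lin: "linear (\<lambda>v. frechet_derivative (\<lambda>y. \<omega> y (xs @ v # ys)) (at x) u)" for x u xs ys
  proof (rule linearI)
    note l = alternating_linear[OF ambient_formsD(1)[OF w]]
    show "frechet_derivative (\<lambda>y. \<omega> y (xs @ (v + v') # ys)) (at x) u =
        frechet_derivative (\<lambda>y. \<omega> y (xs @ v # ys)) (at x) u +
        frechet_derivative (\<lambda>y. \<omega> y (xs @ v' # ys)) (at x) u" for v v'
      by (simp add: linear_add[OF l] frechet_derivative_add d)
    show "frechet_derivative (\<lambda>y. \<omega> y (xs @ (c *\<^sub>R v) # ys)) (at x) u =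
        c *\<^sub>R frechet_derivative (\<lambda>y. \<omega> y (xs @ v # ys)) (at x) u" for c v
      by (simp add: linear_scale[OF l] frechet_derivative_cmult d)
  qed
  have "alternating (k + 1) (ambient_deriv \<omega> x)" for x
    unfolding ambient_deriv_def
    by (intro alternating_alternate alternatingI linear_frechet_derivative d lin) (simp_all add: 0)
  moreover have "smooth (\<lambda>x. ambient_deriv \<omega> x vs)" for vs
    unfolding ambient_deriv_def alternate_def
    by (intro smooth_sum smooth_mult smooth_const smooth_frechet_derivative ambient_formsD(2)[OF w])
  ultimately show ?thesis by (simp add: ambient_forms_def)
qed

lemma ambient_deriv_add:
  assumes "\<omega> \<in> ambient_forms k" "\<eta> \<in> ambient_forms k"
  shows "ambient_deriv (\<omega> + \<eta>) = ambient_deriv \<omega> + ambient_deriv \<eta>"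
  using assms
  by (intro ext) (simp add: ambient_deriv_def alternate_def frechet_derivative_add distrib_left
      sum.distrib smooth_differentiable ambient_formsD)

lemma ambient_deriv_scaleR:
  assumes "\<omega> \<in> ambient_forms k"
  shows "ambient_deriv (c *\<^sub>R \<omega>) = c *\<^sub>R ambient_deriv \<omega>"
  using assms
  by (intro ext) (simp add: ambient_deriv_def alternate_def frechet_derivative_cmult scaleR_fun_def
      sum_distrib_left mult_ac smooth_differentiable ambient_formsD)

text \<open>Here \<open>j\<close> is a position in a list from which the entry \<open>i\<close> has
  been removed. Taking out \<open>i\<close> and then \<open>j < i\<close> removes the same entries
  as taking out \<open>j\<close> and then \<open>i - 1\<close>; this matches the pairs below the
  diagonal with the remaining ones.\<close>

lemma sum_antisymmetric_pairs:
  fixes t :: "nat \<Rightarrow> nat \<Rightarrow> real"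
  assumes "\<And>i j. j < i \<Longrightarrow> i < n \<Longrightarrow> t i j = - t j (i - 1)"
  shows "(\<Sum>i<n. \<Sum>j<n - 1. t i j) = 0"
proof -
  let ?A = "{(i, j). j < i \<and> i < n}" and ?B = "{(i, j). i \<le> j \<and> j < n - 1}"
  have fin: "finite ?A" "finite ?B"
    by (rule finite_subset[of _ "{..<n} \<times> {..<n}"]; force)+
  have "(\<Sum>i<n. \<Sum>j<n - 1. t i j) = (\<Sum>(i, j)\<in>{..<n} \<times> {..<n - 1}. t i j)"
    by (simp add: sum.cartesian_product)
  also have "{..<n} \<times> {..<n - 1} = ?A \<union> ?B" by auto
  also have "(\<Sum>(i, j)\<in>?A \<union> ?B. t i j) = (\<Sum>(i, j)\<in>?A. t i j) + (\<Sum>(i, j)\<in>?B. t i j)"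
    by (rule sum.union_disjoint) (use fin in auto)
  also have "(\<Sum>(i, j)\<in>?B. t i j) = (\<Sum>(i, j)\<in>?A. t j (i - 1))"
    by (rule sum.reindex_bij_witness[of _ "\<lambda>(i, j). (j, i - 1)" "\<lambda>(i, j). (j + 1, i)"]) auto
  also have "(\<Sum>(i, j)\<in>?A. t i j) = - (\<Sum>(i, j)\<in>?A. t j (i - 1))"
    unfolding sum_negf[symmetric] by (rule sum.cong) (auto simp: assms)
  finally show ?thesis by simp
qed

lemma ambient_deriv_ambient_deriv:
  assumes w: "\<omega> \<in> ambient_forms k"
  shows "ambient_deriv (ambient_deriv \<omega>) = 0"
proof (intro ext)
  fix x vs
  let ?H = "\<lambda>us u v. frechet_derivative (\<lambda>y. frechet_derivative (\<lambda>y. \<omega> y us) (at y) u) (at x) v"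
  let ?t = "\<lambda>i j. (-1) ^ i * ((-1) ^ j *
    ?H (remove_nth j (remove_nth i vs)) (remove_nth i vs ! j) (vs ! i))"
  have sm: "smooth (\<lambda>y. frechet_derivative (\<lambda>y. \<omega> y us) (at y) u)" for us u
    by (intro smooth_frechet_derivative ambient_formsD(2)[OF w])
  have "frechet_derivative (\<lambda>y. ambient_deriv \<omega> y us) (at x) v =
      (\<Sum>j<length us. (-1) ^ j * ?H (remove_nth j us) (us ! j) v)" for us v
  proof -
    have "((\<lambda>y. ambient_deriv \<omega> y us) has_derivative
        (\<lambda>v. \<Sum>j<length us. (-1) ^ j * ?H (remove_nth j us) (us ! j) v)) (at x)"
      unfolding ambient_deriv_def alternate_def
      by (intro has_derivative_sum has_derivative_mult_right smooth_has_derivative sm)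
    then show ?thesis by (simp flip: frechet_derivative_at)
  qed
  then have "ambient_deriv (ambient_deriv \<omega>) x vs = (\<Sum>i<length vs. \<Sum>j<length vs - 1. ?t i j)"
    by (simp add: ambient_deriv_def[of "ambient_deriv \<omega>"] alternate_def length_remove_nth sum_distrib_left)
  also have "\<dots> = 0"
  proof (rule sum_antisymmetric_pairs)
    fix i j assume ij: "j < i" "i < length vs"
    then have "remove_nth i vs ! j = vs ! j" "remove_nth j vs ! (i - 1) = vs ! i"
      by (auto simp: nth_remove_nth)
    moreover have "(-1::real) ^ i = - ((-1) ^ (i - 1))"
      using ij by (cases i) auto
    moreover have "?H us (vs ! j) (vs ! i) = ?H us (vs ! i) (vs ! j)" for us
      by (rule smooth_second_derivative_symmetric[OF ambient_formsD(2)[OF w]])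
    ultimately show "?t i j = - ?t j (i - 1)"
      using ij by (simp add: remove_nth_remove_nth)
  qed
  finally show "ambient_deriv (ambient_deriv \<omega>) x vs = 0 x vs" by simp
qed


section \<open>Pullback to convex sets\<close>

lemma tangent_space_diff: "x \<in> T \<Longrightarrow> y \<in> T \<Longrightarrow> x - y \<in> tangent_space T"
  unfolding tangent_space_def by (intro span_base) auto

lemma subspace_tangent_space: "subspace (tangent_space T)"
  by (simp add: tangent_space_def)

lemma tangent_space_mono: "F \<subseteq> T \<Longrightarrow> tangent_space F \<subseteq> tangent_space T"
  unfolding tangent_space_def by (intro span_mono) auto

lemma pullback_pullback: "F \<subseteq> T \<Longrightarrow> pullback F (pullback T \<omega>) = pullback F \<omega>"
  using tangent_space_mono[of F T] by (auto simp: pullback_def fun_eq_iff)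

lemma pullback_add: "pullback T (\<omega> + \<eta>) = pullback T \<omega> + pullback T \<eta>"
  by (auto simp: pullback_def fun_eq_iff)

lemma pullback_scaleR: "pullback T (c *\<^sub>R \<omega>) = c *\<^sub>R pullback T \<omega>"
  by (auto simp: pullback_def fun_eq_iff scaleR_fun_def)

lemma linear_pullback: "linear (pullback T)"
  by (intro linearI pullback_add pullback_scaleR)

lemmas pullback_diff = linear_diff[OF linear_pullback]
lemmas pullback_0 = linear_0[OF linear_pullback]

lemma pullback_eq_0_iff:
  "pullback T \<omega> = 0 \<longleftrightarrow> (\<forall>x\<in>T. \<forall>vs. set vs \<subseteq> tangent_space T \<longrightarrow> \<omega> x vs = 0)"
  by (auto simp: pullback_def fun_eq_iff)

lemma pullback_cong:
  "(\<And>x vs. x \<in> T \<Longrightarrow> set vs \<subseteq> tangent_space T \<Longrightarrow> \<omega> x vs = \<eta> x vs) \<Longrightarrow> pullback T \<omega> = pullback T \<eta>"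
  by (auto simp: pullback_def fun_eq_iff)

text \<open>\<open>T\<close> may have empty interior, so derivatives within it are not unique as
  linear maps. Along a segment from \<open>x\<close> to another point of \<open>T\<close> they are,
  by the one-dimensional case, and such directions generate the tangent space.\<close>

lemma has_derivative_within_convex_unique:
  fixes f :: "'a::euclidean_space \<Rightarrow> real"
  assumes "convex T" "x \<in> T"
    and f: "(f has_derivative f') (at x within T)" "(f has_derivative f'') (at x within T)"
    and "v \<in> tangent_space T"
  shows "f' v = f'' v"
proof -
  define D where "D v = f' v - f'' v" for v
  have lin: "linear D"
    unfolding D_def using f by (intro linear_compose_sub has_derivative_linear)
  have 0: "((\<lambda>y. 0) has_derivative D) (at x within T)"
    unfolding D_def using has_derivative_diff[OF f] by simp
  have *: "D (y - x) = 0" if y: "y \<in> T" for y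
  proof -
    let ?p = "\<lambda>t. x + t *\<^sub>R (y - x)"
    have p: "?p ` {0..1} \<subseteq> T"
      using assms(1,2) y by (auto simp: convex_alt algebra_simps)
    have "(?p has_derivative (\<lambda>t. t *\<^sub>R (y - x))) (at 0 within {0..1})"
      by (auto intro!: derivative_eq_intros)
    moreover have "((\<lambda>y. 0) has_derivative D) (at (?p 0) within ?p ` {0..1})"
      using has_derivative_subset[OF 0 p] by simp
    ultimately have "((\<lambda>t. 0) has_derivative (\<lambda>t. D (t *\<^sub>R (y - x)))) (at 0 within {0..1})"
      by (rule has_derivative_in_compose)
    then have "((\<lambda>t. 0::real) has_vector_derivative D (y - x)) (at 0 within {0..1})"
      by (simp add: has_vector_derivative_def linear_scale[OF lin])
    moreover have "((\<lambda>t. 0::real) has_vector_derivative 0) (at 0 within {0..1})" by simp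
    moreover have "at (0::real) within {0..1} \<noteq> bot"
      by (simp add: trivial_limit_within)
    ultimately show ?thesis using vector_derivative_unique_within by blast
  qed
  have "D w = 0" if "w \<in> {a - b |a b. a \<in> T \<and> b \<in> T}" for w
  proof -
    from that obtain a b where "w = (a - x) - (b - x)" "a \<in> T" "b \<in> T" by auto
    then show ?thesis using * by (simp only: linear_diff[OF lin])
  qed
  then have "D v = 0"
    using assms(5) linear_eq_0_on_span[OF lin] unfolding tangent_space_def by blast
  then show ?thesis by (simp add: D_def)
qed

lemma frechet_derivative_within_convex:
  fixes f :: "'a::euclidean_space \<Rightarrow> real"
  assumes "convex T" "x \<in> T" "smooth f" "\<And>y. y \<in> T \<Longrightarrow> h y = f y" "v \<in> tangent_space T"
  shows "frechet_derivative h (at x within T) v = frechet_derivative f (at x) v"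
proof -
  have "(h has_derivative frechet_derivative f (at x)) (at x within T)"
    by (rule has_derivative_transform_within[where f = f and d = 1])
      (auto simp: assms smooth_has_derivative)
  moreover from this have "(h has_derivative frechet_derivative h (at x within T)) (at x within T)"
    unfolding differentiable_def[symmetric] using frechet_derivative_works differentiable_def by blast
  ultimately show ?thesis
    using has_derivative_within_convex_unique assms by blast
qed

text \<open>The algebra of \<open>ext_deriv\<close> is inherited from \<open>ambient_deriv\<close>
  through this identity. It also shows that the right-hand side does not depend on the chosen
  ambient extension.\<close>

lemma ext_deriv_pullback:
  assumes "convex T" "\<omega> \<in> ambient_forms k"
  shows "ext_deriv T (pullback T \<omega>) = pullback T (ambient_deriv \<omega>)"
  unfolding ext_deriv_def
proof (rule pullback_cong)
  fix x vs assume x: "x \<in> T" and vs: "set vs \<subseteq> tangent_space T"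
  have "frechet_derivative (\<lambda>y. pullback T \<omega> y (remove_nth i vs)) (at x within T) (vs ! i) =
      frechet_derivative (\<lambda>y. \<omega> y (remove_nth i vs)) (at x) (vs ! i)" if "i < length vs" for i
    using that vs set_remove_nth_subset[of i vs]
    by (intro frechet_derivative_within_convex assms(1) x ambient_formsD(2)[OF assms(2)])
      (auto simp: pullback_def)
  then show "(\<Sum>i<length vs. (-1) ^ i *
      frechet_derivative (\<lambda>y. pullback T \<omega> y (remove_nth i vs)) (at x within T) (vs ! i)) =
      ambient_deriv \<omega> x vs"
    by (simp add: ambient_deriv_def alternate_def)
qed

lemma subspace_smooth_forms: "subspace (smooth_forms k T)"
  unfolding smooth_forms_def
  by (intro linear_subspace_image linear_pullback subspace_ambient_forms)

lemma smooth_formsE: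
  assumes "\<omega> \<in> smooth_forms k T"
  obtains \<omega>' where "\<omega>' \<in> ambient_forms k" "\<omega> = pullback T \<omega>'"
  using assms by (auto simp: smooth_forms_def)

lemma pullback_smooth_forms: "F \<subseteq> T \<Longrightarrow> \<omega> \<in> smooth_forms k T \<Longrightarrow> pullback F \<omega> \<in> smooth_forms k F"
  by (auto simp: smooth_forms_def pullback_pullback)

lemma ext_deriv_smooth_forms:
  "convex T \<Longrightarrow> \<omega> \<in> smooth_forms k T \<Longrightarrow> ext_deriv T \<omega> \<in> smooth_forms (k + 1) T"
  by (auto simp: smooth_forms_def ext_deriv_pullback ambient_deriv_ambient_forms)

lemma ext_deriv_add:
  assumes "convex T" "\<omega> \<in> smooth_forms k T" "\<eta> \<in> smooth_forms k T"
  shows "ext_deriv T (\<omega> + \<eta>) = ext_deriv T \<omega> + ext_deriv T \<eta>"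
proof -
  obtain \<omega>' \<eta>' where "\<omega>' \<in> ambient_forms k" "\<omega> = pullback T \<omega>'"
      "\<eta>' \<in> ambient_forms k" "\<eta> = pullback T \<eta>'"
    using assms by (metis smooth_formsE)
  moreover from this have "\<omega>' + \<eta>' \<in> ambient_forms k"
    using subspace_add[OF subspace_ambient_forms] by blast
  ultimately show ?thesis
    by (simp only: pullback_add[symmetric] ext_deriv_pullback[OF assms(1)] ambient_deriv_add)
qed

lemma ext_deriv_scaleR:
  assumes "convex T" "\<omega> \<in> smooth_forms k T"
  shows "ext_deriv T (c *\<^sub>R \<omega>) = c *\<^sub>R ext_deriv T \<omega>"
proof -
  obtain \<omega>' where "\<omega>' \<in> ambient_forms k" "\<omega> = pullback T \<omega>'"
    using assms by (metis smooth_formsE)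
  moreover from this have "c *\<^sub>R \<omega>' \<in> ambient_forms k"
    using subspace_scale[OF subspace_ambient_forms] by blast
  ultimately show ?thesis
    by (simp only: pullback_scaleR[symmetric] ext_deriv_pullback[OF assms(1)] ambient_deriv_scaleR)
qed

lemma ext_deriv_0: "convex T \<Longrightarrow> ext_deriv T 0 = 0"
  using ext_deriv_scaleR[of T 0 0 0] subspace_0[OF subspace_smooth_forms, of 0 T] by simp

lemma ext_deriv_diff:
  assumes "convex T" "\<omega> \<in> smooth_forms k T" "\<eta> \<in> smooth_forms k T"
  shows "ext_deriv T (\<omega> - \<eta>) = ext_deriv T \<omega> - ext_deriv T \<eta>"
  using ext_deriv_add[OF assms(1,2) subspace_scale[OF subspace_smooth_forms assms(3), of "-1"]]
    ext_deriv_scaleR[OF assms(1,3), of "-1"] by simp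

lemma ext_deriv_ext_deriv:
  assumes "convex T" "\<omega> \<in> smooth_forms k T"
  shows "ext_deriv T (ext_deriv T \<omega>) = 0"
  using assms
  by (auto simp: smooth_forms_def ext_deriv_pullback[where k = k] ambient_deriv_ambient_deriv pullback_0
      ext_deriv_pullback[where k = "k + 1", OF _ ambient_deriv_ambient_forms])

lemma pullback_ext_deriv:
  assumes "convex T" "convex F" "F \<subseteq> T" "\<omega> \<in> smooth_forms k T"
  shows "pullback F (ext_deriv T \<omega>) = ext_deriv F (pullback F \<omega>)"
  using assms by (auto simp: smooth_forms_def ext_deriv_pullback pullback_pullback)

lemma smooth_forms_continuous_on:
  assumes "\<omega> \<in> smooth_forms k T" "set vs \<subseteq> tangent_space T"
  shows "continuous_on T (\<lambda>x. \<omega> x vs)"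
proof -
  obtain \<omega>' where w: "\<omega>' \<in> ambient_forms k" "\<omega> = pullback T \<omega>'"
    using assms by (auto elim: smooth_formsE)
  have "continuous_on T (\<lambda>x. \<omega>' x vs)"
    by (intro smooth_continuous_on ambient_formsD(2)[OF w(1)])
  then show ?thesis
    by (rule continuous_on_eq) (use assms w in \<open>auto simp: pullback_def\<close>)
qed


section \<open>Simplices and barycentric coordinates\<close>

abbreviation vertices :: "'a::euclidean_space set \<Rightarrow> 'a set"
  where "vertices T \<equiv> {v. v extreme_point_of T}"

lemma vertices_convex_hull:
  fixes V :: "'a::euclidean_space set"
  shows "\<not> affine_dependent V \<Longrightarrow> vertices (convex hull V) = V"
  by (simp add: extreme_point_of_convex_hull_affine_independent)

lemma is_simplex_convex_hull:
  fixes V :: "'a::euclidean_space set"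
  assumes "\<not> affine_dependent V" "V \<noteq> {}"
  shows "is_simplex (convex hull V)"
proof -
  have "card V > 0" using assms aff_independent_finite by (simp add: card_gt_0_iff)
  then have "int (card V) = int (card V - 1) + 1" by simp
  then show ?thesis using assms unfolding is_simplex_def simplex_def by blast
qed

lemma is_simplexE:
  fixes T :: "'a::euclidean_space set"
  assumes "is_simplex T"
  shows "finite (vertices T)" "vertices T \<noteq> {}" "\<not> affine_dependent (vertices T)"
    "convex hull (vertices T) = T" "aff_dim T = int (card (vertices T)) - 1"
proof -
  obtain m :: nat and C where C: "\<not> affine_dependent C" "int (card C) = int m + 1" "T = convex hull C"
    using assms unfolding is_simplex_def simplex_def by blast
  then have "vertices T = C" by (simp add: vertices_convex_hull)
  moreover have "finite C" using C by (simp add: aff_independent_finite)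
  moreover have "C \<noteq> {}" using C by auto
  ultimately show "finite (vertices T)" "vertices T \<noteq> {}" "\<not> affine_dependent (vertices T)"
      "convex hull (vertices T) = T" "aff_dim T = int (card (vertices T)) - 1"
    using C by (auto simp: aff_dim_affine_independent aff_dim_convex_hull)
qed

lemma is_simplex_convex: "is_simplex T \<Longrightarrow> convex T"
  by (auto simp: is_simplex_def convex_simplex)

lemma is_simplex_compact: "is_simplex T \<Longrightarrow> compact T"
  by (auto simp: is_simplex_def compact_simplex)

lemma is_simplex_aff_dim_nonneg: "is_simplex T \<Longrightarrow> 0 \<le> aff_dim T"
  using is_simplexE[of T] by (simp add: Suc_leI card_gt_0_iff)

lemma vertices_subset: "vertices T \<subseteq> T"
  by (auto simp: extreme_point_of_def)

lemma subsimplices_eq: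
  assumes "is_simplex T"
  shows "subsimplices T = {convex hull W |W. W \<subseteq> vertices T \<and> W \<noteq> {}}"
  using face_of_convex_hull_affine_independent[OF is_simplexE(3)[OF assms]]
  unfolding subsimplices_def is_simplexE(4)[OF assms] by auto

text \<open>Reduces the face relation to inclusion of vertex sets.\<close>

lemma subsimplices_iff:
  assumes T: "is_simplex T"
  shows "F \<in> subsimplices T \<longleftrightarrow> is_simplex F \<and> vertices F \<subseteq> vertices T"
proof
  assume "F \<in> subsimplices T"
  then obtain W where W: "F = convex hull W" "W \<subseteq> vertices T" "W \<noteq> {}"
    using T by (auto simp: subsimplices_eq)
  moreover have "\<not> affine_dependent W"
    using is_simplexE(3)[OF T] W affine_dependent_subset by blast
  ultimately show "is_simplex F \<and> vertices F \<subseteq> vertices T"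
    using is_simplex_convex_hull vertices_convex_hull by auto
next
  assume F: "is_simplex F \<and> vertices F \<subseteq> vertices T"
  then show "F \<in> subsimplices T"
    unfolding subsimplices_eq[OF T] using is_simplexE(2,4) by fastforce
qed

lemma convex_hull_in_subsimplices:
  assumes T: "is_simplex T" and W: "W \<subseteq> vertices T" "W \<noteq> {}"
  shows "convex hull W \<in> subsimplices T" "is_simplex (convex hull W)" "vertices (convex hull W) = W"
proof -
  show "convex hull W \<in> subsimplices T" using assms by (auto simp: subsimplices_eq)
  then show "is_simplex (convex hull W)" using T by (simp add: subsimplices_iff)
  show "vertices (convex hull W) = W"
    using is_simplexE(3)[OF T] W affine_dependent_subset vertices_convex_hull by blast
qed

lemma subsimplices_subset: "F \<in> subsimplices T \<Longrightarrow> F \<subseteq> T"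
  by (simp add: subsimplices_def face_of_imp_subset)

lemma self_in_subsimplices: "is_simplex T \<Longrightarrow> T \<in> subsimplices T"
  by (simp add: subsimplices_iff)

lemma is_simplex_eqI: "is_simplex F \<Longrightarrow> is_simplex G \<Longrightarrow> vertices F = vertices G \<Longrightarrow> F = G"
  using is_simplexE(4) by metis

lemma subsimplices_trans:
  "is_simplex T \<Longrightarrow> F \<in> subsimplices T \<Longrightarrow> G \<in> subsimplices F \<Longrightarrow> G \<in> subsimplices T"
  by (auto simp: subsimplices_iff)

lemma aff_dim_subsimplices_less:
  assumes "is_simplex T" "F \<in> subsimplices T" "F \<noteq> T"
  shows "aff_dim F < aff_dim T"
proof -
  have F: "is_simplex F" "vertices F \<subseteq> vertices T" using assms(1,2) by (auto simp: subsimplices_iff)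
  then have "vertices F \<subset> vertices T" using is_simplex_eqI[OF F(1) assms(1)] assms(3) by blast
  then have "card (vertices F) < card (vertices T)"
    by (rule psubset_card_mono[OF is_simplexE(1)[OF assms(1)]])
  then show ?thesis
    by (simp add: is_simplexE(5)[OF assms(1)] is_simplexE(5)[OF F(1)])
qed

lemma verts:
  assumes "is_simplex T"
  shows "distinct (verts T)" "set (verts T) = vertices T" "length (verts T) = card (vertices T)"
    "int (length (verts T)) = aff_dim T + 1" "verts T \<noteq> []"
proof -
  have "\<exists>vs. distinct vs \<and> set vs = vertices T"
    using finite_distinct_list[OF is_simplexE(1)[OF assms]] by blast
  from someI_ex[OF this] show *: "distinct (verts T)" "set (verts T) = vertices T"
    unfolding verts_def by auto
  then show l: "length (verts T) = card (vertices T)" by (metis distinct_card)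
  then show "int (length (verts T)) = aff_dim T + 1" using is_simplexE(5)[OF assms] by simp
  show "verts T \<noteq> []" using *(2) is_simplexE(2)[OF assms] by auto
qed

lemma length_edges: "is_simplex T \<Longrightarrow> int (length (edges T)) = aff_dim T"
  using verts(4,5)[of T] by (cases "verts T") (auto simp: edges_def)


section \<open>Homogeneous coordinates\<close>

abbreviation homogeneous :: "'a \<Rightarrow> 'a::euclidean_space \<times> real"
  where "homogeneous x \<equiv> (x, 1)"

abbreviation direction :: "'a \<Rightarrow> 'a::euclidean_space \<times> real"
  where "direction v \<equiv> (v, 0)"

text \<open>
  Covectors on the homogeneous coordinates whose values on \<^term>\<open>homogeneous x\<close> are the
  barycentric coordinates of \<open>x\<close>, and whose values on \<^term>\<open>direction v\<close> are their derivatives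
  along \<open>v\<close>. They can be used for all subsimplices at once.
\<close>

definition bary_covectors :: "'a::euclidean_space set \<Rightarrow> ('a \<Rightarrow> 'a \<times> real) \<Rightarrow> bool"
  where "bary_covectors V C \<longleftrightarrow> (\<forall>u\<in>V. \<forall>v\<in>V. C u \<bullet> homogeneous v = (if u = v then 1 else 0))"

lemma bary_covectors_subset: "bary_covectors V C \<Longrightarrow> W \<subseteq> V \<Longrightarrow> bary_covectors W C"
  unfolding bary_covectors_def by blast

lemma bary_covectorsD:
  "bary_covectors V C \<Longrightarrow> u \<in> V \<Longrightarrow> v \<in> V \<Longrightarrow> C u \<bullet> homogeneous v = (if u = v then 1 else 0)"
  by (simp add: bary_covectors_def)

text \<open>Affine independence of \<open>V\<close> is linear independence of the lifted points
  \<open>(v, 1)\<close>, and a dual family of linear functionals exists for them.\<close>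

lemma bary_covectors_exist:
  fixes V :: "'a::euclidean_space set"
  assumes "\<not> affine_dependent V"
  obtains C where "bary_covectors V C"
proof -
  have fin: "finite V" using assms by (simp add: aff_independent_finite)
  have inj: "inj_on homogeneous V" by (auto simp: inj_on_def)
  have "independent (homogeneous ` V)"
  proof
    assume "dependent (homogeneous ` V)"
    then obtain u v where u: "v \<in> V" "u (homogeneous v) \<noteq> 0"
        "(\<Sum>v\<in>homogeneous ` V. u v *\<^sub>R v) = 0"
      using fin by (auto simp: dependent_finite)
    then have "(\<Sum>v\<in>V. u (homogeneous v) *\<^sub>R homogeneous v) = 0"
      by (simp add: sum.reindex[OF inj] o_def)
    then have "(\<Sum>v\<in>V. u (homogeneous v) *\<^sub>R v) = 0" "(\<Sum>v\<in>V. u (homogeneous v)) = 0"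
      by (auto dest: arg_cong[where f = fst] arg_cong[where f = snd] simp: fst_sum snd_sum)
    then have "affine_dependent V"
      unfolding affine_dependent_explicit_finite[OF fin] using u by blast
    then show False using assms by simp
  qed
  then have "\<exists>c. \<forall>v\<in>V. c \<bullet> homogeneous v = (if u = v then 1 else 0)" for u
  proof -
    obtain f :: "'a \<times> real \<Rightarrow> real" where f: "linear f"
        "\<forall>z\<in>homogeneous ` V. f z = (if z = homogeneous u then 1 else 0)"
      using linear_independent_extend[OF \<open>independent (homogeneous ` V)\<close>,
          of "\<lambda>z. if z = homogeneous u then 1 else 0"] by blast
    \<comment> \<open>The adjoint at 1 is the vector that represents the functional
      \<open>f\<close>.\<close>
    then have "adjoint f 1 \<bullet> homogeneous v = (if u = v then 1 else 0)" if "v \<in> V" for v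
      using adjoint_works[OF f(1), of "homogeneous v" 1] that by (auto simp: inner_commute)
    then show ?thesis by blast
  qed
  then obtain C where "\<And>u v. v \<in> V \<Longrightarrow> C u \<bullet> homogeneous v = (if u = v then 1 else 0)"
    by metis
  then show ?thesis by (intro that[of C]) (simp add: bary_covectors_def)
qed

lemma inner_homogeneous_sum:
  fixes c :: "'a::euclidean_space \<times> real"
  assumes "sum u V = 1"
  shows "c \<bullet> homogeneous (\<Sum>v\<in>V. u v *\<^sub>R v) = (\<Sum>v\<in>V. u v * (c \<bullet> homogeneous v))"
proof -
  have "(\<Sum>v\<in>V. u v * (c \<bullet> homogeneous v)) = c \<bullet> (\<Sum>v\<in>V. u v *\<^sub>R homogeneous v)"
    by (simp only: inner_sum_right inner_scaleR_right)
  also have "(\<Sum>v\<in>V. u v *\<^sub>R homogeneous v) = homogeneous (\<Sum>v\<in>V. u v *\<^sub>R v)"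
    using assms by (simp add: prod_eq_iff fst_sum snd_sum)
  finally show ?thesis by simp
qed

lemma bary_coordinates:
  fixes V :: "'a::euclidean_space set"
  assumes "finite V" "bary_covectors V C" "x \<in> convex hull V"
  shows "(\<Sum>v\<in>V. (C v \<bullet> homogeneous x) *\<^sub>R v) = x" "(\<Sum>v\<in>V. C v \<bullet> homogeneous x) = 1"
    "v \<in> V \<Longrightarrow> 0 \<le> C v \<bullet> homogeneous x"
proof -
  obtain u where u: "\<And>v. v \<in> V \<Longrightarrow> 0 \<le> u v" "sum u V = 1" "(\<Sum>v\<in>V. u v *\<^sub>R v) = x"
    using assms(1,3) by (auto simp: convex_hull_finite)
  have *: "C v \<bullet> homogeneous x = u v" if "v \<in> V" for v
  proof -
    have "C v \<bullet> homogeneous x = (\<Sum>w\<in>V. u w * (C v \<bullet> homogeneous w))"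
      using inner_homogeneous_sum[OF u(2), of "C v"] by (simp only: u(3))
    also have "\<dots> = (\<Sum>w\<in>V. if v = w then u w else 0)"
      using that by (intro sum.cong) (auto simp: bary_covectorsD[OF assms(2)])
    finally show ?thesis using assms(1) that by simp
  qed
  then show "(\<Sum>v\<in>V. (C v \<bullet> homogeneous x) *\<^sub>R v) = x" "(\<Sum>v\<in>V. C v \<bullet> homogeneous x) = 1"
    using u by simp_all
  show "0 \<le> C v \<bullet> homogeneous x" if "v \<in> V" using * u that by simp
qed

lemma bary_covectors_eq_0:
  fixes V :: "'a::euclidean_space set"
  assumes "finite V" "bary_covectors V C" "W \<subseteq> V" "x \<in> convex hull W" "v \<in> V - W"
  shows "C v \<bullet> homogeneous x = 0"
proof -
  have fin: "finite W" using assms(1,3) finite_subset by blast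
  obtain u where u: "sum u W = 1" "(\<Sum>v\<in>W. u v *\<^sub>R v) = x"
    using assms(4) fin by (auto simp: convex_hull_finite)
  have "C v \<bullet> homogeneous x = (\<Sum>w\<in>W. u w * (C v \<bullet> homogeneous w))"
    using inner_homogeneous_sum[OF u(1), of "C v"] by (simp only: u(2))
  also have "\<dots> = 0"
    using assms(3,5) bary_covectorsD[OF assms(2)] by (intro sum.neutral) fastforce
  finally show ?thesis .
qed

lemma tangent_space_induct:
  fixes T :: "'a::euclidean_space set"
  assumes "w \<in> tangent_space T" "\<And>x y. x \<in> T \<Longrightarrow> y \<in> T \<Longrightarrow> P (x - y)" "subspace {w. P w}"
  shows "P w"
  using span_minimal[of "{x - y |x y. x \<in> T \<and> y \<in> T}" "{w. P w}"] assms
  unfolding tangent_space_def by blast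

lemma inner_direction_diff:
  fixes c :: "'a::euclidean_space \<times> real"
  shows "c \<bullet> direction (x - y) = c \<bullet> homogeneous x - c \<bullet> homogeneous y"
  by (simp flip: inner_diff_right)

lemma inner_direction_add:
  fixes c :: "'a::euclidean_space \<times> real"
  shows "c \<bullet> direction (v + w) = c \<bullet> direction v + c \<bullet> direction w"
  by (simp flip: inner_add_right)

lemma inner_direction_scaleR:
  fixes c :: "'a::euclidean_space \<times> real"
  shows "c \<bullet> direction (a *\<^sub>R v) = a * (c \<bullet> direction v)"
  by (simp add: inner_prod_def)

lemma bary_directions:
  fixes V :: "'a::euclidean_space set"
  assumes "finite V" "bary_covectors V C" "w \<in> tangent_space (convex hull V)"
  shows "(\<Sum>v\<in>V. (C v \<bullet> direction w) *\<^sub>R v) = w" "(\<Sum>v\<in>V. C v \<bullet> direction w) = 0"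
proof -
  have "(\<Sum>v\<in>V. (C v \<bullet> direction w) *\<^sub>R v) = w \<and> (\<Sum>v\<in>V. C v \<bullet> direction w) = 0"
    using assms(3)
  proof (rule tangent_space_induct)
    fix x y assume "x \<in> convex hull V" "y \<in> convex hull V"
    with bary_coordinates[OF assms(1,2)]
    show "(\<Sum>v\<in>V. (C v \<bullet> direction (x - y)) *\<^sub>R v) = x - y \<and> (\<Sum>v\<in>V. C v \<bullet> direction (x - y)) = 0"
      by (simp only: inner_direction_diff sum_subtractf scaleR_left_diff_distrib simp_thms)
  next
    show "subspace {w. (\<Sum>v\<in>V. (C v \<bullet> direction w) *\<^sub>R v) = w \<and> (\<Sum>v\<in>V. C v \<bullet> direction w) = 0}"
    proof (rule subspaceI)
      show "0 \<in> {w. (\<Sum>v\<in>V. (C v \<bullet> direction w) *\<^sub>R v) = w \<and> (\<Sum>v\<in>V. C v \<bullet> direction w) = 0}"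
        by (simp add: inner_prod_def)
    next
      fix x y assume "x \<in> {w. (\<Sum>v\<in>V. (C v \<bullet> direction w) *\<^sub>R v) = w \<and> (\<Sum>v\<in>V. C v \<bullet> direction w) = 0}"
        "y \<in> {w. (\<Sum>v\<in>V. (C v \<bullet> direction w) *\<^sub>R v) = w \<and> (\<Sum>v\<in>V. C v \<bullet> direction w) = 0}"
      then show "x + y \<in> {w. (\<Sum>v\<in>V. (C v \<bullet> direction w) *\<^sub>R v) = w \<and> (\<Sum>v\<in>V. C v \<bullet> direction w) = 0}"
        by (simp only: inner_direction_add sum.distrib scaleR_left_distrib mem_Collect_eq) simp
    next
      fix c x assume "x \<in> {w. (\<Sum>v\<in>V. (C v \<bullet> direction w) *\<^sub>R v) = w \<and> (\<Sum>v\<in>V. C v \<bullet> direction w) = 0}"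
      moreover have "(\<Sum>v\<in>V. (C v \<bullet> direction (c *\<^sub>R x)) *\<^sub>R v) = c *\<^sub>R (\<Sum>v\<in>V. (C v \<bullet> direction x) *\<^sub>R v)"
        "(\<Sum>v\<in>V. C v \<bullet> direction (c *\<^sub>R x)) = c * (\<Sum>v\<in>V. C v \<bullet> direction x)"
        by (simp_all only: inner_direction_scaleR scaleR_sum_right sum_distrib_left scaleR_scaleR)
      ultimately show "c *\<^sub>R x \<in> {w. (\<Sum>v\<in>V. (C v \<bullet> direction w) *\<^sub>R v) = w \<and> (\<Sum>v\<in>V. C v \<bullet> direction w) = 0}"
        by simp
    qed
  qed
  then show "(\<Sum>v\<in>V. (C v \<bullet> direction w) *\<^sub>R v) = w" "(\<Sum>v\<in>V. C v \<bullet> direction w) = 0" by auto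
qed

lemma subspace_direction_kernel:
  fixes c :: "'a::euclidean_space \<times> real"
  shows "subspace {w. c \<bullet> direction w = 0}"
  by (rule subspaceI) (simp_all add: inner_direction_add inner_direction_scaleR, simp add: inner_prod_def)

lemma bary_covectors_direction_eq_0:
  fixes V :: "'a::euclidean_space set"
  assumes "finite V" "bary_covectors V C" "W \<subseteq> V" "w \<in> tangent_space (convex hull W)" "v \<in> V - W"
  shows "C v \<bullet> direction w = 0"
  using assms(4) _ subspace_direction_kernel
  by (rule tangent_space_induct)
    (simp only: inner_direction_diff bary_covectors_eq_0[OF assms(1,2,3) _ assms(5)] diff_self)

text \<open>A direction that does not change the coordinates of the vertices outside
  \<open>W\<close> is a combination of the vertices in \<open>W\<close>. Its coefficients sum up to
  0, so a fixed \<open>p\<close> in \<open>W\<close> can be subtracted from each of them.\<close>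

lemma in_tangent_space_subset:
  fixes V :: "'a::euclidean_space set"
  assumes "finite V" "bary_covectors V C" "W \<subseteq> V" "W \<noteq> {}" "w \<in> tangent_space (convex hull V)"
    and 0: "\<And>v. v \<in> V - W \<Longrightarrow> C v \<bullet> direction w = 0"
  shows "w \<in> tangent_space (convex hull W)"
proof -
  obtain p where p: "p \<in> W" using assms(4) by blast
  have "(\<Sum>v\<in>W. (C v \<bullet> direction w) *\<^sub>R v) = (\<Sum>v\<in>V. (C v \<bullet> direction w) *\<^sub>R v)"
    "(\<Sum>v\<in>W. C v \<bullet> direction w) = (\<Sum>v\<in>V. C v \<bullet> direction w)"
    using assms by (auto intro!: sum.mono_neutral_left)
  with bary_directions[OF assms(1,2,5)]
  have "w = (\<Sum>v\<in>W. (C v \<bullet> direction w) *\<^sub>R (v - p))"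
    by (simp add: scaleR_right_diff_distrib sum_subtractf flip: scaleR_sum_left)
  also have "\<dots> \<in> tangent_space (convex hull W)"
    using p by (intro subspace_sum subspace_scale subspace_tangent_space tangent_space_diff)
      (auto intro: hull_inc)
  finally show ?thesis .
qed

text \<open>Applying a dual covector to any affine representation of \<open>x\<close> reads off one
  of its coefficients, which is the uniqueness required by the definite description.\<close>

lemma bary_eq:
  assumes T: "is_simplex T" and C: "bary_covectors (vertices T) C"
    and x: "x \<in> T" and i: "i < length (verts T)"
  shows "bary T i x = C (verts T ! i) \<bullet> homogeneous x"
proof -
  let ?vs = "verts T"
  note v = verts[OF T]
  have bij: "bij_betw ((!) ?vs) {..<length ?vs} (vertices T)"
    using bij_betw_nth[OF v(1) refl v(2)[symmetric]] .
  define u where "u j = (if j < length ?vs then C (?vs ! j) \<bullet> homogeneous x else 0)" for j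
  have "x \<in> convex hull vertices T" using x is_simplexE(4)[OF T] by simp
  note b = bary_coordinates[OF is_simplexE(1)[OF T] C this]
  have "(THE u. (\<forall>j\<ge>length ?vs. u j = 0) \<and> (\<Sum>j<length ?vs. u j) = 1 \<and>
      (\<Sum>j<length ?vs. u j *\<^sub>R ?vs ! j) = x) = u"
  proof (rule the_equality)
    have "(\<Sum>j<length ?vs. u j) = 1" "(\<Sum>j<length ?vs. u j *\<^sub>R ?vs ! j) = x"
      using b sum.reindex_bij_betw[OF bij, of "\<lambda>v. C v \<bullet> homogeneous x"]
        sum.reindex_bij_betw[OF bij, of "\<lambda>v. (C v \<bullet> homogeneous x) *\<^sub>R v"]
      by (simp_all add: u_def)
    then show "(\<forall>j\<ge>length ?vs. u j = 0) \<and> (\<Sum>j<length ?vs. u j) = 1 \<and>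
        (\<Sum>j<length ?vs. u j *\<^sub>R ?vs ! j) = x" by (simp add: u_def)
  next
    fix w :: "nat \<Rightarrow> real" assume w: "(\<forall>j\<ge>length ?vs. w j = 0) \<and> (\<Sum>j<length ?vs. w j) = 1 \<and>
        (\<Sum>j<length ?vs. w j *\<^sub>R ?vs ! j) = x"
    have "w j = u j" for j
    proof (cases "j < length ?vs")
      case True
      define g where "g = the_inv_into {..<length ?vs} ((!) ?vs)"
      have g: "g (?vs ! l) = l" if "l < length ?vs" for l
        unfolding g_def using bij that by (auto simp: bij_betw_def intro: the_inv_into_f_f)
      have "(\<Sum>v\<in>vertices T. w (g v)) = (\<Sum>l<length ?vs. w l)"
        "(\<Sum>v\<in>vertices T. w (g v) *\<^sub>R v) = (\<Sum>l<length ?vs. w l *\<^sub>R ?vs ! l)"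
        by (simp_all add: g flip: sum.reindex_bij_betw[OF bij])
      with w have *: "(\<Sum>v\<in>vertices T. w (g v)) = 1" "(\<Sum>v\<in>vertices T. w (g v) *\<^sub>R v) = x" by auto
      have "C (?vs ! j) \<bullet> homogeneous x = (\<Sum>v\<in>vertices T. w (g v) * (C (?vs ! j) \<bullet> homogeneous v))"
        using inner_homogeneous_sum[OF *(1), of "C (?vs ! j)"] by (simp only: *(2))
      also have "\<dots> = (\<Sum>v\<in>vertices T. if ?vs ! j = v then w (g v) else 0)"
        using True v(2) nth_mem[of j ?vs]
        by (intro sum.cong) (auto simp: bary_covectorsD[OF C])
      also have "\<dots> = w j"
        using True v(2) is_simplexE(1)[OF T] by (auto simp: g)
      finally show ?thesis using True by (simp add: u_def)
    qed (use w in \<open>simp add: u_def\<close>)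
    then show "w = u" by blast
  qed
  then show ?thesis using i by (simp add: bary_def u_def)
qed

lemma d_bary_eq:
  assumes T: "is_simplex T" and C: "bary_covectors (vertices T) C"
    and x: "x \<in> T" and w: "w \<in> tangent_space T" and i: "i < length (verts T)"
  shows "d_bary T i x [w] = C (verts T ! i) \<bullet> direction w"
proof -
  obtain c a where ca: "C (verts T ! i) = (c, a)" by force
  have "d_bary T i x [w] = frechet_derivative (bary T i) (at x within T) w"
    using x w by (simp add: d_bary_def ext_deriv_def pullback_def function_form_def)
  also have "\<dots> = frechet_derivative (\<lambda>y. c \<bullet> y + a) (at x) w"
    by (intro frechet_derivative_within_convex is_simplex_convex smooth_affine T x w)
      (simp add: bary_eq[OF T C _ i] ca)
  finally show ?thesis by (simp add: ca)
qed

lemma tangent_space_eq_span_edges: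
  assumes T: "is_simplex T"
  shows "tangent_space T = span (set (edges T))"
proof
  obtain p ps where ps: "verts T = p # ps" using verts(5)[OF T] by (cases "verts T") auto
  have pT: "p \<in> T" "set ps \<subseteq> T" using verts(2)[OF T] vertices_subset[of T] ps by auto
  have e: "set (edges T) = (\<lambda>v. v - p) ` set ps" by (simp add: edges_def ps)
  have *: "x - p \<in> span (set (edges T))" if x: "x \<in> T" for x
  proof -
    have fin: "finite (vertices T)" by (rule is_simplexE(1)[OF T])
    have "x \<in> convex hull (vertices T)" using x is_simplexE(4)[OF T] by simp
    then obtain u where u: "sum u (vertices T) = 1" "(\<Sum>v\<in>vertices T. u v *\<^sub>R v) = x"
      using fin by (auto simp: convex_hull_finite)
    then have "x - p = (\<Sum>v\<in>vertices T. u v *\<^sub>R (v - p))"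
      by (simp add: scaleR_right_diff_distrib sum_subtractf flip: scaleR_sum_left)
    also have "\<dots> \<in> span (set (edges T))"
    proof (intro span_sum span_scale)
      fix v assume "v \<in> vertices T"
      then have "v = p \<or> v - p \<in> set (edges T)" using verts(2)[OF T] by (auto simp: e ps)
      then show "v - p \<in> span (set (edges T))" by (auto intro: span_base span_zero)
    qed
    finally show ?thesis .
  qed
  have "x - y \<in> span (set (edges T))" if "x \<in> T" "y \<in> T" for x y
    using span_diff[OF * *, OF that] by simp
  then show "tangent_space T \<subseteq> span (set (edges T))"
    unfolding tangent_space_def by (intro span_minimal) auto
  show "span (set (edges T)) \<subseteq> tangent_space T"
    using pT by (intro span_minimal subspace_tangent_space) (auto simp: e intro: tangent_space_diff)
qed

lemma smooth_forms_eq_0_dimension: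
  assumes T: "is_simplex T" and w: "\<omega> \<in> smooth_forms k T" and k: "k < 0 \<or> aff_dim T < k"
  shows "\<omega> = 0"
proof -
  obtain \<omega>' where w': "\<omega>' \<in> ambient_forms k" "\<omega> = pullback T \<omega>'" using w by (rule smooth_formsE)
  have "\<omega>' x vs = 0" if "set vs \<subseteq> tangent_space T" for x vs
  proof (cases "k < 0")
    case True
    then show ?thesis
      using alternating_length[OF ambient_formsD(1)[OF w'(1)]] by auto
  next
    case False
    have "int (card (set (edges T))) \<le> aff_dim T"
      using length_edges[OF T] card_length[of "edges T"] by simp
    then show ?thesis
      using alternating_eq_0_dimension[OF ambient_formsD(1)[OF w'(1)], of "set (edges T)"] that
        False k tangent_space_eq_span_edges[OF T] by auto
  qed
  then show ?thesis unfolding w'(2) by (simp add: pullback_eq_0_iff)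
qed


section \<open>Generators of the polynomial forms\<close>

lemma subspace_finite_basis:
  fixes S :: "'b::real_vector set"
  assumes "subspace S" "finite X" "S \<subseteq> span X"
  obtains B where "finite B" "B \<subseteq> S" "independent B" "S = span B"
proof -
  obtain B where B: "B \<subseteq> S" "independent B" "S \<subseteq> span B" using maximal_independent_subset by blast
  have "finite B" using independent_span_bound[OF assms(2) B(2)] B(1) assms(3) by blast
  moreover have "S = span B" using B span_minimal[OF B(1) assms(1)] by blast
  ultimately show ?thesis using B that by blast
qed

lemma sum_fun_apply: "(\<Sum>i\<in>I. f i) x = (\<Sum>i\<in>I. f i x)"
  by (induction I rule: infinite_finite_induct) auto

text \<open>Operators like \<open>ext_deriv\<close> are known to be linear only on a subspace, so
  the library notion of a linear map does not apply to them.\<close>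

lemma additive_on_sum:
  fixes f :: "'b::real_vector \<Rightarrow> 'c::real_vector"
  assumes S: "subspace S"
    and add: "\<And>x y. x \<in> S \<Longrightarrow> y \<in> S \<Longrightarrow> f (x + y) = f x + f y"
    and scale: "\<And>c x. x \<in> S \<Longrightarrow> f (c *\<^sub>R x) = c *\<^sub>R f x"
    and "finite I" "\<And>i. i \<in> I \<Longrightarrow> x i \<in> S"
  shows "f (\<Sum>i\<in>I. c i *\<^sub>R x i) = (\<Sum>i\<in>I. c i *\<^sub>R f (x i))"
  using assms(4,5)
proof (induction I rule: finite_induct)
  case empty
  then show ?case using scale[OF subspace_0[OF S], of 0] by simp
next
  case (insert j I)
  then have "(\<Sum>i\<in>I. c i *\<^sub>R x i) \<in> S" "c j *\<^sub>R x j \<in> S"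
    by (auto intro!: subspace_sum[OF S] subspace_scale[OF S])
  with insert show ?case by (simp add: add scale)
qed

text \<open>The surrounding space of forms is infinite-dimensional and \<open>f\<close> is linear on
  \<open>S\<close> only. The image of a basis is independent; a vector outside its span would give
  more independent vectors than the dimension of \<open>S\<close> allows.\<close>

lemma injective_on_finite_dimensional_imp_surjective:
  fixes f :: "'b::real_vector \<Rightarrow> 'b"
  assumes S: "subspace S" "finite X" "S \<subseteq> span X"
    and add: "\<And>x y. x \<in> S \<Longrightarrow> y \<in> S \<Longrightarrow> f (x + y) = f x + f y"
    and scale: "\<And>c x. x \<in> S \<Longrightarrow> f (c *\<^sub>R x) = c *\<^sub>R f x"
    and f: "\<And>x. x \<in> S \<Longrightarrow> f x \<in> S" "\<And>x. x \<in> S \<Longrightarrow> f x = 0 \<Longrightarrow> x = 0"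
    and y: "y \<in> S"
  obtains x where "x \<in> S" "f x = y"
proof -
  obtain B where B: "finite B" "B \<subseteq> S" "independent B" "S = span B"
    using subspace_finite_basis[OF S] by blast
  have lin: "f (\<Sum>b\<in>B. c b *\<^sub>R b) = (\<Sum>b\<in>B. c b *\<^sub>R f b)" for c
    using B(1,2) by (intro additive_on_sum[OF S(1)] add scale) auto
  have comb: "(\<Sum>b\<in>B. c b *\<^sub>R b) \<in> S" for c
    using B(2) by (auto intro!: subspace_sum[OF S(1)] subspace_scale[OF S(1)])
  have 0: "\<forall>b\<in>B. c b = 0" if "(\<Sum>b\<in>B. c b *\<^sub>R f b) = 0" for c
  proof -
    have "(\<Sum>b\<in>B. c b *\<^sub>R b) = 0" using f(2)[OF comb] that by (simp add: lin)
    then show ?thesis using B(1,3) dependent_finite by blast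
  qed
  have inj: "inj_on f B"
  proof (rule inj_onI)
    fix a b assume ab: "a \<in> B" "b \<in> B" "f a = f b"
    have "a + (-1) *\<^sub>R b \<in> S" using ab B(2) by (intro subspace_add subspace_scale S) auto
    moreover have "f (a + (-1) *\<^sub>R b) = 0"
    proof -
      have "f (a + (-1) *\<^sub>R b) = f a + f ((-1) *\<^sub>R b)"
        using ab B(2) by (intro add subspace_scale S) auto
      also have "f ((-1) *\<^sub>R b) = (-1) *\<^sub>R f b" using ab B(2) by (intro scale) auto
      finally show ?thesis using ab by simp
    qed
    ultimately show "a = b" using f(2) by fastforce
  qed
  have indep: "independent (f ` B)"
  proof
    assume "dependent (f ` B)"
    then obtain u b where "b \<in> B" "u (f b) \<noteq> 0" "(\<Sum>v\<in>f ` B. u v *\<^sub>R v) = 0"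
      using B(1) by (auto simp: dependent_finite)
    then show False using 0[of "\<lambda>b. u (f b)"] by (auto simp: sum.reindex[OF inj] o_def)
  qed
  have sub: "f ` B \<subseteq> span B" using f(1) B(2,4) by blast
  have "y \<in> span (f ` B)"
  proof (rule ccontr)
    assume n: "y \<notin> span (f ` B)"
    then have i: "independent (insert y (f ` B))" by (simp add: independent_insert indep)
    have "insert y (f ` B) \<subseteq> span B" using sub y B(4) by blast
    then have "card (insert y (f ` B)) \<le> card B"
      using independent_span_bound[OF B(1) i] by simp
    moreover from n have "y \<notin> f ` B" by (auto intro: span_base)
    then have "card (insert y (f ` B)) = Suc (card B)"
      using B(1) by (simp only: card_insert_disjoint finite_imageI card_image[OF inj] not_False_eq_True)
    ultimately show False by simp
  qed
  then have "y \<in> range (\<lambda>u. \<Sum>v\<in>f ` B. u v *\<^sub>R v)"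
    by (simp only: span_finite[OF finite_imageI[OF B(1)]])
  then obtain u where "y = (\<Sum>v\<in>f ` B. u v *\<^sub>R v)" by (rule rangeE)
  then have "f (\<Sum>b\<in>B. u (f b) *\<^sub>R b) = y"
    unfolding lin sum.reindex[OF inj] o_def by (rule sym)
  then show ?thesis by (rule that[OF comb])
qed


section \<open>Generators as determinants in homogeneous coordinates\<close>

definition bary_power :: "'a set \<Rightarrow> ('a \<Rightarrow> 'a::euclidean_space \<times> real) \<Rightarrow> ('a \<Rightarrow> nat) \<Rightarrow> 'a \<Rightarrow> real"
  where "bary_power V C a x = (\<Prod>v\<in>V. (C v \<bullet> homogeneous x) ^ a v)"

definition full_gen :: "'a set \<Rightarrow> ('a \<Rightarrow> 'a::euclidean_space \<times> real) \<Rightarrow> ('a \<Rightarrow> nat) \<Rightarrow> 'a list \<Rightarrow> 'a form"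
  where "full_gen V C a \<sigma> = (\<lambda>x vs. bary_power V C a x * covector_wedge (map C \<sigma>) (map direction vs))"

text \<open>
  By expansion along the first column, the determinant is the Whitney form $\phi_\rho$.
\<close>

definition trimmed_gen :: "'a set \<Rightarrow> ('a \<Rightarrow> 'a::euclidean_space \<times> real) \<Rightarrow> ('a \<Rightarrow> nat) \<Rightarrow> 'a list \<Rightarrow> 'a form"
  where "trimmed_gen V C a \<rho> =
    (\<lambda>x vs. bary_power V C a x * covector_wedge (map C \<rho>) (homogeneous x # map direction vs))"

text \<open>Exponents are indexed by vertices rather than by positions in an enumeration, which fits
  the passage to faces. The lists are neither sorted nor free of repetitions: this adds only signed
  copies and zero, and makes prepending a vertex or removing an entry possible without
  reordering.\<close>

definition full_gens :: "'a set \<Rightarrow> ('a \<Rightarrow> 'a::euclidean_space \<times> real) \<Rightarrow> int \<Rightarrow> int \<Rightarrow> 'a form set"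
  where "full_gens V C r k = {full_gen V C a \<sigma> |a \<sigma>.
    (\<Sum>v\<in>V. int (a v)) = r \<and> set \<sigma> \<subseteq> V \<and> int (length \<sigma>) = k}"

definition trimmed_gens :: "'a set \<Rightarrow> ('a \<Rightarrow> 'a::euclidean_space \<times> real) \<Rightarrow> int \<Rightarrow> int \<Rightarrow> 'a form set"
  where "trimmed_gens V C r k = {trimmed_gen V C a \<rho> |a \<rho>.
    (\<Sum>v\<in>V. int (a v)) = r - 1 \<and> set \<rho> \<subseteq> V \<and> int (length \<rho>) = k + 1}"

lemma linear_direction: "linear direction"
  by (rule linearI) auto

lemma smooth_bary: "smooth (\<lambda>x. c \<bullet> homogeneous x)"
  using smooth_affine[of "fst c" "snd c"] by (simp add: inner_prod_def)

lemma smooth_bary_power: "smooth (bary_power V C a)"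
  unfolding bary_power_def by (intro smooth_prod smooth_power smooth_bary)

lemma bary_power_cong: "(\<And>v. v \<in> V \<Longrightarrow> a v = b v) \<Longrightarrow> bary_power V C a = bary_power V C b"
  unfolding bary_power_def by (intro ext prod.cong) auto

lemma full_gen_ambient_forms: "full_gen V C a \<sigma> \<in> ambient_forms (int (length \<sigma>))"
proof -
  have "alternating (int (length \<sigma>)) (full_gen V C a \<sigma> x)" for x
    unfolding full_gen_def
    using alternating_map[OF alternating_covector_wedge[of "map C \<sigma>"] linear_direction]
    by (intro alternating_scale) simp
  moreover have "smooth (\<lambda>x. full_gen V C a \<sigma> x vs)" for vs
    unfolding full_gen_def by (intro smooth_mult smooth_bary_power smooth_const)
  ultimately show ?thesis by (simp add: ambient_forms_def)
qed

text \<open>Expansion along the column \<open>homogeneous x\<close>; each entry of this column is a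
  barycentric coordinate and raises one exponent.\<close>

lemma trimmed_gen_eq_sum:
  assumes "finite V" "set \<rho> \<subseteq> V"
  shows "trimmed_gen V C a \<rho> =
    (\<Sum>i<length \<rho>. (-1) ^ i *\<^sub>R full_gen V C (a(\<rho> ! i := Suc (a (\<rho> ! i)))) (remove_nth i \<rho>))"
proof (intro ext)
  fix x vs
  have "bary_power V C (a(v := Suc (a v))) x = (C v \<bullet> homogeneous x) * bary_power V C a x"
    if "v \<in> V" for v
    using assms(1) that by (simp add: bary_power_def prod.remove mult.assoc)
  moreover have "\<rho> ! i \<in> V" if "i < length \<rho>" for i using assms(2) that nth_mem by blast
  ultimately show "trimmed_gen V C a \<rho> x vs =
    (\<Sum>i<length \<rho>. (-1) ^ i *\<^sub>R full_gen V C (a(\<rho> ! i := Suc (a (\<rho> ! i)))) (remove_nth i \<rho>)) x vs"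
    by (simp add: trimmed_gen_def full_gen_def covector_wedge_column sum_distrib_left
        sum_fun_apply scaleR_fun_def mult_ac map_remove_nth)
qed

lemma trimmed_gens_subset_span_full_gens:
  assumes "finite V"
  shows "trimmed_gens V C r k \<subseteq> span (full_gens V C r k)"
proof
  fix \<omega> assume "\<omega> \<in> trimmed_gens V C r k"
  then obtain a \<rho> where \<omega>: "\<omega> = trimmed_gen V C a \<rho>" and a: "(\<Sum>v\<in>V. int (a v)) = r - 1"
    and \<rho>: "set \<rho> \<subseteq> V" "int (length \<rho>) = k + 1"
    by (auto simp: trimmed_gens_def)
  have "full_gen V C (a(\<rho> ! i := Suc (a (\<rho> ! i)))) (remove_nth i \<rho>) \<in> full_gens V C r k"
    if i: "i < length \<rho>" for i
  proof -
    have "\<rho> ! i \<in> V" using i \<rho> nth_mem by blast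
    then have "(\<Sum>v\<in>V. int ((a(\<rho> ! i := Suc (a (\<rho> ! i)))) v)) = r"
      using assms a by (simp add: sum.remove)
    moreover have "set (remove_nth i \<rho>) \<subseteq> V" using set_remove_nth_subset \<rho> by fast
    moreover have "int (length (remove_nth i \<rho>)) = k" using i \<rho> by (simp add: length_remove_nth)
    ultimately show ?thesis unfolding full_gens_def by blast
  qed
  then show "\<omega> \<in> span (full_gens V C r k)"
    unfolding \<omega> trimmed_gen_eq_sum[OF assms \<rho>(1)] by (intro span_sum span_scale span_base) auto
qed

lemma full_gens_ambient_forms: "full_gens V C r k \<subseteq> ambient_forms k"
  unfolding full_gens_def using full_gen_ambient_forms by blast

lemma span_full_gens_ambient_forms: "span (full_gens V C r k) \<subseteq> ambient_forms k"
  by (intro span_minimal full_gens_ambient_forms subspace_ambient_forms)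

lemma span_trimmed_gens_subset:
  "finite V \<Longrightarrow> span (trimmed_gens V C r k) \<subseteq> span (full_gens V C r k)"
  by (intro span_minimal trimmed_gens_subset_span_full_gens subspace_span)

lemma frechet_derivative_bary_power:
  assumes "finite V"
  shows "frechet_derivative (bary_power V C a) (at x) w =
    (\<Sum>v\<in>V. real (a v) * bary_power V C (a(v := a v - 1)) x * (C v \<bullet> direction w))"
proof -
  have "((\<lambda>x. c \<bullet> homogeneous x) has_derivative (\<lambda>w. c \<bullet> direction w)) (at x)" for c :: "'a \<times> real"
    by (simp add: inner_prod_def) (auto intro!: derivative_eq_intros)
  then have "(bary_power V C a has_derivative (\<lambda>w. \<Sum>v\<in>V.
      real (a v) * (C v \<bullet> direction w) * (C v \<bullet> homogeneous x) ^ (a v - 1) *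
      (\<Prod>u\<in>V - {v}. (C u \<bullet> homogeneous x) ^ a u))) (at x)"
    unfolding bary_power_def by (intro has_derivative_prod has_derivative_power)
  then have "frechet_derivative (bary_power V C a) (at x) w = (\<Sum>v\<in>V.
      real (a v) * (C v \<bullet> direction w) * (C v \<bullet> homogeneous x) ^ (a v - 1) *
      (\<Prod>u\<in>V - {v}. (C u \<bullet> homogeneous x) ^ a u))"
    by (simp flip: frechet_derivative_at)
  also have "\<dots> = (\<Sum>v\<in>V. real (a v) * bary_power V C (a(v := a v - 1)) x * (C v \<bullet> direction w))"
    unfolding bary_power_def using assms
    by (intro sum.cong refl) (simp add: prod.remove mult_ac)
  finally show ?thesis .
qed

lemma ambient_deriv_full_gen:
  assumes "finite V"
  shows "ambient_deriv (full_gen V C a \<sigma>) =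
    (\<Sum>v\<in>V. real (a v) *\<^sub>R full_gen V C (a(v := a v - 1)) (v # \<sigma>))"
proof (intro ext)
  fix x vs
  let ?w = "\<lambda>us. covector_wedge (map C \<sigma>) (map direction us)"
  have "frechet_derivative (\<lambda>y. full_gen V C a \<sigma> y us) (at x) u =
      (\<Sum>v\<in>V. real (a v) * bary_power V C (a(v := a v - 1)) x * (C v \<bullet> direction u)) * ?w us" for us u
    using frechet_derivative_mult[of "bary_power V C a" x "\<lambda>_. ?w us" u]
    by (simp add: full_gen_def smooth_differentiable[OF smooth_bary_power]
        frechet_derivative_bary_power[OF assms])
  then have "ambient_deriv (full_gen V C a \<sigma>) x vs = (\<Sum>i<length vs. \<Sum>v\<in>V. (-1) ^ i *
      (real (a v) * bary_power V C (a(v := a v - 1)) x * (C v \<bullet> direction (vs ! i)) * ?w (remove_nth i vs)))"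
    by (simp add: ambient_deriv_def alternate_def sum_distrib_left sum_distrib_right)
  also have "\<dots> = (\<Sum>v\<in>V. real (a v) * bary_power V C (a(v := a v - 1)) x *
      covector_wedge (map C (v # \<sigma>)) (map direction vs))"
    by (subst sum.swap) (simp add: covector_wedge_Cons alternate_def sum_distrib_left
        map_remove_nth mult_ac)
  finally show "ambient_deriv (full_gen V C a \<sigma>) x vs =
    (\<Sum>v\<in>V. real (a v) *\<^sub>R full_gen V C (a(v := a v - 1)) (v # \<sigma>)) x vs"
    by (simp add: full_gen_def sum_fun_apply scaleR_fun_def mult.assoc)
qed

lemma ambient_deriv_span_full_gens:
  assumes "finite V" "\<omega> \<in> span (full_gens V C r k)"
  shows "ambient_deriv \<omega> \<in> span (full_gens V C (r - 1) (k + 1))"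
proof -
  \<comment> \<open>The induction carries membership in \<open>ambient_forms\<close> along because
    \<open>ambient_deriv_add\<close> requires it.\<close>
  have "ambient_deriv \<omega> \<in> span (full_gens V C (r - 1) (k + 1)) \<and> \<omega> \<in> ambient_forms k"
    using assms(2)
proof (induction rule: span_induct_alt)
  case base
  have "ambient_deriv 0 = (0 :: 'a form)"
    using ambient_deriv_scaleR[OF subspace_0[OF subspace_ambient_forms], of 0] by simp
  then show ?case using subspace_0[OF subspace_ambient_forms, of k] by (simp only: span_zero simp_thms)
next
  case (step c \<omega> \<eta>)
  then obtain a \<sigma> where \<omega>: "\<omega> = full_gen V C a \<sigma>" and a: "(\<Sum>v\<in>V. int (a v)) = r"
    and \<sigma>: "set \<sigma> \<subseteq> V" "int (length \<sigma>) = k"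
    by (auto simp: full_gens_def)
  have "real (a v) *\<^sub>R full_gen V C (a(v := a v - 1)) (v # \<sigma>) \<in> span (full_gens V C (r - 1) (k + 1))"
    if v: "v \<in> V" for v
  \<comment> \<open>If \<open>a v = 0\<close>, the truncated subtraction leaves a generator of the
    wrong degree, but its coefficient is zero.\<close>
  proof (cases "a v = 0")
    case False
    then have "(\<Sum>u\<in>V. int ((a(v := a v - 1)) u)) = r - 1"
      using assms a v by (simp add: sum.remove of_nat_diff)
    then have "full_gen V C (a(v := a v - 1)) (v # \<sigma>) \<in> full_gens V C (r - 1) (k + 1)"
      unfolding full_gens_def using v \<sigma> by (intro CollectI exI[of _ "a(v := a v - 1)"] exI[of _ "v # \<sigma>"]) auto
    then show ?thesis by (intro span_scale span_base)
  qed (simp add: span_zero)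
  then have d: "ambient_deriv \<omega> \<in> span (full_gens V C (r - 1) (k + 1))"
    unfolding \<omega> ambient_deriv_full_gen[OF assms(1)] by (intro span_sum)
  have w: "\<omega> \<in> ambient_forms k" using step.hyps by (rule subsetD[OF full_gens_ambient_forms])
  then have c: "c *\<^sub>R \<omega> \<in> ambient_forms k" by (rule subspace_scale[OF subspace_ambient_forms])
  have \<eta>: "\<eta> \<in> ambient_forms k" "ambient_deriv \<eta> \<in> span (full_gens V C (r - 1) (k + 1))"
    using step.IH by auto
  have e: "ambient_deriv (c *\<^sub>R \<omega> + \<eta>) = c *\<^sub>R ambient_deriv \<omega> + ambient_deriv \<eta>"
    by (simp only: ambient_deriv_add[OF c \<eta>(1)] ambient_deriv_scaleR[OF w])
  show ?case
    unfolding e by (intro conjI span_add span_scale subspace_add[OF subspace_ambient_forms] c \<eta> d)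
  qed
  then show ?thesis ..
qed


section \<open>Comparison with the enumerated definitions\<close>

lemma alternating_rows: "alternating (int (length vs)) (\<lambda>cs. covector_wedge cs vs)"
  using alternating_covector_wedge[of vs] by (subst covector_wedge_commute)

lemma full_gen_mset:
  "mset \<sigma> = mset \<sigma>' \<Longrightarrow> full_gen V C a \<sigma>' = full_gen V C a \<sigma> \<or> full_gen V C a \<sigma>' = - full_gen V C a \<sigma>"
proof (rule mset_eq_sign)
  fix xs ys u v
  show "full_gen V C a (xs @ v # u # ys) = - full_gen V C a (xs @ u # v # ys)"
    using alternating_swap[OF alternating_rows, of "map C xs" "C v" "C u" "map C ys"]
    by (auto simp: full_gen_def fun_eq_iff)
qed

lemma trimmed_gen_mset:
  "mset \<rho> = mset \<rho>' \<Longrightarrow> trimmed_gen V C a \<rho>' = trimmed_gen V C a \<rho> \<or> trimmed_gen V C a \<rho>' = - trimmed_gen V C a \<rho>"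
proof (rule mset_eq_sign)
  fix xs ys u v
  show "trimmed_gen V C a (xs @ v # u # ys) = - trimmed_gen V C a (xs @ u # v # ys)"
    using alternating_swap[OF alternating_rows, of "map C xs" "C v" "C u" "map C ys"]
    by (auto simp: trimmed_gen_def fun_eq_iff)
qed

lemma full_gen_not_distinct: "\<not> distinct \<sigma> \<Longrightarrow> full_gen V C a \<sigma> = 0"
  using alternating_not_distinct[OF alternating_rows, of "map C \<sigma>"]
  by (auto simp: full_gen_def fun_eq_iff distinct_map)

lemma trimmed_gen_not_distinct: "\<not> distinct \<rho> \<Longrightarrow> trimmed_gen V C a \<rho> = 0"
  using alternating_not_distinct[OF alternating_rows, of "map C \<rho>"]
  by (auto simp: trimmed_gen_def fun_eq_iff distinct_map)

lemma span_insert_signed: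
  assumes "x \<in> S" "y = x \<or> y = - x \<or> y = 0"
  shows "y \<in> span S"
  using assms by (auto intro: span_base span_neg span_zero)

text \<open>Passes from increasing lists of positions in \<open>verts T\<close> to arbitrary lists
  of vertices: sorting a list changes a generator at most by a sign, and a repeated entry makes it
  zero. \<Phi> and \<Psi> are abstract so that the full and the trimmed generators are treated
  together.\<close>

lemma span_index_lists:
  fixes \<Phi> :: "('a::euclidean_space \<Rightarrow> nat) \<Rightarrow> 'a list \<Rightarrow> 'a form"
  assumes T: "is_simplex T"
    and mset: "\<And>a \<rho> \<rho>'. mset \<rho> = mset \<rho>' \<Longrightarrow> \<Phi> a \<rho>' = \<Phi> a \<rho> \<or> \<Phi> a \<rho>' = - \<Phi> a \<rho>"
    and dist: "\<And>a \<rho>. \<not> distinct \<rho> \<Longrightarrow> \<Phi> a \<rho> = 0"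
    and cong: "\<And>a b \<rho>. (\<And>v. v \<in> vertices T \<Longrightarrow> a v = b v) \<Longrightarrow> \<Phi> a \<rho> = \<Phi> b \<rho>"
    and eq: "\<And>a \<rho>. set \<rho> \<subseteq> {..<length (verts T)} \<Longrightarrow>
      \<Psi> (\<lambda>i. a (verts T ! i)) \<rho> = \<Phi> a (map ((!) (verts T)) \<rho>)"
    and eq': "\<And>a b \<rho>. (\<And>i. i < length (verts T) \<Longrightarrow> a i = b i) \<Longrightarrow> \<Psi> a \<rho> = \<Psi> b \<rho>"
  shows "span {\<Psi> a \<rho> |a \<rho>. (\<Sum>i<length (verts T). int (a i)) = r \<and>
      \<rho> \<in> increasing_lists (length (verts T)) \<and> int (length \<rho>) = k} =
    span {\<Phi> a \<rho> |a \<rho>. (\<Sum>v\<in>vertices T. int (a v)) = r \<and> set \<rho> \<subseteq> vertices T \<and> int (length \<rho>) = k}"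
    (is "span ?A = span ?B")
proof -
  let ?vs = "verts T" let ?n = "length (verts T)"
  note v = verts[OF T]
  have bij: "bij_betw ((!) ?vs) {..<?n} (vertices T)"
    using bij_betw_nth[OF v(1) refl v(2)[symmetric]] .
  define g where "g = the_inv_into {..<?n} ((!) ?vs)"
  have g: "g (?vs ! l) = l" if "l < ?n" for l
    unfolding g_def using bij that by (auto simp: bij_betw_def intro: the_inv_into_f_f)
  have g': "?vs ! g v = v" "g v < ?n" if "v \<in> vertices T" for v
    using that bij unfolding g_def bij_betw_def
    by (auto simp: f_the_inv_into_f dest: the_inv_into_into[OF _ _ subset_refl])
  have vm: "?vs ! i \<in> vertices T" if "i < ?n" for i using v(2) nth_mem[OF that] by simp
  have s: "(\<Sum>i<?n. int (a (?vs ! i))) = (\<Sum>v\<in>vertices T. int (a v))" for a :: "'a \<Rightarrow> nat"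
    by (rule sum.reindex_bij_betw[OF bij])
  have AB: "?A \<subseteq> ?B"
  proof
    fix \<omega> assume "\<omega> \<in> ?A"
    then obtain a \<rho> where a: "\<omega> = \<Psi> a \<rho>" "(\<Sum>i<?n. int (a i)) = r" "set \<rho> \<subseteq> {..<?n}"
      "int (length \<rho>) = k" by (auto simp: increasing_lists_def)
    have "\<Psi> a \<rho> = \<Psi> (\<lambda>i. a (g (?vs ! i))) \<rho>" by (rule eq') (simp add: g)
    then have "\<omega> = \<Phi> (\<lambda>v. a (g v)) (map ((!) ?vs) \<rho>)"
      using a(1) eq[OF a(3), of "\<lambda>v. a (g v)"] by simp
    moreover have "(\<Sum>v\<in>vertices T. int (a (g v))) = r"
      using s[of "\<lambda>v. a (g v)"] a(2) by (simp add: g)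
    moreover have "set (map ((!) ?vs) \<rho>) \<subseteq> vertices T" using a(3) vm by fastforce
    ultimately show "\<omega> \<in> ?B" using a(4)
      by (intro CollectI exI[of _ "\<lambda>v. a (g v)"] exI[of _ "map ((!) ?vs) \<rho>"]) simp
  qed
  have BA: "?B \<subseteq> span ?A"
  proof
    fix \<omega> assume "\<omega> \<in> ?B"
    then obtain a \<rho> where a: "\<omega> = \<Phi> a \<rho>" "(\<Sum>v\<in>vertices T. int (a v)) = r" "set \<rho> \<subseteq> vertices T"
      "int (length \<rho>) = k" by blast
    show "\<omega> \<in> span ?A"
    proof (cases "distinct \<rho>")
      case True
      define l where "l = sort (map g \<rho>)"
      have "inj_on g (set \<rho>)" using a(3) g' by (intro inj_on_inverseI[of _ "(!) ?vs"]) auto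
      then have "sorted_wrt (<) l" using True by (simp add: l_def strict_sorted_iff distinct_map)
      moreover have l: "set l \<subseteq> {..<?n}" using a(3) g' by (auto simp: l_def)
      ultimately have "l \<in> increasing_lists ?n" by (simp add: increasing_lists_def)
      moreover have "int (length l) = k" using a(4) by (simp add: l_def)
      moreover have "(\<Sum>i<?n. int (a (?vs ! i))) = r" using s a(2) by simp
      ultimately have "\<Psi> (\<lambda>i. a (?vs ! i)) l \<in> ?A" by blast
      moreover have "mset (map ((!) ?vs) l) = mset \<rho>"
      proof -
        have "mset (map ((!) ?vs) l) = image_mset (\<lambda>v. ?vs ! g v) (mset \<rho>)"
          by (simp add: l_def image_mset.compositionality o_def)
        also have "\<dots> = image_mset id (mset \<rho>)" using a(3) g' by (intro image_mset_cong) auto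
        finally show ?thesis by simp
      qed
      ultimately show ?thesis
        using mset[of "map ((!) ?vs) l" \<rho> a] by (intro span_insert_signed) (auto simp: a(1) eq[OF l])
    qed (use dist in \<open>simp add: a span_zero\<close>)
  qed
  show ?thesis
    by (rule subset_antisym[OF span_mono[OF AB] span_minimal[OF BA subspace_span]])
qed

lemma bary_monom_eq:
  assumes T: "is_simplex T" and C: "bary_covectors (vertices T) C" and x: "x \<in> T"
  shows "bary_monom T (\<lambda>i. a (verts T ! i)) x = bary_power (vertices T) C a x"
proof -
  have bij: "bij_betw ((!) (verts T)) {..<length (verts T)} (vertices T)"
    using bij_betw_nth[OF verts(1)[OF T] refl verts(2)[OF T, symmetric]] .
  show ?thesis
    unfolding bary_power_def bary_monom_def prod.reindex_bij_betw[OF bij, symmetric]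
    by (intro prod.cong) (simp_all add: bary_eq[OF T C x])
qed

lemma wedge_d_bary_eq:
  assumes T: "is_simplex T" and C: "bary_covectors (vertices T) C" and x: "x \<in> T"
    and vs: "set vs \<subseteq> tangent_space T" and "set \<sigma> \<subseteq> {..<length (verts T)}"
  shows "wedge (map (d_bary T) \<sigma>) x vs =
    covector_wedge (map C (map ((!) (verts T)) \<sigma>)) (map direction vs)"
  using wedge_eq_covector_wedge[of \<sigma> vs "d_bary T" x "\<lambda>i. C (verts T ! i)" direction]
    d_bary_eq[OF T C x] assms by (auto simp: o_def subset_iff)

text \<open>Exhibits the space as the pullback of a space of ambient forms, so that derivatives and
  traces can be computed on generators before restricting to \<open>T\<close>.\<close>

lemma full_poly_forms_eq:
  assumes T: "is_simplex T" and C: "bary_covectors (vertices T) C"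
  shows "full_poly_forms r k T = pullback T ` span (full_gens (vertices T) C r k)"
proof -
  let ?\<Phi> = "\<lambda>a \<sigma>. pullback T (full_gen (vertices T) C a \<sigma>)"
  let ?\<Psi> = "\<lambda>a \<sigma>. pullback T (\<lambda>x vs. bary_monom T a x * wedge (map (d_bary T) \<sigma>) x vs)"
  have "full_poly_forms r k T = span {?\<Phi> a \<rho> |a \<rho>. (\<Sum>v\<in>vertices T. int (a v)) = r \<and>
      set \<rho> \<subseteq> vertices T \<and> int (length \<rho>) = k}"
    unfolding full_poly_forms_def
  proof (rule span_index_lists[OF T, where \<Phi> = ?\<Phi> and \<Psi> = ?\<Psi>])
    show "?\<Phi> a \<rho>' = ?\<Phi> a \<rho> \<or> ?\<Phi> a \<rho>' = - ?\<Phi> a \<rho>" if "mset \<rho> = mset \<rho>'" for a \<rho> \<rho>'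
      using full_gen_mset[OF that, of "vertices T" C a] linear_neg[OF linear_pullback, of T] by auto
    show "?\<Phi> a \<rho> = 0" if "\<not> distinct \<rho>" for a \<rho>
      using full_gen_not_distinct[OF that] pullback_0 by metis
    show "?\<Phi> a \<rho> = ?\<Phi> b \<rho>" if "\<And>v. v \<in> vertices T \<Longrightarrow> a v = b v" for a b \<rho>
    proof -
      have "bary_power (vertices T) C a = bary_power (vertices T) C b"
        by (rule bary_power_cong) (rule that)
      then show ?thesis by (simp add: full_gen_def)
    qed
    show "pullback T (\<lambda>x vs. bary_monom T a x * wedge (map (d_bary T) \<rho>) x vs) =
        pullback T (\<lambda>x vs. bary_monom T b x * wedge (map (d_bary T) \<rho>) x vs)"
      if "\<And>i. i < length (verts T) \<Longrightarrow> a i = b i" for a b \<rho>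
    proof -
      have "bary_monom T a = bary_monom T b"
        unfolding bary_monom_def by (intro ext prod.cong) (auto simp: that)
      then show ?thesis by simp
    qed
    show "pullback T (\<lambda>x vs. bary_monom T (\<lambda>i. a (verts T ! i)) x * wedge (map (d_bary T) \<rho>) x vs) =
        ?\<Phi> a (map ((!) (verts T)) \<rho>)" if "set \<rho> \<subseteq> {..<length (verts T)}" for a \<rho>
      by (intro pullback_cong) (simp add: full_gen_def bary_monom_eq[OF T C] wedge_d_bary_eq[OF T C _ _ that] del: map_map)
  qed
  also have "\<dots> = span (pullback T ` full_gens (vertices T) C r k)"
    unfolding full_gens_def by (rule arg_cong[where f = span], blast)
  finally show ?thesis by (simp add: linear_span_image[OF linear_pullback])
qed

lemma trimmed_poly_forms_eq:
  assumes T: "is_simplex T" and C: "bary_covectors (vertices T) C"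
  shows "trimmed_poly_forms r k T = pullback T ` span (trimmed_gens (vertices T) C r k)"
proof -
  let ?\<Phi> = "\<lambda>a \<sigma>. pullback T (trimmed_gen (vertices T) C a \<sigma>)"
  let ?\<Psi> = "\<lambda>a \<rho>. pullback T (\<lambda>x vs. bary_monom T a x * whitney_form T \<rho> x vs)"
  have "trimmed_poly_forms r k T = span {?\<Phi> a \<rho> |a \<rho>. (\<Sum>v\<in>vertices T. int (a v)) = r - 1 \<and>
      set \<rho> \<subseteq> vertices T \<and> int (length \<rho>) = k + 1}"
    unfolding trimmed_poly_forms_def
  proof (rule span_index_lists[OF T, where \<Phi> = ?\<Phi> and \<Psi> = ?\<Psi>])
    show "?\<Phi> a \<rho>' = ?\<Phi> a \<rho> \<or> ?\<Phi> a \<rho>' = - ?\<Phi> a \<rho>" if "mset \<rho> = mset \<rho>'" for a \<rho> \<rho>'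
      using trimmed_gen_mset[OF that, of "vertices T" C a] linear_neg[OF linear_pullback, of T] by auto
    show "?\<Phi> a \<rho> = 0" if "\<not> distinct \<rho>" for a \<rho>
      using trimmed_gen_not_distinct[OF that] pullback_0 by metis
    show "?\<Phi> a \<rho> = ?\<Phi> b \<rho>" if "\<And>v. v \<in> vertices T \<Longrightarrow> a v = b v" for a b \<rho>
    proof -
      have "bary_power (vertices T) C a = bary_power (vertices T) C b"
        by (rule bary_power_cong) (rule that)
      then show ?thesis by (simp add: trimmed_gen_def)
    qed
    show "pullback T (\<lambda>x vs. bary_monom T a x * whitney_form T \<rho> x vs) =
        pullback T (\<lambda>x vs. bary_monom T b x * whitney_form T \<rho> x vs)"
      if "\<And>i. i < length (verts T) \<Longrightarrow> a i = b i" for a b \<rho>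
    proof -
      have "bary_monom T a = bary_monom T b"
        unfolding bary_monom_def by (intro ext prod.cong) (auto simp: that)
      then show ?thesis by simp
    qed
    show "pullback T (\<lambda>x vs. bary_monom T (\<lambda>i. a (verts T ! i)) x * whitney_form T \<rho> x vs) =
        ?\<Phi> a (map ((!) (verts T)) \<rho>)" if \<rho>: "set \<rho> \<subseteq> {..<length (verts T)}" for a \<rho>
    proof (intro pullback_cong)
      fix x vs assume x: "x \<in> T" and vs: "set vs \<subseteq> tangent_space T"
      have "bary T (\<rho> ! i) x * wedge (map (d_bary T) (remove_nth i \<rho>)) x vs =
          (C (verts T ! (\<rho> ! i)) \<bullet> homogeneous x) *
          covector_wedge (remove_nth i (map C (map ((!) (verts T)) \<rho>))) (map direction vs)"
        if i: "i < length \<rho>" for i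
      proof -
        have "\<rho> ! i < length (verts T)" using i \<rho> nth_mem by fastforce
        moreover have "set (remove_nth i \<rho>) \<subseteq> {..<length (verts T)}"
          using \<rho> set_remove_nth_subset by fast
        ultimately show ?thesis
          by (simp only: bary_eq[OF T C x] wedge_d_bary_eq[OF T C x vs] map_remove_nth[symmetric])
      qed
      then have "whitney_form T \<rho> x vs = covector_wedge (map C (map ((!) (verts T)) \<rho>))
          (homogeneous x # map direction vs)"
        unfolding whitney_form_def covector_wedge_column by (auto simp: mult.assoc intro!: sum.cong)
      then show "bary_monom T (\<lambda>i. a (verts T ! i)) x * whitney_form T \<rho> x vs =
          trimmed_gen (vertices T) C a (map ((!) (verts T)) \<rho>) x vs"
        by (simp add: trimmed_gen_def bary_monom_eq[OF T C x] del: map_map)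
    qed
  qed
  also have "\<dots> = span (pullback T ` trimmed_gens (vertices T) C r k)"
    unfolding trimmed_gens_def by (rule arg_cong[where f = span], blast)
  finally show ?thesis by (simp add: linear_span_image[OF linear_pullback])
qed


section \<open>Traces, extension and derivatives of polynomial forms\<close>

lemma subspace_full_poly_forms: "subspace (full_poly_forms r k T)"
  by (simp add: full_poly_forms_def)

lemma subspace_trimmed_poly_forms: "subspace (trimmed_poly_forms r k T)"
  by (simp add: trimmed_poly_forms_def)

lemma full_poly_formsE:
  assumes "is_simplex T" "\<omega> \<in> full_poly_forms r k T"
  obtains C \<omega>' where "bary_covectors (vertices T) C" "\<omega>' \<in> span (full_gens (vertices T) C r k)"
    "\<omega> = pullback T \<omega>'"
proof -
  obtain C where C: "bary_covectors (vertices T) C"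
    using bary_covectors_exist[OF is_simplexE(3)[OF assms(1)]] .
  then show ?thesis using that assms by (auto simp: full_poly_forms_eq)
qed

lemma trimmed_subset_full:
  assumes "is_simplex T"
  shows "trimmed_poly_forms r k T \<subseteq> full_poly_forms r k T"
proof -
  obtain C where C: "bary_covectors (vertices T) C"
    using bary_covectors_exist[OF is_simplexE(3)[OF assms]] .
  show ?thesis
    unfolding full_poly_forms_eq[OF assms C] trimmed_poly_forms_eq[OF assms C]
    by (intro image_mono span_trimmed_gens_subset is_simplexE assms)
qed

lemma full_poly_forms_smooth:
  assumes "is_simplex T"
  shows "full_poly_forms r k T \<subseteq> smooth_forms k T"
proof
  fix \<omega> assume "\<omega> \<in> full_poly_forms r k T"
  then obtain C \<omega>' where "\<omega>' \<in> span (full_gens (vertices T) C r k)" "\<omega> = pullback T \<omega>'"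
    using full_poly_formsE[OF assms] by blast
  then show "\<omega> \<in> smooth_forms k T"
    using span_full_gens_ambient_forms[of "vertices T" C r k] by (auto simp: smooth_forms_def)
qed

lemma ext_deriv_full_poly_forms:
  assumes "is_simplex T" "\<omega> \<in> full_poly_forms r k T"
  shows "ext_deriv T \<omega> \<in> full_poly_forms (r - 1) (k + 1) T"
proof -
  obtain C \<omega>' where C: "bary_covectors (vertices T) C"
    and w: "\<omega>' \<in> span (full_gens (vertices T) C r k)" "\<omega> = pullback T \<omega>'"
    using full_poly_formsE[OF assms] .
  have "\<omega>' \<in> ambient_forms k" using w(1) span_full_gens_ambient_forms by blast
  then have "ext_deriv T \<omega> = pullback T (ambient_deriv \<omega>')"
    using ext_deriv_pullback is_simplex_convex assms(1) w(2) by blast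
  then show ?thesis
    unfolding full_poly_forms_eq[OF assms(1) C]
    using ambient_deriv_span_full_gens[OF is_simplexE(1)[OF assms(1)] w(1)] by blast
qed

text \<open>This inclusion uses that the barycentric coordinates sum up to \<open>1\<close>.\<close>

lemma full_subset_trimmed:
  assumes T: "is_simplex T"
  shows "full_poly_forms (r - 1) k T \<subseteq> trimmed_poly_forms r k T"
proof -
  let ?V = "vertices T"
  obtain C where C: "bary_covectors ?V C" using bary_covectors_exist[OF is_simplexE(3)[OF T]] .
  have "pullback T (full_gen ?V C a \<sigma>) \<in> span (pullback T ` trimmed_gens ?V C r k)"
    if a: "(\<Sum>v\<in>?V. int (a v)) = r - 1" and \<sigma>: "set \<sigma> \<subseteq> ?V" "int (length \<sigma>) = k" for a \<sigma>
  proof -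
    have "pullback T (full_gen ?V C a \<sigma>) = pullback T (\<Sum>v\<in>?V. trimmed_gen ?V C a (v # \<sigma>))"
    proof (rule pullback_cong)
      fix x vs assume x: "x \<in> T" and vs: "set vs \<subseteq> tangent_space T"
      let ?us = "homogeneous x # map direction vs"
      have "(\<Sum>v\<in>?V. C v) \<bullet> homogeneous x = 1"
        using bary_coordinates(2)[OF is_simplexE(1)[OF T] C] x is_simplexE(4)[OF T]
        by (simp only: inner_sum_left)
      moreover have "(\<Sum>v\<in>?V. C v) \<bullet> direction (vs ! i) = 0" if "i < length vs" for i
        using bary_directions(2)[OF is_simplexE(1)[OF T] C] vs that is_simplexE(4)[OF T] nth_mem
        by (simp only: inner_sum_left) blast
      \<comment> \<open>The sum of all covectors is 1 on the first column and 0 on all others, so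
        the expansion along this row has a single term.\<close>
      ultimately have "covector_wedge ((\<Sum>v\<in>?V. C v) # map C \<sigma>) ?us =
          covector_wedge (map C \<sigma>) (map direction vs)"
        by (simp add: covector_wedge_Cons alternate_def sum.lessThan_Suc_shift del: sum.lessThan_Suc)
      then show "full_gen ?V C a \<sigma> x vs = (\<Sum>v\<in>?V. trimmed_gen ?V C a (v # \<sigma>)) x vs"
        by (simp add: full_gen_def trimmed_gen_def sum_fun_apply flip: sum_distrib_left covector_wedge_sum)
    qed
    also have "\<dots> = (\<Sum>v\<in>?V. pullback T (trimmed_gen ?V C a (v # \<sigma>)))"
      by (rule linear_sum[OF linear_pullback])
    also have "\<dots> \<in> span (pullback T ` trimmed_gens ?V C r k)"
    proof (intro span_sum span_base imageI)
      fix v assume "v \<in> ?V"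
      then have "set (v # \<sigma>) \<subseteq> ?V" "int (length (v # \<sigma>)) = k + 1" using \<sigma> by auto
      with a show "trimmed_gen ?V C a (v # \<sigma>) \<in> trimmed_gens ?V C r k"
        unfolding trimmed_gens_def by blast
    qed
    finally show ?thesis .
  qed
  then have "pullback T ` full_gens ?V C (r - 1) k \<subseteq> span (pullback T ` trimmed_gens ?V C r k)"
    unfolding full_gens_def by blast
  then show ?thesis
    unfolding full_poly_forms_eq[OF T C] trimmed_poly_forms_eq[OF T C] linear_span_image[OF linear_pullback, symmetric]
    by (intro span_minimal subspace_span)
qed

lemma trimmed_poly_forms_smooth: "is_simplex T \<Longrightarrow> trimmed_poly_forms r k T \<subseteq> smooth_forms k T"
  by (rule order_trans[OF trimmed_subset_full full_poly_forms_smooth])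

text \<open>P_r^- lies in P_r, the derivative lowers the degree by one, and P_(r-1) lies in
  P_r^-.\<close>

lemma ext_deriv_trimmed_poly_forms:
  "is_simplex T \<Longrightarrow> \<omega> \<in> trimmed_poly_forms r k T \<Longrightarrow> ext_deriv T \<omega> \<in> trimmed_poly_forms r (k + 1) T"
  using trimmed_subset_full ext_deriv_full_poly_forms full_subset_trimmed by blast


section \<open>Contraction and traces of trimmed forms\<close>

lemma pullback_eq_0D:
  "pullback T \<omega> = 0 \<Longrightarrow> x \<in> T \<Longrightarrow> set vs \<subseteq> tangent_space T \<Longrightarrow> \<omega> x vs = 0"
  unfolding pullback_eq_0_iff by blast

text \<open>The Koszul operator with base point \<open>p\<close>, denoted by \<kappa> once it is
  followed by the pullback.\<close>

definition contract :: "'a::euclidean_space \<Rightarrow> 'a form \<Rightarrow> 'a form"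
  where "contract p \<omega> = (\<lambda>x vs. \<omega> x ((x - p) # vs))"

lemma linear_contract: "linear (contract p)"
  by (rule linearI) (auto simp: contract_def scaleR_fun_def fun_eq_iff)

text \<open>For \<open>p\<close> in \<open>F\<close> the vector \<open>x - p\<close> is tangent to
  \<open>F\<close>, so the restriction to \<open>F\<close> still sees the contracted
  argument.\<close>

lemma pullback_contract_pullback:
  "F \<subseteq> T \<Longrightarrow> p \<in> F \<Longrightarrow> pullback F (contract p (pullback T \<omega>)) = pullback F (contract p \<omega>)"
  using tangent_space_mono[of F T] tangent_space_diff[of _ F p]
  by (intro pullback_cong) (auto simp: contract_def pullback_def)

text \<open>\<open>direction (x - p)\<close> is \<open>homogeneous x - homogeneous p\<close>, and
  \<open>homogeneous x\<close> is already a column. So contraction inserts the constant column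
  \<open>homogeneous p\<close>, and expanding along it drops one index while the monomial stays the
  same.\<close>

lemma contract_trimmed_gen:
  "contract p (trimmed_gen V C a \<rho>) =
    (\<Sum>i<length \<rho>. ((-1) ^ i * (C (\<rho> ! i) \<bullet> homogeneous p)) *\<^sub>R trimmed_gen V C a (remove_nth i \<rho>))"
proof (intro ext)
  fix x :: 'a and vs :: "'a list"
  let ?h = "homogeneous x" and ?p = "homogeneous p" and ?ds = "map direction vs"
  let ?w = "covector_wedge (map C \<rho>)"
  note alt = alternating_covector_wedge[of "map C \<rho>"]
  have "?w (?h # direction (x - p) # ?ds) = ?w ([?h] @ (?h - ?p) # ?ds)" by simp
  also have "\<dots> = ?w ([?h] @ ?h # ?ds) - ?w ([?h] @ ?p # ?ds)"
    by (rule linear_diff[OF alternating_linear[OF alt]])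
  also have "?w ([?h] @ ?h # ?ds) = 0"
    by (rule alternating_not_distinct[OF alt]) simp
  also have "0 - ?w ([?h] @ ?p # ?ds) = ?w (?p # ?h # ?ds)"
    using alternating_swap[OF alt, of "[]" ?h ?p ?ds] by simp
  also have "\<dots> = (\<Sum>i<length \<rho>. (-1) ^ i * ((C (\<rho> ! i) \<bullet> ?p) *
      covector_wedge (map C (remove_nth i \<rho>)) (?h # ?ds)))"
    unfolding covector_wedge_column by (simp add: map_remove_nth)
  finally show "contract p (trimmed_gen V C a \<rho>) x vs = (\<Sum>i<length \<rho>.
      ((-1) ^ i * (C (\<rho> ! i) \<bullet> ?p)) *\<^sub>R trimmed_gen V C a (remove_nth i \<rho>)) x vs"
    by (simp add: contract_def trimmed_gen_def sum_fun_apply scaleR_fun_def sum_distrib_left mult_ac)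
qed

lemma contract_trimmed_poly_forms:
  assumes T: "is_simplex T" and p: "p \<in> T" and w: "\<omega> \<in> trimmed_poly_forms r k T"
  shows "pullback T (contract p \<omega>) \<in> trimmed_poly_forms r (k - 1) T"
proof -
  let ?V = "vertices T"
  obtain C where C: "bary_covectors ?V C" using bary_covectors_exist[OF is_simplexE(3)[OF T]] .
  obtain \<omega>' where w': "\<omega>' \<in> span (trimmed_gens ?V C r k)" "\<omega> = pullback T \<omega>'"
    using w trimmed_poly_forms_eq[OF T C] by blast
  have "contract p ` trimmed_gens ?V C r k \<subseteq> span (trimmed_gens ?V C r (k - 1))"
  proof
    fix \<eta> assume "\<eta> \<in> contract p ` trimmed_gens ?V C r k"
    then obtain a \<rho> where \<eta>: "\<eta> = contract p (trimmed_gen ?V C a \<rho>)"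
      and a: "(\<Sum>v\<in>?V. int (a v)) = r - 1" and \<rho>: "set \<rho> \<subseteq> ?V" "int (length \<rho>) = k + 1"
      by (auto simp: trimmed_gens_def)
    show "\<eta> \<in> span (trimmed_gens ?V C r (k - 1))"
      unfolding \<eta> contract_trimmed_gen
    proof (intro span_sum span_scale span_base)
      fix i assume "i \<in> {..<length \<rho>}"
      then have "set (remove_nth i \<rho>) \<subseteq> ?V" "int (length (remove_nth i \<rho>)) = k - 1 + 1"
        using set_remove_nth_subset[of i \<rho>] \<rho> by (auto simp: length_remove_nth)
      with a show "trimmed_gen ?V C a (remove_nth i \<rho>) \<in> trimmed_gens ?V C r (k - 1)"
        unfolding trimmed_gens_def by blast
    qed
  qed
  then have "span (contract p ` trimmed_gens ?V C r k) \<subseteq> span (trimmed_gens ?V C r (k - 1))"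
    by (intro span_minimal subspace_span)
  then have "contract p \<omega>' \<in> span (trimmed_gens ?V C r (k - 1))"
    using w'(1) linear_span_image[OF linear_contract, of p "trimmed_gens ?V C r k"] by blast
  then show ?thesis
    using trimmed_poly_forms_eq[OF T C] w'(2) pullback_contract_pullback[OF subset_refl p] by auto
qed

text \<open>On the face, the covector of a vertex outside \<open>W\<close> vanishes on points and
  directions alike: in the monomial it gives a zero factor, in the determinant a zero row.\<close>

lemma pullback_trimmed_gen:
  fixes V :: "'a::euclidean_space set"
  assumes V: "finite V" "bary_covectors V C" "W \<subseteq> V" and \<rho>: "set \<rho> \<subseteq> V"
  shows "pullback (convex hull W) (trimmed_gen V C a \<rho>) =
    (if (\<forall>v\<in>V - W. a v = 0) \<and> set \<rho> \<subseteq> W then pullback (convex hull W) (trimmed_gen W C a \<rho>) else 0)"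
proof (cases "(\<forall>v\<in>V - W. a v = 0) \<and> set \<rho> \<subseteq> W")
  case True
  have "bary_power V C a x = bary_power W C a x" for x
    unfolding bary_power_def using V True by (intro prod.mono_neutral_right) auto
  then have "trimmed_gen V C a \<rho> = trimmed_gen W C a \<rho>" by (simp add: trimmed_gen_def)
  then show ?thesis using True by simp
next
  case False
  have "trimmed_gen V C a \<rho> x vs = 0"
    if x: "x \<in> convex hull W" and vs: "set vs \<subseteq> tangent_space (convex hull W)" for x vs
  proof (cases "\<forall>v\<in>V - W. a v = 0")
    case True
    then obtain v where v: "v \<in> set \<rho>" "v \<in> V - W" using False \<rho> by blast
    have "covector_wedge (map C \<rho>) (homogeneous x # map direction vs) = 0"
    proof (rule covector_wedge_eq_0_row)
      show "C v \<in> set (map C \<rho>)" using v by simp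
      show "C v \<bullet> z = 0" if "z \<in> set (homogeneous x # map direction vs)" for z
        using that vs bary_covectors_eq_0[OF V x v(2)]
          bary_covectors_direction_eq_0[OF V _ v(2)] by auto
    qed
    then show ?thesis by (simp add: trimmed_gen_def)
  next
    case False
    then obtain v where v: "v \<in> V - W" "a v \<noteq> 0" by blast
    have "C v \<bullet> homogeneous x = 0" by (rule bary_covectors_eq_0[OF V x v(1)])
    then have "bary_power V C a x = 0"
      unfolding bary_power_def using V(1) v by (intro prod_zero) (auto intro!: bexI[of _ v])
    then show ?thesis by (simp add: trimmed_gen_def)
  qed
  then have "pullback (convex hull W) (trimmed_gen V C a \<rho>) = 0" by (simp add: pullback_eq_0_iff)
  then show ?thesis using False by (simp only: if_False)
qed

lemma pullback_trimmed_poly_forms: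
  assumes T: "is_simplex T" and F: "F \<in> subsimplices T" and w: "\<omega> \<in> trimmed_poly_forms r k T"
  shows "pullback F \<omega> \<in> trimmed_poly_forms r k F"
proof -
  let ?V = "vertices T" and ?W = "vertices F"
  obtain C where C: "bary_covectors ?V C" using bary_covectors_exist[OF is_simplexE(3)[OF T]] .
  have F': "is_simplex F" "?W \<subseteq> ?V" using F T by (auto simp: subsimplices_iff)
  have CF: "bary_covectors ?W C" by (rule bary_covectors_subset[OF C F'(2)])
  have hull: "convex hull ?W = F" by (rule is_simplexE(4)[OF F'(1)])
  obtain \<omega>' where w': "\<omega>' \<in> span (trimmed_gens ?V C r k)" "\<omega> = pullback T \<omega>'"
    using w trimmed_poly_forms_eq[OF T C] by blast
  have "pullback F ` trimmed_gens ?V C r k \<subseteq> trimmed_poly_forms r k F"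
  proof
    fix \<eta> assume "\<eta> \<in> pullback F ` trimmed_gens ?V C r k"
    then obtain a \<rho> where \<eta>: "\<eta> = pullback F (trimmed_gen ?V C a \<rho>)"
      and a: "(\<Sum>v\<in>?V. int (a v)) = r - 1" and \<rho>: "set \<rho> \<subseteq> ?V" "int (length \<rho>) = k + 1"
      by (auto simp: trimmed_gens_def)
    show "\<eta> \<in> trimmed_poly_forms r k F"
    proof (cases "(\<forall>v\<in>?V - ?W. a v = 0) \<and> set \<rho> \<subseteq> ?W")
      case True
      then have "\<eta> = pullback F (trimmed_gen ?W C a \<rho>)"
        using pullback_trimmed_gen[OF is_simplexE(1)[OF T] C F'(2) \<rho>(1), of a] hull \<eta> by simp
      moreover have "(\<Sum>v\<in>?W. int (a v)) = (\<Sum>v\<in>?V. int (a v))"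
        using True F'(2) is_simplexE(1)[OF T] by (intro sum.mono_neutral_left) auto
      ultimately show ?thesis
        unfolding trimmed_poly_forms_eq[OF F'(1) CF] trimmed_gens_def
        using True a \<rho> by (auto intro!: imageI span_base)
    next
      case False
      then have "\<eta> = 0"
        using pullback_trimmed_gen[OF is_simplexE(1)[OF T] C F'(2) \<rho>(1), of a] hull \<eta> by (simp only: if_False)
      then show ?thesis by (simp only: subspace_0[OF subspace_trimmed_poly_forms])
    qed
  qed
  then have "span (pullback F ` trimmed_gens ?V C r k) \<subseteq> trimmed_poly_forms r k F"
    by (intro span_minimal subspace_trimmed_poly_forms)
  then have "pullback F \<omega>' \<in> trimmed_poly_forms r k F"
    using w'(1) linear_span_image[OF linear_pullback, of F "trimmed_gens ?V C r k"] by blast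
  then show ?thesis using w'(2) pullback_pullback[OF subsimplices_subset[OF F]] by simp
qed

text \<open>Exponents count only through their restriction to \<open>V\<close>, where they are
  bounded by their sum.\<close>

lemma finite_gens:
  fixes \<Phi> :: "('a \<Rightarrow> nat) \<Rightarrow> 'a list \<Rightarrow> 'b"
  assumes V: "finite V" and cong: "\<And>a b \<rho>. (\<And>v. v \<in> V \<Longrightarrow> a v = b v) \<Longrightarrow> \<Phi> a \<rho> = \<Phi> b \<rho>"
  shows "finite {\<Phi> a \<rho> |a \<rho>. (\<Sum>v\<in>V. int (a v)) = r \<and> set \<rho> \<subseteq> V \<and> int (length \<rho>) = k}"
proof (rule finite_subset)
  let ?A = "PiE V (\<lambda>_. {..nat r}) \<times> {\<rho>. set \<rho> \<subseteq> V \<and> length \<rho> = nat k}"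
  show "finite ((\<lambda>(a, \<rho>). \<Phi> a \<rho>) ` ?A)"
    using V by (intro finite_imageI finite_cartesian_product finite_PiE finite_lists_length_eq) auto
  show "{\<Phi> a \<rho> |a \<rho>. (\<Sum>v\<in>V. int (a v)) = r \<and> set \<rho> \<subseteq> V \<and> int (length \<rho>) = k} \<subseteq>
      (\<lambda>(a, \<rho>). \<Phi> a \<rho>) ` ?A"
  proof safe
    fix a :: "'a \<Rightarrow> nat" and \<rho> :: "'a list"
    assume \<rho>: "set \<rho> \<subseteq> V"
    have "a v \<le> nat (\<Sum>v\<in>V. int (a v))" if "v \<in> V" for v
      using member_le_sum[OF that, of "\<lambda>v. int (a v)"] V by simp
    then have "(restrict a V, \<rho>) \<in> PiE V (\<lambda>_. {..nat (\<Sum>v\<in>V. int (a v))}) \<times>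
        {\<rho>'. set \<rho>' \<subseteq> V \<and> length \<rho>' = nat (int (length \<rho>))}"
      using \<rho> by auto
    moreover have "\<Phi> a \<rho> = \<Phi> (restrict a V) \<rho>" by (rule cong) simp
    ultimately show "\<Phi> a \<rho> \<in> (\<lambda>(a, \<rho>). \<Phi> a \<rho>) ` (PiE V (\<lambda>_. {..nat (\<Sum>v\<in>V. int (a v))}) \<times>
        {\<rho>'. set \<rho>' \<subseteq> V \<and> length \<rho>' = nat (int (length \<rho>))})"
      by force
  qed
qed

lemma full_poly_forms_finite_dimensional:
  assumes T: "is_simplex T"
  shows "\<exists>X. finite X \<and> full_poly_forms r k T \<subseteq> span X"
proof -
  let ?V = "vertices T"
  obtain C where C: "bary_covectors ?V C" using bary_covectors_exist[OF is_simplexE(3)[OF T]] .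
  have "full_gen ?V C a \<sigma> = full_gen ?V C b \<sigma>" if "\<And>v. v \<in> ?V \<Longrightarrow> a v = b v" for a b \<sigma>
    using bary_power_cong[of ?V a b C] that by (simp add: full_gen_def)
  then have "finite (full_gens ?V C r k)"
    unfolding full_gens_def by (rule finite_gens[OF is_simplexE(1)[OF T]])
  then show ?thesis
    unfolding full_poly_forms_eq[OF T C] linear_span_image[OF linear_pullback, symmetric] by blast
qed

lemma trimmed_poly_forms_finite_dimensional:
  "is_simplex T \<Longrightarrow> \<exists>X. finite X \<and> trimmed_poly_forms r k T \<subseteq> span X"
  using full_poly_forms_finite_dimensional trimmed_subset_full by (meson order_trans)


section \<open>Extension from a facet\<close>

lemma alternating_Cons_cong:
  assumes "alternating k \<alpha>" "list_all2 (\<lambda>u u'. \<exists>t. u = u' + t *\<^sub>R a) us us'"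
  shows "\<alpha> (xs @ a # ys @ us) = \<alpha> (xs @ a # ys @ us')"
  using assms(2)
proof (induction arbitrary: ys rule: list_all2_induct)
  case (Cons u us u' us')
  then obtain t where u: "u = u' + t *\<^sub>R a" by blast
  let ?f = "\<lambda>v. \<alpha> ((xs @ a # ys) @ v # us)"
  have l: "linear ?f" by (rule alternating_linear[OF assms(1)])
  have "?f a = 0" by (rule alternating_not_distinct[OF assms(1)]) simp
  then have "?f u = ?f u'" by (simp only: u linear_add[OF l] linear_scale[OF l]) simp
  then show ?case using Cons.IH[of "ys @ [u']"] by simp
qed simp

text \<open>
  The forms in \<^term>\<open>trimmed_gens W C r k\<close> with \<open>W = V - {p}\<close> are homogeneous of degree \<open>r\<close> in the
  barycentric coordinates of \<open>W\<close>, hence they are determined by their values on the facet opposite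
  to \<open>p\<close>.
\<close>

lemma trimmed_gens_homogeneous:
  assumes W: "finite W" and w: "\<omega> \<in> span (trimmed_gens W C r k)" and r: "1 \<le> r"
    and x: "\<And>v. v \<in> W \<Longrightarrow> C v \<bullet> homogeneous x = s * (C v \<bullet> homogeneous y)"
    and vs: "length vs = length vs'" "\<And>j v. j < length vs \<Longrightarrow> v \<in> W \<Longrightarrow>
      C v \<bullet> direction (vs ! j) = C v \<bullet> direction (vs' ! j) + t j * (C v \<bullet> homogeneous y)"
  shows "\<omega> x vs = s ^ nat r * \<omega> y vs'"
proof -
  let ?S = "{\<omega> :: 'a form. \<omega> x vs = s ^ nat r * \<omega> y vs'}"
  have sub: "subspace ?S"
    by (rule subspaceI) (auto simp: scaleR_fun_def algebra_simps)
  have gen: "\<omega> \<in> ?S" if "\<omega> \<in> trimmed_gens W C r k" for \<omega>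
  proof -
    from that obtain a \<rho> where \<omega>: "\<omega> = trimmed_gen W C a \<rho>"
      and a: "(\<Sum>v\<in>W. int (a v)) = r - 1" and \<rho>: "set \<rho> \<subseteq> W"
      by (auto simp: trimmed_gens_def)
    have "bary_power W C a x = (\<Prod>v\<in>W. s ^ a v * (C v \<bullet> homogeneous y) ^ a v)"
      unfolding bary_power_def by (intro prod.cong refl) (simp only: x power_mult_distrib)
    also have "\<dots> = s ^ (\<Sum>v\<in>W. a v) * bary_power W C a y"
      by (simp only: prod.distrib power_sum bary_power_def)
    also have "(\<Sum>v\<in>W. a v) = nat r - 1" using a r by (simp add: nat_diff_distrib flip: of_nat_sum)
    finally have 1: "bary_power W C a x = s ^ (nat r - 1) * bary_power W C a y" .
    let ?y = "homogeneous y"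
    \<comment> \<open>The rows \<open>C v\<close> with \<open>v \<in> W\<close> cannot distinguish
      the given columns from \<open>s *\<^sub>R ?y\<close> and \<open>?us\<close>. Pulling
      \<open>s\<close> out of the first column supplies the last of the \<open>r\<close> factors;
      the multiples of \<open>?y\<close> in the other columns do not change the determinant.\<close>
    let ?us = "map (\<lambda>j. direction (vs' ! j) + t j *\<^sub>R ?y) [0..<length vs]"
    let ?w = "covector_wedge (map C \<rho>)"
    note alt = alternating_covector_wedge[of "map C \<rho>"]
    have "?w (homogeneous x # map direction vs) = covector_wedge (map id (map C \<rho>)) ((s *\<^sub>R ?y) # ?us)"
    proof (rule covector_wedge_cong)
      fix c j assume "c \<in> set (map C \<rho>)" and j: "j < length ((s *\<^sub>R ?y) # ?us)"
      then obtain v where v: "c = C v" "v \<in> W" using \<rho> by auto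
      show "c \<bullet> (homogeneous x # map direction vs) ! j = id c \<bullet> ((s *\<^sub>R ?y) # ?us) ! j"
      proof (cases j)
        case 0
        then show ?thesis using v x by (simp only: nth_Cons_0 inner_scaleR_right id_apply)
      next
        case (Suc i)
        then have i: "i < length vs" using j by simp
        have "((s *\<^sub>R ?y) # ?us) ! j = direction (vs' ! i) + t i *\<^sub>R ?y"
          "(homogeneous x # map direction vs) ! j = direction (vs ! i)" using Suc i by simp_all
        then show ?thesis
          by (simp only: vs(2)[OF i v(2)] v(1) inner_add_right inner_scaleR_right id_apply)
      qed
    qed simp
    also have "\<dots> = s * ?w (?y # ?us)"
      using linear_scale[OF alternating_linear_Cons[OF alt], of s ?y ?us] by simp
    also have "?w (?y # ?us) = ?w (?y # map direction vs')"
      using alternating_Cons_cong[OF alt, of ?y ?us "map direction vs'" "[]" "[]"] vs(1)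
      by (auto simp: list_all2_conv_all_nth)
    finally have "?w (homogeneous x # map direction vs) = s * ?w (?y # map direction vs')" .
    moreover have "s ^ nat r = s ^ (nat r - 1) * s" using r by (cases "nat r") auto
    ultimately show ?thesis by (simp add: \<omega> trimmed_gen_def 1)
  qed
  have "span (trimmed_gens W C r k) \<subseteq> ?S"
    by (rule span_minimal[OF subsetI[OF gen] sub])
  then show ?thesis using w by blast
qed

text \<open>The simplex on \<open>U\<close> is a cone with apex \<open>p\<close> over the opposite
  face. Projecting a point and its tangent vectors from \<open>p\<close> onto that face changes the
  value of the form by a power of the scaling factor, by homogeneity.\<close>

lemma trimmed_gens_cone_vanish:
  fixes V :: "'a::euclidean_space set"
  assumes V: "finite V" "bary_covectors V C" and U: "U \<subseteq> V" "p \<in> U"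
    and w: "\<omega> \<in> span (trimmed_gens (V - {p}) C r k)"
    and 0: "U \<noteq> {p} \<Longrightarrow> pullback (convex hull (U - {p})) \<omega> = 0"
  shows "pullback (convex hull U) \<omega> = 0"
proof (cases "1 \<le> r")
  case True
  note hom = trimmed_gens_homogeneous[OF finite_Diff[OF V(1)] w True]
  have fU: "finite U" and CU: "bary_covectors U C"
    using U V finite_subset bary_covectors_subset by blast+
  have "\<omega> x vs = 0" if x: "x \<in> convex hull U" and vs: "set vs \<subseteq> tangent_space (convex hull U)" for x vs
  proof -
    define s where "s = (\<Sum>v\<in>U - {p}. C v \<bullet> homogeneous x)"
    note b = bary_coordinates[OF fU CU x]
    show ?thesis
    proof (cases "s = 0")
      case True
      have "C v \<bullet> homogeneous x = 0" if v: "v \<in> V - {p}" for v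
      proof (cases "v \<in> U")
        case True
        then show ?thesis
          using \<open>s = 0\<close> fU b(3) v sum_nonneg_eq_0_iff[of "U - {p}" "\<lambda>v. C v \<bullet> homogeneous x"]
          by (auto simp: s_def simp del: inner_Pair)
      next
        case False
        then show ?thesis using bary_covectors_eq_0[OF V U(1) x] v by blast
      qed
      \<comment> \<open>At the apex, homogeneity applies with \<open>y = x\<close> and scaling
        factor 0; as \<open>1 \<le> r\<close>, the power of 0 vanishes.\<close>
      then have "\<omega> x vs = 0 ^ nat r * \<omega> x vs"
        by (intro hom[where t = "\<lambda>_. 0"]) simp_all
      then show ?thesis using \<open>1 \<le> r\<close> by (simp add: power_0_left)
    next
      case False
      define y where "y = (\<Sum>v\<in>U - {p}. ((C v \<bullet> homogeneous x) / s) *\<^sub>R v)"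
      have "s \<ge> 0" unfolding s_def by (rule sum_nonneg, rule b(3), blast)
      with False have spos: "s > 0" by simp
      have "(\<Sum>v\<in>U - {p}. (C v \<bullet> homogeneous x) / s) = 1"
        using False by (simp add: sum_divide_distrib[symmetric] s_def[symmetric] del: inner_Pair)
      moreover have "0 \<le> (C v \<bullet> homogeneous x) / s" if "v \<in> U - {p}" for v
        using that spos by (intro divide_nonneg_pos b(3)) auto
      ultimately have y: "y \<in> convex hull (U - {p})"
        unfolding convex_hull_finite[OF finite_Diff[OF fU]] y_def
        by (intro CollectI exI[of _ "\<lambda>v. (C v \<bullet> homogeneous x) / s"] conjI ballI) simp_all
      then have yU: "y \<in> convex hull U" by (rule subsetD[OF hull_mono[OF Diff_subset]])
      have pU: "p \<in> convex hull U" by (rule hull_inc[OF U(2)])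
      have Up2: "U - {p} \<noteq> {}"
      proof
        assume "U - {p} = {}"
        with y show False by (simp only: convex_hull_empty empty_iff)
      qed
      then have Up1: "U \<noteq> {p}" by blast
      have "s *\<^sub>R y = (\<Sum>v\<in>U - {p}. (C v \<bullet> homogeneous x) *\<^sub>R v)"
        unfolding y_def scaleR_sum_right using False by (intro sum.cong) auto
      moreover have "C p \<bullet> homogeneous x = 1 - s"
        using b(2) U fU by (simp add: s_def sum.remove del: inner_Pair)
      ultimately have "x = (1 - s) *\<^sub>R p + s *\<^sub>R y"
        using b(1) U fU by (simp add: sum.remove del: inner_Pair)
      then have hx: "homogeneous x = (1 - s) *\<^sub>R homogeneous p + s *\<^sub>R homogeneous y" by simp
      have Cp: "C v \<bullet> homogeneous p = 0" if "v \<in> V - {p}" for v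
        using bary_covectorsD[OF V(2), of v p] that U by auto
      have Cpy: "C p \<bullet> homogeneous y = 0"
        by (rule bary_covectors_eq_0[OF V _ y]) (use U in auto)
      \<comment> \<open>This choice removes the \<open>p\<close>-component of \<open>f v\<close>, so
        that \<open>f v\<close> is tangent to the opposite face.\<close>
      define t where "t v = - (C p \<bullet> direction v)" for v
      define f where "f v = v - t v *\<^sub>R (y - p)" for v
      have df: "direction (f v) = direction v - t v *\<^sub>R (homogeneous y - homogeneous p)" for v
        by (simp add: f_def)
      have f: "f v \<in> tangent_space (convex hull (U - {p}))" if v: "v \<in> set vs" for v
      proof (rule in_tangent_space_subset[OF fU CU _ Up2])
        show "f v \<in> tangent_space (convex hull U)"
          unfolding f_def using v vs yU pU
          by (intro subspace_diff subspace_scale subspace_tangent_space tangent_space_diff) auto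
        have "C p \<bullet> homogeneous p = 1" using bary_covectorsD[OF CU U(2) U(2)] by simp
        then have "C p \<bullet> direction (f v) = 0"
          unfolding df by (simp only: inner_diff_right inner_scaleR_right Cpy t_def) simp
        then show "C u \<bullet> direction (f v) = 0" if "u \<in> U - (U - {p})" for u
          using that by auto
      qed auto
      have "\<omega> x vs = s ^ nat r * \<omega> y (map f vs)"
      proof (rule hom[where t = "\<lambda>j. t (vs ! j)"])
        show "C v \<bullet> homogeneous x = s * (C v \<bullet> homogeneous y)" if "v \<in> V - {p}" for v
          unfolding hx by (simp only: inner_add_right inner_scaleR_right Cp[OF that])
        show "C v \<bullet> direction (vs ! j) = C v \<bullet> direction (map f vs ! j) + t (vs ! j) * (C v \<bullet> homogeneous y)"
          if "j < length vs" "v \<in> V - {p}" for j v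
          by (simp only: nth_map[OF that(1)] df inner_diff_right inner_scaleR_right Cp[OF that(2)]) simp
      qed simp
      also have "\<omega> y (map f vs) = 0"
        by (rule pullback_eq_0D[OF 0[OF Up1] y]) (use f in auto)
      finally show ?thesis by simp
    qed
  qed
  then show ?thesis by (simp add: pullback_eq_0_iff)
next
  case False
  \<comment> \<open>For \<open>r \<le> 0\<close> no exponents have the sum
    \<open>r - 1\<close>.\<close>
  have "trimmed_gens (V - {p}) C r k = {}"
  proof (rule equals0I)
    fix \<eta> assume "\<eta> \<in> trimmed_gens (V - {p}) C r k"
    then obtain a where "(\<Sum>v\<in>V - {p}. int (a v)) = r - 1" by (auto simp: trimmed_gens_def)
    moreover have "0 \<le> (\<Sum>v\<in>V - {p}. int (a v))" by (intro sum_nonneg) simp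
    ultimately show False using False by simp
  qed
  then show ?thesis using w by (auto intro: pullback_0)
qed

text \<open>A generator on \<open>F\<close> is, as an expression in the coordinates, also a
  generator on \<open>T\<close>. A proper face \<open>H\<close> of \<open>T\<close> through
  \<open>p\<close> is a cone over a proper face of \<open>F\<close>, or \<open>p\<close> itself;
  since \<sigma> vanishes on that face, the extension vanishes on \<open>H\<close>.\<close>

lemma extend_trimmed_bubble:
  assumes T: "is_simplex T" and p: "p \<in> vertices T" and F: "vertices T - {p} \<noteq> {}"
    "F = convex hull (vertices T - {p})"
    and w: "\<sigma> \<in> trimmed_poly_forms r k F" "\<And>G. G \<in> subsimplices F \<Longrightarrow> G \<noteq> F \<Longrightarrow> pullback G \<sigma> = 0"
  obtains \<tau> where "\<tau> \<in> trimmed_poly_forms r k T" "pullback F \<tau> = \<sigma>"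
    "\<And>H. H \<in> subsimplices T \<Longrightarrow> H \<noteq> T \<Longrightarrow> p \<in> H \<Longrightarrow> pullback H \<tau> = 0"
proof -
  let ?V = "vertices T"
  obtain C where C: "bary_covectors ?V C" using bary_covectors_exist[OF is_simplexE(3)[OF T]] .
  have FT: "F \<in> subsimplices T" "is_simplex F" "vertices F = ?V - {p}"
    unfolding F(2) using convex_hull_in_subsimplices[OF T _ F(1)] by auto
  have CF: "bary_covectors (vertices F) C" using bary_covectors_subset[OF C] FT(3) by auto
  obtain \<omega> where w': "\<omega> \<in> span (trimmed_gens (?V - {p}) C r k)" "\<sigma> = pullback F \<omega>"
    using w(1) unfolding trimmed_poly_forms_eq[OF FT(2) CF] FT(3) by blast
  have "trimmed_gens (?V - {p}) C r k \<subseteq> trimmed_gens ?V C r k"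
  proof
    fix \<omega> assume "\<omega> \<in> trimmed_gens (?V - {p}) C r k"
    then obtain a \<rho> where a: "\<omega> = trimmed_gen (?V - {p}) C a \<rho>" "(\<Sum>v\<in>?V - {p}. int (a v)) = r - 1"
      "set \<rho> \<subseteq> ?V - {p}" "int (length \<rho>) = k + 1" by (auto simp: trimmed_gens_def)
    \<comment> \<open>The exponent of \<open>p\<close> does not occur in the generator on
      \<open>F\<close>; setting it to 0 preserves the total degree on \<open>T\<close>.\<close>
    let ?a = "a(p := 0)"
    have "bary_power (?V - {p}) C a = bary_power (?V - {p}) C ?a" by (rule bary_power_cong) auto
    also have "\<dots> = bary_power ?V C ?a"
      using p is_simplexE(1)[OF T] by (auto simp: bary_power_def prod.remove fun_eq_iff)
    finally have "\<omega> = trimmed_gen ?V C ?a \<rho>" by (simp add: a trimmed_gen_def)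
    moreover have "(\<Sum>v\<in>?V. int (?a v)) = r - 1"
      using a(2) p is_simplexE(1)[OF T] by (simp add: sum.remove)
    ultimately show "\<omega> \<in> trimmed_gens ?V C r k" using a(3,4) unfolding trimmed_gens_def by blast
  qed
  then have "\<omega> \<in> span (trimmed_gens ?V C r k)" using w'(1) span_mono by blast
  then have 1: "pullback T \<omega> \<in> trimmed_poly_forms r k T"
    unfolding trimmed_poly_forms_eq[OF T C] by blast
  have 2: "pullback F (pullback T \<omega>) = \<sigma>"
    using pullback_pullback[OF subsimplices_subset[OF FT(1)]] w'(2) by simp
  have 3: "pullback H (pullback T \<omega>) = 0" if H: "H \<in> subsimplices T" "H \<noteq> T" "p \<in> H" for H
  proof -
    have H': "is_simplex H" "vertices H \<subseteq> ?V" using H(1) T by (auto simp: subsimplices_iff)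
    have pH: "p \<in> vertices H"
    proof (rule ccontr)
      assume "p \<notin> vertices H"
      then have "C p \<bullet> homogeneous p = 0"
        using bary_covectors_eq_0[OF is_simplexE(1)[OF T] C H'(2), of p p] p H(3) is_simplexE(4)[OF H'(1)] by blast
      then show False using bary_covectorsD[OF C p p] by simp
    qed
    have "pullback (convex hull (vertices H)) \<omega> = 0"
      using is_simplexE(1)[OF T] C H'(2) pH w'(1)
    proof (rule trimmed_gens_cone_vanish)
      assume "vertices H \<noteq> {p}"
      then have ne: "vertices H - {p} \<noteq> {}" using pH by blast
      define G where "G = convex hull (vertices H - {p})"
      have G: "is_simplex G" "vertices G = vertices H - {p}"
        unfolding G_def using convex_hull_in_subsimplices[OF H'(1) _ ne] by auto
      have GF: "G \<in> subsimplices F"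
        unfolding subsimplices_iff[OF FT(2)] G(2) FT(3) by (intro conjI G(1) Diff_mono H'(2) subset_refl)
      moreover have "G \<noteq> F"
      proof
        assume "G = F"
        have "vertices H - {p} = ?V - {p}" unfolding G(2)[symmetric] \<open>G = F\<close> by (rule FT(3))
        then have "insert p (vertices H - {p}) = insert p (?V - {p})" by (rule arg_cong)
        then have "vertices H = ?V" unfolding insert_Diff[OF pH] insert_Diff[OF p] .
        then show False by (rule notE[OF H(2) is_simplex_eqI[OF H'(1) T]])
      qed
      ultimately have "pullback G \<sigma> = 0" by (rule w(2))
      then show "pullback (convex hull (vertices H - {p})) \<omega> = 0"
        using w'(2) pullback_pullback[OF subsimplices_subset[OF GF]] by (simp add: G_def)
    qed
    then show ?thesis
      using pullback_pullback[OF subsimplices_subset[OF H(1)]] is_simplexE(4)[OF H'(1)] by simp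
  qed
  show ?thesis by (rule that[OF 1 2 3])
qed


section \<open>Spaces of an admissible type\<close>

lemma subspace_poly_forms: "subspace (poly_forms P k T)"
  by (cases "P T k") (simp_all add: poly_forms_def subspace_full_poly_forms subspace_trimmed_poly_forms)

lemma poly_forms_smooth: "is_simplex T \<Longrightarrow> poly_forms P k T \<subseteq> smooth_forms k T"
  by (cases "P T k") (simp_all add: poly_forms_def full_poly_forms_smooth trimmed_poly_forms_smooth)

lemma poly_forms_finite_dimensional: "is_simplex T \<Longrightarrow> \<exists>X. finite X \<and> poly_forms P k T \<subseteq> span X"
  by (cases "P T k") (simp_all add: poly_forms_def full_poly_forms_finite_dimensional
      trimmed_poly_forms_finite_dimensional)

text \<open>One \<open>r\<close> serves both degrees: the space in degree \<open>k\<close> lies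
  between P_r^- and P_r, and that in degree \<open>k + 1\<close> between P_(r-1) and P_r^-. The
  outer bounds give the mapping property of d, the inner ones let potentials be sought in
  P_r^-.\<close>

lemma admissible_trimmed:
  assumes T: "is_simplex T" and P: "admissible (P T)"
  obtains r where "trimmed_poly_forms r k T \<subseteq> poly_forms P k T"
    "poly_forms P k T \<subseteq> full_poly_forms r k T"
    "poly_forms P (k + 1) T \<subseteq> trimmed_poly_forms r (k + 1) T"
    "full_poly_forms (r - 1) (k + 1) T \<subseteq> poly_forms P (k + 1) T"
proof -
  obtain r where r: "P T k = Trimmed r \<or> P T k = Full r" by (cases "P T k") auto
  then have "P T (k + 1) = Trimmed r \<or> P T (k + 1) = Full (r - 1)"
    using P unfolding admissible_def by blast
  with r show ?thesis
    using trimmed_subset_full[OF T, of r k] full_subset_trimmed[OF T, of r "k + 1"]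
    by (intro that[of r]) (auto simp: poly_forms_def)
qed

lemma ext_deriv_poly_forms:
  assumes "is_simplex T" "admissible (P T)" "\<omega> \<in> poly_forms P k T"
  shows "ext_deriv T \<omega> \<in> poly_forms P (k + 1) T"
proof -
  obtain r where "poly_forms P k T \<subseteq> full_poly_forms r k T"
      "full_poly_forms (r - 1) (k + 1) T \<subseteq> poly_forms P (k + 1) T"
    by (rule admissible_trimmed[where P = P and k = k, OF assms(1,2)])
  then show ?thesis using ext_deriv_full_poly_forms[OF assms(1), of \<omega> r k] assms(3) by blast
qed


section \<open>Integrals over simplices\<close>

abbreviation cube_measure :: "nat \<Rightarrow> (nat \<Rightarrow> real) measure"
  where "cube_measure m \<equiv> Pi\<^sub>M {..<m} (\<lambda>_. lborel)"

text \<open>Like \<open>param\<close>, but with the base point and the edges as arguments, so that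
  the edges can be permuted and the base moved to another vertex.\<close>

definition affine_param :: "'a::euclidean_space \<Rightarrow> 'a list \<Rightarrow> (nat \<Rightarrow> real) \<Rightarrow> 'a"
  where "affine_param p es t = p + (\<Sum>i<length es. t i *\<^sub>R es ! i)"

definition simplex_integral :: "'a::euclidean_space \<Rightarrow> 'a list \<Rightarrow> ('a \<Rightarrow> real) \<Rightarrow> real"
  where "simplex_integral p es f =
    (LINT t:std_simplex_set (length es)|cube_measure (length es). f (affine_param p es t))"

lemma coord_integral_eq: "coord_integral T f = simplex_integral (hd (verts T)) (edges T) f"
  by (simp add: coord_integral_def simplex_integral_def param_def affine_param_def)

interpretation cube: product_sigma_finite "\<lambda>_::nat. lborel :: real measure"
  by standard

lemma measurable_affine_param [measurable]:
  "affine_param p es \<in> borel_measurable (cube_measure (length es))"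
  unfolding affine_param_def by measurable

text \<open>\<open>std_simplex_set\<close> leaves the coordinates from \<open>m\<close> on
  arbitrary, whereas the product space contains only extensional functions; hence the
  intersection.\<close>

lemma sets_std_simplex_set [measurable]:
  "std_simplex_set m \<inter> space (cube_measure m) \<in> sets (cube_measure m)"
proof -
  have "{t \<in> space (cube_measure m). (\<forall>i\<in>{..<m}. 0 \<le> t i) \<and> (\<Sum>i<m. t i) \<le> 1} \<in> sets (cube_measure m)"
    by measurable
  also have "{t \<in> space (cube_measure m). (\<forall>i\<in>{..<m}. 0 \<le> t i) \<and> (\<Sum>i<m. t i) \<le> 1} =
      std_simplex_set m \<inter> space (cube_measure m)"
    by (auto simp: std_simplex_set_def)
  finally show ?thesis .
qed

lemma emeasure_std_simplex_set: "emeasure (cube_measure m) (std_simplex_set m \<inter> space (cube_measure m)) < \<infinity>"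
proof -
  have "t i \<le> 1" if "t \<in> std_simplex_set m" "i < m" for t i
    using that member_le_sum[of i "{..<m}" t] by (auto simp: std_simplex_set_def)
  then have "std_simplex_set m \<inter> space (cube_measure m) \<subseteq> Pi\<^sub>E {..<m} (\<lambda>_. {0..1})"
    by (auto simp: space_PiM std_simplex_set_def PiE_iff)
  then have "emeasure (cube_measure m) (std_simplex_set m \<inter> space (cube_measure m)) \<le>
      emeasure (cube_measure m) (Pi\<^sub>E {..<m} (\<lambda>_. {0..1}))"
    by (intro emeasure_mono sets_PiM_I_finite) auto
  also have "\<dots> < \<infinity>" by (subst cube.emeasure_PiM) auto
  finally show ?thesis .
qed

lemma integrable_simplex:
  fixes f :: "'a::euclidean_space \<Rightarrow> real"
  assumes "compact K" "continuous_on K f" "\<And>t. t \<in> std_simplex_set (length es) \<Longrightarrow> affine_param p es t \<in> K"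
  shows "set_integrable (cube_measure (length es)) (std_simplex_set (length es)) (\<lambda>t. f (affine_param p es t))"
proof -
  let ?m = "length es"
  let ?A = "std_simplex_set ?m \<inter> space (cube_measure ?m)"
  obtain B where B: "\<And>x. x \<in> K \<Longrightarrow> norm (f x) \<le> B"
    using compact_imp_bounded[OF compact_continuous_image[OF assms(2,1)]] by (auto simp: bounded_iff)
  \<comment> \<open>Off \<open>K\<close> nothing is known about \<open>f\<close>; cutting it off
    there yields a Borel function.\<close>
  have g: "(\<lambda>x. indicator K x *\<^sub>R f x) \<in> borel_measurable borel"
    by (rule borel_measurable_continuous_on_indicator[OF borel_compact[OF assms(1)] assms(2)])
  have "integrable (cube_measure ?m) (\<lambda>t. indicator ?A t *\<^sub>R (indicator K (affine_param p es t) *\<^sub>R f (affine_param p es t)))"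
  proof (rule integrableI_bounded_set[where A = ?A and B = B])
    show "?A \<in> sets (cube_measure ?m)" by (rule sets_std_simplex_set)
    show "emeasure (cube_measure ?m) ?A < \<infinity>" by (rule emeasure_std_simplex_set)
    have "(\<lambda>t. indicator K (affine_param p es t) *\<^sub>R f (affine_param p es t)) \<in> borel_measurable (cube_measure ?m)"
      by (rule measurable_compose[OF measurable_affine_param g])
    then show "(\<lambda>t. indicator ?A t *\<^sub>R (indicator K (affine_param p es t) *\<^sub>R f (affine_param p es t)))
        \<in> borel_measurable (cube_measure ?m)"
      by (rule borel_measurable_scaleR[OF borel_measurable_indicator[OF sets_std_simplex_set]])
    show "AE t in cube_measure ?m. t \<in> ?A \<longrightarrow> norm (indicator ?A t *\<^sub>R
        (indicator K (affine_param p es t) *\<^sub>R f (affine_param p es t))) \<le> B"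
      by (rule AE_I2) (simp add: indicator_def B[unfolded real_norm_def] assms(3))
    show "AE t in cube_measure ?m. t \<notin> ?A \<longrightarrow> indicator ?A t *\<^sub>R
        (indicator K (affine_param p es t) *\<^sub>R f (affine_param p es t)) = 0"
      by auto
  qed
  then show ?thesis
    unfolding set_integrable_def
    by (rule Bochner_Integration.integrable_cong[THEN iffD1, OF refl, rotated])
      (auto simp: indicator_def assms(3))
qed

lemma simplex_integral_cong:
  assumes "\<And>t. t \<in> std_simplex_set (length es) \<Longrightarrow> f (affine_param p es t) = g (affine_param p es t)"
  shows "simplex_integral p es f = simplex_integral p es g"
  unfolding simplex_integral_def set_lebesgue_integral_def
  by (intro Bochner_Integration.integral_cong) (auto simp: indicator_def assms)

lemma simplex_integral_cmult: "simplex_integral p es (\<lambda>x. c * f x) = c * simplex_integral p es f"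
  unfolding simplex_integral_def by simp

lemma simplex_integral_add:
  assumes "compact K" "continuous_on K f" "continuous_on K g"
    "\<And>t. t \<in> std_simplex_set (length es) \<Longrightarrow> affine_param p es t \<in> K"
  shows "simplex_integral p es (\<lambda>x. f x + g x) = simplex_integral p es f + simplex_integral p es g"
  unfolding simplex_integral_def
  by (rule set_integral_add(2)[OF integrable_simplex integrable_simplex]) (use assms in auto)

lemma simplex_integral_0: "simplex_integral p es (\<lambda>x. 0) = 0"
  using simplex_integral_cmult[of p es 0 "\<lambda>x. 0"] by simp

lemma simplex_integral_sum:
  assumes "compact K" "\<And>i. i \<in> I \<Longrightarrow> continuous_on K (f i)" "finite I"
    "\<And>t. t \<in> std_simplex_set (length es) \<Longrightarrow> affine_param p es t \<in> K"
  shows "simplex_integral p es (\<lambda>x. \<Sum>i\<in>I. f i x) = (\<Sum>i\<in>I. simplex_integral p es (f i))"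
  using assms(3,2)
proof (induction I)
  case (insert i I)
  have "continuous_on K (\<lambda>x. \<Sum>i\<in>I. f i x)" by (intro continuous_on_sum insert.prems) simp
  from simplex_integral_add[OF assms(1) insert.prems[OF insertI1] this assms(4)]
    insert.IH[OF insert.prems[OF insertI2]] insert.hyps
  show ?case by simp
qed (simp add: simplex_integral_0)

text \<open>The interior point \<open>u\<close> of the standard simplex pulls \<open>t\<close> off its boundary.\<close>

lemma simplex_integral_eq_0_imp:
  assumes K: "compact K" "continuous_on K f" "\<And>t. t \<in> std_simplex_set (length es) \<Longrightarrow> affine_param p es t \<in> K"
    and nonneg: "\<And>t. t \<in> std_simplex_set (length es) \<Longrightarrow> 0 \<le> f (affine_param p es t)"
    and 0: "simplex_integral p es f = 0" and t: "t \<in> std_simplex_set (length es)"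
  shows "f (affine_param p es t) = 0"
proof (rule ccontr)
  let ?m = "length es" and ?q = "affine_param p es"
  assume "f (?q t) \<noteq> 0"
  then have pos: "0 < f (?q t)" using nonneg[OF t] by simp
  \<comment> \<open>The barycentre: its coordinates and their distance to the bound 1 on the sum are
    all equal to \<open>1 / (m + 1)\<close>.\<close>
  define u :: "nat \<Rightarrow> real" where "u i = 1 / (real ?m + 1)" for i
  have u: "0 < u i" "(\<Sum>i<?m. u i) < 1" for i
    by (auto simp: u_def)
  define s where "s e i = (1 - e) * t i + e * u i" for e i
  have s: "0 < s e i" "(\<Sum>i<?m. s e i) < 1" if "0 < e" "e \<le> 1" "i < ?m" for e i
  proof -
    have "0 \<le> t i" "(\<Sum>i<?m. t i) \<le> 1" using t that by (auto simp: std_simplex_set_def)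
    then show "0 < s e i" using that u by (auto simp: s_def intro!: add_nonneg_pos)
    have "(\<Sum>i<?m. s e i) = (1 - e) * (\<Sum>i<?m. t i) + e * (\<Sum>i<?m. u i)"
      by (simp add: s_def sum.distrib sum_distrib_left)
    also have "\<dots> < (1 - e) * 1 + e * 1"
      using that u \<open>(\<Sum>i<?m. t i) \<le> 1\<close> by (intro add_le_less_mono mult_left_mono mult_strict_left_mono) auto
    finally show "(\<Sum>i<?m. s e i) < 1" by simp
  qed
  have sS: "s e \<in> std_simplex_set ?m" if "0 < e" "e \<le> 1" for e
    using s(1)[OF that] s(2)[OF that, of 0] by (cases "?m = 0") (auto simp: std_simplex_set_def less_imp_le)
  have "((\<lambda>e. ?q (s e)) \<longlongrightarrow> ?q (s 0)) (at_right 0)"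
    unfolding affine_param_def s_def by (intro tendsto_intros)
  moreover have "s 0 = t" by (auto simp: s_def)
  ultimately have lim: "((\<lambda>e. ?q (s e)) \<longlongrightarrow> ?q t) (at_right 0)" by simp
  have ev: "eventually (\<lambda>e. 0 < e \<and> e \<le> (1::real)) (at_right 0)"
    using eventually_at_right_field[of "\<lambda>e. 0 < e \<and> e \<le> 1" "0::real"] by (auto intro!: exI[of _ 1])
  have "((\<lambda>e. f (?q (s e))) \<longlongrightarrow> f (?q t)) (at_right 0)"
  proof (rule continuous_on_tendsto_compose[OF K(2) lim K(3)[OF t]])
    show "eventually (\<lambda>e. ?q (s e) \<in> K) (at_right 0)"
      using ev by eventually_elim (use sS K(3) in auto)
  qed
  then have "eventually (\<lambda>e. f (?q t) / 2 < f (?q (s e))) (at_right 0)"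
    using pos by (intro order_tendstoD) auto
  with ev have "eventually (\<lambda>e. 0 < e \<and> e \<le> 1 \<and> f (?q t) / 2 < f (?q (s e))) (at_right (0::real))"
    by eventually_elim auto
  from eventually_happens'[OF trivial_limit_at_right_real this]
  obtain e where "0 < e \<and> e \<le> 1 \<and> f (?q t) / 2 < f (?q (s e))" ..
  with pos have e: "0 < e" "e \<le> 1" "0 < f (?q (s e))" by auto
  define c where "c = f (?q (s e)) / 2"
  have c: "0 < c" using e by (simp add: c_def)
  have "?q (s e) \<in> K" using sS e K(3) by auto
  from bspec[OF K(2)[unfolded continuous_on_iff] this, THEN spec, THEN mp, OF c]
  obtain d where d: "d > 0" "\<And>y. y \<in> K \<Longrightarrow> dist y (?q (s e)) < d \<Longrightarrow> dist (f y) (f (?q (s e))) < c"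
    by blast
  define N where "N = (\<Sum>i<?m. norm (es ! i)) + 1"
  have "0 \<le> (\<Sum>i<?m. norm (es ! i))" by (rule sum_nonneg) simp
  then have N: "N > 0" by (simp add: N_def)
  obtain r where r: "r > 0" "\<And>i. i < ?m \<Longrightarrow> r \<le> s e i" "real ?m * r \<le> 1 - (\<Sum>i<?m. s e i)" "r * N < d"
  proof -
    \<comment> \<open>Half the side length of a box around \<open>s e\<close>. The three kinds of
      bounds keep its image within distance \<open>d\<close>, the coordinate sums at most 1, and the
      coordinates nonnegative.\<close>
    define r where "r = Min (insert (d / (2 * N)) (insert ((if ?m = 0 then 1 else 1 - (\<Sum>i<?m. s e i)) / (real ?m + 1)) (s e ` {..<?m})))"
    have fin: "finite (insert (d / (2 * N)) (insert ((if ?m = 0 then 1 else 1 - (\<Sum>i<?m. s e i)) / (real ?m + 1)) (s e ` {..<?m})))"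
      by simp
    have "r > 0" unfolding r_def using e d N s(1)[of e] s(2)[of e 0] by (subst Min_gr_iff) (auto intro!: divide_pos_pos)
    moreover have "r \<le> s e i" if "i < ?m" for i unfolding r_def using that by (intro Min_le fin) auto
    moreover have "real ?m * r \<le> 1 - (\<Sum>i<?m. s e i)"
    proof (cases "?m = 0")
      case False
      then have "r \<le> (1 - (\<Sum>i<?m. s e i)) / (real ?m + 1)" unfolding r_def by (intro Min_le fin) auto
      then have "r * (real ?m + 1) \<le> 1 - (\<Sum>i<?m. s e i)" by (simp add: pos_le_divide_eq)
      moreover have "real ?m * r \<le> r * (real ?m + 1)" using \<open>r > 0\<close> by (simp add: algebra_simps)
      ultimately show ?thesis by linarith
    qed simp
    moreover have "r \<le> d / (2 * N)" unfolding r_def by (intro Min_le fin) auto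
    then have "r * N \<le> d / 2" using N by (simp add: field_simps)
    then have "r * N < d" using d(1) by simp
    ultimately show ?thesis by (rule that)
  qed
  \<comment> \<open>On this box \<open>f\<close> is at least \<open>c\<close>, and the box has the
    positive measure \<open>(2 * r) ^ m\<close>, also for \<open>m = 0\<close>; so the integral
    cannot vanish.\<close>
  define R where "R = Pi\<^sub>E {..<?m} (\<lambda>i. {s e i - r .. s e i + r})"
  have R: "R \<in> sets (cube_measure ?m)" unfolding R_def by (intro sets_PiM_I_finite) auto
  have RS: "t' \<in> std_simplex_set ?m" "c \<le> f (?q t')" if t': "t' \<in> R" for t'
  proof -
    have b: "s e i - r \<le> t' i" "t' i \<le> s e i + r" if "i < ?m" for i
      using t' that by (auto simp: R_def PiE_iff)
    have "(\<Sum>i<?m. t' i) \<le> (\<Sum>i<?m. s e i + r)" using b by (intro sum_mono) auto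
    also have "\<dots> = (\<Sum>i<?m. s e i) + real ?m * r" by (simp add: sum.distrib)
    finally have "(\<Sum>i<?m. t' i) \<le> 1" using r(3) by simp
    moreover have "0 \<le> t' i" if "i < ?m" for i using b[OF that] r(2)[OF that] by simp
    ultimately show S: "t' \<in> std_simplex_set ?m" by (auto simp: std_simplex_set_def)
    have "dist (?q t') (?q (s e)) = norm (\<Sum>i<?m. (t' i - s e i) *\<^sub>R es ! i)"
      by (simp add: affine_param_def dist_norm sum_subtractf scaleR_left_diff_distrib)
    also have "\<dots> \<le> (\<Sum>i<?m. norm ((t' i - s e i) *\<^sub>R es ! i))" by (rule norm_sum)
    also have "\<dots> \<le> (\<Sum>i<?m. r * norm (es ! i))"
    proof (rule sum_mono)
      fix i assume "i \<in> {..<?m}"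
      then have "\<bar>t' i - s e i\<bar> \<le> r" using b[of i] by (simp add: abs_le_iff)
      then show "norm ((t' i - s e i) *\<^sub>R es ! i) \<le> r * norm (es ! i)"
        by (simp add: mult_right_mono)
    qed
    also have "\<dots> \<le> r * N" using r(1) by (simp add: N_def flip: sum_distrib_left)
    finally have "dist (?q t') (?q (s e)) < d" using r(4) by simp
    then have "dist (f (?q t')) (f (?q (s e))) < c" using d(2) K(3)[OF S] by blast
    then show "c \<le> f (?q t')" unfolding c_def dist_real_def abs_less_iff by simp
  qed
  have intf: "integrable (cube_measure ?m) (\<lambda>t. indicator (std_simplex_set ?m) t *\<^sub>R f (?q t))"
    using integrable_simplex[OF K] by (simp add: set_integrable_def)
  have fR: "emeasure (cube_measure ?m) R = ennreal ((2 * r) ^ ?m)"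
    unfolding R_def using r(1) by (subst cube.emeasure_PiM) (auto simp: prod_ennreal ennreal_power)
  then have "integrable (cube_measure ?m) (\<lambda>t. indicator R t *\<^sub>R c)"
    using R by (intro integrable_scaleR_left integrable_real_indicator) auto
  then have "(\<integral>t. indicator R t *\<^sub>R c \<partial>cube_measure ?m) \<le> (\<integral>t. indicator (std_simplex_set ?m) t *\<^sub>R f (?q t) \<partial>cube_measure ?m)"
    using intf
  proof (rule integral_mono)
    fix t' show "indicator R t' *\<^sub>R c \<le> indicator (std_simplex_set ?m) t' *\<^sub>R f (?q t')"
      using RS[of t'] nonneg[of t'] by (auto simp: indicator_def)
  qed
  also have "\<dots> = 0" using 0 by (simp add: simplex_integral_def set_lebesgue_integral_def)
  also have "(\<integral>t. indicator R t *\<^sub>R c \<partial>cube_measure ?m) = measure (cube_measure ?m) R * c"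
    using R by simp
  also have "measure (cube_measure ?m) R = (2 * r) ^ ?m" using fR r(1) by (simp add: measure_def)
  finally have "(2 * r) ^ ?m * c \<le> 0" .
  moreover have "0 < (2 * r) ^ ?m * c" using c r(1) by simp
  ultimately show False by simp
qed


section \<open>Reparametrization and integration along an edge\<close>

lemma affine_param_in_hull:
  assumes "t \<in> std_simplex_set (length es)"
  shows "affine_param p es t \<in> convex hull (insert p ((+) p ` set es))"
proof -
  let ?m = "length es" let ?H = "convex hull (insert p ((+) p ` set es))"
  have "(\<Sum>i<Suc ?m. (if i < ?m then t i else 1 - (\<Sum>i<?m. t i)) *\<^sub>R (if i < ?m then p + es ! i else p)) \<in> ?H"
    using assms by (intro convex_sum) (auto simp: std_simplex_set_def intro!: hull_inc)
  also have "(\<Sum>i<Suc ?m. (if i < ?m then t i else 1 - (\<Sum>i<?m. t i)) *\<^sub>R (if i < ?m then p + es ! i else p)) =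
      affine_param p es t"
    by (simp add: affine_param_def algebra_simps sum.distrib flip: scaleR_sum_left)
  finally show ?thesis .
qed

lemma compact_edge_hull:
  fixes p :: "'a::euclidean_space"
  shows "compact (convex hull (insert p ((+) p ` set es)))"
  by (intro finite_imp_compact_convex_hull) auto

lemmas integrable_simplex_continuous =
  integrable_simplex[OF compact_edge_hull _ affine_param_in_hull]

lemma distr_cube_permute:
  assumes "\<pi> permutes {..<m}"
  shows "distr (cube_measure m) (cube_measure m) (\<lambda>t. \<lambda>i\<in>{..<m}. t (\<pi> i)) = cube_measure m"
proof (rule cube.PiM_eqI)
  have in_m: "\<pi> i \<in> {..<m}" if "i \<in> {..<m}" for i using permutes_in_image[OF assms] that by blast
  have meas: "(\<lambda>t. \<lambda>i\<in>{..<m}. t (\<pi> i)) \<in> measurable (cube_measure m) (cube_measure m)"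
    using in_m by (intro measurable_restrict measurable_component_singleton) auto
  fix A :: "nat \<Rightarrow> real set" assume A: "\<And>i. i \<in> {..<m} \<Longrightarrow> A i \<in> sets lborel"
  let ?B = "\<lambda>i. A (inv_into UNIV \<pi> i)"
  have inv: "inv_into UNIV \<pi> i \<in> {..<m}" if "i \<in> {..<m}" for i
    using permutes_in_image[OF permutes_inv[OF assms]] that by blast
  have "(\<lambda>t. \<lambda>i\<in>{..<m}. t (\<pi> i)) -` Pi\<^sub>E {..<m} A \<inter> space (cube_measure m) = Pi\<^sub>E {..<m} ?B"
  proof (intro equalityI subsetI)
    fix t assume t: "t \<in> (\<lambda>t. \<lambda>i\<in>{..<m}. t (\<pi> i)) -` Pi\<^sub>E {..<m} A \<inter> space (cube_measure m)"
    have "t i \<in> A (inv_into UNIV \<pi> i)" if i: "i \<in> {..<m}" for i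
    proof -
      have "(\<lambda>i\<in>{..<m}. t (\<pi> i)) \<in> Pi\<^sub>E {..<m} A" using t by simp
      from PiE_mem[OF this inv[OF i]]
      show ?thesis using inv[OF i] permutes_inverses(1)[OF assms] by simp
    qed
    then show "t \<in> Pi\<^sub>E {..<m} ?B" using t by (auto simp: space_PiM PiE_iff)
  next
    fix t assume t: "t \<in> Pi\<^sub>E {..<m} ?B"
    have "t (\<pi> i) \<in> A i" if i: "i \<in> {..<m}" for i
      using PiE_mem[OF t in_m[OF i]] permutes_inverses(2)[OF assms] by simp
    then show "t \<in> (\<lambda>t. \<lambda>i\<in>{..<m}. t (\<pi> i)) -` Pi\<^sub>E {..<m} A \<inter> space (cube_measure m)"
      using t by (auto simp: space_PiM PiE_iff)
  qed
  then have "emeasure (distr (cube_measure m) (cube_measure m) (\<lambda>t. \<lambda>i\<in>{..<m}. t (\<pi> i))) (Pi\<^sub>E {..<m} A) =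
      emeasure (cube_measure m) (Pi\<^sub>E {..<m} ?B)"
    using A by (subst emeasure_distr[OF meas]) (auto intro!: sets_PiM_I_finite)
  also have "\<dots> = (\<Prod>i<m. emeasure lborel (A (inv_into UNIV \<pi> i)))"
    using A inv by (intro cube.emeasure_PiM) auto
  also have "\<dots> = (\<Prod>i<m. emeasure lborel (A i))"
    using prod.permute[OF permutes_inv[OF assms], of "\<lambda>i. emeasure lborel (A i)"] by (simp add: o_def)
  finally show "emeasure (distr (cube_measure m) (cube_measure m) (\<lambda>t. \<lambda>i\<in>{..<m}. t (\<pi> i))) (Pi\<^sub>E {..<m} A) =
      (\<Prod>i<m. emeasure lborel (A i))" .
qed auto

text \<open>The product measure and the standard simplex are both symmetric in the
  coordinates.\<close>

lemma simplex_integral_mset: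
  assumes "mset es = mset es'" "continuous_on UNIV f"
  shows "simplex_integral p es f = simplex_integral p es' f"
proof -
  let ?m = "length es'"
  obtain \<pi> where \<pi>: "\<pi> permutes {..<?m}" "permute_list \<pi> es' = es"
    using mset_eq_permutation[OF assms(1)] by blast
  have len: "length es = ?m" using assms(1) by (metis size_mset)
  let ?g = "\<lambda>t. indicator (std_simplex_set ?m) t *\<^sub>R f (affine_param p es' t)"
  let ?\<phi> = "\<lambda>t. \<lambda>i\<in>{..<?m}. t (inv_into UNIV \<pi> i)"
  have inv: "inv_into UNIV \<pi> permutes {..<?m}" by (rule permutes_inv[OF \<pi>(1)])
  have in_m: "inv_into UNIV \<pi> i \<in> {..<?m}" if "i \<in> {..<?m}" for i using permutes_in_image[OF inv] that by blast
  have meas: "?\<phi> \<in> measurable (cube_measure ?m) (cube_measure ?m)"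
    using in_m by (intro measurable_restrict measurable_component_singleton) auto
  have "continuous_on (convex hull (insert p ((+) p ` set es'))) f"
    using assms(2) continuous_on_subset by blast
  from integrable_simplex_continuous[OF this]
  have g: "?g \<in> borel_measurable (cube_measure ?m)"
    unfolding set_integrable_def by (rule borel_measurable_integrable)
  have "simplex_integral p es' f = (\<integral>t. ?g t \<partial>cube_measure ?m)"
    by (simp add: simplex_integral_def set_lebesgue_integral_def)
  also have "\<dots> = (\<integral>t. ?g t \<partial>distr (cube_measure ?m) (cube_measure ?m) ?\<phi>)"
    by (simp only: distr_cube_permute[OF inv])
  also have "\<dots> = (\<integral>t. ?g (?\<phi> t) \<partial>cube_measure ?m)"
    by (rule integral_distr[OF meas g])
  also have "\<dots> = (\<integral>t. indicator (std_simplex_set ?m) t *\<^sub>R f (affine_param p es t) \<partial>cube_measure ?m)"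
  proof (rule Bochner_Integration.integral_cong[OF refl])
    fix t :: "nat \<Rightarrow> real"
    have "(\<Sum>i<?m. ?\<phi> t i) = (\<Sum>i<?m. t (inv_into UNIV \<pi> i))" by (rule sum.cong) auto
    also have "\<dots> = (\<Sum>i<?m. t i)" using sum.permute[OF inv, of t] by (simp add: o_def)
    finally have 1: "(\<Sum>i<?m. ?\<phi> t i) = (\<Sum>i<?m. t i)" .
    have 2: "(\<forall>i<?m. 0 \<le> ?\<phi> t i) \<longleftrightarrow> (\<forall>i<?m. 0 \<le> t i)"
    proof
      assume a: "\<forall>i<?m. 0 \<le> ?\<phi> t i"
      show "\<forall>i<?m. 0 \<le> t i"
      proof (intro allI impI)
        fix i assume i: "i < ?m"
        then have "\<pi> i < ?m" using permutes_in_image[OF \<pi>(1)] by blast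
        then have "0 \<le> t (inv_into UNIV \<pi> (\<pi> i))" using a by auto
        then show "0 \<le> t i" using permutes_inverses(2)[OF \<pi>(1)] by simp
      qed
    qed (use in_m in auto)
    have "(\<Sum>i<?m. ?\<phi> t i *\<^sub>R es' ! i) = (\<Sum>i<?m. t (inv_into UNIV \<pi> i) *\<^sub>R es' ! i)" by (rule sum.cong) auto
    also have "\<dots> = (\<Sum>i<?m. t (inv_into UNIV \<pi> (\<pi> i)) *\<^sub>R es' ! \<pi> i)"
      using sum.permute[OF \<pi>(1), of "\<lambda>i. t (inv_into UNIV \<pi> i) *\<^sub>R es' ! i"] by (simp add: o_def)
    also have "\<dots> = (\<Sum>i<?m. t i *\<^sub>R es ! i)"
      using permutes_inverses(2)[OF \<pi>(1)] permute_list_nth[OF \<pi>(1)] \<pi>(2) by (intro sum.cong) auto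
    finally show "?g (?\<phi> t) = indicator (std_simplex_set ?m) t *\<^sub>R f (affine_param p es t)"
      using 1 2 by (simp add: affine_param_def std_simplex_set_def indicator_def len)
  qed
  also have "\<dots> = simplex_integral p es f"
    by (simp add: simplex_integral_def set_lebesgue_integral_def len)
  finally show ?thesis by simp
qed

text \<open>Fubini with the last coordinate innermost; for fixed other coordinates it runs from 0 to
  one minus their sum.\<close>

lemma simplex_integral_snoc:
  assumes "continuous_on UNIV f"
  shows "simplex_integral p (es @ [v]) f = (LINT t:std_simplex_set (length es)|cube_measure (length es).
    (\<integral>y. f (affine_param p es t + y *\<^sub>R v) * indicator {0..1 - (\<Sum>i<length es. t i)} y \<partial>lborel))"
proof -
  let ?m = "length es"
  let ?g = "\<lambda>t. indicator (std_simplex_set (Suc ?m)) t *\<^sub>R f (affine_param p (es @ [v]) t)"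
  have "continuous_on (convex hull (insert p ((+) p ` set (es @ [v])))) f"
    using assms continuous_on_subset by blast
  from integrable_simplex_continuous[OF this]
  have int: "integrable (Pi\<^sub>M (insert ?m {..<?m}) (\<lambda>_. lborel)) ?g"
    by (simp add: set_integrable_def lessThan_Suc)
  have "simplex_integral p (es @ [v]) f = (\<integral>t. ?g t \<partial>Pi\<^sub>M (insert ?m {..<?m}) (\<lambda>_. lborel))"
    by (simp add: simplex_integral_def set_lebesgue_integral_def lessThan_Suc)
  also have "\<dots> = (\<integral>t. (\<integral>y. ?g (t(?m := y)) \<partial>lborel) \<partial>cube_measure ?m)"
    by (rule cube.product_integral_insert[OF _ _ int]) auto
  also have "\<dots> = (\<integral>t. indicator (std_simplex_set ?m) t *\<^sub>R
      (\<integral>y. f (affine_param p es t + y *\<^sub>R v) * indicator {0..1 - (\<Sum>i<?m. t i)} y \<partial>lborel) \<partial>cube_measure ?m)"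
  proof (rule Bochner_Integration.integral_cong[OF refl])
    fix t :: "nat \<Rightarrow> real"
    have "?g (t(?m := y)) = indicator (std_simplex_set ?m) t *
        (f (affine_param p es t + y *\<^sub>R v) * indicator {0..1 - (\<Sum>i<?m. t i)} y)" for y
    proof -
      have "affine_param p (es @ [v]) (t(?m := y)) = affine_param p es t + y *\<^sub>R v"
        by (simp add: affine_param_def nth_append add.assoc cong: sum.cong_simp)
      moreover have "t(?m := y) \<in> std_simplex_set (Suc ?m) \<longleftrightarrow>
          t \<in> std_simplex_set ?m \<and> y \<in> {0..1 - (\<Sum>i<?m. t i)}"
        unfolding std_simplex_set_def by (auto simp: less_Suc_eq cong: sum.cong_simp)
      ultimately show ?thesis by (auto simp: indicator_def)
    qed
    then show "(\<integral>y. ?g (t(?m := y)) \<partial>lborel) = indicator (std_simplex_set ?m) t *\<^sub>R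
        (\<integral>y. f (affine_param p es t + y *\<^sub>R v) * indicator {0..1 - (\<Sum>i<?m. t i)} y \<partial>lborel)"
      by simp
  qed
  finally show ?thesis by (simp add: set_lebesgue_integral_def)
qed

lemma affine_param_last_vertex:
  "affine_param (p + v) (map (\<lambda>e. e - v) es) t = affine_param p es t + (1 - (\<Sum>i<length es. t i)) *\<^sub>R v"
  by (simp add: affine_param_def scaleR_right_diff_distrib sum_subtractf algebra_simps flip: scaleR_sum_left)

text \<open>Moving the base point to the end of the last edge reverses the innermost
  interval.\<close>

lemma simplex_integral_change_base:
  assumes "continuous_on UNIV f"
  shows "simplex_integral (p + v) (map (\<lambda>e. e - v) es @ [- v]) f = simplex_integral p (es @ [v]) f"
proof -
  have "(\<integral>y. f (affine_param (p + v) (map (\<lambda>e. e - v) es) t + y *\<^sub>R - v) *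
        indicator {0..1 - (\<Sum>i<length es. t i)} y \<partial>lborel) =
      (\<integral>y. f (affine_param p es t + y *\<^sub>R v) * indicator {0..1 - (\<Sum>i<length es. t i)} y \<partial>lborel)" for t
  proof -
    define L where "L = 1 - (\<Sum>i<length es. t i)"
    \<comment> \<open>The substitution of \<open>L - y\<close> for \<open>y\<close>.\<close>
    have "(\<integral>y. f (affine_param p es t + y *\<^sub>R v) * indicator {0..L} y \<partial>lborel) =
        (\<integral>y. f (affine_param p es t + (L + (-1) * y) *\<^sub>R v) * indicator {0..L} (L + (-1) * y) \<partial>lborel)"
      by (subst lborel_integral_real_affine[where t = L and c = "-1"]) auto
    also have "\<dots> = (\<integral>y. f (affine_param (p + v) (map (\<lambda>e. e - v) es) t + y *\<^sub>R - v) * indicator {0..L} y \<partial>lborel)"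
      by (intro Bochner_Integration.integral_cong)
        (auto simp: affine_param_last_vertex L_def[symmetric] indicator_def algebra_simps)
    finally show ?thesis by (simp add: L_def)
  qed
  then show ?thesis
    by (simp add: simplex_integral_snoc[OF assms])
qed

text \<open>The fundamental theorem of calculus for the innermost integral. The upper limit lies on
  the face opposite to \<open>p\<close>, parametrized from \<open>p + v\<close>, and the lower limit
  on the face spanned by \<open>p\<close> and \<open>es\<close>.\<close>

lemma simplex_integral_directional_derivative:
  assumes f: "smooth f"
  shows "simplex_integral p (es @ [v]) (\<lambda>x. frechet_derivative f (at x) v) =
    simplex_integral (p + v) (map (\<lambda>e. e - v) es) f - simplex_integral p es f"
proof -
  let ?m = "length es" let ?L = "\<lambda>t. 1 - (\<Sum>i<?m. t i)"
  let ?q = "affine_param p es"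
  have c: "continuous_on UNIV (\<lambda>x. frechet_derivative f (at x) v)"
    by (intro smooth_continuous_on smooth_frechet_derivative f)
  have inner: "(\<integral>y. frechet_derivative f (at (?q t + y *\<^sub>R v)) v * indicator {0..?L t} y \<partial>lborel) =
      f (?q t + ?L t *\<^sub>R v) - f (?q t)" if "t \<in> std_simplex_set ?m" for t
  proof -
    have "(\<integral>y. frechet_derivative f (at (?q t + y *\<^sub>R v)) v * indicator {0..?L t} y \<partial>lborel) =
        f (?q t + ?L t *\<^sub>R v) - f (?q t + 0 *\<^sub>R v)"
    proof (rule integral_FTC_Icc_real)
      show "0 \<le> ?L t" using that by (simp add: std_simplex_set_def)
      show "DERIV (\<lambda>y. f (?q t + y *\<^sub>R v)) y :> frechet_derivative f (at (?q t + y *\<^sub>R v)) v" for y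
        by (rule smooth_line_has_derivative[OF f])
      have "continuous_on UNIV (\<lambda>y. frechet_derivative f (at (?q t + y *\<^sub>R v)) v)"
        by (rule continuous_on_compose2[OF c]) (auto intro!: continuous_intros)
      then show "isCont (\<lambda>y. frechet_derivative f (at (?q t + y *\<^sub>R v)) v) y" for y
        by (simp add: continuous_on_eq_continuous_at)
    qed
    then show ?thesis by simp
  qed
  have "simplex_integral p (es @ [v]) (\<lambda>x. frechet_derivative f (at x) v) =
      (LINT t:std_simplex_set ?m|cube_measure ?m. f (affine_param (p + v) (map (\<lambda>e. e - v) es) t) - f (?q t))"
    unfolding simplex_integral_snoc[OF c] set_lebesgue_integral_def
  proof (intro Bochner_Integration.integral_cong refl)
    fix t :: "nat \<Rightarrow> real"
    show "indicator (std_simplex_set ?m) t *\<^sub>R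
        (\<integral>y. frechet_derivative f (at (?q t + y *\<^sub>R v)) v * indicator {0..?L t} y \<partial>lborel) =
      indicator (std_simplex_set ?m) t *\<^sub>R (f (affine_param (p + v) (map (\<lambda>e. e - v) es) t) - f (?q t))"
      by (cases "t \<in> std_simplex_set ?m") (simp_all only: inner affine_param_last_vertex indicator_simps scaleR_zero_left simp_thms)
  qed
  also have "\<dots> = simplex_integral (p + v) (map (\<lambda>e. e - v) es) f - simplex_integral p es f"
    unfolding simplex_integral_def length_map
    by (rule set_integral_diff(2))
      (use integrable_simplex_continuous[of "p + v" "map (\<lambda>e. e - v) es" f]
        integrable_simplex_continuous[of p es f] smooth_continuous_on[OF f] in auto)
  finally show ?thesis .
qed


section \<open>Stokes' theorem\<close>

definition edge_list :: "'a::euclidean_space list \<Rightarrow> 'a list"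
  where "edge_list vs = map (\<lambda>v. v - hd vs) (tl vs)"

lemma edge_list_Cons: "edge_list (p # ps) = map (\<lambda>v. v - p) ps"
  by (simp add: edge_list_def)

lemma edges_eq_edge_list: "edges T = edge_list (verts T)"
  by (simp add: edges_def edge_list_def)

text \<open>An unsigned integral, hence independent of the order of the vertices; the sign of a
  reordering appears only in the value of a form on the edges.\<close>

definition vertex_integral :: "'a::euclidean_space list \<Rightarrow> ('a \<Rightarrow> real) \<Rightarrow> real"
  where "vertex_integral vs f = simplex_integral (hd vs) (edge_list vs) f"

lemma vertex_integral_Cons: "vertex_integral (p # ps) f = simplex_integral p (map (\<lambda>v. v - p) ps) f"
  by (simp add: vertex_integral_def edge_list_def)

text \<open>Permuting the edges fixes the first vertex, and a change of base exchanges the first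
  vertex with the last; together these give all reorderings.\<close>

lemma vertex_integral_mset:
  assumes "mset vs = mset vs'" and f: "continuous_on UNIV f"
  shows "vertex_integral vs f = vertex_integral vs' f"
proof (cases vs)
  case Nil
  then show ?thesis using assms by simp
next
  case (Cons p ps)
  have same: "vertex_integral (q # as) f = vertex_integral (q # bs) f" if "mset as = mset bs" for q as bs
    unfolding vertex_integral_Cons using that f by (intro simplex_integral_mset) auto
  have swap: "vertex_integral (q # as @ [r]) f = vertex_integral (r # as @ [q]) f" for q r as
  proof -
    have "map (\<lambda>e. e - (r - q)) (map (\<lambda>v. v - q) as) @ [- (r - q)] = map (\<lambda>v. v - r) (as @ [q])"
      "q + (r - q) = r" "map (\<lambda>v. v - q) as @ [r - q] = map (\<lambda>v. v - q) (as @ [r])" by simp_all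
    then show ?thesis
      using simplex_integral_change_base[OF f, of q "r - q" "map (\<lambda>v. v - q) as"]
      unfolding vertex_integral_Cons by (simp only:)
  qed
  have "length vs' = Suc (length ps)" using mset_eq_length[OF assms(1)] Cons by simp
  then obtain q qs where q: "vs' = q # qs" by (cases vs') simp_all
  show ?thesis
  proof (cases "p = q")
    case True
    with assms(1) have "mset ps = mset qs" by (simp add: Cons q)
    then show ?thesis unfolding Cons q True by (rule same)
  next
    case False
    have "q \<in> set (p # ps)" using mset_eq_setD[OF assms(1)] by (simp add: Cons q)
    then have "q \<in> set ps" using False by simp
    then obtain as bs where ps: "ps = as @ q # bs" by (meson split_list)
    have "vertex_integral vs f = vertex_integral (p # (as @ bs) @ [q]) f"
      unfolding Cons by (rule same) (simp add: ps)
    also have "\<dots> = vertex_integral (q # (as @ bs) @ [p]) f" by (rule swap)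
    also have "\<dots> = vertex_integral vs' f"
      unfolding q by (rule same) (use assms(1) Cons q ps in \<open>simp add: add_mset_commute\<close>)
    finally show ?thesis .
  qed
qed

text \<open>The factor is the same for all alternating maps, which later makes the constants in
  Stokes' theorem independent of the form.\<close>

lemma edge_list_sign:
  assumes "mset vs = mset vs'"
  shows "\<exists>\<epsilon>::real. \<epsilon> \<noteq> 0 \<and> (\<forall>\<alpha>. alternating k \<alpha> \<longrightarrow> \<alpha> (edge_list vs') = \<epsilon> * \<alpha> (edge_list vs))"
proof -
  \<comment> \<open>The value 0 on other maps makes the exchange rule hold at every argument of the
    function \<open>\<Phi> vs\<close>.\<close>
  define \<Phi> :: "'a list \<Rightarrow> ('a list \<Rightarrow> real) \<Rightarrow> real"
    where "\<Phi> vs = (\<lambda>\<alpha>. if alternating k \<alpha> then \<alpha> (edge_list vs) else 0)" for vs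
  have "\<Phi> vs' = \<Phi> vs \<or> \<Phi> vs' = - \<Phi> vs"
    using assms
  proof (rule mset_eq_sign[rotated])
    fix xs a b ys
    have "\<alpha> (edge_list (xs @ b # a # ys)) = - \<alpha> (edge_list (xs @ a # b # ys))"
      if alt: "alternating k \<alpha>" for \<alpha> :: "'a list \<Rightarrow> real"
    proof (cases xs)
      case Nil
      \<comment> \<open>Exchanging the first two vertices shifts the remaining edges by
        \<open>a - b\<close>, which is invisible beside the edge \<open>a - b\<close>
        itself.\<close>
      have "\<alpha> ([] @ (a - b) # [] @ map (\<lambda>u. u - (a - b)) (map (\<lambda>v. v - b) ys)) =
          \<alpha> ([] @ (a - b) # [] @ map (\<lambda>v. v - b) ys)"
        by (rule alternating_Cons_diff[OF alt])
      then have "\<alpha> ((a - b) # map (\<lambda>v. v - b) ys) = \<alpha> ((a - b) # map (\<lambda>v. v - a) ys)"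
        by (simp add: o_def)
      also have "\<dots> = - \<alpha> ((b - a) # map (\<lambda>v. v - a) ys)"
        using linear_neg[OF alternating_linear_Cons[OF alt], of "b - a" "map (\<lambda>v. v - a) ys"] by simp
      finally show ?thesis using Nil by (simp add: edge_list_Cons)
    next
      case (Cons x xs')
      then show ?thesis
        using alternating_swap[OF alt, of "map (\<lambda>v. v - x) xs'" "b - x" "a - x"]
        by (simp add: edge_list_Cons)
    qed
    then show "\<Phi> (xs @ b # a # ys) = - \<Phi> (xs @ a # b # ys)"
      by (auto simp: \<Phi>_def fun_eq_iff)
  qed
  then show ?thesis
  proof
    assume eq: "\<Phi> vs' = \<Phi> vs"
    have "\<alpha> (edge_list vs') = 1 * \<alpha> (edge_list vs)" if "alternating k \<alpha>" for \<alpha>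
      using fun_cong[OF eq, of \<alpha>] that by (simp add: \<Phi>_def)
    then show ?thesis by (intro exI[of _ 1]) simp
  next
    assume eq: "\<Phi> vs' = - \<Phi> vs"
    have "\<alpha> (edge_list vs') = (-1) * \<alpha> (edge_list vs)" if "alternating k \<alpha>" for \<alpha>
      using fun_cong[OF eq, of \<alpha>] that by (simp add: \<Phi>_def)
    then show ?thesis by (intro exI[of _ "-1"]) simp
  qed
qed

text \<open>
  Each term of the exterior derivative is integrated along its edge: this gives the value on the
  face opposite to \<open>p\<close>, parametrized from the endpoint of the edge, and on a face through \<open>p\<close>.
\<close>

lemma vertex_integral_ambient_deriv:
  assumes w: "\<omega> \<in> ambient_forms k" and ps: "ps \<noteq> []"
  shows "vertex_integral (p # ps) (\<lambda>x. ambient_deriv \<omega> x (edge_list (p # ps))) =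
    vertex_integral ps (\<lambda>x. \<omega> x (edge_list ps)) -
    (\<Sum>i<length ps. (-1) ^ i * vertex_integral (p # remove_nth i ps) (\<lambda>x. \<omega> x (edge_list (p # remove_nth i ps))))"
proof -
  define es where "es = edge_list (p # ps)"
  define h where "h i x = \<omega> x (remove_nth i es)" for i x
  let ?m = "length ps"
  have es: "es = map (\<lambda>v. v - p) ps" "length es = ?m" by (simp_all add: es_def edge_list_Cons)
  have h: "smooth (h i)" for i unfolding h_def by (rule ambient_formsD(2)[OF w])
  have re: "remove_nth i es = edge_list (p # remove_nth i ps)" for i
    by (simp add: es edge_list_Cons map_remove_nth)
  have cont: "continuous_on S (h i)" "continuous_on S (\<lambda>x. frechet_derivative (h i) (at x) v)" for i v S
    by (intro smooth_continuous_on smooth_frechet_derivative h)+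
  have term_eq: "simplex_integral p es (\<lambda>x. frechet_derivative (h i) (at x) (es ! i)) =
      vertex_integral ps (h i) - vertex_integral (p # remove_nth i ps) (h i)" if i: "i < ?m" for i
  proof -
    obtain as bs where s: "ps = as @ ps ! i # bs" "length as = i" "remove_nth i ps = as @ bs"
      using remove_nth_split[OF i] .
    let ?q = "ps ! i"
    have ei: "es ! i = ?q - p" "remove_nth i es = map (\<lambda>v. v - p) (as @ bs)"
      using i s(3) by (simp_all add: es flip: map_remove_nth)
    have "mset es = mset (map (\<lambda>v. v - p) (as @ bs) @ [?q - p])"
      unfolding es(1) by (subst s(1)) simp
    then have "simplex_integral p es (\<lambda>x. frechet_derivative (h i) (at x) (es ! i)) =
        simplex_integral p (map (\<lambda>v. v - p) (as @ bs) @ [?q - p]) (\<lambda>x. frechet_derivative (h i) (at x) (?q - p))"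
      unfolding ei(1) by (rule simplex_integral_mset) (rule cont)
    also have "\<dots> = simplex_integral ?q (map (\<lambda>v. v - ?q) (as @ bs)) (h i) -
        simplex_integral p (map (\<lambda>v. v - p) (as @ bs)) (h i)"
    proof -
      have "map (\<lambda>e. e - (?q - p)) (map (\<lambda>v. v - p) (as @ bs)) = map (\<lambda>v. v - ?q) (as @ bs)"
        "p + (?q - p) = ?q" by simp_all
      then show ?thesis
        using simplex_integral_directional_derivative[OF h[of i], where p = p
            and es = "map (\<lambda>v. v - p) (as @ bs)" and v = "?q - p"]
        by (simp only:)
    qed
    also have "simplex_integral ?q (map (\<lambda>v. v - ?q) (as @ bs)) (h i) = vertex_integral (?q # as @ bs) (h i)"
      by (simp only: vertex_integral_Cons)
    also have "\<dots> = vertex_integral ps (h i)"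
      by (rule vertex_integral_mset[OF _ cont(1)]) (subst (2) s(1), simp)
    also have "simplex_integral p (map (\<lambda>v. v - p) (as @ bs)) (h i) = vertex_integral (p # remove_nth i ps) (h i)"
      by (simp only: vertex_integral_Cons s(3))
    finally show ?thesis .
  qed
  have "vertex_integral (p # ps) (\<lambda>x. ambient_deriv \<omega> x es) =
      simplex_integral p es (\<lambda>x. \<Sum>i<?m. (-1) ^ i * frechet_derivative (h i) (at x) (es ! i))"
    by (simp add: vertex_integral_Cons es ambient_deriv_def alternate_def h_def[abs_def])
  also have "\<dots> = (\<Sum>i<?m. simplex_integral p es (\<lambda>x. (-1) ^ i * frechet_derivative (h i) (at x) (es ! i)))"
    by (rule simplex_integral_sum[OF compact_edge_hull _ _ affine_param_in_hull])
      (auto intro!: continuous_intros cont)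
  also have "\<dots> = (\<Sum>i<?m. (-1) ^ i * (vertex_integral ps (h i) - vertex_integral (p # remove_nth i ps) (h i)))"
    by (intro sum.cong refl) (simp add: simplex_integral_cmult term_eq)
  also have "\<dots> = (\<Sum>i<?m. vertex_integral ps (\<lambda>x. (-1) ^ i * h i x)) -
      (\<Sum>i<?m. (-1) ^ i * vertex_integral (p # remove_nth i ps) (h i))"
    by (simp add: right_diff_distrib sum_subtractf vertex_integral_def simplex_integral_cmult)
  also have "(\<Sum>i<?m. vertex_integral ps (\<lambda>x. (-1) ^ i * h i x)) =
      vertex_integral ps (\<lambda>x. \<Sum>i<?m. (-1) ^ i * h i x)"
    unfolding vertex_integral_def
    by (rule simplex_integral_sum[OF compact_edge_hull _ _ affine_param_in_hull, symmetric])
      (auto intro!: continuous_intros cont)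
  \<comment> \<open>All terms on the opposite face combine to the form evaluated on the edges of
    that face, since these are differences of edges from \<open>p\<close>.\<close>
  also have "(\<lambda>x. \<Sum>i<?m. (-1) ^ i * h i x) = (\<lambda>x. \<omega> x (edge_list ps))"
  proof
    fix x
    obtain q qs where q: "ps = q # qs" using ps by (cases ps) auto
    let ?us = "map (\<lambda>v. v - p) qs"
    have "edge_list ps = map (\<lambda>u. u - (q - p)) ?us" by (simp add: q edge_list_Cons o_def)
    then have "\<omega> x (edge_list ps) = \<omega> x ?us -
        (\<Sum>j<length ?us. (-1) ^ j * \<omega> x ((q - p) # remove_nth j ?us))"
      using alternating_map_diff[OF ambient_formsD(1)[OF w], of x "[]" "q - p" ?us] by simp
    also have "\<dots> = (\<Sum>i<?m. (-1) ^ i * h i x)"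
      by (simp add: h_def es q sum.lessThan_Suc_shift sum_negf del: sum.lessThan_Suc)
    finally show "(\<Sum>i<?m. (-1) ^ i * h i x) = \<omega> x (edge_list ps)" by simp
  qed
  finally show ?thesis unfolding es_def[symmetric] re[symmetric] h_def .
qed

lemma form_integral_eq:
  "form_integral ori T \<omega> = ori T * vertex_integral (verts T) (\<lambda>x. \<omega> x (edges T))"
  by (simp add: form_integral_def coord_integral_eq vertex_integral_def edges_eq_edge_list)

lemma affine_param_in_simplex:
  assumes T: "is_simplex T" and t: "t \<in> std_simplex_set (length (edges T))"
  shows "affine_param (hd (verts T)) (edges T) t \<in> T"
proof -
  have "insert (hd (verts T)) ((+) (hd (verts T)) ` set (edges T)) = vertices T"
    using verts(5)[OF T] unfolding verts(2)[OF T, symmetric]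
    by (cases "verts T") (auto simp: edges_def image_image)
  then show ?thesis using affine_param_in_hull[OF t] is_simplexE(4)[OF T] by metis
qed

lemma edges_tangent: "is_simplex T \<Longrightarrow> set (edges T) \<subseteq> tangent_space T"
  using tangent_space_eq_span_edges span_superset by blast

lemma form_integral_pullback:
  assumes "is_simplex T"
  shows "form_integral ori T (pullback T \<omega>) = ori T * vertex_integral (verts T) (\<lambda>x. \<omega> x (edges T))"
  unfolding form_integral_eq vertex_integral_def edges_eq_edge_list[symmetric]
  using affine_param_in_simplex[OF assms] edges_tangent[OF assms]
  by (intro arg_cong2[where f = "(*)"] simplex_integral_cong refl) (simp add: pullback_def)

text \<open>Compares the vertex order inherited from the larger simplex with the reference order and
  orientation of the facet.\<close>

lemma facet_integral:
  assumes G: "is_simplex G" and ori: "ori G \<noteq> 0" and us: "distinct us" "set us = vertices G"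
  shows "\<exists>c. c \<noteq> 0 \<and> (\<forall>\<omega>\<in>ambient_forms k.
    vertex_integral us (\<lambda>x. \<omega> x (edge_list us)) = c * form_integral ori G (pullback G \<omega>))"
proof -
  have m: "mset (verts G) = mset us"
    using verts[OF G] us by (metis set_eq_iff_mset_eq_distinct)
  obtain \<epsilon> :: real where e: "\<epsilon> \<noteq> 0"
    "\<And>\<alpha>. alternating k \<alpha> \<Longrightarrow> \<alpha> (edge_list us) = \<epsilon> * \<alpha> (edge_list (verts G))"
    using edge_list_sign[OF m, where k = k] by blast
  have "vertex_integral us (\<lambda>x. \<omega> x (edge_list us)) = (\<epsilon> / ori G) * form_integral ori G (pullback G \<omega>)"
    if w: "\<omega> \<in> ambient_forms k" for \<omega>
  proof -
    have "vertex_integral us (\<lambda>x. \<omega> x (edge_list us)) = vertex_integral us (\<lambda>x. \<epsilon> * \<omega> x (edges G))"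
      by (simp add: e(2)[OF ambient_formsD(1)[OF w]] edges_eq_edge_list)
    also have "\<dots> = \<epsilon> * vertex_integral us (\<lambda>x. \<omega> x (edges G))"
      by (simp add: vertex_integral_def simplex_integral_cmult)
    also have "vertex_integral us (\<lambda>x. \<omega> x (edges G)) = vertex_integral (verts G) (\<lambda>x. \<omega> x (edges G))"
      by (rule vertex_integral_mset[OF m[symmetric] smooth_continuous_on[OF ambient_formsD(2)[OF w]]])
    finally show ?thesis using ori by (simp add: form_integral_pullback[OF G])
  qed
  then show ?thesis using e(1) ori by (intro exI[of _ "\<epsilon> / ori G"]) simp
qed

lemma set_remove_nth_distinct: "distinct xs \<Longrightarrow> i < length xs \<Longrightarrow> set (remove_nth i xs) = set xs - {xs ! i}"
  by (rule remove_nth_split[of i xs]) (assumption, metis Diff_insert_absorb Un_iff distinct_append insert_absorb set_append list.simps(15) Un_insert_right disjoint_iff not_distinct_conv_prefix distinct.simps(2))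

lemma distinct_remove_nth: "distinct xs \<Longrightarrow> distinct (remove_nth i xs)"
  by (auto simp: remove_nth_def distinct_append dest: in_set_takeD in_set_dropD
      set_take_disj_set_drop_if_distinct[of xs i "Suc i"])

text \<open>The coefficients stand for the incidence signs. What counts is that they are nonzero and
  chosen before \<omega>: if all facet integrals but one vanish, the integral of the derivative
  decides whether the last one vanishes.\<close>

lemma stokes:
  assumes T: "is_simplex T" and dim: "1 \<le> aff_dim T" and ori: "\<And>G. G \<in> subsimplices T \<Longrightarrow> ori G \<noteq> 0"
  obtains \<epsilon> :: "nat \<Rightarrow> real" where "\<And>i. i < length (verts T) \<Longrightarrow> \<epsilon> i \<noteq> 0"
    "\<And>\<omega>. \<omega> \<in> smooth_forms k T \<Longrightarrow> form_integral ori T (ext_deriv T \<omega>) =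
      (\<Sum>i<length (verts T). \<epsilon> i * form_integral ori (convex hull (vertices T - {verts T ! i}))
        (pullback (convex hull (vertices T - {verts T ! i})) \<omega>))"
proof -
  obtain p ps where ps: "verts T = p # ps" using verts(5)[OF T] by (cases "verts T") auto
  have ne: "ps \<noteq> []" using verts(4)[OF T] dim ps by auto
  let ?vs = "verts T" and ?n = "length (verts T)"
  define G where "G i = convex hull (vertices T - {?vs ! i})" for i
  have G: "is_simplex (G i)" "G i \<in> subsimplices T" "vertices (G i) = vertices T - {?vs ! i}" for i
  proof -
    have "card (vertices T) \<ge> 2" using verts(3,4)[OF T] dim by simp
    moreover have "card (vertices T) \<le> card {?vs ! i}" if "vertices T - {?vs ! i} = {}"
      using that by (intro card_mono) auto
    ultimately have "vertices T - {?vs ! i} \<noteq> {}" by auto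
    from convex_hull_in_subsimplices[OF T _ this]
    show "is_simplex (G i)" "G i \<in> subsimplices T" "vertices (G i) = vertices T - {?vs ! i}"
      unfolding G_def by auto
  qed
  have "\<exists>c. c \<noteq> 0 \<and> (\<forall>\<omega>\<in>ambient_forms k. vertex_integral (remove_nth i ?vs)
      (\<lambda>x. \<omega> x (edge_list (remove_nth i ?vs))) = c * form_integral ori (G i) (pullback (G i) \<omega>))"
    if i: "i < ?n" for i
  proof -
    have "set (remove_nth i ?vs) = vertices (G i)"
      unfolding G(3) verts(2)[OF T, symmetric] by (rule set_remove_nth_distinct[OF verts(1)[OF T] i])
    from facet_integral[where ori = ori and k = k,
        OF G(1)[of i] ori[OF G(2)[of i]] distinct_remove_nth[OF verts(1)[OF T]] this]
    show ?thesis .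
  qed
  then have "\<forall>i\<in>{..<?n}. \<exists>c. c \<noteq> 0 \<and> (\<forall>\<omega>\<in>ambient_forms k. vertex_integral (remove_nth i ?vs)
      (\<lambda>x. \<omega> x (edge_list (remove_nth i ?vs))) = c * form_integral ori (G i) (pullback (G i) \<omega>))"
    by simp
  from bchoice[OF this] obtain c where c: "\<And>i. i < ?n \<Longrightarrow> c i \<noteq> (0::real)"
    "\<And>i \<omega>. i < ?n \<Longrightarrow> \<omega> \<in> ambient_forms k \<Longrightarrow> vertex_integral (remove_nth i ?vs)
      (\<lambda>x. \<omega> x (edge_list (remove_nth i ?vs))) = c i * form_integral ori (G i) (pullback (G i) \<omega>)"
    by auto
  define \<epsilon> where "\<epsilon> i = ori T * (-1) ^ i * c i" for i
  have "form_integral ori T (ext_deriv T \<omega>) = (\<Sum>i<?n. \<epsilon> i * form_integral ori (G i) (pullback (G i) \<omega>))"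
    if w: "\<omega> \<in> smooth_forms k T" for \<omega>
  proof -
    obtain \<omega>' where w': "\<omega>' \<in> ambient_forms k" "\<omega> = pullback T \<omega>'" using w by (rule smooth_formsE)
    have "form_integral ori T (ext_deriv T \<omega>) = ori T * vertex_integral ?vs (\<lambda>x. ambient_deriv \<omega>' x (edges T))"
      by (simp only: w'(2) ext_deriv_pullback[OF is_simplex_convex[OF T] w'(1)] form_integral_pullback[OF T])
    also have "\<dots> = ori T * (vertex_integral (remove_nth 0 ?vs) (\<lambda>x. \<omega>' x (edge_list (remove_nth 0 ?vs))) -
        (\<Sum>i<length ps. (-1) ^ i * vertex_integral (remove_nth (Suc i) ?vs) (\<lambda>x. \<omega>' x (edge_list (remove_nth (Suc i) ?vs)))))"
      using vertex_integral_ambient_deriv[OF w'(1) ne, of p] by (simp add: ps edges_eq_edge_list)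
    also have "\<dots> = ori T * (c 0 * form_integral ori (G 0) (pullback (G 0) \<omega>') -
        (\<Sum>i<length ps. (-1) ^ i * (c (Suc i) * form_integral ori (G (Suc i)) (pullback (G (Suc i)) \<omega>'))))"
    proof -
      have "(\<Sum>i<length ps. (-1) ^ i * vertex_integral (remove_nth (Suc i) ?vs) (\<lambda>x. \<omega>' x (edge_list (remove_nth (Suc i) ?vs)))) =
          (\<Sum>i<length ps. (-1) ^ i * (c (Suc i) * form_integral ori (G (Suc i)) (pullback (G (Suc i)) \<omega>')))"
        by (intro sum.cong refl arg_cong2[where f = "(*)"] c(2) w'(1)) (simp add: ps)
      moreover have "0 < ?n" by (simp add: ps)
      ultimately show ?thesis by (simp only: c(2)[OF _ w'(1)])
    qed
    also have "\<dots> = (\<Sum>i<?n. \<epsilon> i * form_integral ori (G i) (pullback (G i) \<omega>'))"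
      by (simp add: ps sum.lessThan_Suc_shift \<epsilon>_def sum_distrib_left sum_negf algebra_simps del: sum.lessThan_Suc)
    finally show ?thesis
      unfolding w'(2) by (simp add: pullback_pullback[OF subsimplices_subset[OF G(2)]])
  qed
  moreover have "\<epsilon> i \<noteq> 0" if "i < ?n" for i
    using c(1)[OF that] ori[OF self_in_subsimplices[OF T]] by (simp add: \<epsilon>_def)
  ultimately show ?thesis using that[of \<epsilon>] unfolding G_def by blast
qed


section \<open>Exactness of the bubble complex for trimmed forms\<close>

lemma linear_expand:
  fixes f :: "'a::euclidean_space \<Rightarrow> real"
  assumes "linear f"
  shows "f u = (\<Sum>b\<in>Basis. (u \<bullet> b) * f b)"
proof -
  have "f u = f (\<Sum>b\<in>Basis. (u \<bullet> b) *\<^sub>R b)" by (simp only: euclidean_representation)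
  also have "\<dots> = (\<Sum>b\<in>Basis. (u \<bullet> b) * f b)"
    by (simp add: linear_sum[OF assms] linear_scale[OF assms])
  finally show ?thesis .
qed

lemma linear_frechet_derivative_slot:
  assumes w: "\<omega> \<in> ambient_forms k"
  shows "linear (\<lambda>v. frechet_derivative (\<lambda>y. \<omega> y (v # us)) (at x) u)"
proof (rule linearI)
  note l = alternating_linear_Cons[OF ambient_formsD(1)[OF w]]
  note d = smooth_differentiable[OF ambient_formsD(2)[OF w]]
  show "frechet_derivative (\<lambda>y. \<omega> y ((v + v') # us)) (at x) u =
      frechet_derivative (\<lambda>y. \<omega> y (v # us)) (at x) u + frechet_derivative (\<lambda>y. \<omega> y (v' # us)) (at x) u" for v v'
    by (simp add: linear_add[OF l] frechet_derivative_add d)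
  show "frechet_derivative (\<lambda>y. \<omega> y ((c *\<^sub>R v) # us)) (at x) u =
      c *\<^sub>R frechet_derivative (\<lambda>y. \<omega> y (v # us)) (at x) u" for c v
    by (simp add: linear_scale[OF l] frechet_derivative_cmult d)
qed

text \<open>In standard coordinates the point-dependent argument \<open>x - p\<close> becomes affine
  coefficients of constant arguments, which makes smoothness and the product rule available.\<close>

lemma contract_eq_sum:
  assumes w: "\<omega> \<in> ambient_forms k"
  shows "contract p \<omega> y us = (\<Sum>b\<in>Basis. (b \<bullet> y + - (b \<bullet> p)) * \<omega> y (b # us))"
  unfolding contract_def
  by (subst linear_expand[OF alternating_linear_Cons[OF ambient_formsD(1)[OF w]]])
    (simp add: inner_commute[of "y - p"] inner_diff_right)

lemma contract_ambient_forms: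
  assumes w: "\<omega> \<in> ambient_forms k"
  shows "contract p \<omega> \<in> ambient_forms (k - 1)"
proof -
  have "smooth (\<lambda>y. contract p \<omega> y us)" for us
    unfolding contract_eq_sum[OF w]
    by (intro smooth_sum smooth_mult smooth_affine ambient_formsD(2)[OF w])
  moreover have "alternating (k - 1) (contract p \<omega> x)" for x
    unfolding contract_def by (rule alternating_Cons[OF ambient_formsD(1)[OF w]])
  ultimately show ?thesis by (simp add: ambient_forms_def)
qed

text \<open>The second summand arises because the vector field \<open>x - p\<close> has the identity
  as its derivative.\<close>

lemma frechet_derivative_contract:
  assumes w: "\<omega> \<in> ambient_forms k"
  shows "frechet_derivative (\<lambda>y. contract p \<omega> y us) (at x) v =
    frechet_derivative (\<lambda>y. \<omega> y ((x - p) # us)) (at x) v + \<omega> x (v # us)"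
proof -
  let ?D = "\<lambda>b v. frechet_derivative (\<lambda>y. \<omega> y (b # us)) (at x) v"
  have "((\<lambda>y. (b \<bullet> y + - (b \<bullet> p)) * \<omega> y (b # us)) has_derivative
      (\<lambda>v. (b \<bullet> x + - (b \<bullet> p)) * ?D b v + (b \<bullet> v) * \<omega> x (b # us))) (at x)" for b
    by (rule has_derivative_mult[OF _ smooth_has_derivative[OF ambient_formsD(2)[OF w]]])
      (auto intro!: derivative_eq_intros)
  then have "((\<lambda>y. contract p \<omega> y us) has_derivative
      (\<lambda>v. \<Sum>b\<in>Basis. (b \<bullet> x + - (b \<bullet> p)) * ?D b v + (b \<bullet> v) * \<omega> x (b # us))) (at x)"
    unfolding contract_eq_sum[OF w] by (intro has_derivative_sum)
  then have "frechet_derivative (\<lambda>y. contract p \<omega> y us) (at x) v =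
      (\<Sum>b\<in>Basis. (b \<bullet> x + - (b \<bullet> p)) * ?D b v + (b \<bullet> v) * \<omega> x (b # us))"
    by (simp flip: frechet_derivative_at)
  also have "\<dots> = (\<Sum>b\<in>Basis. ((x - p) \<bullet> b) * ?D b v) + (\<Sum>b\<in>Basis. (v \<bullet> b) * \<omega> x (b # us))"
    by (simp add: sum.distrib inner_commute[of "x - p"] inner_commute[of v] inner_diff_right)
  also have "\<dots> = ?D (x - p) v + \<omega> x (v # us)"
    by (simp only: linear_expand[OF linear_frechet_derivative_slot[OF w], symmetric]
        linear_expand[OF alternating_linear_Cons[OF ambient_formsD(1)[OF w]], symmetric])
  finally show ?thesis .
qed

text \<open>Cartan's formula for the Lie derivative along \<open>x - p\<close>.\<close>

lemma ambient_deriv_contract: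
  assumes w: "\<omega> \<in> ambient_forms k"
  shows "ambient_deriv (contract p \<omega>) x vs + contract p (ambient_deriv \<omega>) x vs =
    frechet_derivative (\<lambda>y. \<omega> y vs) (at x) (x - p) + real (length vs) * \<omega> x vs"
proof -
  let ?D = "\<lambda>us u. frechet_derivative (\<lambda>y. \<omega> y us) (at x) u"
  let ?S = "\<Sum>i<length vs. (-1) ^ i * ?D ((x - p) # remove_nth i vs) (vs ! i)"
  have "ambient_deriv (contract p \<omega>) x vs =
      ?S + (\<Sum>i<length vs. (-1) ^ i * \<omega> x (vs ! i # remove_nth i vs))"
    by (simp add: ambient_deriv_def alternate_def frechet_derivative_contract[OF w] distrib_left sum.distrib)
  also have "(\<Sum>i<length vs. (-1) ^ i * \<omega> x (vs ! i # remove_nth i vs)) = (\<Sum>i<length vs. \<omega> x vs)"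
    by (intro sum.cong refl)
      (simp add: alternating_move_front[OF ambient_formsD(1)[OF w]] flip: mult.assoc power_add)
  finally have "ambient_deriv (contract p \<omega>) x vs = ?S + real (length vs) * \<omega> x vs" by simp
  \<comment> \<open>Differentiating along \<open>x - p\<close> itself gives the first term; the
    remaining terms cancel \<open>?S\<close>.\<close>
  moreover have "contract p (ambient_deriv \<omega>) x vs = ?D vs (x - p) - ?S"
    by (simp add: contract_def ambient_deriv_def alternate_def sum.lessThan_Suc_shift sum_negf
        del: sum.lessThan_Suc)
  ultimately show ?thesis by simp
qed

text \<open>
  Along the ray from \<open>p\<close> through \<open>x\<close>, the function \<open>t\<^sup>k \<omega>(p + t (x - p))\<close> has derivative zero.
\<close>

lemma closed_contract_closed_imp_eq_0:
  assumes T: "convex T" "p \<in> T" and k: "0 < k" and w: "\<omega> \<in> smooth_forms k T"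
    and closed: "ext_deriv T \<omega> = 0" "ext_deriv T (pullback T (contract p \<omega>)) = 0"
  shows "\<omega> = 0"
proof -
  obtain \<omega>' where w': "\<omega>' \<in> ambient_forms k" "\<omega> = pullback T \<omega>'" using w by (rule smooth_formsE)
  have c1: "pullback T (ambient_deriv \<omega>') = 0"
    using closed(1) ext_deriv_pullback[OF T(1) w'(1)] w'(2) by simp
  have c2: "pullback T (ambient_deriv (contract p \<omega>')) = 0"
    using closed(2) ext_deriv_pullback[OF T(1) contract_ambient_forms[OF w'(1)], of p]
      pullback_contract_pullback[OF subset_refl T(2), of \<omega>'] w'(2) by simp
  have "\<omega>' x vs = 0" if x: "x \<in> T" and vs: "set vs \<subseteq> tangent_space T" for x vs
  proof (cases "int (length vs) = k")
    case False
    then show ?thesis using alternating_length[OF ambient_formsD(1)[OF w'(1)]] by blast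
  next
    case True
    define n where "n = length vs"
    have n: "n > 0" using True k unfolding n_def by linarith
    let ?y = "\<lambda>t. p + t *\<^sub>R (x - p)"
    let ?D = "\<lambda>t. frechet_derivative (\<lambda>y. \<omega>' y vs) (at (?y t))"
    let ?\<phi> = "\<lambda>t. t ^ n * \<omega>' (?y t) vs"
    have yT: "?y t \<in> T" if "0 \<le> t" "t \<le> 1" for t
      using convexD_alt[OF T(1) T(2) x, of t] that by (simp add: algebra_simps)
    note sm = ambient_formsD(2)[OF w'(1)]
    have der: "DERIV ?\<phi> t :> real n * t ^ (n - 1) * \<omega>' (?y t) vs + ?D t (x - p) * t ^ n" for t
      using DERIV_mult[OF DERIV_pow[of n t] smooth_line_has_derivative[OF sm[of vs],
          where a = p and v = "x - p" and t = t and S = UNIV]]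
      by (simp add: mult_ac)
    have "?\<phi> 1 = ?\<phi> 0"
    proof (rule DERIV_isconst_end[where f = ?\<phi> and a = 0 and b = 1])
      show "continuous_on {0..1} ?\<phi>"
        using der DERIV_continuous_on has_field_derivative_at_within by (intro DERIV_continuous_on) blast
      fix t :: real assume t: "0 < t" "t < 1"
      have y: "?y t \<in> T" using yT t by simp
      have tan: "?y t - p \<in> tangent_space T" by (rule tangent_space_diff[OF y T(2)])
      have "ambient_deriv (contract p \<omega>') (?y t) vs = 0" by (rule pullback_eq_0D[OF c2 y vs])
      moreover have "contract p (ambient_deriv \<omega>') (?y t) vs = 0"
        unfolding contract_def by (rule pullback_eq_0D[OF c1 y]) (use tan vs in auto)
      ultimately have "?D t (?y t - p) + real n * \<omega>' (?y t) vs = 0"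
        using ambient_deriv_contract[OF w'(1), of p "?y t" vs] by (simp add: n_def)
      moreover have "?D t (?y t - p) = t * ?D t (x - p)"
        using linear_scale[OF linear_frechet_derivative[OF smooth_differentiable[OF sm]]] by simp
      ultimately have "t ^ (n - 1) * (t * ?D t (x - p) + real n * \<omega>' (?y t) vs) = 0" by simp
      moreover have "t ^ n = t ^ (n - 1) * t" using n by (cases n) auto
      ultimately have "real n * t ^ (n - 1) * \<omega>' (?y t) vs + ?D t (x - p) * t ^ n = 0"
        by (simp add: algebra_simps)
      then show "DERIV ?\<phi> t :> 0" using der[of t] by simp
    qed simp
    \<comment> \<open>As \<open>n\<close> is positive, the function vanishes at 0, while its value
      at 1 is \<open>\<omega>' x vs\<close>.\<close>
    then show ?thesis using n by (simp add: power_0_left)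
  qed
  then show ?thesis unfolding w'(2) by (simp add: pullback_eq_0_iff)
qed

text \<open>Degree 0, where the factor \<open>t ^ k\<close> no longer forces the value at the start
  of the ray to vanish, so that value is assumed to be zero.\<close>

lemma closed_0_form_constant:
  assumes T: "convex T" "p \<in> T" and w: "\<omega> \<in> smooth_forms 0 T" and closed: "ext_deriv T \<omega> = 0"
    and 0: "\<omega> p [] = 0"
  shows "\<omega> = 0"
proof -
  obtain \<omega>' where w': "\<omega>' \<in> ambient_forms 0" "\<omega> = pullback T \<omega>'" using w by (rule smooth_formsE)
  have c: "pullback T (ambient_deriv \<omega>') = 0"
    using closed ext_deriv_pullback[OF T(1) w'(1)] w'(2) by simp
  have "\<omega>' x vs = 0" if x: "x \<in> T" for x vs
  proof (cases "vs = []")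
    case False
    then show ?thesis using alternating_length[OF ambient_formsD(1)[OF w'(1)]] by simp
  next
    case True
    let ?y = "\<lambda>t. p + t *\<^sub>R (x - p)"
    note sm = ambient_formsD(2)[OF w'(1)]
    have der: "DERIV (\<lambda>t. \<omega>' (?y t) []) t :> frechet_derivative (\<lambda>y. \<omega>' y []) (at (?y t)) (x - p)" for t
      by (rule smooth_line_has_derivative[OF sm])
    have "\<omega>' (?y 1) [] = \<omega>' (?y 0) []"
    proof (rule DERIV_isconst_end[where f = "\<lambda>t. \<omega>' (?y t) []" and a = 0 and b = 1])
      show "continuous_on {0..1} (\<lambda>t. \<omega>' (?y t) [])"
        using der DERIV_continuous_on has_field_derivative_at_within by (intro DERIV_continuous_on) blast
      fix t :: real assume t: "0 < t" "t < 1"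
      have "?y t \<in> T" using convexD_alt[OF T(1) T(2) x, of t] t by (simp add: algebra_simps)
      then have "ambient_deriv \<omega>' (?y t) [x - p] = 0"
        by (rule pullback_eq_0D[OF c]) (use tangent_space_diff[OF x T(2)] in simp)
      then show "DERIV (\<lambda>t. \<omega>' (?y t) []) t :> 0"
        using der[of t] by (simp add: ambient_deriv_def alternate_def)
    qed simp
    moreover have "\<omega>' p [] = 0" using 0 T(2) by (simp add: w'(2) pullback_def)
    ultimately show ?thesis using True by simp
  qed
  then show ?thesis unfolding w'(2) by (simp add: pullback_eq_0_iff)
qed

lemma simplex_integral_1: "simplex_integral p es (\<lambda>_. 1) \<noteq> 0"
proof
  assume 0: "simplex_integral p es (\<lambda>_. 1) = 0"
  have "(\<lambda>_. 0) \<in> std_simplex_set (length es)" by (simp add: std_simplex_set_def)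
  from simplex_integral_eq_0_imp[OF compact_edge_hull continuous_on_const affine_param_in_hull _ 0 this]
  show False by simp
qed

lemma form_integral_0: "form_integral ori T 0 = 0"
  by (simp add: form_integral_eq vertex_integral_def simplex_integral_0)

text \<open>Vanishing of an integral is insensitive to the orientation, so the constant orientation
  is used. The degree varies in the induction, because the correction on the facet needs exactness
  one degree lower.\<close>

lemma trimmed_bubble_exact:
  assumes "is_simplex T" "\<eta> \<in> trimmed_poly_forms r k T"
    and "\<And>F. F \<in> subsimplices T \<Longrightarrow> F \<noteq> T \<Longrightarrow> pullback F \<eta> = 0"
    and "ext_deriv T \<eta> = 0" "k = aff_dim T \<Longrightarrow> form_integral (\<lambda>_. 1) T \<eta> = 0"
  shows "\<exists>\<rho>\<in>trimmed_poly_forms r (k - 1) T.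
    (\<forall>F\<in>subsimplices T - {T}. pullback F \<rho> = 0) \<and> ext_deriv T \<rho> = \<eta>"
  using assms
proof (induction "card (vertices T)" arbitrary: T k \<eta> rule: less_induct)
  case less
  note T = less.prems(1) and \<eta> = less.prems(2) and bubble = less.prems(3) and closed = less.prems(4)
  have conv: "convex T" by (rule is_simplex_convex[OF T])
  define p where "p = verts T ! 0"
  have p: "p \<in> vertices T" using verts(2,5)[OF T] unfolding p_def by (metis length_greater_0_conv nth_mem)
  then have pT: "p \<in> T" using vertices_subset by blast
  have \<eta>s: "\<eta> \<in> smooth_forms k T" by (rule subsetD[OF trimmed_poly_forms_smooth[OF T] \<eta>])
  show ?case
  proof (cases "\<eta> = 0")
    case True
    then show ?thesis
      using subspace_0[OF subspace_trimmed_poly_forms, of r "k - 1" T] pullback_0 ext_deriv_0[OF conv]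
      by (intro bexI[of _ 0]) auto
  next
    case False
    have "0 \<le> k \<and> k \<le> aff_dim T"
      using smooth_forms_eq_0_dimension[OF T \<eta>s] False by force
    \<comment> \<open>A closed 0-form is constant. It vanishes at \<open>p\<close> by the trace on
      that vertex or, if \<open>T\<close> is a point, by the integral condition.\<close>
    moreover have "k \<noteq> 0"
    proof
      assume "k = 0"
      have "\<eta> p [] = 0"
      proof (cases "aff_dim T = 0")
        case True
        then have "verts T = [p]" using verts(4)[OF T] unfolding p_def by (cases "verts T") auto
        then have "form_integral (\<lambda>_. 1) T \<eta> = simplex_integral p [] (\<lambda>x. \<eta> x [])"
          by (simp add: form_integral_eq vertex_integral_def edges_eq_edge_list edge_list_def)
        also have "\<dots> = simplex_integral p [] (\<lambda>x. \<eta> p [] * 1)"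
          by (rule simplex_integral_cong) (simp add: affine_param_def)
        also have "\<dots> = \<eta> p [] * simplex_integral p [] (\<lambda>_. 1)" by (rule simplex_integral_cmult)
        finally show ?thesis using less.prems(5) True \<open>k = 0\<close> simplex_integral_1[of p "[]"] by simp
      next
        case False
        have "{p} \<in> subsimplices T" using convex_hull_in_subsimplices(1)[OF T, of "{p}"] p by simp
        moreover have "{p} \<noteq> T" using False by auto
        ultimately have "pullback {p} \<eta> = 0" by (rule bubble)
        then show ?thesis by (rule pullback_eq_0D) auto
      qed
      then have "\<eta> = 0" using closed_0_form_constant[OF conv pT _ closed] \<eta>s \<open>k = 0\<close> by simp
      then show False using \<open>\<eta> \<noteq> 0\<close> by simp
    qed
    ultimately have k: "0 < k" "k \<le> aff_dim T" by auto
    \<comment> \<open>Nothing is required on the facet opposite to \<open>p\<close>: contraction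
      would not preserve a vanishing trace there, whereas these conditions are preserved by d
      \<kappa>.\<close>
    define Z where "Z = {\<omega> \<in> trimmed_poly_forms r k T. ext_deriv T \<omega> = 0 \<and>
      (\<forall>H\<in>subsimplices T - {T}. p \<in> H \<longrightarrow> pullback H \<omega> = 0)}"
    define \<kappa> where "\<kappa> \<omega> = pullback T (contract p \<omega>)" for \<omega> :: "'a form"
    have \<kappa>_lin: "\<kappa> (x + y) = \<kappa> x + \<kappa> y" "\<kappa> (c *\<^sub>R x) = c *\<^sub>R \<kappa> x" for x y c
      by (simp_all only: \<kappa>_def linear_add[OF linear_contract] linear_scale[OF linear_contract]
          pullback_add pullback_scaleR)
    have \<kappa>: "\<kappa> \<omega> \<in> trimmed_poly_forms r (k - 1) T" if "\<omega> \<in> trimmed_poly_forms r k T" for \<omega>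
      unfolding \<kappa>_def by (rule contract_trimmed_poly_forms[OF T pT that])
    have \<kappa>s: "\<kappa> \<omega> \<in> smooth_forms (k - 1) T" if "\<omega> \<in> trimmed_poly_forms r k T" for \<omega>
      by (rule subsetD[OF trimmed_poly_forms_smooth[OF T] \<kappa>[OF that]])
    have Zs: "\<omega> \<in> smooth_forms k T" if "\<omega> \<in> Z" for \<omega>
      using that subsetD[OF trimmed_poly_forms_smooth[OF T, of r k]] by (simp add: Z_def)
    have \<kappa>_trace: "pullback H (\<kappa> \<omega>) = 0"
      if w: "\<omega> \<in> Z" and H: "H \<in> subsimplices T" "H \<noteq> T" "p \<in> H" for \<omega> H
    proof -
      have "pullback H (\<kappa> \<omega>) = pullback H (contract p \<omega>)"
        unfolding \<kappa>_def by (rule pullback_pullback[OF subsimplices_subset[OF H(1)]])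
      also have "\<dots> = pullback H (contract p (pullback H \<omega>))"
        by (rule pullback_contract_pullback[OF subset_refl H(3), symmetric])
      also have "pullback H \<omega> = 0" using w H by (simp add: Z_def)
      finally show ?thesis by (simp only: linear_0[OF linear_contract] pullback_0)
    qed
    have d_trace: "pullback H (ext_deriv T \<omega>) = 0"
      if "\<omega> \<in> smooth_forms j T" "H \<in> subsimplices T" "pullback H \<omega> = 0" for \<omega> H j
    proof -
      have H: "convex H" using that(2) T is_simplex_convex subsimplices_iff by blast
      show ?thesis
        using pullback_ext_deriv[OF conv H subsimplices_subset[OF that(2)] that(1)] that(3)
        by (simp only: ext_deriv_0[OF H])
    qed
    have sub: "subspace Z"
    proof (rule subspaceI)
      show "0 \<in> Z" using subspace_0[OF subspace_trimmed_poly_forms, of r k T]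
        unfolding Z_def by (simp only: mem_Collect_eq ext_deriv_0[OF conv] pullback_0) simp
      show "x + y \<in> Z" if "x \<in> Z" "y \<in> Z" for x y
      proof -
        have "x + y \<in> trimmed_poly_forms r k T"
          using that by (intro subspace_add[OF subspace_trimmed_poly_forms]) (auto simp: Z_def)
        moreover have "ext_deriv T (x + y) = 0"
          using ext_deriv_add[OF conv Zs[OF that(1)] Zs[OF that(2)]] that by (simp add: Z_def)
        ultimately show ?thesis using that by (simp add: Z_def pullback_add)
      qed
      show "c *\<^sub>R x \<in> Z" if "x \<in> Z" for c x
      proof -
        have "c *\<^sub>R x \<in> trimmed_poly_forms r k T"
          using that by (intro subspace_scale[OF subspace_trimmed_poly_forms]) (auto simp: Z_def)
        moreover have "ext_deriv T (c *\<^sub>R x) = 0"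
          using ext_deriv_scaleR[OF conv Zs[OF that]] that by (simp add: Z_def)
        ultimately show ?thesis using that by (simp add: Z_def pullback_scaleR)
      qed
    qed
    obtain X where X: "finite X" "trimmed_poly_forms r k T \<subseteq> span X"
      using trimmed_poly_forms_finite_dimensional[OF T] by blast
    have "\<eta> \<in> Z" using \<eta> closed bubble by (auto simp: Z_def)
    \<comment> \<open>If \<open>ext_deriv T (\<kappa> x) = 0\<close>, both \<open>x\<close> and its
      contraction are closed, so \<open>x = 0\<close>; surjectivity onto the finite-dimensional
      \<open>Z\<close> follows.\<close>
    have "\<exists>\<zeta>\<in>Z. ext_deriv T (\<kappa> \<zeta>) = \<eta>"
    proof (rule injective_on_finite_dimensional_imp_surjective[OF sub X(1),
          where f = "\<lambda>x. ext_deriv T (\<kappa> x)" and y = \<eta>])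
      show "Z \<subseteq> span X" using X(2) by (auto simp: Z_def)
      show "\<eta> \<in> Z" by fact
      show "ext_deriv T (\<kappa> (x + y)) = ext_deriv T (\<kappa> x) + ext_deriv T (\<kappa> y)" if "x \<in> Z" "y \<in> Z" for x y
        unfolding \<kappa>_lin by (rule ext_deriv_add[OF conv \<kappa>s \<kappa>s]) (use that in \<open>auto simp: Z_def\<close>)
      show "ext_deriv T (\<kappa> (c *\<^sub>R x)) = c *\<^sub>R ext_deriv T (\<kappa> x)" if "x \<in> Z" for c x
        unfolding \<kappa>_lin by (rule ext_deriv_scaleR[OF conv \<kappa>s]) (use that in \<open>auto simp: Z_def\<close>)
      show "x = 0" if "x \<in> Z" "ext_deriv T (\<kappa> x) = 0" for x
        by (rule closed_contract_closed_imp_eq_0[OF conv pT k(1) Zs[OF that(1)]])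
          (use that in \<open>auto simp: Z_def \<kappa>_def\<close>)
      show "ext_deriv T (\<kappa> x) \<in> Z" if x: "x \<in> Z" for x
      proof -
        have x': "x \<in> trimmed_poly_forms r k T" using x by (simp add: Z_def)
        have "ext_deriv T (\<kappa> x) \<in> trimmed_poly_forms r k T"
          using ext_deriv_trimmed_poly_forms[OF T \<kappa>[OF x']] by simp
        moreover have "ext_deriv T (ext_deriv T (\<kappa> x)) = 0"
          by (rule ext_deriv_ext_deriv[OF conv \<kappa>s[OF x']])
        ultimately show ?thesis
          using d_trace[OF \<kappa>s[OF x']] \<kappa>_trace[OF x] by (simp add: Z_def)
      qed
    qed blast
    then obtain \<zeta> where \<zeta>: "\<zeta> \<in> Z" "ext_deriv T (\<kappa> \<zeta>) = \<eta>" by blast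
    define \<rho> where "\<rho> = \<kappa> \<zeta>"
    have \<rho>: "\<rho> \<in> trimmed_poly_forms r (k - 1) T" "\<rho> \<in> smooth_forms (k - 1) T"
      unfolding \<rho>_def using \<kappa> \<kappa>s \<zeta>(1) by (auto simp: Z_def)
    have \<rho>_trace: "pullback H \<rho> = 0" if "H \<in> subsimplices T" "H \<noteq> T" "p \<in> H" for H
      unfolding \<rho>_def by (rule \<kappa>_trace[OF \<zeta>(1) that])
    define V where "V = vertices T - {p}"
    define F where "F = convex hull V"
    have V: "V \<noteq> {}"
    proof
      assume "V = {}"
      then have "card (vertices T) \<le> card {p}" by (intro card_mono) (auto simp: V_def)
      then show False using is_simplexE(5)[OF T] k by simp
    qed
    have F: "F \<in> subsimplices T" "is_simplex F" "vertices F = V"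
      unfolding F_def using convex_hull_in_subsimplices[OF T _ V] by (auto simp: V_def)
    have cardF: "card (vertices F) < card (vertices T)"
      unfolding F(3) V_def by (rule card_Diff1_less[OF is_simplexE(1)[OF T] p])
    have dimF: "aff_dim F = aff_dim T - 1"
    proof -
      have "card (vertices T) = Suc (card V)"
        unfolding V_def using card_Suc_Diff1[OF is_simplexE(1)[OF T] p] by simp
      then show ?thesis using is_simplexE(5)[OF T] is_simplexE(5)[OF F(2)] unfolding F(3) by simp
    qed
    have convF: "convex F" by (rule is_simplex_convex[OF F(2)])
    define \<tau> where "\<tau> = pullback F \<rho>"
    have "\<exists>\<sigma>\<in>trimmed_poly_forms r (k - 1 - 1) F.
        (\<forall>G\<in>subsimplices F - {F}. pullback G \<sigma> = 0) \<and> ext_deriv F \<sigma> = \<tau>"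
    proof (rule less.hyps[OF cardF F(2)])
      show "\<tau> \<in> trimmed_poly_forms r (k - 1) F"
        unfolding \<tau>_def by (rule pullback_trimmed_poly_forms[OF T F(1) \<rho>(1)])
      have "ext_deriv F \<tau> = pullback F \<eta>"
        unfolding \<tau>_def
        using pullback_ext_deriv[OF conv convF subsimplices_subset[OF F(1)] \<rho>(2)] \<zeta>(2) \<rho>_def by simp
      moreover have "F \<noteq> T" using dimF by auto
      ultimately show "ext_deriv F \<tau> = 0" using bubble[OF F(1)] by simp
      show "pullback G \<tau> = 0" if G: "G \<in> subsimplices F" "G \<noteq> F" for G
      proof -
        have G': "is_simplex G" "vertices G \<subseteq> V" using G(1) F by (auto simp: subsimplices_iff)
        \<comment> \<open>The join of \<open>G\<close> with \<open>p\<close> is a proper face of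
          \<open>T\<close> through \<open>p\<close>; \<rho> vanishes on it and hence on
          \<open>G\<close>.\<close>
        define H where "H = convex hull (insert p (vertices G))"
        have sub: "insert p (vertices G) \<subseteq> vertices T" using G'(2) p by (auto simp: V_def)
        have H: "H \<in> subsimplices T" "vertices H = insert p (vertices G)"
          unfolding H_def using convex_hull_in_subsimplices[OF T sub] by auto
        have "p \<in> H" unfolding H_def by (rule hull_inc) simp
        moreover have "H \<noteq> T"
        proof
          assume "H = T"
          then have "insert p (vertices G) = vertices T" using H(2) by simp
          moreover have "p \<notin> vertices G" using G'(2) by (auto simp: V_def)
          ultimately have "vertices G = V" unfolding V_def by blast
          then show False using is_simplex_eqI[OF G'(1) F(2)] F(3) G(2) by simp
        qed
        ultimately have 0: "pullback H \<rho> = 0" using \<rho>_trace H(1) by blast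
        have GH: "G \<subseteq> H"
          using hull_mono[of "vertices G" "insert p (vertices G)"] is_simplexE(4)[OF G'(1)] unfolding H_def by blast
        have "pullback G \<tau> = pullback G \<rho>"
          unfolding \<tau>_def by (rule pullback_pullback[OF subsimplices_subset[OF G(1)]])
        also have "\<dots> = pullback G (pullback H \<rho>)" by (rule pullback_pullback[OF GH, symmetric])
        finally show ?thesis by (simp only: 0 pullback_0)
      qed
      \<comment> \<open>In top degree, Stokes' theorem applied to \<rho> leaves only the term of
        \<open>F\<close>, since every other facet contains \<open>p\<close>. The integral of \<eta>
        is zero and the coefficient is not.\<close>
      show "form_integral (\<lambda>_. 1) F \<tau> = 0" if top: "k - 1 = aff_dim F"
      proof -
        have dim: "1 \<le> aff_dim T" using k by simp
        obtain \<epsilon> :: "nat \<Rightarrow> real" where \<epsilon>: "\<And>i. i < length (verts T) \<Longrightarrow> \<epsilon> i \<noteq> 0"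
          "\<And>\<omega>. \<omega> \<in> smooth_forms (k - 1) T \<Longrightarrow> form_integral (\<lambda>_. 1) T (ext_deriv T \<omega>) =
            (\<Sum>i<length (verts T). \<epsilon> i * form_integral (\<lambda>_. 1) (convex hull (vertices T - {verts T ! i}))
              (pullback (convex hull (vertices T - {verts T ! i})) \<omega>))"
          by (rule stokes[OF T dim, where ori = "\<lambda>_. 1" and k = "k - 1"]) (simp, blast)
        let ?G = "\<lambda>i. convex hull (vertices T - {verts T ! i})"
        have n: "0 < length (verts T)" using verts(5)[OF T] by simp
        have z: "pullback (?G i) \<rho> = 0" if i: "i < length (verts T)" "i \<noteq> 0" for i
        proof (rule \<rho>_trace)
          have "verts T ! i \<noteq> p" unfolding p_def using i n nth_eq_iff_index_eq[OF verts(1)[OF T]] by blast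
          then have "p \<in> vertices T - {verts T ! i}" using p by blast
          then show "p \<in> ?G i" by (rule hull_inc)
          have "?G i \<in> subsimplices T \<and> vertices (?G i) = vertices T - {verts T ! i}"
            using \<open>p \<in> vertices T - {verts T ! i}\<close> convex_hull_in_subsimplices[OF T, of "vertices T - {verts T ! i}"] by blast
          then show "?G i \<in> subsimplices T" "?G i \<noteq> T"
            using verts(2)[OF T] nth_mem[OF i(1)] by auto
        qed
        have "form_integral (\<lambda>_. 1) T \<eta> = (\<Sum>i<length (verts T). \<epsilon> i * form_integral (\<lambda>_. 1) (?G i) (pullback (?G i) \<rho>))"
          using \<epsilon>(2)[OF \<rho>(2)] \<zeta>(2) \<rho>_def by simp
        also have "\<dots> = (\<Sum>i\<in>{0}. \<epsilon> i * form_integral (\<lambda>_. 1) (?G i) (pullback (?G i) \<rho>))"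
        proof (rule sum.mono_neutral_right)
          show "\<forall>i\<in>{..<length (verts T)} - {0}. \<epsilon> i * form_integral (\<lambda>_. 1) (?G i) (pullback (?G i) \<rho>) = 0"
          proof
            fix i assume "i \<in> {..<length (verts T)} - {0}"
            then have "pullback (?G i) \<rho> = 0" using z by blast
            then show "\<epsilon> i * form_integral (\<lambda>_. 1) (?G i) (pullback (?G i) \<rho>) = 0"
              by (simp only: form_integral_0 mult_zero_right)
          qed
        qed (use n in auto)
        also have "\<dots> = \<epsilon> 0 * form_integral (\<lambda>_. 1) F \<tau>"
          by (simp add: F_def V_def \<tau>_def p_def)
        finally show ?thesis
          using less.prems(5) top dimF \<epsilon>(1)[OF n] by simp
      qed
    qed
    then obtain \<sigma> where \<sigma>: "\<sigma> \<in> trimmed_poly_forms r (k - 1 - 1) F"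
      "\<And>G. G \<in> subsimplices F \<Longrightarrow> G \<noteq> F \<Longrightarrow> pullback G \<sigma> = 0" "ext_deriv F \<sigma> = \<tau>" by blast
    \<comment> \<open>Subtracting the derivative of \<sigma>' cancels the trace on \<open>F\<close>
      without changing the derivative of \<rho> or the zero traces on the proper faces through
      \<open>p\<close>.\<close>
    obtain \<sigma>' where \<sigma>': "\<sigma>' \<in> trimmed_poly_forms r (k - 1 - 1) T" "pullback F \<sigma>' = \<sigma>"
      "\<And>H. H \<in> subsimplices T \<Longrightarrow> H \<noteq> T \<Longrightarrow> p \<in> H \<Longrightarrow> pullback H \<sigma>' = 0"
      using extend_trimmed_bubble[OF T p V[unfolded V_def] F_def[unfolded V_def] \<sigma>(1) \<sigma>(2)] by blast
    have \<sigma>'s: "\<sigma>' \<in> smooth_forms (k - 1 - 1) T" by (rule subsetD[OF trimmed_poly_forms_smooth[OF T] \<sigma>'(1)])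
    have d\<sigma>': "ext_deriv T \<sigma>' \<in> trimmed_poly_forms r (k - 1) T" "ext_deriv T \<sigma>' \<in> smooth_forms (k - 1) T"
      using ext_deriv_trimmed_poly_forms[OF T \<sigma>'(1)] ext_deriv_smooth_forms[OF conv \<sigma>'s] by simp_all
    show ?thesis
    proof (intro bexI conjI ballI)
      show "\<rho> - ext_deriv T \<sigma>' \<in> trimmed_poly_forms r (k - 1) T"
        by (rule subspace_diff[OF subspace_trimmed_poly_forms \<rho>(1) d\<sigma>'(1)])
      show "ext_deriv T (\<rho> - ext_deriv T \<sigma>') = \<eta>"
        using ext_deriv_diff[OF conv \<rho>(2) d\<sigma>'(2)] ext_deriv_ext_deriv[OF conv \<sigma>'s] \<zeta>(2) \<rho>_def by simp
      fix H assume "H \<in> subsimplices T - {T}"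
      then have H: "H \<in> subsimplices T" "H \<noteq> T" by auto
      show "pullback H (\<rho> - ext_deriv T \<sigma>') = 0"
      proof (cases "p \<in> H")
        case True
        then show ?thesis
          unfolding pullback_diff using \<rho>_trace[OF H] d_trace[OF \<sigma>'s H(1) \<sigma>'(3)[OF H]] by simp
      next
        case False
        have H': "is_simplex H" "vertices H \<subseteq> vertices T" using H(1) T by (auto simp: subsimplices_iff)
        \<comment> \<open>A face that avoids \<open>p\<close> is contained in the opposite
          facet.\<close>
        then have "vertices H \<subseteq> V" using False vertices_subset[of H] by (auto simp: V_def)
        then have "H \<in> subsimplices F" using H'(1) F by (simp add: subsimplices_iff)
        then have HF: "H \<subseteq> F" by (rule subsimplices_subset)
        have "pullback F (\<rho> - ext_deriv T \<sigma>') = \<tau> - ext_deriv F (pullback F \<sigma>')"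
          unfolding pullback_diff \<tau>_def
          by (simp only: pullback_ext_deriv[OF conv convF subsimplices_subset[OF F(1)] \<sigma>'s])
        also have "\<dots> = 0" unfolding \<sigma>'(2) \<sigma>(3) by simp
        finally have "pullback H (pullback F (\<rho> - ext_deriv T \<sigma>')) = 0" by (simp only: pullback_0)
        then show ?thesis by (simp only: pullback_pullback[OF HF])
      qed
    qed
  qed
qed


section \<open>Bases of the tangent space and sums over index lists\<close>

section \<open>Orthonormal frames\<close>

lemma edges_independent:
  assumes T: "is_simplex T"
  shows "distinct (edges T)" "independent (set (edges T))"
proof -
  obtain p ps where ps: "verts T = p # ps" using verts(5)[OF T] by (cases "verts T") auto
  have d: "distinct (p # ps)" and V: "set (p # ps) = vertices T" using verts[OF T] ps by auto
  have e: "edges T = map (\<lambda>v. v - p) ps" by (simp add: edges_def ps)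
  show "distinct (edges T)" using d by (simp add: e distinct_map inj_on_def)
  have "p \<in> vertices T" using V by auto
  moreover have "vertices T - {p} = set ps" using V d by auto
  ultimately have "\<not> dependent ((\<lambda>x. - p + x) ` set ps)"
    using affine_dependent_iff_dependent[of p "set ps"] is_simplexE(3)[OF T] d V[symmetric] by simp
  then show "independent (set (edges T))" by (simp add: e)
qed

lemma dim_tangent_space:
  assumes T: "is_simplex T"
  shows "dim (tangent_space T) = length (edges T)"
  using edges_independent[OF T] tangent_space_eq_span_edges[OF T]
  by (metis dim_span dim_eq_card_independent distinct_card)

lemma affine_param_surj:
  assumes T: "is_simplex T" and x: "x \<in> T"
  obtains t where "t \<in> std_simplex_set (length (edges T))" "x = affine_param (hd (verts T)) (edges T) t"
proof -
  obtain p ps where ps: "verts T = p # ps" using verts(5)[OF T] by (cases "verts T") auto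
  have d: "distinct (p # ps)" and V: "set (p # ps) = vertices T" using verts[OF T] ps by auto
  have "x \<in> convex hull (set (p # ps))" using x is_simplexE(4)[OF T] V by simp
  then obtain u where u: "\<And>v. v \<in> set (p # ps) \<Longrightarrow> 0 \<le> u v" "sum u (set (p # ps)) = 1"
    "(\<Sum>v\<in>set (p # ps). u v *\<^sub>R v) = x"
    by (auto simp: convex_hull_finite)
  have bij: "bij_betw ((!) ps) {..<length ps} (set ps)" using d by (intro bij_betw_nth) auto
  define t where "t i = u (ps ! i)" for i
  have s: "(\<Sum>i<length ps. t i) = 1 - u p"
    using u(2) d sum.reindex_bij_betw[OF bij, of u] by (simp add: t_def)
  have S: "(\<Sum>i<length ps. t i *\<^sub>R ps ! i) = x - u p *\<^sub>R p"
    using u(3) d sum.reindex_bij_betw[OF bij, of "\<lambda>v. u v *\<^sub>R v"] by (simp add: t_def algebra_simps)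
  have "affine_param p (map (\<lambda>v. v - p) ps) t =
      p + ((\<Sum>i<length ps. t i *\<^sub>R ps ! i) - (\<Sum>i<length ps. t i) *\<^sub>R p)"
    by (simp add: affine_param_def scaleR_right_diff_distrib sum_subtractf flip: scaleR_sum_left)
  also have "\<dots> = x" unfolding S s by (simp add: algebra_simps)
  finally have "affine_param p (map (\<lambda>v. v - p) ps) t = x" .
  moreover have "t \<in> std_simplex_set (length ps)"
    using u(1) s by (auto simp: std_simplex_set_def t_def)
  ultimately show ?thesis using that[of t] by (simp add: ps edges_def)
qed

text \<open>Each increasing list of length \<open>k\<close> is the sorted form of
  \<open>fact k\<close> lists without repetitions. The sum over all lists can then be transformed
  one argument at a time.\<close>

lemma alternating_sum_lists:
  fixes \<alpha> \<beta> :: "'a::euclidean_space list \<Rightarrow> real"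
  assumes "alternating (int k) \<alpha>" "alternating (int k) \<beta>"
  shows "(\<Sum>l | set l \<subseteq> {..<n} \<and> length l = k. \<alpha> (map ((!) bs) l) * \<beta> (map ((!) bs) l)) =
    fact k * (\<Sum>\<sigma>\<in>increasing_lists n. \<alpha> (map ((!) bs) \<sigma>) * \<beta> (map ((!) bs) \<sigma>))"
proof -
  let ?f = "\<lambda>l. \<alpha> (map ((!) bs) l) * \<beta> (map ((!) bs) l)"
  let ?L = "{l. set l \<subseteq> {..<n} \<and> length l = k}"
  let ?D = "{l. set l \<subseteq> {..<n} \<and> length l = k \<and> distinct l}"
  let ?I = "{\<sigma> \<in> increasing_lists n. length \<sigma> = k}"
  have finL: "finite ?L" by (rule finite_lists_length_eq) simp
  have inc: "set \<sigma> \<subseteq> {..<n}" "distinct \<sigma>" "sorted \<sigma>" if "\<sigma> \<in> increasing_lists n" for \<sigma>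
    using that by (auto simp: increasing_lists_def strict_sorted_iff)
  have fin: "finite (increasing_lists n)"
    by (rule finite_subset[OF _ finite_subset_distinct[of "{..<n}"]]) (use inc in auto)
  have eq: "?f l' = ?f l" if "mset l = mset l'" for l l'
  proof -
    have m: "mset (map ((!) bs) l) = mset (map ((!) bs) l')" using that by simp
    \<comment> \<open>Pairing the two maps forces the same sign for both, so their product is
      unchanged.\<close>
    define \<Phi> where "\<Phi> vs = (\<lambda>b::bool. if b then \<alpha> vs else \<beta> vs)" for vs
    have "\<Phi> (map ((!) bs) l') = \<Phi> (map ((!) bs) l) \<or> \<Phi> (map ((!) bs) l') = - \<Phi> (map ((!) bs) l)"
    proof (rule mset_eq_sign[OF _ m])
      fix xs ys :: "'a list" and a b
      show "\<Phi> (xs @ b # a # ys) = - \<Phi> (xs @ a # b # ys)"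
        by (rule ext) (simp add: \<Phi>_def alternating_swap[OF assms(1), of xs b a ys]
            alternating_swap[OF assms(2), of xs b a ys])
    qed
    then show ?thesis
    proof
      assume e: "\<Phi> (map ((!) bs) l') = \<Phi> (map ((!) bs) l)"
      from fun_cong[OF e, of True] fun_cong[OF e, of False] show ?thesis by (simp add: \<Phi>_def)
    next
      assume e: "\<Phi> (map ((!) bs) l') = - \<Phi> (map ((!) bs) l)"
      from fun_cong[OF e, of True] fun_cong[OF e, of False] show ?thesis by (simp add: \<Phi>_def)
    qed
  qed
  have "(\<Sum>l\<in>?L. ?f l) = (\<Sum>l\<in>?D. ?f l)"
    using finL alternating_not_distinct[OF assms(1)]
    by (intro sum.mono_neutral_right) (auto simp: distinct_map)
  also have "\<dots> = (\<Sum>\<sigma>\<in>?I. \<Sum>l | l \<in> ?D \<and> sort l = \<sigma>. ?f l)"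
  proof (rule sum.group[symmetric])
    show "finite ?D" by (rule finite_subset[OF _ finL]) auto
    show "finite ?I" using fin by simp
    show "sort ` ?D \<subseteq> ?I" by (auto simp: increasing_lists_def strict_sorted_iff)
  qed
  also have "\<dots> = (\<Sum>\<sigma>\<in>?I. fact k * ?f \<sigma>)"
  proof (rule sum.cong[OF refl])
    fix \<sigma> assume \<sigma>: "\<sigma> \<in> ?I"
    note i = inc[of \<sigma>]
    have "{l. l \<in> ?D \<and> sort l = \<sigma>} = permutations_of_set (set \<sigma>)"
    proof (intro equalityI subsetI)
      fix l assume "l \<in> permutations_of_set (set \<sigma>)"
      then have l: "set l = set \<sigma>" "distinct l" by (auto simp: permutations_of_set_def)
      moreover from this have "sort l = \<sigma>"
        using i \<sigma> by (intro sorted_distinct_set_unique) auto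
      ultimately show "l \<in> {l. l \<in> ?D \<and> sort l = \<sigma>}" using i \<sigma> by (auto simp: distinct_card[symmetric])
    qed (auto simp: permutations_of_set_def)
    then have "(\<Sum>l | l \<in> ?D \<and> sort l = \<sigma>. ?f l) = (\<Sum>l\<in>permutations_of_set (set \<sigma>). ?f l)"
      by (simp only:)
    also have "\<dots> = (\<Sum>l\<in>permutations_of_set (set \<sigma>). ?f \<sigma>)"
      using i \<sigma> by (intro sum.cong refl eq) (auto simp: permutations_of_set_def set_eq_iff_mset_eq_distinct)
    also have "\<dots> = fact k * ?f \<sigma>" using i \<sigma> by (simp add: distinct_card)
    finally show "(\<Sum>l | l \<in> ?D \<and> sort l = \<sigma>. ?f l) = fact k * ?f \<sigma>" .
  qed
  also have "\<dots> = fact k * (\<Sum>\<sigma>\<in>?I. ?f \<sigma>)" by (simp add: sum_distrib_left)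
  also have "(\<Sum>\<sigma>\<in>?I. ?f \<sigma>) = (\<Sum>\<sigma>\<in>increasing_lists n. ?f \<sigma>)"
    using fin alternating_length[OF assms(1)] by (intro sum.mono_neutral_left) auto
  finally show ?thesis .
qed

lemma sum_lists_Suc:
  "(\<Sum>l | set l \<subseteq> {..<n::nat} \<and> length l = Suc k. f l) =
    (\<Sum>i<n. \<Sum>l | set l \<subseteq> {..<n} \<and> length l = k. f (i # l))"
proof -
  have "(\<Sum>i<n. \<Sum>l | set l \<subseteq> {..<n} \<and> length l = k. f (i # l)) =
      (\<Sum>(i, l)\<in>{..<n} \<times> {l. set l \<subseteq> {..<n} \<and> length l = k}. f (i # l))"
    by (simp add: sum.cartesian_product)
  also have "\<dots> = (\<Sum>l | set l \<subseteq> {..<n} \<and> length l = Suc k. f l)"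
    by (rule sum.reindex_bij_witness[of _ "\<lambda>l. (hd l, tl l)" "\<lambda>(i, l). i # l"])
      (auto simp: length_Suc_conv)
  finally show ?thesis by simp
qed

text \<open>The assumption treats a single argument; the induction exchanges the basis in the tail
  of the list and then at its head.\<close>

lemma sum_lists_basis_independent:
  fixes \<alpha> \<beta> :: "'a::euclidean_space list \<Rightarrow> real"
  assumes trace: "\<And>f f' :: 'a \<Rightarrow> real. linear f \<Longrightarrow> linear f' \<Longrightarrow>
      (\<Sum>i<n. f (bs ! i) * f' (bs ! i)) = (\<Sum>i<n. f (cs ! i) * f' (cs ! i))"
    and "alternating (int k) \<alpha>" "alternating (int k) \<beta>"
  shows "(\<Sum>l | set l \<subseteq> {..<n} \<and> length l = k. \<alpha> (map ((!) bs) l) * \<beta> (map ((!) bs) l)) =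
    (\<Sum>l | set l \<subseteq> {..<n} \<and> length l = k. \<alpha> (map ((!) cs) l) * \<beta> (map ((!) cs) l))"
  using assms(2,3)
proof (induction k arbitrary: \<alpha> \<beta>)
  case 0
  have "{l. set l \<subseteq> {..<n} \<and> length l = 0} = {[]}" by auto
  then show ?case by simp
next
  case (Suc k)
  let ?L = "{l. set l \<subseteq> {..<n} \<and> length l = k}"
  have alt: "alternating (int k) (\<lambda>vs. \<alpha> (u # vs))" "alternating (int k) (\<lambda>vs. \<beta> (u # vs))" for u
    using alternating_Cons[OF Suc.prems(1), of u] alternating_Cons[OF Suc.prems(2), of u] by simp_all
  have "(\<Sum>l | set l \<subseteq> {..<n} \<and> length l = Suc k. \<alpha> (map ((!) bs) l) * \<beta> (map ((!) bs) l)) =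
      (\<Sum>i<n. \<Sum>l\<in>?L. \<alpha> (bs ! i # map ((!) bs) l) * \<beta> (bs ! i # map ((!) bs) l))"
    by (subst sum_lists_Suc) simp
  also have "\<dots> = (\<Sum>i<n. \<Sum>l\<in>?L. \<alpha> (bs ! i # map ((!) cs) l) * \<beta> (bs ! i # map ((!) cs) l))"
    by (intro sum.cong refl Suc.IH[OF alt])
  also have "\<dots> = (\<Sum>l\<in>?L. \<Sum>i<n. \<alpha> (bs ! i # map ((!) cs) l) * \<beta> (bs ! i # map ((!) cs) l))"
    by (rule sum.swap)
  also have "\<dots> = (\<Sum>l\<in>?L. \<Sum>i<n. \<alpha> (cs ! i # map ((!) cs) l) * \<beta> (cs ! i # map ((!) cs) l))"
    by (intro sum.cong refl trace alternating_linear_Cons[OF Suc.prems(1)] alternating_linear_Cons[OF Suc.prems(2)])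
  also have "\<dots> = (\<Sum>i<n. \<Sum>l\<in>?L. \<alpha> (cs ! i # map ((!) cs) l) * \<beta> (cs ! i # map ((!) cs) l))"
    by (rule sum.swap)
  also have "\<dots> = (\<Sum>l | set l \<subseteq> {..<n} \<and> length l = Suc k. \<alpha> (map ((!) cs) l) * \<beta> (map ((!) cs) l))"
    by (subst sum_lists_Suc) simp
  finally show ?case .
qed

text \<open>The varying arguments are expanded one after another in the standard basis, which leaves
  continuous coefficients and constant arguments.\<close>

lemma ambient_forms_continuous_on_arguments:
  assumes w: "\<omega> \<in> ambient_forms k" and us: "\<And>u. u \<in> set us \<Longrightarrow> continuous_on S u"
  shows "continuous_on S (\<lambda>x. \<omega> x (map (\<lambda>u. u x) us))"
proof -
  have "continuous_on S (\<lambda>x. \<omega> x (pre @ map (\<lambda>u. u x) us))" for pre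
    using us
  proof (induction us arbitrary: pre)
    case Nil
    then show ?case using smooth_continuous_on[OF ambient_formsD(2)[OF w]] by simp
  next
    case (Cons u us)
    have "\<omega> x (pre @ map (\<lambda>u. u x) (u # us)) =
        (\<Sum>b\<in>Basis. (u x \<bullet> b) * \<omega> x ((pre @ [b]) @ map (\<lambda>u. u x) us))" for x
      using linear_expand[OF alternating_linear[OF ambient_formsD(1)[OF w, of x]],
          where xs1 = pre and ys1 = "map (\<lambda>u. u x) us" and u = "u x"] by simp
    moreover have "continuous_on S (\<lambda>x. \<Sum>b\<in>Basis. (u x \<bullet> b) * \<omega> x ((pre @ [b]) @ map (\<lambda>u. u x) us))"
      using Cons.prems by (intro continuous_intros Cons.IH) auto
    ultimately show ?case by simp
  qed
  from this[of "[]"] show ?thesis by simp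
qed


section \<open>Frames for a metric on one simplex\<close>

context
  fixes T :: "'a::euclidean_space set" and g :: "'a metric"
  assumes T: "is_simplex T" and g: "riemannian_metric T g"
begin

lemma metric_add: "x \<in> T \<Longrightarrow> u \<in> tangent_space T \<Longrightarrow> v \<in> tangent_space T \<Longrightarrow> w \<in> tangent_space T \<Longrightarrow>
    g x (u + v) w = g x u w + g x v w"
  and metric_scale: "x \<in> T \<Longrightarrow> u \<in> tangent_space T \<Longrightarrow> w \<in> tangent_space T \<Longrightarrow>
    g x (c *\<^sub>R u) w = c * g x u w"
  and metric_sym: "x \<in> T \<Longrightarrow> u \<in> tangent_space T \<Longrightarrow> v \<in> tangent_space T \<Longrightarrow> g x u v = g x v u"
  and metric_pos: "x \<in> T \<Longrightarrow> u \<in> tangent_space T \<Longrightarrow> u \<noteq> 0 \<Longrightarrow> 0 < g x u u"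
  and metric_smooth: "u \<in> tangent_space T \<Longrightarrow> v \<in> tangent_space T \<Longrightarrow> \<exists>f. smooth f \<and> (\<forall>x\<in>T. f x = g x u v)"
  using g unfolding riemannian_metric_def by blast+

lemma metric_sum:
  assumes "x \<in> T" "w \<in> tangent_space T" "finite I" "\<And>i. i \<in> I \<Longrightarrow> u i \<in> tangent_space T"
  shows "g x (\<Sum>i\<in>I. c i *\<^sub>R u i) w = (\<Sum>i\<in>I. c i * g x (u i) w)"
  using additive_on_sum[of "tangent_space T" "\<lambda>u. g x u w" I u c, OF subspace_tangent_space]
    metric_add metric_scale assms by simp

text \<open>The metric is smooth for constant vectors only; varying ones are expanded in the
  differences \<open>v - p\<close> with continuous coefficients.\<close>

lemma metric_continuous_on:
  assumes u: "continuous_on T u" "\<And>x. x \<in> T \<Longrightarrow> u x \<in> tangent_space T"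
    and w: "continuous_on T w" "\<And>x. x \<in> T \<Longrightarrow> w x \<in> tangent_space T"
  shows "continuous_on T (\<lambda>x. g x (u x) (w x))"
proof -
  let ?V = "vertices T"
  obtain C where C: "bary_covectors ?V C" using bary_covectors_exist[OF is_simplexE(3)[OF T]] .
  obtain p where p: "p \<in> ?V" using is_simplexE(2)[OF T] by blast
  have fin: "finite ?V" by (rule is_simplexE(1)[OF T])
  have e: "v - p \<in> tangent_space T" if "v \<in> ?V" for v
    using that p vertices_subset[of T] by (intro tangent_space_diff) auto
  have expand: "z = (\<Sum>v\<in>?V. (C v \<bullet> direction z) *\<^sub>R (v - p))" if "z \<in> tangent_space T" for z
    using bary_directions[OF fin C, of z] that is_simplexE(4)[OF T]
    by (simp add: scaleR_right_diff_distrib sum_subtractf flip: scaleR_sum_left)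
  have "g x (u x) (w x) = (\<Sum>v\<in>?V. (C v \<bullet> direction (u x)) * (\<Sum>v'\<in>?V. (C v' \<bullet> direction (w x)) * g x (v' - p) (v - p)))"
    if x: "x \<in> T" for x
  proof -
    have "g x (u x) (w x) = g x (\<Sum>v\<in>?V. (C v \<bullet> direction (u x)) *\<^sub>R (v - p)) (w x)"
      using expand[OF u(2)[OF x]] by simp
    also have "\<dots> = (\<Sum>v\<in>?V. (C v \<bullet> direction (u x)) * g x (v - p) (w x))"
      by (rule metric_sum[OF x w(2)[OF x] fin e])
    also have "\<dots> = (\<Sum>v\<in>?V. (C v \<bullet> direction (u x)) * g x (w x) (v - p))"
      by (intro sum.cong refl arg_cong2[where f = "(*)"] metric_sym x e w(2))
    also have "\<dots> = (\<Sum>v\<in>?V. (C v \<bullet> direction (u x)) * g x (\<Sum>v'\<in>?V. (C v' \<bullet> direction (w x)) *\<^sub>R (v' - p)) (v - p))"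
      using expand[OF w(2)[OF x]] by simp
    also have "\<dots> = (\<Sum>v\<in>?V. (C v \<bullet> direction (u x)) * (\<Sum>v'\<in>?V. (C v' \<bullet> direction (w x)) * g x (v' - p) (v - p)))"
      by (intro sum.cong refl arg_cong2[where f = "(*)"] metric_sum x fin e)
    finally show ?thesis .
  qed
  moreover have "continuous_on T (\<lambda>x. g x (v' - p) (v - p))" if "v' \<in> ?V" "v \<in> ?V" for v v'
  proof -
    obtain f where "smooth f" "\<forall>x\<in>T. f x = g x (v' - p) (v - p)"
      using metric_smooth e \<open>v' \<in> ?V\<close> \<open>v \<in> ?V\<close> by meson
    then show ?thesis using smooth_continuous_on[of f T] continuous_on_cong[OF refl] by (metis (no_types, lifting))
  qed
  then have "continuous_on T (\<lambda>x. \<Sum>v\<in>?V. (C v \<bullet> direction (u x)) * (\<Sum>v'\<in>?V. (C v' \<bullet> direction (w x)) * g x (v' - p) (v - p)))"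
    by (intro continuous_intros u(1) w(1)) auto
  ultimately show ?thesis using continuous_on_cong[OF refl] by (metis (no_types, lifting))
qed

lemma orthonormal_expand:
  assumes x: "x \<in> T" and bs: "orthonormal_basis T (g x) bs" and u: "u \<in> tangent_space T"
  shows "u = (\<Sum>i<length bs. g x u (bs ! i) *\<^sub>R bs ! i)"
proof -
  have W: "bs ! i \<in> tangent_space T" if "i < length bs" for i
    using bs nth_mem[OF that] unfolding orthonormal_basis_def by blast
  have on: "g x (bs ! i) (bs ! j) = (if i = j then 1 else 0)" if "i < length bs" "j < length bs" for i j
    using bs that by (auto simp: orthonormal_basis_def)
  have coef: "g x (\<Sum>i<length bs. c i *\<^sub>R bs ! i) (bs ! j) = c j" if j: "j < length bs" for c j
  proof -
    have "g x (\<Sum>i<length bs. c i *\<^sub>R bs ! i) (bs ! j) = (\<Sum>i<length bs. c i * g x (bs ! i) (bs ! j))"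
      using W by (intro metric_sum x W j) auto
    also have "\<dots> = (\<Sum>i<length bs. if i = j then c i else 0)"
      using on j by (intro sum.cong) auto
    finally show ?thesis using j by simp
  qed
  have dist: "distinct bs"
    unfolding distinct_conv_nth using on by (metis zero_neq_one)
  have bij: "bij_betw ((!) bs) {..<length bs} (set bs)" using dist by (intro bij_betw_nth) auto
  have ind: "independent (set bs)"
  proof
    assume "dependent (set bs)"
    then obtain c v where c: "v \<in> set bs" "c v \<noteq> 0" "(\<Sum>v\<in>set bs. c v *\<^sub>R v) = 0"
      by (auto simp: dependent_finite)
    then obtain j where j: "j < length bs" "v = bs ! j" by (metis in_set_conv_nth)
    have z: "(\<Sum>i<length bs. c (bs ! i) *\<^sub>R bs ! i) = 0"
      using c(3) sum.reindex_bij_betw[OF bij, of "\<lambda>v. c v *\<^sub>R v"] by simp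
    have "g x 0 (bs ! j) = 0" using metric_scale[OF x W[OF j(1)] W[OF j(1)], of 0] by simp
    then show False using coef[OF j(1), of "\<lambda>i. c (bs ! i)"] z c(2) j(2) by simp
  qed
  have "tangent_space T \<subseteq> span (set bs)"
  proof (rule card_ge_dim_independent[OF _ ind])
    show "set bs \<subseteq> tangent_space T" using bs by (simp add: orthonormal_basis_def)
    have "int (length bs) = int (length (edges T))" using bs length_edges[OF T] by (simp add: orthonormal_basis_def)
    then show "dim (tangent_space T) \<le> card (set bs)"
      using dist dim_tangent_space[OF T] by (simp add: distinct_card)
  qed
  then obtain c where "u = (\<Sum>v\<in>set bs. c v *\<^sub>R v)"
    using u by (auto simp: span_finite)
  then have "u = (\<Sum>i<length bs. c (bs ! i) *\<^sub>R bs ! i)"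
    using sum.reindex_bij_betw[OF bij, of "\<lambda>v. c v *\<^sub>R v"] by simp
  moreover from this have "g x u (bs ! j) = c (bs ! j)" if "j < length bs" for j
    using coef[OF that, of "\<lambda>i. c (bs ! i)"] by simp
  ultimately show ?thesis by (metis (no_types, lifting) lessThan_iff sum.cong)
qed

text \<open>One matrix \<open>O'\<close> expresses the first basis in the second and, transposed,
  the second in the first; inserting both expansions moves the sum from one basis to the
  other.\<close>

lemma orthonormal_trace:
  assumes x: "x \<in> T" and bs: "orthonormal_basis T (g x) bs" and cs: "orthonormal_basis T (g x) cs"
    and lin: "linear f" "linear f'"
  shows "(\<Sum>i<length bs. f (bs ! i) * f' (bs ! i)) = (\<Sum>i<length bs. f (cs ! i) * (f' (cs ! i) :: real))"
proof -
  let ?n = "length bs"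
  have n: "length cs = ?n" using bs cs by (simp add: orthonormal_basis_def)
  have W: "bs ! i \<in> tangent_space T" "cs ! i \<in> tangent_space T" if "i < ?n" for i
    using bs cs nth_mem[of i bs] nth_mem[of i cs] that n unfolding orthonormal_basis_def by auto
  define O' where "O' i j = g x (bs ! i) (cs ! j)" for i j
  have b: "bs ! i = (\<Sum>j<?n. O' i j *\<^sub>R cs ! j)" if "i < ?n" for i
    using orthonormal_expand[OF x cs W(1)[OF that]] by (simp add: O'_def n)
  have c: "cs ! j = (\<Sum>i<?n. O' i j *\<^sub>R bs ! i)" if "j < ?n" for j
  proof -
    have "cs ! j = (\<Sum>i<?n. g x (cs ! j) (bs ! i) *\<^sub>R bs ! i)"
      by (rule orthonormal_expand[OF x bs W(2)[OF that]])
    also have "\<dots> = (\<Sum>i<?n. O' i j *\<^sub>R bs ! i)"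
      unfolding O'_def using W that x by (intro sum.cong refl arg_cong2[where f = "(*\<^sub>R)"] metric_sym) auto
    finally show ?thesis .
  qed
  have "(\<Sum>i<?n. f (bs ! i) * f' (bs ! i)) = (\<Sum>i<?n. \<Sum>j<?n. (O' i j * f (cs ! j)) * f' (bs ! i))"
  proof (rule sum.cong[OF refl])
    fix i assume "i \<in> {..<?n}"
    then have "f (bs ! i) = f (\<Sum>j<?n. O' i j *\<^sub>R cs ! j)" by (intro arg_cong[where f = f] b) simp
    also have "\<dots> = (\<Sum>j<?n. O' i j * f (cs ! j))"
      by (simp add: linear_sum[OF lin(1)] linear_scale[OF lin(1)])
    finally show "f (bs ! i) * f' (bs ! i) = (\<Sum>j<?n. (O' i j * f (cs ! j)) * f' (bs ! i))"
      by (simp add: sum_distrib_right)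
  qed
  also have "\<dots> = (\<Sum>j<?n. \<Sum>i<?n. (O' i j * f (cs ! j)) * f' (bs ! i))" by (rule sum.swap)
  also have "\<dots> = (\<Sum>j<?n. f (cs ! j) * f' (cs ! j))"
  proof (rule sum.cong[OF refl])
    fix j assume "j \<in> {..<?n}"
    then have "f' (cs ! j) = f' (\<Sum>i<?n. O' i j *\<^sub>R bs ! i)" by (intro arg_cong[where f = f'] c) simp
    also have "\<dots> = (\<Sum>i<?n. O' i j * f' (bs ! i))"
      by (simp add: linear_sum[OF lin(2)] linear_scale[OF lin(2)])
    finally show "(\<Sum>i<?n. (O' i j * f (cs ! j)) * f' (bs ! i)) = f (cs ! j) * f' (cs ! j)"
      by (simp add: sum_distrib_left mult_ac)
  qed
  finally show ?thesis .
qed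

text \<open>The Gram-Schmidt process, applied to the edges at all points simultaneously.\<close>

lemma continuous_orthonormal_frame:
  "\<exists>c. (\<forall>x\<in>T. orthonormal_basis T (g x) (map (\<lambda>i. c i x) [0..<length (edges T)])) \<and>
    (\<forall>i<length (edges T). continuous_on T (c i))"
proof -
  let ?e = "\<lambda>i. edges T ! i" and ?n = "length (edges T)" and ?W = "tangent_space T"
  have eW: "?e i \<in> ?W" if "i < ?n" for i using edges_tangent[OF T] that nth_mem by blast
  \<comment> \<open>The span condition ensures that the next edge is independent of the vectors
    constructed so far, so its orthogonal part is nonzero at every point.\<close>
  have "\<exists>c. (\<forall>i<m. continuous_on T (c i)) \<and> (\<forall>x\<in>T. \<forall>i<m. c i x \<in> span (?e ` {..i}) \<and> c i x \<in> ?W \<and>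
      (\<forall>j<m. g x (c i x) (c j x) = (if i = j then 1 else 0)))" if "m \<le> ?n" for m
    using that
  proof (induction m)
    case (Suc m)
    then have "\<exists>c. (\<forall>i<m. continuous_on T (c i)) \<and> (\<forall>x\<in>T. \<forall>i<m. c i x \<in> span (?e ` {..i}) \<and> c i x \<in> ?W \<and>
      (\<forall>j<m. g x (c i x) (c j x) = (if i = j then 1 else 0)))" by simp
    then obtain c where C: "\<forall>i<m. continuous_on T (c i)" "\<forall>x\<in>T. \<forall>i<m. c i x \<in> span (?e ` {..i}) \<and> c i x \<in> ?W \<and>
      (\<forall>j<m. g x (c i x) (c j x) = (if i = j then 1 else 0))" by (elim exE conjE)
    have c: "i < m \<Longrightarrow> continuous_on T (c i)" "x \<in> T \<Longrightarrow> i < m \<Longrightarrow> c i x \<in> span (?e ` {..i})"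
      "x \<in> T \<Longrightarrow> i < m \<Longrightarrow> c i x \<in> ?W"
      "x \<in> T \<Longrightarrow> i < m \<Longrightarrow> j < m \<Longrightarrow> g x (c i x) (c j x) = (if i = j then 1 else 0)" for x i j
      using C by auto
    have m: "m < ?n" using Suc.prems by simp
    define f where "f x = ?e m - (\<Sum>i<m. g x (?e m) (c i x) *\<^sub>R c i x)" for x
    have fW: "f x \<in> ?W" if "x \<in> T" for x
      unfolding f_def using c(3)[OF that] eW[OF m]
      by (intro subspace_diff[OF subspace_tangent_space] subspace_sum[OF subspace_tangent_space]
          subspace_scale[OF subspace_tangent_space]) auto
    have fc: "continuous_on T f"
      unfolding f_def using c(1,3) eW[OF m] by (intro continuous_intros metric_continuous_on) auto
    have f0: "f x \<noteq> 0" if x: "x \<in> T" for x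
    proof
      assume "f x = 0"
      then have "?e m = (\<Sum>i<m. g x (?e m) (c i x) *\<^sub>R c i x)" by (simp add: f_def)
      also have "\<dots> \<in> span (?e ` {..<m})"
      proof (intro span_sum span_scale)
        fix i assume "i \<in> {..<m}"
        then have "c i x \<in> span (?e ` {..i})" "?e ` {..i} \<subseteq> ?e ` {..<m}" using c(2)[OF x] by auto
        then show "c i x \<in> span (?e ` {..<m})" by (rule subsetD[OF span_mono, rotated])
      qed
      finally have "?e m \<in> span (?e ` {..<m})" .
      moreover have "?e ` {..<m} \<subseteq> set (edges T) - {?e m}"
        using m edges_independent(1)[OF T] nth_eq_iff_index_eq by fastforce
      ultimately have "?e m \<in> span (set (edges T) - {?e m})" by (rule subsetD[OF span_mono, rotated])
      then show False using edges_independent(2)[OF T] nth_mem[OF m] unfolding dependent_def by blast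
    qed
    have fo: "g x (f x) (c j x) = 0" if x: "x \<in> T" and j: "j < m" for x j
    proof -
      have s: "(\<Sum>i<m. g x (?e m) (c i x) *\<^sub>R c i x) \<in> ?W"
        using c(3)[OF x] by (intro subspace_sum[OF subspace_tangent_space] subspace_scale[OF subspace_tangent_space]) auto
      have "f x = ?e m + (-1) *\<^sub>R (\<Sum>i<m. g x (?e m) (c i x) *\<^sub>R c i x)" by (simp add: f_def)
      then have "g x (f x) (c j x) = g x (?e m) (c j x) - g x (\<Sum>i<m. g x (?e m) (c i x) *\<^sub>R c i x) (c j x)"
        using metric_add[OF x eW[OF m] subspace_scale[OF subspace_tangent_space s, of "-1"] c(3)[OF x j]]
          metric_scale[OF x s c(3)[OF x j], of "-1"] by simp
      also have "g x (\<Sum>i<m. g x (?e m) (c i x) *\<^sub>R c i x) (c j x) = (\<Sum>i<m. g x (?e m) (c i x) * g x (c i x) (c j x))"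
        using c(3)[OF x] j by (intro metric_sum x) auto
      also have "\<dots> = (\<Sum>i<m. if i = j then g x (?e m) (c i x) else 0)"
        using c(4)[OF x _ j] by (intro sum.cong) auto
      finally show ?thesis using j by simp
    qed
    define h where "h x = (1 / sqrt (g x (f x) (f x))) *\<^sub>R f x" for x
    have pos: "0 < g x (f x) (f x)" if "x \<in> T" for x by (rule metric_pos[OF that fW[OF that] f0[OF that]])
    have hW: "h x \<in> ?W" if "x \<in> T" for x
      unfolding h_def by (rule subspace_scale[OF subspace_tangent_space fW[OF that]])
    have hc: "continuous_on T h"
      unfolding h_def using pos less_imp_neq by (intro continuous_intros metric_continuous_on fc fW) fastforce+
    have hh: "g x (h x) (h x) = 1" if x: "x \<in> T" for x
    proof -
      define r where "r = 1 / sqrt (g x (f x) (f x))"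
      have "g x (h x) (h x) = r * g x (f x) (r *\<^sub>R f x)"
        unfolding h_def r_def[symmetric]
        by (rule metric_scale[OF x fW[OF x] subspace_scale[OF subspace_tangent_space fW[OF x]]])
      also have "g x (f x) (r *\<^sub>R f x) = g x (r *\<^sub>R f x) (f x)"
        by (rule metric_sym[OF x fW[OF x] subspace_scale[OF subspace_tangent_space fW[OF x]]])
      also have "\<dots> = r * g x (f x) (f x)" by (rule metric_scale[OF x fW[OF x] fW[OF x]])
      also have "r * (r * g x (f x) (f x)) = 1"
        using pos[OF x] by (simp add: r_def field_simps flip: real_sqrt_mult)
      finally show ?thesis .
    qed
    have ho: "g x (h x) (c j x) = 0" "g x (c j x) (h x) = 0" if x: "x \<in> T" and j: "j < m" for x j
      using fo[OF x j] metric_scale[OF x fW[OF x] c(3)[OF x j]] metric_sym[OF x hW[OF x] c(3)[OF x j]]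
      by (simp_all add: h_def)
    have hs: "h x \<in> span (?e ` {..m})" if x: "x \<in> T" for x
      unfolding h_def f_def
    proof (intro span_scale span_diff span_sum)
      show "?e m \<in> span (?e ` {..m})" by (intro span_base) auto
      fix i assume "i \<in> {..<m}"
      then have "c i x \<in> span (?e ` {..i})" "?e ` {..i} \<subseteq> ?e ` {..m}" using c(2)[OF x] by auto
      then show "c i x \<in> span (?e ` {..m})" by (rule subsetD[OF span_mono, rotated])
    qed
    show ?case
      using c hW hc hh ho hs
      by (intro exI[of _ "c(m := h)"]) (auto simp: less_Suc_eq)
  qed auto
  from this[OF order_refl] obtain c where c: "\<forall>i<?n. continuous_on T (c i)"
    "\<forall>x\<in>T. \<forall>i<?n. c i x \<in> span (?e ` {..i}) \<and> c i x \<in> ?W \<and>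
      (\<forall>j<?n. g x (c i x) (c j x) = (if i = j then 1 else 0))" by blast
  have "orthonormal_basis T (g x) (map (\<lambda>i. c i x) [0..<?n])" if "x \<in> T" for x
    using c(2) that length_edges[OF T] by (auto simp: orthonormal_basis_def)
  with c(1) show ?thesis by blast
qed

end


section \<open>The inner product of smooth forms\<close>

lemma alt_inner_add: "alt_inner T h (\<alpha> + \<alpha>') \<beta> = alt_inner T h \<alpha> \<beta> + alt_inner T h \<alpha>' \<beta>"
  by (simp add: alt_inner_def Let_def distrib_right sum.distrib)

lemma alt_inner_scaleR: "alt_inner T h (c *\<^sub>R \<alpha>) \<beta> = c * alt_inner T h \<alpha> \<beta>"
  by (simp add: alt_inner_def Let_def scaleR_fun_def sum_distrib_left mult.assoc)

lemma alt_inner_commute: "alt_inner T h \<alpha> \<beta> = alt_inner T h \<beta> \<alpha>"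
  by (simp add: alt_inner_def mult.commute)

context
  fixes T :: "'a::euclidean_space set" and g :: "'a metric"
  assumes T: "is_simplex T" and g: "riemannian_metric T g"
begin

definition gram :: "'a \<Rightarrow> real mat"
  where "gram x = Matrix.mat (length (edges T)) (length (edges T)) (\<lambda>(i, j). g x (edges T ! i) (edges T ! j))"

lemma riemannian_integral_eq:
  "riemannian_integral T g f = simplex_integral (hd (verts T)) (edges T) (\<lambda>x. f x * sqrt (Determinant.det (gram x)))"
  by (simp add: riemannian_integral_def coord_integral_eq gram_def)

lemma edge_tangent: "i < length (edges T) \<Longrightarrow> edges T ! i \<in> tangent_space T"
  using edges_tangent[OF T] nth_mem by blast

lemma orthonormal_basis_exists: "x \<in> T \<Longrightarrow> \<exists>bs. orthonormal_basis T (g x) bs"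
  using continuous_orthonormal_frame[OF T g] by blast

lemma gram_continuous_on: "continuous_on T (\<lambda>x. sqrt (Determinant.det (gram x)))"
proof -
  let ?n = "length (edges T)"
  have "Determinant.det (gram x) = (\<Sum>\<pi> | \<pi> permutes {0..<?n}.
      signof \<pi> * (\<Prod>i = 0..<?n. g x (edges T ! i) (edges T ! \<pi> i)))" for x
  proof -
    have G: "gram x \<in> carrier_mat ?n ?n" by (simp add: gram_def)
    have "\<pi> i < ?n" if "\<pi> permutes {0..<?n}" "i < ?n" for \<pi> i
      using permutes_in_image[OF that(1), of i] that(2) by simp
    then show ?thesis
      unfolding det_def'[OF G] by (intro sum.cong refl arg_cong2[where f = "(*)"] prod.cong) (auto simp: gram_def)
  qed
  moreover have "continuous_on T (\<lambda>x. \<Sum>\<pi> | \<pi> permutes {0..<?n}.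
      signof \<pi> * (\<Prod>i = 0..<?n. g x (edges T ! i) (edges T ! \<pi> i)))"
  proof (intro continuous_intros)
    fix \<pi> i assume "\<pi> \<in> {\<pi>. \<pi> permutes {0..<?n}}" "i \<in> {0..<?n}"
    then have "i < ?n" "\<pi> i < ?n" using permutes_in_image[of \<pi> "{0..<?n}" i] by auto
    then show "continuous_on T (\<lambda>x. g x (edges T ! i) (edges T ! \<pi> i))"
      by (intro metric_continuous_on[OF T g] continuous_on_const edge_tangent)
  qed
  ultimately show ?thesis by (intro continuous_intros) simp
qed

text \<open>In an orthonormal basis the Gram matrix is \<open>A\<close> times its transpose, so the
  determinant is a square. A kernel vector would give the coefficients of a tangent vector
  orthogonal to itself, which contradicts independence of the edges.\<close>

lemma gram_det_pos:
  assumes x: "x \<in> T"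
  shows "0 < Determinant.det (gram x)"
proof -
  let ?n = "length (edges T)" and ?e = "\<lambda>i. edges T ! i"
  have G: "gram x \<in> carrier_mat ?n ?n" by (simp add: gram_def)
  obtain bs where bs: "orthonormal_basis T (g x) bs" using orthonormal_basis_exists[OF x] by blast
  have n: "length bs = ?n" using bs length_edges[OF T] by (simp add: orthonormal_basis_def)
  have bW: "bs ! k \<in> tangent_space T" if "k < ?n" for k
    using bs nth_mem[of k bs] n that unfolding orthonormal_basis_def by auto
  define A where "A = Matrix.mat ?n ?n (\<lambda>(i, k). g x (?e i) (bs ! k))"
  have A: "A \<in> carrier_mat ?n ?n" by (simp add: A_def)
  have "gram x = A * transpose_mat A"
  proof (rule eq_matI)
    fix i j assume "i < dim_row (A * transpose_mat A)" "j < dim_col (A * transpose_mat A)"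
    then have ij: "i < ?n" "j < ?n" by (simp_all add: A_def)
    have "g x (?e i) (?e j) = g x (\<Sum>k<?n. g x (?e i) (bs ! k) *\<^sub>R bs ! k) (?e j)"
      using orthonormal_expand[OF T g x bs edge_tangent[OF ij(1)]] n by simp
    also have "\<dots> = (\<Sum>k<?n. g x (?e i) (bs ! k) * g x (bs ! k) (?e j))"
      using bW by (intro metric_sum[OF T g x edge_tangent[OF ij(2)]]) auto
    also have "\<dots> = (\<Sum>k<?n. g x (?e i) (bs ! k) * g x (?e j) (bs ! k))"
      using bW by (intro sum.cong refl arg_cong2[where f = "(*)"] metric_sym[OF T g x] edge_tangent[OF ij(2)]) auto
    finally show "gram x $$ (i, j) = (A * transpose_mat A) $$ (i, j)"
      using ij by (simp add: gram_def A_def scalar_prod_def atLeast0LessThan)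
  qed (simp_all add: gram_def A_def)
  then have "Determinant.det (gram x) = (Determinant.det A)\<^sup>2"
    using det_mult[OF A, of "transpose_mat A"] det_transpose[OF A] A by (simp add: power2_eq_square)
  moreover have "Determinant.det (gram x) \<noteq> 0"
  proof
    assume "Determinant.det (gram x) = 0"
    then obtain v where v: "v \<in> carrier_vec ?n" "v \<noteq> 0\<^sub>v ?n" "gram x *\<^sub>v v = 0\<^sub>v ?n"
      using det_0_iff_vec_prod_zero_field[OF G] by blast
    define w where "w = (\<Sum>i<?n. vec_index v i *\<^sub>R ?e i)"
    have wW: "w \<in> tangent_space T"
      unfolding w_def by (intro subspace_sum subspace_scale subspace_tangent_space edge_tangent) auto
    have "g x (?e j) w = 0" if j: "j < ?n" for j
    proof -
      have "g x (?e j) w = g x w (?e j)" by (rule metric_sym[OF T g x edge_tangent[OF j] wW])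
      also have "\<dots> = (\<Sum>i<?n. vec_index v i * g x (?e i) (?e j))"
        unfolding w_def by (intro metric_sum[OF T g x edge_tangent[OF j]] edge_tangent) auto
      also have "\<dots> = (\<Sum>i<?n. g x (?e j) (?e i) * vec_index v i)"
      proof (rule sum.cong[OF refl])
        fix i assume "i \<in> {..<?n}"
        then show "vec_index v i * g x (?e i) (?e j) = g x (?e j) (?e i) * vec_index v i"
          using metric_sym[OF T g x edge_tangent edge_tangent, of i j] j by simp
      qed
      also have "\<dots> = vec_index (gram x *\<^sub>v v) j"
        using j v(1) by (simp add: gram_def scalar_prod_def atLeast0LessThan)
      finally show ?thesis using j v(3) by simp
    qed
    then have "(\<Sum>i<?n. vec_index v i * g x (?e i) w) = 0" by simp
    moreover have "g x w w = (\<Sum>i<?n. vec_index v i * g x (?e i) w)"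
      by (subst (1) w_def) (intro metric_sum[OF T g x wW] edge_tangent, auto)
    ultimately have "w = 0" using metric_pos[OF T g x wW] by force
    have bij: "bij_betw ((!) (edges T)) {..<?n} (set (edges T))"
      using edges_independent(1)[OF T] by (intro bij_betw_nth) auto
    define u where "u e = vec_index v (the_inv_into {..<?n} ((!) (edges T)) e)" for e
    have u: "u (?e i) = vec_index v i" if "i < ?n" for i
      unfolding u_def using the_inv_into_f_f[of "(!) (edges T)" "{..<?n}" i] bij that by (simp add: bij_betw_def)
    have "(\<Sum>e\<in>set (edges T). u e *\<^sub>R e) = w"
      unfolding w_def sum.reindex_bij_betw[OF bij, symmetric] by (intro sum.cong) (auto simp: u)
    then have "\<forall>e\<in>set (edges T). u e = 0"
      using \<open>w = 0\<close> edges_independent(2)[OF T] by (auto simp: dependent_finite)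
    then have "vec_index v i = 0" if "i < ?n" for i using u[OF that] nth_mem[OF that] by metis
    then have "v = 0\<^sub>v ?n" using v(1) by (intro eq_vecI) auto
    with v(2) show False ..
  qed
  ultimately show ?thesis by (simp add: zero_less_power2)
qed

text \<open>The definition chooses a basis at each point separately, with no continuity in the
  point. This formula allows any orthonormal basis, in particular the continuous frame.\<close>

lemma alt_inner_eq:
  assumes x: "x \<in> T" and cs: "orthonormal_basis T (g x) cs"
    and a: "a \<in> ambient_forms (int m)" and b: "b \<in> ambient_forms (int m)"
  shows "fact m * alt_inner T (g x) (pullback T a x) (pullback T b x) =
    (\<Sum>l | set l \<subseteq> {..<length (edges T)} \<and> length l = m. a x (map ((!) cs) l) * b x (map ((!) cs) l))"
proof -
  let ?n = "length (edges T)"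
  define bs where "bs = (SOME bs. orthonormal_basis T (g x) bs)"
  have bs: "orthonormal_basis T (g x) bs"
    unfolding bs_def by (rule someI_ex[OF orthonormal_basis_exists[OF x]])
  have n: "length bs = ?n" "set bs \<subseteq> tangent_space T"
    using bs length_edges[OF T] by (simp_all add: orthonormal_basis_def)
  have "set (map ((!) bs) \<sigma>) \<subseteq> tangent_space T" if "\<sigma> \<in> increasing_lists ?n" for \<sigma>
  proof -
    have "set (map ((!) bs) \<sigma>) \<subseteq> set bs" using that n(1) by (fastforce simp: increasing_lists_def)
    then show ?thesis using n(2) by (rule order_trans)
  qed
  then have "alt_inner T (g x) (pullback T a x) (pullback T b x) =
      (\<Sum>\<sigma>\<in>increasing_lists ?n. a x (map ((!) bs) \<sigma>) * b x (map ((!) bs) \<sigma>))"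
    unfolding alt_inner_def bs_def[symmetric] Let_def n(1) using x
    by (intro sum.cong refl) (simp add: pullback_def)
  then have "fact m * alt_inner T (g x) (pullback T a x) (pullback T b x) =
      (\<Sum>l | set l \<subseteq> {..<?n} \<and> length l = m. a x (map ((!) bs) l) * b x (map ((!) bs) l))"
    by (simp only: alternating_sum_lists[OF ambient_formsD(1)[OF a] ambient_formsD(1)[OF b]])
  also have "\<dots> = (\<Sum>l | set l \<subseteq> {..<?n} \<and> length l = m. a x (map ((!) cs) l) * b x (map ((!) cs) l))"
    by (rule sum_lists_basis_independent[OF _ ambient_formsD(1)[OF a] ambient_formsD(1)[OF b]])
      (use orthonormal_trace[OF T g x bs cs] n(1) in simp)
  finally show ?thesis .
qed

lemma smooth_forms_nonneg_degree:
  assumes "\<alpha> \<in> smooth_forms k T" "\<alpha> \<noteq> 0"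
  obtains m where "k = int m"
  using smooth_forms_eq_0_dimension[OF T assms(1)] assms(2) by (metis not_less zero_le_imp_eq_int)

lemma alt_inner_0: "alt_inner T h 0 \<beta> = 0" "alt_inner T h \<alpha> 0 = 0"
  by (simp_all add: alt_inner_def Let_def)

lemma alt_inner_continuous_on:
  assumes \<alpha>: "\<alpha> \<in> smooth_forms k T" and \<beta>: "\<beta> \<in> smooth_forms k T"
  shows "continuous_on T (\<lambda>x. alt_inner T (g x) (\<alpha> x) (\<beta> x))"
proof (cases "\<alpha> = 0")
  case True
  then have "alt_inner T (g x) (\<alpha> x) (\<beta> x) = 0" for x using alt_inner_0(1) by simp
  then show ?thesis by simp
next
  case False
  then obtain m where k: "k = int m" using smooth_forms_nonneg_degree[OF \<alpha>] by blast
  let ?n = "length (edges T)"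
  obtain a where a: "a \<in> ambient_forms (int m)" "\<alpha> = pullback T a" using \<alpha> k by (auto elim: smooth_formsE)
  obtain b where b: "b \<in> ambient_forms (int m)" "\<beta> = pullback T b" using \<beta> k by (auto elim: smooth_formsE)
  obtain c where c: "\<And>x. x \<in> T \<Longrightarrow> orthonormal_basis T (g x) (map (\<lambda>i. c i x) [0..<?n])"
    "\<And>i. i < ?n \<Longrightarrow> continuous_on T (c i)"
    using continuous_orthonormal_frame[OF T g] by blast
  have "continuous_on T (\<lambda>x. w x (map ((!) (map (\<lambda>i. c i x) [0..<?n])) l))"
    if w: "w \<in> ambient_forms (int m)" and l: "set l \<subseteq> {..<?n}" for w l
  proof -
    have "map ((!) (map (\<lambda>i. c i x) [0..<?n])) l = map (\<lambda>u. u x) (map c l)" for x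
      using l by auto
    moreover have "continuous_on T (\<lambda>x. w x (map (\<lambda>u. u x) (map c l)))"
      by (rule ambient_forms_continuous_on_arguments[OF w]) (use c(2) l in auto)
    ultimately show ?thesis by (simp only:)
  qed
  then have "continuous_on T (\<lambda>x. (\<Sum>l | set l \<subseteq> {..<?n} \<and> length l = m.
      a x (map ((!) (map (\<lambda>i. c i x) [0..<?n])) l) * b x (map ((!) (map (\<lambda>i. c i x) [0..<?n])) l)) / fact m)"
    using a(1) b(1) by (intro continuous_intros) auto
  then show ?thesis
  proof (rule continuous_on_eq)
    fix x assume x: "x \<in> T"
    show "(\<Sum>l | set l \<subseteq> {..<?n} \<and> length l = m. a x (map ((!) (map (\<lambda>i. c i x) [0..<?n])) l) *
        b x (map ((!) (map (\<lambda>i. c i x) [0..<?n])) l)) / fact m = alt_inner T (g x) (\<alpha> x) (\<beta> x)"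
      unfolding alt_inner_eq[OF x c(1)[OF x] a(1) b(1), symmetric] by (simp add: a(2) b(2))
  qed
qed

lemma alt_inner_self:
  assumes x: "x \<in> T" and \<alpha>: "\<alpha> \<in> smooth_forms k T"
  shows "0 \<le> alt_inner T (g x) (\<alpha> x) (\<alpha> x)" "alt_inner T (g x) (\<alpha> x) (\<alpha> x) = 0 \<Longrightarrow> \<alpha> x = 0"
proof -
  show "0 \<le> alt_inner T (g x) (\<alpha> x) (\<alpha> x)"
    by (auto simp: alt_inner_def Let_def intro!: sum_nonneg)
  assume 0: "alt_inner T (g x) (\<alpha> x) (\<alpha> x) = 0"
  show "\<alpha> x = 0"
  proof (cases "\<alpha> = 0")
    case False
    then obtain m where k: "k = int m" using smooth_forms_nonneg_degree[OF \<alpha>] by blast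
    let ?n = "length (edges T)"
    let ?L = "{l. set l \<subseteq> {..<?n} \<and> length l = m}"
    obtain a where a: "a \<in> ambient_forms (int m)" "\<alpha> = pullback T a" using \<alpha> k by (auto elim: smooth_formsE)
    obtain cs where cs: "orthonormal_basis T (g x) cs" using orthonormal_basis_exists[OF x] by blast
    have n: "length cs = ?n" using cs length_edges[OF T] by (simp add: orthonormal_basis_def)
    have fin: "finite ?L" by (rule finite_lists_length_eq) simp
    have "(\<Sum>l\<in>?L. a x (map ((!) cs) l) * a x (map ((!) cs) l)) = 0"
      using alt_inner_eq[OF x cs a(1) a(1)] 0 a(2) by simp
    then have z: "a x (map ((!) cs) l) = 0" if "l \<in> ?L" for l
      using sum_nonneg_eq_0_iff[OF fin, of "\<lambda>l. a x (map ((!) cs) l) * a x (map ((!) cs) l)"] that by simp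
    have "tangent_space T \<subseteq> span (set cs)"
    proof
      fix u assume "u \<in> tangent_space T"
      then have "u = (\<Sum>i<length cs. g x u (cs ! i) *\<^sub>R cs ! i)" by (rule orthonormal_expand[OF T g x cs])
      also have "\<dots> \<in> span (set cs)" by (intro span_sum span_scale span_base) auto
      finally show "u \<in> span (set cs)" .
    qed
    moreover have "a x us = 0" if us: "set us \<subseteq> set cs" for us
    proof (cases "length us = m")
      case True
      have "\<forall>u\<in>set us. \<exists>i. i < ?n \<and> cs ! i = u" using us n by (metis in_set_conv_nth subset_code(1))
      then obtain f where f: "\<And>u. u \<in> set us \<Longrightarrow> f u < ?n \<and> cs ! f u = u" by metis
      have "map ((!) cs) (map f us) = us" using f by (simp add: map_idI)
      moreover have "map f us \<in> ?L" using f True by auto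
      ultimately show ?thesis using z by metis
    qed (use alternating_length[OF ambient_formsD(1)[OF a(1)]] in auto)
    ultimately have "a x vs = 0" if "set vs \<subseteq> tangent_space T" for vs
      using alternating_eq_0_on_span[OF ambient_formsD(1)[OF a(1), of x], of "set cs" vs] that by blast
    then show ?thesis using a(2) by (auto simp: pullback_def fun_eq_iff)
  qed simp
qed

lemma alt_inner_density_continuous_on:
  assumes "\<alpha> \<in> smooth_forms k T" "\<beta> \<in> smooth_forms k T"
  shows "continuous_on T (\<lambda>x. alt_inner T (g x) (\<alpha> x) (\<beta> x) * sqrt (Determinant.det (gram x)))"
  by (rule continuous_on_mult[OF alt_inner_continuous_on[OF assms] gram_continuous_on])

lemma simplex_integral_add_T:
  assumes "continuous_on T f" "continuous_on T h"
  shows "simplex_integral (hd (verts T)) (edges T) (\<lambda>x. f x + h x) =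
    simplex_integral (hd (verts T)) (edges T) f + simplex_integral (hd (verts T)) (edges T) h"
  by (rule simplex_integral_add[OF is_simplex_compact[OF T] assms affine_param_in_simplex[OF T]])

lemma L2_inner_add:
  assumes "\<alpha> \<in> smooth_forms k T" "\<alpha>' \<in> smooth_forms k T" "\<beta> \<in> smooth_forms k T"
  shows "L2_inner T g (\<alpha> + \<alpha>') \<beta> = L2_inner T g \<alpha> \<beta> + L2_inner T g \<alpha>' \<beta>"
  unfolding L2_inner_def riemannian_integral_eq
    simplex_integral_add_T[OF alt_inner_density_continuous_on[OF assms(1,3)]
      alt_inner_density_continuous_on[OF assms(2,3)], symmetric]
  by (simp add: alt_inner_add distrib_right)

lemma L2_inner_diff:
  assumes "\<alpha> \<in> smooth_forms k T" "\<alpha>' \<in> smooth_forms k T" "\<beta> \<in> smooth_forms k T"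
  shows "L2_inner T g (\<alpha> - \<alpha>') \<beta> = L2_inner T g \<alpha> \<beta> - L2_inner T g \<alpha>' \<beta>"
  using L2_inner_add[OF subspace_diff[OF subspace_smooth_forms assms(1,2)] assms(2,3)] by simp

lemma L2_inner_scaleR: "L2_inner T g (c *\<^sub>R \<alpha>) \<beta> = c * L2_inner T g \<alpha> \<beta>"
proof -
  have "alt_inner T (g x) ((c *\<^sub>R \<alpha>) x) (\<beta> x) = c * alt_inner T (g x) (\<alpha> x) (\<beta> x)" for x
    using alt_inner_scaleR[of T "g x" c "\<alpha> x" "\<beta> x"] by (simp add: scaleR_fun_def)
  then show ?thesis
    by (simp add: L2_inner_def riemannian_integral_eq mult.assoc simplex_integral_cmult)
qed

lemma L2_inner_commute: "L2_inner T g \<alpha> \<beta> = L2_inner T g \<beta> \<alpha>"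
  by (simp add: L2_inner_def alt_inner_commute)

lemma L2_inner_eq_0_imp:
  assumes \<alpha>: "\<alpha> \<in> smooth_forms k T" and 0: "L2_inner T g \<alpha> \<alpha> = 0"
  shows "\<alpha> = 0"
proof -
  let ?f = "\<lambda>x. alt_inner T (g x) (\<alpha> x) (\<alpha> x) * sqrt (Determinant.det (gram x))"
  have "\<alpha> x = 0" if x: "x \<in> T" for x
  proof -
    obtain t where t: "t \<in> std_simplex_set (length (edges T))" "x = affine_param (hd (verts T)) (edges T) t"
      using affine_param_surj[OF T x] .
    have cont: "continuous_on T ?f" by (rule alt_inner_density_continuous_on[OF \<alpha> \<alpha>])
    have zero: "simplex_integral (hd (verts T)) (edges T) ?f = 0"
      using 0 by (simp only: L2_inner_def riemannian_integral_eq)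
    have "0 \<le> ?f (affine_param (hd (verts T)) (edges T) t)" if "t \<in> std_simplex_set (length (edges T))" for t
      using alt_inner_self(1)[OF affine_param_in_simplex[OF T that] \<alpha>]
        gram_det_pos[OF affine_param_in_simplex[OF T that]] by (intro mult_nonneg_nonneg) simp_all
    from simplex_integral_eq_0_imp[OF is_simplex_compact[OF T] cont affine_param_in_simplex[OF T] this zero t(1)]
    have "?f x = 0" unfolding t(2) by simp
    then have "alt_inner T (g x) (\<alpha> x) (\<alpha> x) = 0" using gram_det_pos[OF x] by simp
    then show ?thesis by (rule alt_inner_self(2)[OF x \<alpha>])
  qed
  moreover have "\<alpha> x = 0" if x: "x \<notin> T" for x
  proof -
    obtain a where "\<alpha> = pullback T a" using \<alpha> by (rule smooth_formsE)
    then show ?thesis using x by (simp add: pullback_def zero_fun_def)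
  qed
  ultimately have "\<alpha> x = 0" for x by blast
  then show ?thesis by (simp add: fun_eq_iff)
qed

lemma riemannian_integral_1: "riemannian_integral T g (\<lambda>x. 1) \<noteq> 0"
proof
  let ?f = "\<lambda>x. 1 * sqrt (Determinant.det (gram x))"
  assume 0: "riemannian_integral T g (\<lambda>x. 1) = 0"
  have t: "(\<lambda>_. 0) \<in> std_simplex_set (length (edges T))" by (simp add: std_simplex_set_def)
  have cont: "continuous_on T ?f" by (rule continuous_on_mult[OF continuous_on_const gram_continuous_on])
  have zero: "simplex_integral (hd (verts T)) (edges T) ?f = 0"
    using 0 by (simp only: riemannian_integral_eq)
  have "0 \<le> ?f (affine_param (hd (verts T)) (edges T) t)" if "t \<in> std_simplex_set (length (edges T))" for t
    using gram_det_pos[OF affine_param_in_simplex[OF T that]] by simp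
  from simplex_integral_eq_0_imp[OF is_simplex_compact[OF T] cont affine_param_in_simplex[OF T] this zero t]
  show False using gram_det_pos[OF affine_param_in_simplex[OF T t]] by simp
qed

end

lemma vol_nonzero:
  assumes T: "is_simplex T"
  shows "vol T \<noteq> 0"
proof -
  have "riemannian_metric T (\<lambda>x u v. u \<bullet> v)"
    unfolding riemannian_metric_def
  proof (intro conjI ballI allI impI)
    show "\<exists>f. smooth f \<and> (\<forall>x\<in>T. f x = u \<bullet> v)" for u v :: 'a
      by (rule exI[of _ "\<lambda>_. u \<bullet> v"]) simp
  qed (auto simp: inner_add_left intro: inner_commute)
  then show ?thesis unfolding vol_def by (rule riemannian_integral_1[OF T])
qed

text \<open>One Gram-Schmidt step per element of \<open>X\<close>: \<open>e\<close> is the part of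
  \<open>x\<close> orthogonal to the span of the others. The surrounding \<open>S\<close> may be
  infinite-dimensional, as for smooth forms.\<close>

lemma finite_dimensional_projection:
  fixes ip :: "'b::real_vector \<Rightarrow> 'b \<Rightarrow> real"
  assumes S: "subspace S"
    and add: "\<And>x y z. x \<in> S \<Longrightarrow> y \<in> S \<Longrightarrow> z \<in> S \<Longrightarrow> ip (x + y) z = ip x z + ip y z"
    and scale: "\<And>c x z. ip (c *\<^sub>R x) z = c * ip x z"
    and sym: "\<And>x y. ip x y = ip y x"
    and definite: "\<And>x. x \<in> S \<Longrightarrow> ip x x = 0 \<Longrightarrow> x = 0"
    and X: "finite X" "X \<subseteq> S" and \<tau>: "\<tau> \<in> S"
  shows "\<exists>b\<in>span X. \<forall>b'\<in>span X. ip b b' = ip \<tau> b'"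
  using X \<tau>
proof (induction X arbitrary: \<tau> rule: finite_induct)
  case empty
  have "ip x 0 = 0" for x using scale[of 0 0 x] sym by simp
  then show ?case by auto
next
  case (insert x X)
  have x: "x \<in> S" and XS: "span X \<subseteq> S" using insert.prems span_minimal[OF _ S] by auto
  obtain p where p: "p \<in> span X" "\<And>b'. b' \<in> span X \<Longrightarrow> ip p b' = ip x b'"
    using insert.IH[of x] insert.prems by blast
  obtain b where b: "b \<in> span X" "\<And>b'. b' \<in> span X \<Longrightarrow> ip b b' = ip \<tau> b'"
    using insert.IH[of \<tau>] insert.prems by blast
  define e where "e = x - p"
  have pS: "p \<in> S" and bS: "b \<in> S" using p(1) b(1) XS by auto
  have eS: "e \<in> S" unfolding e_def by (rule subspace_diff[OF S x pS])
  have diff: "ip (u - v) w = ip u w - ip v w" if "u \<in> S" "v \<in> S" "w \<in> S" for u v w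
    using add[OF that(1) subspace_scale[OF S that(2), of "-1"] that(3)] scale[of "-1" v w] by simp
  have e0: "ip e b' = 0" if "b' \<in> span X" for b'
    unfolding e_def using diff[OF x pS] p(2)[OF that] that XS by auto
  \<comment> \<open>Chosen so that the products with \<open>e\<close> agree. If
    \<open>e = 0\<close>, the new element adds nothing to the span.\<close>
  define c where "c = (if e = 0 then 0 else (ip \<tau> e - ip b e) / ip e e)"
  have ce: "ip (b + c *\<^sub>R e) e = ip \<tau> e"
  proof (cases "e = 0")
    case True
    have "ip y 0 = 0" for y using scale[of 0 0 y] sym by simp
    then show ?thesis using True by simp
  next
    case False
    then have "ip e e \<noteq> 0" using definite[OF eS] by blast
    then show ?thesis using False
      by (simp add: add[OF bS subspace_scale[OF S eS] eS] scale c_def)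
  qed
  show ?case
  proof (intro bexI ballI)
    have "p \<in> span (insert x X)" "b \<in> span (insert x X)"
      using p(1) b(1) span_mono[of X "insert x X"] by auto
    moreover have "x \<in> span (insert x X)" by (rule span_base) simp
    ultimately show "b + c *\<^sub>R e \<in> span (insert x X)"
      unfolding e_def by (intro span_add span_scale span_diff)
    fix z assume "z \<in> span (insert x X)"
    then obtain r where r: "z - r *\<^sub>R x \<in> span X" by (auto simp: span_insert)
    define y where "y = (z - r *\<^sub>R x) + r *\<^sub>R p"
    have y: "y \<in> span X" unfolding y_def by (intro span_add span_scale r p(1))
    have z: "z = y + r *\<^sub>R e" by (simp add: y_def e_def algebra_simps)
    have yS: "y \<in> S" using y XS by blast
    have zz: "ip u z = ip u y + r * ip u e" if "u \<in> S" for u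
      unfolding z using add[OF yS subspace_scale[OF S eS] that, of r] scale[of r e u] by (simp add: sym)
    have "b + c *\<^sub>R e \<in> S" by (intro subspace_add[OF S] subspace_scale[OF S] bS eS)
    moreover have "ip (b + c *\<^sub>R e) y = ip \<tau> y"
      using add[OF bS subspace_scale[OF S eS] yS, of c] b(2)[OF y] e0[OF y] by (simp add: scale)
    ultimately show "ip (b + c *\<^sub>R e) z = ip \<tau> z"
      using zz[of "b + c *\<^sub>R e"] zz[OF insert.prems(2)] ce by simp
  qed
qed


section \<open>Local projections\<close>

lemma form_integral_orientation:
  "form_integral ori T \<omega> = ori T * form_integral (\<lambda>_. 1) T \<omega>"
  by (simp add: form_integral_def)

lemma form_integral_scaleR: "form_integral ori T (c *\<^sub>R \<omega>) = c * form_integral ori T \<omega>"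
  by (simp add: form_integral_eq vertex_integral_def scaleR_fun_def simplex_integral_cmult)

lemma form_integral_add:
  assumes T: "is_simplex T" and \<omega>: "\<omega> \<in> smooth_forms k T" and \<eta>: "\<eta> \<in> smooth_forms k T"
  shows "form_integral ori T (\<omega> + \<eta>) = form_integral ori T \<omega> + form_integral ori T \<eta>"
  using simplex_integral_add[OF is_simplex_compact[OF T] smooth_forms_continuous_on[OF \<omega> edges_tangent[OF T]]
      smooth_forms_continuous_on[OF \<eta> edges_tangent[OF T]] affine_param_in_simplex[OF T]]
  by (simp add: form_integral_def coord_integral_eq distrib_left)

lemma form_integral_diff:
  assumes T: "is_simplex T" and \<omega>: "\<omega> \<in> smooth_forms k T" and \<eta>: "\<eta> \<in> smooth_forms k T"
  shows "form_integral ori T (\<omega> - \<eta>) = form_integral ori T \<omega> - form_integral ori T \<eta>"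
  using form_integral_add[OF T subspace_diff[OF subspace_smooth_forms \<omega> \<eta>] \<eta>, of ori] by simp

lemma form_integral_ext_deriv_eq_0:
  assumes T: "is_simplex T" and \<omega>: "\<omega> \<in> smooth_forms k T" and dim: "aff_dim T = k + 1"
    and ori: "\<And>G. G \<in> subsimplices T \<Longrightarrow> ori G \<noteq> 0"
    and facets: "\<And>G. G \<in> subsimplices T \<Longrightarrow> aff_dim G = k \<Longrightarrow> form_integral ori G (pullback G \<omega>) = 0"
  shows "form_integral ori T (ext_deriv T \<omega>) = 0"
proof (cases "k < 0")
  case True
  then have "\<omega> = 0" using smooth_forms_eq_0_dimension[OF T \<omega>] by blast
  then show ?thesis using ext_deriv_0[OF is_simplex_convex[OF T]] form_integral_0 by simp
next
  case False
  then have "1 \<le> aff_dim T" using dim by simp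
  then have "\<exists>\<epsilon>::nat \<Rightarrow> real. form_integral ori T (ext_deriv T \<omega>) =
      (\<Sum>i<length (verts T). \<epsilon> i * form_integral ori (convex hull (vertices T - {verts T ! i}))
        (pullback (convex hull (vertices T - {verts T ! i})) \<omega>))"
    by (rule stokes[OF T _ ori, where k = k]) (simp, use \<omega> in blast)
  then obtain \<epsilon> :: "nat \<Rightarrow> real" where \<epsilon>: "form_integral ori T (ext_deriv T \<omega>) =
      (\<Sum>i<length (verts T). \<epsilon> i * form_integral ori (convex hull (vertices T - {verts T ! i}))
        (pullback (convex hull (vertices T - {verts T ! i})) \<omega>))" ..
  have "form_integral ori (convex hull (vertices T - {verts T ! i}))
      (pullback (convex hull (vertices T - {verts T ! i})) \<omega>) = 0" if i: "i < length (verts T)" for i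
  proof -
    let ?W = "vertices T - {verts T ! i}"
    have v: "verts T ! i \<in> vertices T" using nth_mem[OF i] by (simp only: verts(2)[OF T])
    have card: "int (card ?W) = k + 1"
      using is_simplexE(5)[OF T] is_simplexE(1,2)[OF T] dim v by (simp add: card_Diff_singleton card_gt_0_iff of_nat_diff Suc_leI)
    have W: "?W \<noteq> {}"
    proof (rule notI)
      assume "?W = {}"
      then have "int 0 = k + 1" using card by (simp only: card.empty)
      then show False using False by simp
    qed
    note G = convex_hull_in_subsimplices[OF T Diff_subset W]
    have "aff_dim (convex hull ?W) = k" 
      unfolding is_simplexE(5)[OF G(2)] G(3) card by simp
    then show ?thesis by (rule facets[OF G(1)])
  qed
  then show ?thesis unfolding \<epsilon> by simp
qed

lemma bubble_forms_poly: "\<omega> \<in> bubble_forms P k T \<Longrightarrow> \<omega> \<in> poly_forms P k T"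
  by (simp add: bubble_forms_def)

lemma bubble_forms_trace:
  "\<omega> \<in> bubble_forms P k T \<Longrightarrow> F \<in> subsimplices T \<Longrightarrow> F \<noteq> T \<Longrightarrow> pullback F \<omega> = 0"
  by (simp add: bubble_forms_def)

lemma reduced_bubble_forms_bubble: "\<omega> \<in> reduced_bubble_forms ori P k T \<Longrightarrow> \<omega> \<in> bubble_forms P k T"
  by (simp add: reduced_bubble_forms_def split: if_splits)

lemma reduced_bubble_forms_poly: "\<omega> \<in> reduced_bubble_forms ori P k T \<Longrightarrow> \<omega> \<in> poly_forms P k T"
  by (intro bubble_forms_poly reduced_bubble_forms_bubble)

lemma reduced_bubble_forms_integral:
  "\<omega> \<in> reduced_bubble_forms ori P k T \<Longrightarrow> k = aff_dim T \<Longrightarrow> form_integral ori T \<omega> = 0"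
  by (simp add: reduced_bubble_forms_def)

lemma reduced_bubble_formsI:
  "\<omega> \<in> bubble_forms P k T \<Longrightarrow> (k = aff_dim T \<Longrightarrow> form_integral ori T \<omega> = 0) \<Longrightarrow>
    \<omega> \<in> reduced_bubble_forms ori P k T"
  unfolding reduced_bubble_forms_def by (cases "k = aff_dim T") (simp_all only: if_True if_False simp_thms mem_Collect_eq)

lemma bubble_forms_smooth: "is_simplex T \<Longrightarrow> \<omega> \<in> bubble_forms P k T \<Longrightarrow> \<omega> \<in> smooth_forms k T"
  by (rule subsetD[OF poly_forms_smooth bubble_forms_poly])

lemma reduced_bubble_forms_smooth:
  "is_simplex T \<Longrightarrow> \<omega> \<in> reduced_bubble_forms ori P k T \<Longrightarrow> \<omega> \<in> smooth_forms k T"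
  by (rule bubble_forms_smooth[OF _ reduced_bubble_forms_bubble])

lemma subspace_bubble_forms: "subspace (bubble_forms P k T)"
proof -
  have eq: "bubble_forms P k T = poly_forms P k T \<inter> (\<Inter>F\<in>subsimplices T - {T}. {\<omega>. pullback F \<omega> = 0})"
    unfolding bubble_forms_def by blast
  show ?thesis
    unfolding eq
    by (intro subspace_inter subspace_poly_forms subspace_Inter)
      (simp add: linear_subspace_kernel[OF linear_pullback])
qed

lemma subspace_reduced_bubble_forms:
  assumes T: "is_simplex T"
  shows "subspace (reduced_bubble_forms ori P k T)"
proof (cases "k = aff_dim T")
  case True
  then have eq: "reduced_bubble_forms ori P k T = {\<omega> \<in> bubble_forms P k T. form_integral ori T \<omega> = 0}"
    by (simp only: reduced_bubble_forms_def if_True simp_thms)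
  show ?thesis unfolding eq
  proof (rule subspaceI)
    show "0 \<in> {\<omega> \<in> bubble_forms P k T. form_integral ori T \<omega> = 0}"
      by (intro CollectI conjI subspace_0[OF subspace_bubble_forms] form_integral_0)
    show "\<omega> + \<eta> \<in> {\<omega> \<in> bubble_forms P k T. form_integral ori T \<omega> = 0}"
      if h: "\<omega> \<in> {\<omega> \<in> bubble_forms P k T. form_integral ori T \<omega> = 0}"
        "\<eta> \<in> {\<omega> \<in> bubble_forms P k T. form_integral ori T \<omega> = 0}" for \<omega> \<eta>
    proof -
      have m: "\<omega> \<in> bubble_forms P k T" "\<eta> \<in> bubble_forms P k T" "form_integral ori T \<omega> = 0" "form_integral ori T \<eta> = 0"
        using h by (simp_all only: mem_Collect_eq)
      have "form_integral ori T (\<omega> + \<eta>) = 0"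
        unfolding form_integral_add[OF T bubble_forms_smooth[OF T m(1)] bubble_forms_smooth[OF T m(2)]] m(3,4) by simp
      then show ?thesis using subspace_add[OF subspace_bubble_forms m(1,2)] by blast
    qed
    show "c *\<^sub>R \<omega> \<in> {\<omega> \<in> bubble_forms P k T. form_integral ori T \<omega> = 0}"
      if h: "\<omega> \<in> {\<omega> \<in> bubble_forms P k T. form_integral ori T \<omega> = 0}" for c \<omega>
    proof -
      have m: "\<omega> \<in> bubble_forms P k T" "form_integral ori T \<omega> = 0"
        using h by (simp_all only: mem_Collect_eq)
      have "form_integral ori T (c *\<^sub>R \<omega>) = 0" unfolding form_integral_scaleR m(2) by simp
      then show ?thesis using subspace_scale[OF subspace_bubble_forms m(1)] by blast
    qed
  qed
next
  case False
  then have "reduced_bubble_forms ori P k T = bubble_forms P k T"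
    by (simp only: reduced_bubble_forms_def if_False)
  then show ?thesis using subspace_bubble_forms[of P k T] by (rule ssubst)
qed

lemma subspace_ext_deriv_image:
  assumes "convex T" "subspace S" "S \<subseteq> smooth_forms k T"
  shows "subspace (ext_deriv T ` S)"
proof (rule subspaceI)
  show "0 \<in> ext_deriv T ` S"
    by (rule image_eqI[where f = "ext_deriv T" and x = 0, OF ext_deriv_0[OF assms(1), symmetric] subspace_0[OF assms(2)]])
  show "x + y \<in> ext_deriv T ` S" if h: "x \<in> ext_deriv T ` S" "y \<in> ext_deriv T ` S" for x y
  proof -
    obtain a where a: "x = ext_deriv T a" "a \<in> S" using h(1) by (rule imageE)
    obtain b where b: "y = ext_deriv T b" "b \<in> S" using h(2) by (rule imageE)
    have "x + y = ext_deriv T (a + b)"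
      unfolding a(1) b(1)
      by (rule ext_deriv_add[OF assms(1) subsetD[OF assms(3) a(2)] subsetD[OF assms(3) b(2)], symmetric])
    then show ?thesis using subspace_add[OF assms(2) a(2) b(2)] by (rule image_eqI)
  qed
  show "c *\<^sub>R x \<in> ext_deriv T ` S" if h: "x \<in> ext_deriv T ` S" for c x
  proof -
    obtain a where a: "x = ext_deriv T a" "a \<in> S" using h by (rule imageE)
    have "c *\<^sub>R x = ext_deriv T (c *\<^sub>R a)"
      unfolding a(1) by (rule ext_deriv_scaleR[OF assms(1) subsetD[OF assms(3) a(2)], symmetric])
    then show ?thesis using subspace_scale[OF assms(2) a(2)] by (rule image_eqI)
  qed
qed

section \<open>Unique solvability on one simplex\<close>

context
  fixes F :: "'a::euclidean_space set" and ori :: "'a set \<Rightarrow> real" and P :: "'a type_assignment"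
  assumes F: "is_simplex F" and ori: "\<And>G. G \<in> subsimplices F \<Longrightarrow> ori G \<noteq> 0" and P: "admissible (P F)"
begin

lemma ext_deriv_reduced_bubble_forms:
  assumes \<rho>: "\<rho> \<in> reduced_bubble_forms ori P k F"
  shows "ext_deriv F \<rho> \<in> reduced_bubble_forms ori P (k + 1) F"
proof (rule reduced_bubble_formsI)
  note smooth = reduced_bubble_forms_smooth[OF F \<rho>]
  note bubble = reduced_bubble_forms_bubble[OF \<rho>]
  have "pullback G (ext_deriv F \<rho>) = 0" if "G \<in> subsimplices F" "G \<noteq> F" for G
  proof -
    have G: "is_simplex G" using that(1) subsimplices_iff[OF F] by blast
    have "pullback G (ext_deriv F \<rho>) = ext_deriv G (pullback G \<rho>)"
      by (rule pullback_ext_deriv[OF is_simplex_convex[OF F] is_simplex_convex[OF G] subsimplices_subset[OF that(1)] smooth])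
    then show ?thesis
      by (simp only: bubble_forms_trace[OF bubble that] ext_deriv_0[OF is_simplex_convex[OF G]])
  qed
  then have "\<forall>G\<in>subsimplices F - {F}. pullback G (ext_deriv F \<rho>) = 0" by (intro ballI) simp
  then show "ext_deriv F \<rho> \<in> bubble_forms P (k + 1) F"
    unfolding bubble_forms_def
    by (intro CollectI conjI ext_deriv_poly_forms[where P = P and k = k, OF F P bubble_forms_poly[OF bubble]])
  assume dim: "k + 1 = aff_dim F"
  show "form_integral ori F (ext_deriv F \<rho>) = 0"
  proof (rule form_integral_ext_deriv_eq_0[OF F smooth dim[symmetric] ori])
    fix G assume G: "G \<in> subsimplices F" "aff_dim G = k"
    then have "G \<noteq> F" using dim by auto
    then have "pullback G \<rho> = 0" by (rule bubble_forms_trace[OF bubble G(1)])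
    then show "form_integral ori G (pullback G \<rho>) = 0" by (simp only: form_integral_0)
  qed
qed

lemma reduced_bubble_forms_exact:
  assumes \<eta>: "\<eta> \<in> reduced_bubble_forms ori P k F" and closed: "ext_deriv F \<eta> = 0"
  shows "\<exists>\<rho>\<in>reduced_bubble_forms ori P (k - 1) F. ext_deriv F \<rho> = \<eta>"
\<comment> \<open>Only in this case does the potential have to satisfy the integral condition; but
  then the degree of \<eta> exceeds the dimension, so \<eta> and its potential 0 are
  trivial.\<close>
proof (cases "k - 1 = aff_dim F")
  case True
  then have "\<eta> = 0" using smooth_forms_eq_0_dimension[OF F reduced_bubble_forms_smooth[OF F \<eta>]] by simp
  then have "ext_deriv F 0 = \<eta>" by (simp only: ext_deriv_0[OF is_simplex_convex[OF F]])
  then show ?thesis using subspace_0[OF subspace_reduced_bubble_forms[OF F]] by (rule bexI)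
next
  case False
  obtain r where r: "trimmed_poly_forms r (k - 1) F \<subseteq> poly_forms P (k - 1) F"
    "poly_forms P (k - 1 + 1) F \<subseteq> trimmed_poly_forms r (k - 1 + 1) F"
    by (rule admissible_trimmed[where P = P and k = "k - 1", OF F P])
  have \<eta>r: "\<eta> \<in> trimmed_poly_forms r k F"
    using r(2) reduced_bubble_forms_poly[OF \<eta>] by (simp add: subset_iff)
  have int: "form_integral (\<lambda>_. 1) F \<eta> = 0" if "k = aff_dim F"
    using reduced_bubble_forms_integral[OF \<eta> that] ori[OF self_in_subsimplices[OF F]]
    by (simp add: form_integral_orientation[of ori])
  have "\<exists>\<rho>\<in>trimmed_poly_forms r (k - 1) F. (\<forall>G\<in>subsimplices F - {F}. pullback G \<rho> = 0) \<and> ext_deriv F \<rho> = \<eta>"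
    by (rule trimmed_bubble_exact[OF F \<eta>r])
      (assumption | rule bubble_forms_trace[OF reduced_bubble_forms_bubble[OF \<eta>]] closed int)+
  then obtain \<rho> where \<rho>: "\<rho> \<in> trimmed_poly_forms r (k - 1) F"
    "\<forall>G\<in>subsimplices F - {F}. pullback G \<rho> = 0" "ext_deriv F \<rho> = \<eta>"
    by (elim bexE conjE)
  have "\<rho> \<in> bubble_forms P (k - 1) F"
    unfolding bubble_forms_def by (intro CollectI conjI subsetD[OF r(1) \<rho>(1)] \<rho>(2))
  then have "\<rho> \<in> reduced_bubble_forms ori P (k - 1) F" using False by (intro reduced_bubble_formsI) simp_all
  with \<rho>(3) show ?thesis by (rule bexI)
qed

context
  fixes g :: "'a set \<Rightarrow> 'a metric"
  assumes g: "riemannian_metric F (g F)"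
begin

lemma reduced_bubble_forms_eq_0:
  assumes \<eta>: "\<eta> \<in> reduced_bubble_forms ori P k F"
    and 1: "\<And>\<rho>. \<rho> \<in> reduced_bubble_forms ori P (k - 1) F \<Longrightarrow> L2_inner F (g F) \<eta> (ext_deriv F \<rho>) = 0"
    and 2: "\<And>\<beta>. \<beta> \<in> reduced_bubble_forms ori P k F \<Longrightarrow> L2_inner F (g F) (ext_deriv F \<eta>) (ext_deriv F \<beta>) = 0"
  shows "\<eta> = 0"
proof -
  note smooth = reduced_bubble_forms_smooth[OF F \<eta>]
  have "ext_deriv F \<eta> = 0"
    by (rule L2_inner_eq_0_imp[OF F g ext_deriv_smooth_forms[OF is_simplex_convex[OF F] smooth] 2[OF \<eta>]])
  from reduced_bubble_forms_exact[OF \<eta> this]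
  obtain \<rho> where \<rho>: "\<rho> \<in> reduced_bubble_forms ori P (k - 1) F" "ext_deriv F \<rho> = \<eta>" by (rule bexE)
  have "L2_inner F (g F) \<eta> \<eta> = 0" using 1[OF \<rho>(1)] by (simp only: \<rho>(2))
  then show ?thesis by (rule L2_inner_eq_0_imp[OF F g smooth])
qed

lemma poly_forms_projection:
  assumes S: "subspace S" "S \<subseteq> poly_forms P k F" and \<tau>: "\<tau> \<in> smooth_forms k F"
  shows "\<exists>b\<in>S. \<forall>b'\<in>S. L2_inner F (g F) b b' = L2_inner F (g F) \<tau> b'"
proof -
  obtain X where X: "finite X" "poly_forms P k F \<subseteq> span X" using poly_forms_finite_dimensional[OF F] by blast
  obtain B where B: "finite B" "B \<subseteq> S" "S = span B"
    by (rule subspace_finite_basis[OF S(1) X(1) order_trans[OF S(2) X(2)]])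
  show ?thesis unfolding B(3)
  proof (rule finite_dimensional_projection[where S = "smooth_forms k F", OF subspace_smooth_forms _ _ _ _ B(1) _ \<tau>])
    show "B \<subseteq> smooth_forms k F" by (rule order_trans[OF order_trans[OF B(2) S(2)] poly_forms_smooth[OF F]])
    show "L2_inner F (g F) (x + y) z = L2_inner F (g F) x z + L2_inner F (g F) y z"
      if "x \<in> smooth_forms k F" "y \<in> smooth_forms k F" "z \<in> smooth_forms k F" for x y z
      by (rule L2_inner_add[OF F g that])
    show "x = 0" if "x \<in> smooth_forms k F" "L2_inner F (g F) x x = 0" for x
      by (rule L2_inner_eq_0_imp[OF F g that])
  qed (rule L2_inner_scaleR[OF F g] L2_inner_commute[OF F g])+
qed

text \<open>For existence the equations are solved in turn: the derivative of
  \<open>\<beta>\<^sub>0\<close> is the projection of the derivative of \<tau>, and an exact form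
  matches the rest of the first equation without affecting the second. Uniqueness is
  \<open>reduced_bubble_forms_eq_0\<close>.\<close>

lemma local_projection_ex1:
  assumes \<tau>: "\<tau> \<in> smooth_forms k F"
  shows "\<exists>!\<eta>. \<eta> \<in> reduced_bubble_forms ori P k F \<and>
    (\<forall>\<rho>\<in>reduced_bubble_forms ori P (k - 1) F.
      L2_inner F (g F) \<eta> (ext_deriv F \<rho>) = L2_inner F (g F) \<tau> (ext_deriv F \<rho>)) \<and>
    (\<forall>\<beta>\<in>reduced_bubble_forms ori P k F.
      L2_inner F (g F) (ext_deriv F \<eta>) (ext_deriv F \<beta>) =
      L2_inner F (g F) (ext_deriv F \<tau>) (ext_deriv F \<beta>))" (is "\<exists>!\<eta>. ?spec \<eta>")
proof (rule ex_ex1I)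
  let ?R = "\<lambda>k. reduced_bubble_forms ori P k F" and ?d = "ext_deriv F" and ?ip = "L2_inner F (g F)"
  note cF = is_simplex_convex[OF F]
  have sm: "\<And>\<eta> k. \<eta> \<in> ?R k \<Longrightarrow> \<eta> \<in> smooth_forms k F" by (rule reduced_bubble_forms_smooth[OF F])
  have dsm: "\<And>\<eta> k. \<eta> \<in> ?R k \<Longrightarrow> ?d \<eta> \<in> smooth_forms (k + 1) F"
    by (rule ext_deriv_smooth_forms[OF cF sm])
  have dR: "\<rho> \<in> ?R (k - 1) \<Longrightarrow> ?d \<rho> \<in> ?R k" for \<rho>
    using ext_deriv_reduced_bubble_forms[of \<rho> "k - 1"] by simp
  have sub: "subspace (?d ` ?R k)" for k
    by (rule subspace_ext_deriv_image[OF cF subspace_reduced_bubble_forms[OF F] subsetI[OF sm]])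
  have "?d ` ?R k \<subseteq> poly_forms P (k + 1) F"
    by (rule image_subsetI[OF reduced_bubble_forms_poly[OF ext_deriv_reduced_bubble_forms]])
  from poly_forms_projection[OF sub this ext_deriv_smooth_forms[OF cF \<tau>]]
  obtain x where x: "x \<in> ?d ` ?R k" "\<forall>y\<in>?d ` ?R k. ?ip x y = ?ip (?d \<tau>) y" by (rule bexE)
  obtain \<beta>\<^sub>0 where x\<^sub>0: "x = ?d \<beta>\<^sub>0" "\<beta>\<^sub>0 \<in> ?R k" using x(1) by (rule imageE)
  note \<beta>\<^sub>0 = x\<^sub>0(2) bspec[OF x(2)[unfolded x\<^sub>0(1)] imageI]
  note s0 = sm[OF \<beta>\<^sub>0(1)]
  have "?d ` ?R (k - 1) \<subseteq> poly_forms P k F"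
    by (rule image_subsetI[OF reduced_bubble_forms_poly[OF dR]])
  from poly_forms_projection[OF sub this subspace_diff[OF subspace_smooth_forms \<tau> s0]]
  obtain y where y: "y \<in> ?d ` ?R (k - 1)" "\<forall>z\<in>?d ` ?R (k - 1). ?ip y z = ?ip (\<tau> - \<beta>\<^sub>0) z" by (rule bexE)
  obtain \<rho>\<^sub>0 where y\<^sub>0: "y = ?d \<rho>\<^sub>0" "\<rho>\<^sub>0 \<in> ?R (k - 1)" using y(1) by (rule imageE)
  note \<rho>\<^sub>0 = y\<^sub>0(2) bspec[OF y(2)[unfolded y\<^sub>0(1)] imageI]
  note b = dR[OF \<rho>\<^sub>0(1)]
  show "\<exists>\<eta>. ?spec \<eta>"
  proof (intro exI conjI ballI)
    show "\<beta>\<^sub>0 + ?d \<rho>\<^sub>0 \<in> ?R k" by (rule subspace_add[OF subspace_reduced_bubble_forms[OF F] \<beta>\<^sub>0(1) b])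
    fix \<rho> assume \<rho>: "\<rho> \<in> ?R (k - 1)"
    note s = sm[OF dR[OF \<rho>]]
    show "?ip (\<beta>\<^sub>0 + ?d \<rho>\<^sub>0) (?d \<rho>) = ?ip \<tau> (?d \<rho>)"
      unfolding L2_inner_add[OF F g s0 sm[OF b] s] \<rho>\<^sub>0(2)[OF \<rho>] L2_inner_diff[OF F g \<tau> s0 s] by simp
  next
    fix \<beta> assume \<beta>: "\<beta> \<in> ?R k"
    have "?d (\<beta>\<^sub>0 + ?d \<rho>\<^sub>0) = ?d \<beta>\<^sub>0"
      unfolding ext_deriv_add[OF cF s0 sm[OF b]] ext_deriv_ext_deriv[OF cF sm[OF \<rho>\<^sub>0(1)]] by (rule add_0_right)
    then show "?ip (?d (\<beta>\<^sub>0 + ?d \<rho>\<^sub>0)) (?d \<beta>) = ?ip (?d \<tau>) (?d \<beta>)" by (simp only: \<beta>\<^sub>0(2)[OF \<beta>])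
  qed
  fix \<eta> \<eta>' assume \<eta>: "?spec \<eta>" and \<eta>': "?spec \<eta>'"
  have R: "\<eta> \<in> ?R k" "\<eta>' \<in> ?R k" by (rule conjunct1[OF \<eta>], rule conjunct1[OF \<eta>'])
  have "\<eta> - \<eta>' = 0"
  proof (rule reduced_bubble_forms_eq_0)
    show "\<eta> - \<eta>' \<in> ?R k" by (rule subspace_diff[OF subspace_reduced_bubble_forms[OF F] R])
    show "?ip (\<eta> - \<eta>') (?d \<rho>) = 0" if "\<rho> \<in> ?R (k - 1)" for \<rho>
      unfolding L2_inner_diff[OF F g sm[OF R(1)] sm[OF R(2)] sm[OF dR[OF that]]] using \<eta> \<eta>' that by simp
    show "?ip (?d (\<eta> - \<eta>')) (?d \<beta>) = 0" if "\<beta> \<in> ?R k" for \<beta>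
      unfolding ext_deriv_diff[OF cF sm[OF R(1)] sm[OF R(2)]] L2_inner_diff[OF F g dsm[OF R(1)] dsm[OF R(2)] dsm[OF that]]
      using \<eta> \<eta>' that by simp
  qed
  then show "\<eta> = \<eta>'" by simp
qed

lemma local_projection:
  assumes "\<tau> \<in> smooth_forms k F"
  shows "local_projection ori P g k F \<tau> \<in> reduced_bubble_forms ori P k F"
    and "\<rho> \<in> reduced_bubble_forms ori P (k - 1) F \<Longrightarrow>
      L2_inner F (g F) (local_projection ori P g k F \<tau>) (ext_deriv F \<rho>) = L2_inner F (g F) \<tau> (ext_deriv F \<rho>)"
    and "\<beta> \<in> reduced_bubble_forms ori P k F \<Longrightarrow>
      L2_inner F (g F) (ext_deriv F (local_projection ori P g k F \<tau>)) (ext_deriv F \<beta>) =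
      L2_inner F (g F) (ext_deriv F \<tau>) (ext_deriv F \<beta>)"
  using theI'[OF local_projection_ex1[OF assms]] unfolding local_projection_def by blast+

end

end

text \<open>The differentials of the coordinates of all vertices but the first are dual to the
  edges, so their wedge product is 1 on the edges. Constant forms of top degree are multiples of it,
  and constants lie in P_0, which is contained in P_1^-.\<close>

lemma vol_form:
  assumes F: "is_simplex F" and ori: "ori F \<noteq> 0"
  shows "vol_form ori F \<in> trimmed_poly_forms 1 (aff_dim F) F"
    and "form_integral ori F (vol_form ori F) = vol F"
proof -
  obtain p ps where ps: "verts F = p # ps" using verts(5)[OF F] by (cases "verts F") auto
  have e: "edges F = map (\<lambda>v. v - p) ps" by (simp add: edges_def ps)
  have dim: "int (length ps) = aff_dim F" using verts(4)[OF F] ps by simp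
  have d: "p \<notin> set ps" "distinct ps" "p \<in> vertices F" "set ps \<subseteq> vertices F"
    using verts(1,2)[OF F] ps by auto
  obtain C where C: "bary_covectors (vertices F) C" by (rule bary_covectors_exist[OF is_simplexE(3)[OF F]])
  define \<alpha> where "\<alpha> vs = covector_wedge (map C ps) (map direction vs)" for vs :: "'a list"
  have alt: "alternating (aff_dim F) \<alpha>"
    unfolding \<alpha>_def using alternating_map[OF alternating_covector_wedge[of "map C ps"] linear_direction] dim by simp
  have val: "C (ps ! i) \<bullet> direction (edges F ! j) = (if i = j then 1 else 0)"
    if "i < length ps" "j < length ps" for i j
  proof -
    have "ps ! i \<in> vertices F" "ps ! j \<in> vertices F" "ps ! i \<noteq> p"
      using d that nth_mem by blast+
    then show ?thesis
      using that d(2,3) by (simp add: e inner_direction_diff bary_covectorsD[OF C] nth_eq_iff_index_eq)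
  qed
  have "Matrix.mat (length ps) (length ps) (\<lambda>(i, j). map C ps ! i \<bullet> map direction (edges F) ! j) = 1\<^sub>m (length ps)"
    using val by (intro eq_matI) (simp_all add: e)
  then have \<alpha>1: "\<alpha> (edges F) = 1" by (simp add: \<alpha>_def covector_wedge_def e)
  have int: "form_integral ori F (pullback F (\<lambda>x. \<beta>)) = ori F * \<beta> (edges F) * simplex_integral (hd (verts F)) (edges F) (\<lambda>_. 1)" for \<beta>
    using simplex_integral_cmult[of "hd (verts F)" "edges F" "\<beta> (edges F)" "\<lambda>_. 1"]
    by (simp add: form_integral_pullback[OF F] vertex_integral_def edges_eq_edge_list)
  let ?s = "simplex_integral (hd (verts F)) (edges F) (\<lambda>_. 1)"
  \<comment> \<open>The factor that turns the integral into the volume.\<close>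
  define c where "c = vol F / (ori F * ?s)"
  have s: "ori F * ?s \<noteq> 0" using ori simplex_integral_1 by simp
  let ?spec = "\<lambda>\<omega>. (\<exists>\<alpha>. alternating (aff_dim F) \<alpha> \<and> \<omega> = pullback F (\<lambda>x. \<alpha>)) \<and> form_integral ori F \<omega> = vol F"
  have spec: "?spec (pullback F (\<lambda>x vs. c * \<alpha> vs))"
    using alternating_scale[OF alt, of c] s by (auto simp: int \<alpha>1 c_def)
  have uniq: "\<omega> = pullback F (\<lambda>x vs. c * \<alpha> vs)" if \<omega>: "?spec \<omega>" for \<omega>
  proof -
    obtain \<beta> where \<beta>: "alternating (aff_dim F) \<beta>" "\<omega> = pullback F (\<lambda>x. \<beta>)" "form_integral ori F \<omega> = vol F"
      using \<omega> by blast
    have \<beta>c: "\<beta> (edges F) = c" using \<beta>(3) s ori by (simp add: \<beta>(2) int c_def field_simps)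
    have alt': "alternating (int (length (edges F))) (\<lambda>vs. \<beta> vs + (- c) * \<alpha> vs)"
      unfolding length_edges[OF F] by (intro alternating_add alternating_scale \<beta>(1) alt)
    have "\<beta> vs + (- c) * \<alpha> vs = 0" if "set vs \<subseteq> tangent_space F" for vs
      by (rule alternating_eq_0_basis[OF alt']) (use that \<beta>c \<alpha>1 tangent_space_eq_span_edges[OF F] in simp_all)
    then show ?thesis unfolding \<beta>(2) by (intro pullback_cong) simp
  qed
  have eq: "vol_form ori F = pullback F (\<lambda>x vs. c * \<alpha> vs)"
    unfolding vol_form_def by (rule the_equality[where P = ?spec, OF spec uniq])
  show "form_integral ori F (vol_form ori F) = vol F" unfolding eq using spec by (rule conjunct2)
  have "full_gen (vertices F) C (\<lambda>_. 0) ps = (\<lambda>x. \<alpha>)"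
    by (simp add: full_gen_def bary_power_def \<alpha>_def fun_eq_iff)
  moreover have "full_gen (vertices F) C (\<lambda>_. 0) ps \<in> full_gens (vertices F) C 0 (aff_dim F)"
    unfolding full_gens_def using dim d(4) by (intro CollectI exI[of _ "\<lambda>_. 0"] exI[of _ ps] conjI) simp_all
  ultimately have "(\<lambda>x. \<alpha>) \<in> full_gens (vertices F) C 0 (aff_dim F)" by (simp only:)
  then have "pullback F (\<lambda>x. \<alpha>) \<in> full_poly_forms 0 (aff_dim F) F"
    unfolding full_poly_forms_eq[OF F C] by (intro imageI span_base)
  then have "c *\<^sub>R pullback F (\<lambda>x. \<alpha>) \<in> full_poly_forms 0 (aff_dim F) F"
    by (rule subspace_scale[OF subspace_full_poly_forms])
  moreover have "c *\<^sub>R pullback F (\<lambda>x. \<alpha>) = vol_form ori F"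
    unfolding eq pullback_scaleR[symmetric] by (simp add: scaleR_fun_def)
  ultimately have "vol_form ori F \<in> full_poly_forms (1 - 1) (aff_dim F) F" by simp
  then show "vol_form ori F \<in> trimmed_poly_forms 1 (aff_dim F) F"
    by (rule subsetD[OF full_subset_trimmed[OF F]])
qed


section \<open>The canonical interpolant\<close>

definition complex_poly_forms ::
    "'a::euclidean_space set set \<Rightarrow> 'a type_assignment \<Rightarrow> int \<Rightarrow> ('a set \<Rightarrow> 'a form) set"
  where "complex_poly_forms \<T> P k = {u.
    (\<forall>T\<in>\<T>. u T \<in> poly_forms P k T \<and> (\<forall>F\<in>subsimplices T. pullback F (u T) = u F)) \<and>
    (\<forall>T. T \<notin> \<T> \<longrightarrow> u T = 0)}"

lemma complex_poly_formsI:
  assumes "\<And>T. T \<in> \<T> \<Longrightarrow> u T \<in> poly_forms P k T"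
    and "\<And>T F. T \<in> \<T> \<Longrightarrow> F \<in> subsimplices T \<Longrightarrow> pullback F (u T) = u F"
    and "\<And>T. T \<notin> \<T> \<Longrightarrow> u T = 0"
  shows "u \<in> complex_poly_forms \<T> P k"
  unfolding complex_poly_forms_def by (intro CollectI conjI ballI allI impI assms)

lemma complex_poly_formsD:
  assumes "u \<in> complex_poly_forms \<T> P k"
  shows "T \<in> \<T> \<Longrightarrow> u T \<in> poly_forms P k T"
    and "T \<in> \<T> \<Longrightarrow> F \<in> subsimplices T \<Longrightarrow> pullback F (u T) = u F"
    and "T \<notin> \<T> \<Longrightarrow> u T = 0"
  using assms unfolding complex_poly_forms_def mem_Collect_eq by simp_all

lemma complex_formsD:
  assumes "u \<in> complex_forms \<T> k"
  shows "T \<in> \<T> \<Longrightarrow> u T \<in> smooth_forms k T"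
    and "T \<in> \<T> \<Longrightarrow> F \<in> subsimplices T \<Longrightarrow> pullback F (u T) = u F"
    and "T \<notin> \<T> \<Longrightarrow> u T = 0"
  using assms unfolding complex_forms_def mem_Collect_eq by simp_all

lemma subspace_complex_poly_forms: "subspace (complex_poly_forms \<T> P k)"
proof (rule subspaceI)
  show "0 \<in> complex_poly_forms \<T> P k"
    by (rule complex_poly_formsI)
      (simp_all only: zero_fun_apply pullback_0 subspace_0[OF subspace_poly_forms])
  fix u assume u: "u \<in> complex_poly_forms \<T> P k"
  show "c *\<^sub>R u \<in> complex_poly_forms \<T> P k" for c
  proof (rule complex_poly_formsI)
    show "(c *\<^sub>R u) T \<in> poly_forms P k T" if "T \<in> \<T>" for T
      unfolding scaleR_fun_def[of c u] by (rule subspace_scale[OF subspace_poly_forms complex_poly_formsD(1)[OF u that]])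
    show "pullback F ((c *\<^sub>R u) T) = (c *\<^sub>R u) F" if "T \<in> \<T>" "F \<in> subsimplices T" for T F
      unfolding scaleR_fun_def[of c u] pullback_scaleR complex_poly_formsD(2)[OF u that] ..
    show "(c *\<^sub>R u) T = 0" if "T \<notin> \<T>" for T
      unfolding scaleR_fun_def[of c u] complex_poly_formsD(3)[OF u that] by (rule scaleR_zero_right)
  qed
  fix v assume v: "v \<in> complex_poly_forms \<T> P k"
  show "u + v \<in> complex_poly_forms \<T> P k"
  proof (rule complex_poly_formsI)
    show "(u + v) T \<in> poly_forms P k T" if "T \<in> \<T>" for T
      unfolding plus_fun_apply[of u v]
      by (rule subspace_add[OF subspace_poly_forms complex_poly_formsD(1)[OF u that] complex_poly_formsD(1)[OF v that]])
    show "pullback F ((u + v) T) = (u + v) F" if "T \<in> \<T>" "F \<in> subsimplices T" for T F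
      unfolding plus_fun_apply[of u v] pullback_add complex_poly_formsD(2)[OF u that] complex_poly_formsD(2)[OF v that] ..
    show "(u + v) T = 0" if "T \<notin> \<T>" for T
      unfolding plus_fun_apply[of u v] complex_poly_formsD(3)[OF u that] complex_poly_formsD(3)[OF v that]
      by (rule add_0_right)
  qed
qed

context
  fixes \<T> :: "'a::euclidean_space set set" and ori :: "'a set \<Rightarrow> real" and P :: "'a type_assignment"
    and ext :: "'a extension" and g :: "'a set \<Rightarrow> 'a metric"
  assumes complex: "finite_complex \<T>" and orientation: "orientation \<T> ori"
    and admissible: "\<And>T. T \<in> \<T> \<Longrightarrow> admissible (P T)" and whitney: "contains_whitney \<T> P"
    and extension: "extension_operators \<T> P ext" and metric: "\<And>T. T \<in> \<T> \<Longrightarrow> riemannian_metric T (g T)"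
begin

lemma complex_simplex: "T \<in> \<T> \<Longrightarrow> is_simplex T"
  using complex by (simp add: finite_complex_def)

lemma complex_subsimplex: "T \<in> \<T> \<Longrightarrow> F \<in> subsimplices T \<Longrightarrow> F \<in> \<T>"
  using complex unfolding finite_complex_def by blast

lemma finite_simplices_of_dim: "finite (simplices_of_dim \<T> m)"
  using complex by (simp add: finite_complex_def simplices_of_dim_def)

lemma orientation_nonzero: "T \<in> \<T> \<Longrightarrow> ori T \<noteq> 0"
  using orientation by (force simp: orientation_def)

lemmas orientation_subsimplex = orientation_nonzero[OF complex_subsimplex]

lemma complex_poly_forms_smooth: "u \<in> complex_poly_forms \<T> P k \<Longrightarrow> T \<in> \<T> \<Longrightarrow> u T \<in> smooth_forms k T"
  by (rule subsetD[OF poly_forms_smooth[OF complex_simplex] complex_poly_formsD(1)])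

lemma complex_deriv_complex_forms:
  assumes \<omega>: "\<omega> \<in> complex_forms \<T> k"
  shows "complex_deriv \<T> \<omega> \<in> complex_forms \<T> (k + 1)"
proof -
  have "pullback F (ext_deriv T (\<omega> T)) = ext_deriv F (\<omega> F)" if T: "T \<in> \<T>" and F: "F \<in> subsimplices T" for T F
    using pullback_ext_deriv[OF is_simplex_convex[OF complex_simplex[OF T]]
        is_simplex_convex[OF complex_simplex[OF complex_subsimplex[OF T F]]] subsimplices_subset[OF F] complex_formsD(1)[OF \<omega> T]]
    by (simp only: complex_formsD(2)[OF \<omega> T F])
  then show ?thesis
    unfolding complex_forms_def complex_deriv_def mem_Collect_eq
    using ext_deriv_smooth_forms[OF is_simplex_convex[OF complex_simplex] complex_formsD(1)[OF \<omega>]] complex_subsimplex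
    by (intro conjI ballI allI impI) simp_all
qed

lemma complex_deriv_complex_poly_forms:
  assumes u: "u \<in> complex_poly_forms \<T> P k"
  shows "complex_deriv \<T> u \<in> complex_poly_forms \<T> P (k + 1)"
proof (rule complex_poly_formsI)
  show "complex_deriv \<T> u T \<in> poly_forms P (k + 1) T" if T: "T \<in> \<T>" for T
    unfolding complex_deriv_def if_P[OF T]
    by (rule ext_deriv_poly_forms[where P = P and k = k, OF complex_simplex[OF T] admissible[OF T] complex_poly_formsD(1)[OF u T]])
  show "pullback F (complex_deriv \<T> u T) = complex_deriv \<T> u F" if T: "T \<in> \<T>" and F: "F \<in> subsimplices T" for T F
    using pullback_ext_deriv[OF is_simplex_convex[OF complex_simplex[OF T]]
        is_simplex_convex[OF complex_simplex[OF complex_subsimplex[OF T F]]] subsimplices_subset[OF F]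
        complex_poly_forms_smooth[OF u T]]
    unfolding complex_deriv_def if_P[OF T] if_P[OF complex_subsimplex[OF T F]] complex_poly_formsD(2)[OF u T F] .
  show "complex_deriv \<T> u T = 0" if "T \<notin> \<T>" for T
    unfolding complex_deriv_def if_not_P[OF that] ..
qed

lemma complex_poly_forms_eq_0:
  assumes v: "v \<in> complex_poly_forms \<T> P k"
    and integral: "\<And>F. F \<in> \<T> \<Longrightarrow> aff_dim F = k \<Longrightarrow> form_integral ori F (v F) = 0"
    and 1: "\<And>F \<rho>. F \<in> \<T> \<Longrightarrow> k \<le> aff_dim F \<Longrightarrow> \<rho> \<in> reduced_bubble_forms ori P (k - 1) F \<Longrightarrow>
      L2_inner F (g F) (v F) (ext_deriv F \<rho>) = 0"
    and 2: "\<And>F \<beta>. F \<in> \<T> \<Longrightarrow> k \<le> aff_dim F \<Longrightarrow> \<beta> \<in> reduced_bubble_forms ori P k F \<Longrightarrow>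
      L2_inner F (g F) (ext_deriv F (v F)) (ext_deriv F \<beta>) = 0"
  shows "v = 0"
proof -
  have "v F = 0" if "F \<in> \<T>" for F
    using that
  proof (induction "nat (aff_dim F)" arbitrary: F rule: less_induct)
    case less
    note FT = less.prems
    note F = complex_simplex[OF FT]
    show ?case
    proof (cases "aff_dim F < k")
      case True
      then show ?thesis
        by (intro smooth_forms_eq_0_dimension[OF F complex_poly_forms_smooth[OF v FT]] disjI2)
    next
      case False
      have "pullback G (v F) = 0" if G: "G \<in> subsimplices F - {F}" for G
      proof -
        have "aff_dim G < aff_dim F" "G \<in> subsimplices F"
          using aff_dim_subsimplices_less[OF F] G by auto
        moreover have "0 \<le> aff_dim G"
          by (rule is_simplex_aff_dim_nonneg[OF complex_simplex[OF complex_subsimplex[OF FT \<open>G \<in> subsimplices F\<close>]]])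
        ultimately have "v G = 0"
          by (intro less.hyps[OF _ complex_subsimplex[OF FT]]) simp_all
        then show ?thesis using complex_poly_formsD(2)[OF v FT \<open>G \<in> subsimplices F\<close>] by (simp only:)
      qed
      then have "v F \<in> bubble_forms P k F"
        unfolding bubble_forms_def by (intro CollectI conjI ballI complex_poly_formsD(1)[OF v FT])
      then have R: "v F \<in> reduced_bubble_forms ori P k F"
        by (rule reduced_bubble_formsI) (rule integral[OF FT], simp)
      show ?thesis
        by (rule reduced_bubble_forms_eq_0[where ori = ori and P = P and g = g, OF F orientation_subsimplex[OF FT] admissible[OF FT] metric[OF FT] R])
          (use 1[OF FT] 2[OF FT] False in simp_all)
    qed
  qed
  then have "v F = 0" for F using complex_poly_formsD(3)[OF v] by blast
  then show ?thesis by (simp only: fun_eq_iff[of v 0] zero_fun_apply simp_thms)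
qed

lemma global_ext_complex_poly_forms:
  assumes F: "F \<in> \<T>" and \<eta>: "\<eta> \<in> bubble_forms P k F"
  shows "global_ext \<T> ext k F \<eta> \<in> complex_poly_forms \<T> P k"
proof (rule complex_poly_formsI)
  show "global_ext \<T> ext k F \<eta> T \<in> poly_forms P k T" if T: "T \<in> \<T>" for T
  proof (cases "F \<in> subsimplices T")
    case True
    then have "ext k F T \<eta> \<in> poly_forms P k T"
      using extension T \<eta> unfolding extension_operators_def by blast
    then show ?thesis using T True by (simp only: global_ext_def simp_thms if_True)
  next
    case False
    then show ?thesis
      by (simp only: global_ext_def simp_thms if_False subspace_0[OF subspace_poly_forms])
  qed
  show "pullback G (global_ext \<T> ext k F \<eta> T) = global_ext \<T> ext k F \<eta> G" if T: "T \<in> \<T>" and G: "G \<in> subsimplices T" for T G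
  proof (cases "F \<in> subsimplices G")
    case True
    have FT: "F \<in> subsimplices T" by (rule subsimplices_trans[OF complex_simplex[OF T] G True])
    have "pullback G (ext k F T \<eta>) = ext k F G \<eta>"
      using extension T G True \<eta> unfolding extension_operators_def by blast
    then show ?thesis
      using True FT T complex_subsimplex[OF T G] by (simp only: global_ext_def simp_thms if_True)
  next
    case False
    have "pullback G (ext k F T \<eta>) = 0" if "F \<in> subsimplices T"
      using extension T G False \<eta> that unfolding extension_operators_def by blast
    then show ?thesis
      using False T by (cases "F \<in> subsimplices T") (simp_all only: global_ext_def simp_thms if_True if_False pullback_0)
  qed
  show "global_ext \<T> ext k F \<eta> T = 0" if "T \<notin> \<T>" for T
    using that by (simp only: global_ext_def simp_thms if_False)
qed

lemma global_ext_self: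
  assumes F: "F \<in> \<T>" and \<eta>: "\<eta> \<in> bubble_forms P k F"
  shows "global_ext \<T> ext k F \<eta> F = \<eta>"
proof -
  have "ext k F F \<eta> = \<eta>" using extension F \<eta> unfolding extension_operators_def by blast
  then show ?thesis
    using F self_in_subsimplices[OF complex_simplex[OF F]] by (simp only: global_ext_def simp_thms if_True)
qed

text \<open>A different simplex of at least the same dimension is not a face of \<open>F\<close>.
  The construction is therefore triangular in the dimension: later levels do not disturb what has
  been fixed on \<open>F\<close>.\<close>

lemma global_ext_other:
  assumes F: "F \<in> \<T>" and "aff_dim F \<le> aff_dim G" "G \<noteq> F"
  shows "global_ext \<T> ext k G \<eta> F = 0"
proof -
  have "G \<notin> subsimplices F" using aff_dim_subsimplices_less[OF complex_simplex[OF F], of G] assms(2,3) by auto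
  then show ?thesis by (simp only: global_ext_def simp_thms if_False)
qed

lemma sum_global_ext_same_dim:
  assumes F: "F \<in> \<T>" and dim: "aff_dim F = m" and \<eta>: "\<eta> F \<in> bubble_forms P k F"
  shows "(\<Sum>G\<in>simplices_of_dim \<T> m. c G *\<^sub>R global_ext \<T> ext k G (\<eta> G)) F = c F *\<^sub>R \<eta> F"
proof -
  have "(\<Sum>G\<in>simplices_of_dim \<T> m. c G *\<^sub>R global_ext \<T> ext k G (\<eta> G)) F =
      (\<Sum>G\<in>simplices_of_dim \<T> m. c G *\<^sub>R global_ext \<T> ext k G (\<eta> G) F)"
    by (simp only: sum_fun_apply scaleR_fun_def[of _ "global_ext _ _ _ _ _"])
  also have "\<dots> = (\<Sum>G\<in>simplices_of_dim \<T> m. if F = G then c F *\<^sub>R \<eta> F else 0)"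
  proof (rule sum.cong[OF refl])
    fix G assume G: "G \<in> simplices_of_dim \<T> m"
    show "c G *\<^sub>R global_ext \<T> ext k G (\<eta> G) F = (if F = G then c F *\<^sub>R \<eta> F else 0)"
    proof (cases "F = G")
      case True
      then show ?thesis using global_ext_self[OF F \<eta>] by (simp only: simp_thms if_True)
    next
      case False
      have "global_ext \<T> ext k G (\<eta> G) F = 0"
        by (rule global_ext_other[OF F]) (use G dim False in \<open>auto simp: simplices_of_dim_def\<close>)
      then show ?thesis using False by (simp only: if_False scaleR_zero_right)
    qed
  qed
  also have "\<dots> = (if F \<in> simplices_of_dim \<T> m then c F *\<^sub>R \<eta> F else 0)"
    by (rule sum.delta'[OF finite_simplices_of_dim])
  also have "\<dots> = c F *\<^sub>R \<eta> F"
    using F dim by (simp only: simplices_of_dim_def mem_Collect_eq simp_thms if_True)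
  finally show ?thesis .
qed

lemma sum_global_ext_higher_dim:
  assumes F: "F \<in> \<T>" and dim: "aff_dim F < m"
  shows "(\<Sum>G\<in>simplices_of_dim \<T> m. global_ext \<T> ext k G (\<eta> G)) F = 0"
proof -
  have "global_ext \<T> ext k G (\<eta> G) F = 0" if "G \<in> simplices_of_dim \<T> m" for G
    by (rule global_ext_other[OF F]) (use that dim in \<open>auto simp: simplices_of_dim_def\<close>)
  then have "(\<Sum>G\<in>simplices_of_dim \<T> m. global_ext \<T> ext k G (\<eta> G) F) = 0" by (intro sum.neutral ballI)
  then show ?thesis by (simp only: sum_fun_apply)
qed

lemma vol_form_bubble:
  assumes F: "F \<in> \<T>" and dim: "aff_dim F = k"
  shows "vol_form ori F \<in> bubble_forms P k F"
proof -
  have v: "vol_form ori F \<in> trimmed_poly_forms 1 k F"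
    using vol_form(1)[where ori = ori, OF complex_simplex[OF F] orientation_nonzero[OF F]] by (simp only: dim)
  have smooth: "vol_form ori F \<in> smooth_forms k F"
    by (rule subsetD[OF trimmed_poly_forms_smooth[OF complex_simplex[OF F]] v])
  have "pullback G (vol_form ori F) = 0" if G: "G \<in> subsimplices F - {F}" for G
  proof (rule smooth_forms_eq_0_dimension[OF _ pullback_smooth_forms[OF _ smooth]])
    show "is_simplex G" using complex_simplex[OF complex_subsimplex[OF F]] G by blast
    show "G \<subseteq> F" using subsimplices_subset G by blast
    show "k < 0 \<or> aff_dim G < k" using aff_dim_subsimplices_less[OF complex_simplex[OF F], of G] G dim by auto
  qed
  moreover have "vol_form ori F \<in> poly_forms P k F"
    using whitney F v unfolding contains_whitney_def by blast
  ultimately show ?thesis unfolding bubble_forms_def by (intro CollectI conjI ballI)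
qed

lemma whitney_interpolant_complex_poly_forms:
  "whitney_interpolant \<T> ori ext k \<omega> \<in> complex_poly_forms \<T> P k"
  unfolding whitney_interpolant_def
  by (intro subspace_sum[OF subspace_complex_poly_forms] subspace_scale[OF subspace_complex_poly_forms]
      global_ext_complex_poly_forms vol_form_bubble) (simp_all add: simplices_of_dim_def)

lemma whitney_interpolant_integral:
  assumes F: "F \<in> \<T>" and dim: "aff_dim F = k"
  shows "form_integral ori F (whitney_interpolant \<T> ori ext k \<omega> F) = form_integral ori F (\<omega> F)"
proof -
  have "whitney_interpolant \<T> ori ext k \<omega> F = (form_integral ori F (\<omega> F) / vol F) *\<^sub>R vol_form ori F"
    unfolding whitney_interpolant_def
    by (rule sum_global_ext_same_dim[OF F dim, where c = "\<lambda>F. form_integral ori F (\<omega> F) / vol F"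
          and \<eta> = "vol_form ori", OF vol_form_bubble[OF F dim]])
  then show ?thesis
    using vol_form(2)[where ori = ori, OF complex_simplex[OF F] orientation_nonzero[OF F]] vol_nonzero[OF complex_simplex[OF F]]
    by (simp only: form_integral_scaleR) simp
qed

section \<open>Characterization of the interpolant of one family\<close>

context
  fixes k :: int and \<omega> :: "'a set \<Rightarrow> 'a form"
  assumes \<omega>: "\<omega> \<in> complex_forms \<T> k"
begin

definition remainder :: "int \<Rightarrow> 'a set \<Rightarrow> 'a form"
  where "remainder m = \<omega> - whitney_interpolant \<T> ori ext k \<omega> - (\<Sum>l\<in>{k..<m}. level_interpolant \<T> ori P ext g k \<omega> l)"

lemma level_interpolant_remainder:
  "level_interpolant \<T> ori P ext g k \<omega> m =
    (\<Sum>F\<in>simplices_of_dim \<T> m. global_ext \<T> ext k F (local_projection ori P g k F (remainder m F)))"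
  unfolding remainder_def by (rule level_interpolant.simps)

text \<open>The assumption on earlier levels breaks a circle: a level lies in the polynomial space
  because its remainder is smooth, and the remainder is smooth because the earlier levels are
  polynomial.\<close>

lemma remainder_smooth_if:
  assumes "\<And>l. k \<le> l \<Longrightarrow> l < m \<Longrightarrow> level_interpolant \<T> ori P ext g k \<omega> l \<in> complex_poly_forms \<T> P k"
    and F: "F \<in> \<T>"
  shows "remainder m F \<in> smooth_forms k F"
proof -
  have "(\<Sum>l\<in>{k..<m}. level_interpolant \<T> ori P ext g k \<omega> l) \<in> complex_poly_forms \<T> P k"
    by (rule subspace_sum[OF subspace_complex_poly_forms]) (use assms(1) in simp)
  then show ?thesis
    unfolding remainder_def minus_apply[of _ _ F]
    by (intro subspace_diff[OF subspace_smooth_forms] complex_formsD(1)[OF \<omega> F] complex_poly_forms_smooth[OF _ F]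
        whitney_interpolant_complex_poly_forms)
qed

lemma local_projection_complex:
  assumes "F \<in> \<T>" "\<tau> \<in> smooth_forms k F"
  shows "local_projection ori P g k F \<tau> \<in> reduced_bubble_forms ori P k F"
    and "\<rho> \<in> reduced_bubble_forms ori P (k - 1) F \<Longrightarrow>
      L2_inner F (g F) (local_projection ori P g k F \<tau>) (ext_deriv F \<rho>) = L2_inner F (g F) \<tau> (ext_deriv F \<rho>)"
    and "\<beta> \<in> reduced_bubble_forms ori P k F \<Longrightarrow>
      L2_inner F (g F) (ext_deriv F (local_projection ori P g k F \<tau>)) (ext_deriv F \<beta>) =
      L2_inner F (g F) (ext_deriv F \<tau>) (ext_deriv F \<beta>)"
  by (rule local_projection[where ori = ori and P = P and g = g,
        OF complex_simplex[OF assms(1)] orientation_subsimplex[OF assms(1)] admissible[OF assms(1)] metric[OF assms(1)] assms(2)];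
      assumption)+

lemma level_interpolant_complex_poly_forms:
  "level_interpolant \<T> ori P ext g k \<omega> m \<in> complex_poly_forms \<T> P k"
proof (induction "nat (m - k)" arbitrary: m rule: less_induct)
  case less
  have IH: "level_interpolant \<T> ori P ext g k \<omega> l \<in> complex_poly_forms \<T> P k" if "k \<le> l" "l < m" for l
    by (rule less.hyps) (use that in simp)
  have "global_ext \<T> ext k F (local_projection ori P g k F (remainder m F)) \<in> complex_poly_forms \<T> P k"
    if "F \<in> simplices_of_dim \<T> m" for F
  proof -
    have F: "F \<in> \<T>" using that by (simp add: simplices_of_dim_def)
    show ?thesis
      by (rule global_ext_complex_poly_forms[OF F reduced_bubble_forms_bubble[OF local_projection_complex(1)[OF F remainder_smooth_if[OF IH F]]]])
  qed
  then show ?case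
    unfolding level_interpolant_remainder by (rule subspace_sum[OF subspace_complex_poly_forms])
qed

lemmas remainder_smooth = remainder_smooth_if[OF level_interpolant_complex_poly_forms]

lemma canonical_interpolant_complex_poly_forms:
  "canonical_interpolant \<T> ori P ext g k \<omega> \<in> complex_poly_forms \<T> P k"
  unfolding canonical_interpolant_def
  by (intro subspace_add[OF subspace_complex_poly_forms] subspace_sum[OF subspace_complex_poly_forms]
      whitney_interpolant_complex_poly_forms level_interpolant_complex_poly_forms)

text \<open>On \<open>F\<close> the levels above its dimension vanish, its own level contributes
  only the local projection on \<open>F\<close>, and the lower levels are what the remainder has
  already subtracted.\<close>

lemma canonical_interpolant_component:
  assumes F: "F \<in> \<T>" and dim: "k \<le> aff_dim F"
  shows "\<omega> F - canonical_interpolant \<T> ori P ext g k \<omega> F =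
    remainder (aff_dim F) F - local_projection ori P g k F (remainder (aff_dim F) F)"
proof -
  let ?L = "level_interpolant \<T> ori P ext g k \<omega>" and ?m = "aff_dim F"
  have "aff_dim F \<in> aff_dim ` \<T>" using F by (rule imageI)
  then have n: "?m \<le> complex_dim \<T>"
    using complex unfolding complex_dim_def finite_complex_def by (intro Max_ge) simp_all
  have m: "?L ?m F = local_projection ori P g k F (remainder ?m F)"
    using sum_global_ext_same_dim[OF F refl, where c = "\<lambda>_. 1" and \<eta> = "\<lambda>F. local_projection ori P g k F (remainder ?m F)",
        OF reduced_bubble_forms_bubble[OF local_projection_complex(1)[OF F remainder_smooth[OF F]]]]
    by (simp only: level_interpolant_remainder scaleR_one)
  have high: "?L l F = 0" if "?m < l" for l
    unfolding level_interpolant_remainder by (rule sum_global_ext_higher_dim[OF F that])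
  have "(\<Sum>l\<in>{k..complex_dim \<T>}. ?L l F) = (\<Sum>l\<in>{k..?m}. ?L l F)"
    by (rule sum.mono_neutral_right) (use n high in auto)
  also have "{k..?m} = insert ?m {k..<?m}" using dim by auto
  also have "(\<Sum>l\<in>\<dots>. ?L l F) = ?L ?m F + (\<Sum>l\<in>{k..<?m}. ?L l F)"
    by (rule sum.insert) simp_all
  finally have "canonical_interpolant \<T> ori P ext g k \<omega> F = whitney_interpolant \<T> ori ext k \<omega> F +
      (local_projection ori P g k F (remainder ?m F) + (\<Sum>l\<in>{k..<?m}. ?L l F))"
    unfolding canonical_interpolant_def plus_fun_apply[of _ _ F] sum_fun_apply m by (rule arg_cong)
  then show ?thesis
    unfolding remainder_def[of ?m] minus_apply[of _ _ F] sum_fun_apply by (simp add: algebra_simps)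
qed

lemma canonical_interpolant_orthogonal:
  assumes F: "F \<in> \<T>" and dim: "k \<le> aff_dim F"
  shows "\<rho> \<in> reduced_bubble_forms ori P (k - 1) F \<Longrightarrow>
      L2_inner F (g F) (\<omega> F - canonical_interpolant \<T> ori P ext g k \<omega> F) (ext_deriv F \<rho>) = 0"
    and "\<beta> \<in> reduced_bubble_forms ori P k F \<Longrightarrow>
      L2_inner F (g F) (ext_deriv F (\<omega> F - canonical_interpolant \<T> ori P ext g k \<omega> F)) (ext_deriv F \<beta>) = 0"
proof -
  let ?\<tau> = "remainder (aff_dim F) F"
  let ?\<eta> = "local_projection ori P g k F ?\<tau>"
  note F' = complex_simplex[OF F]
  note cF = is_simplex_convex[OF F']
  note \<tau> = remainder_smooth[OF F, of "aff_dim F"]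
  note \<eta> = reduced_bubble_forms_smooth[OF F' local_projection_complex(1)[OF F \<tau>]]
  note diff = L2_inner_diff[OF F' metric[OF F]]
  have d: "\<And>\<theta> j. \<theta> \<in> smooth_forms j F \<Longrightarrow> ext_deriv F \<theta> \<in> smooth_forms (j + 1) F"
    by (rule ext_deriv_smooth_forms[OF cF])
  show "L2_inner F (g F) (\<omega> F - canonical_interpolant \<T> ori P ext g k \<omega> F) (ext_deriv F \<rho>) = 0"
    if \<rho>: "\<rho> \<in> reduced_bubble_forms ori P (k - 1) F"
  proof -
    have "ext_deriv F \<rho> \<in> smooth_forms k F"
      using d[OF reduced_bubble_forms_smooth[OF F' \<rho>]] by simp
    from diff[OF \<tau> \<eta> this] show ?thesis
      unfolding canonical_interpolant_component[OF F dim] local_projection_complex(2)[OF F \<tau> \<rho>] by simp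
  qed
  show "L2_inner F (g F) (ext_deriv F (\<omega> F - canonical_interpolant \<T> ori P ext g k \<omega> F)) (ext_deriv F \<beta>) = 0"
    if \<beta>: "\<beta> \<in> reduced_bubble_forms ori P k F"
    using diff[OF d[OF \<tau>] d[OF \<eta>] d[OF reduced_bubble_forms_smooth[OF F' \<beta>]]]
    unfolding canonical_interpolant_component[OF F dim] ext_deriv_diff[OF cF \<tau> \<eta>]
      local_projection_complex(3)[OF F \<tau> \<beta>] by simp
qed

text \<open>The Whitney part reproduces the integrals over \<open>k\<close>-simplices, and the local
  projection on a \<open>k\<close>-simplex lies in the reduced space, where the integral is
  zero.\<close>

lemma canonical_interpolant_integral:
  assumes F: "F \<in> \<T>" and dim: "aff_dim F = k"
  shows "form_integral ori F (\<omega> F - canonical_interpolant \<T> ori P ext g k \<omega> F) = 0"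
proof -
  let ?w = "whitney_interpolant \<T> ori ext k \<omega> F"
  note F' = complex_simplex[OF F]
  have w: "?w \<in> smooth_forms k F"
    by (rule complex_poly_forms_smooth[OF whitney_interpolant_complex_poly_forms F])
  have rem: "remainder (aff_dim F) F = \<omega> F - ?w"
    by (simp only: remainder_def dim atLeastLessThan_empty[OF order_refl] sum.empty minus_apply[of _ _ F]
        zero_fun_apply diff_0_right)
  have \<tau>: "\<omega> F - ?w \<in> smooth_forms k F"
    by (rule subspace_diff[OF subspace_smooth_forms complex_formsD(1)[OF \<omega> F] w])
  note \<eta> = local_projection_complex(1)[OF F \<tau>]
  have "form_integral ori F (\<omega> F - ?w - local_projection ori P g k F (\<omega> F - ?w)) = 0"
    unfolding form_integral_diff[OF F' \<tau> reduced_bubble_forms_smooth[OF F' \<eta>]]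
      form_integral_diff[OF F' complex_formsD(1)[OF \<omega> F] w]
      reduced_bubble_forms_integral[OF \<eta> dim[symmetric]] whitney_interpolant_integral[OF F dim] by simp
  moreover have "k \<le> aff_dim F" by (simp add: dim)
  note canonical_interpolant_component[OF F this]
  ultimately show ?thesis by (simp only: rem)
qed

end

lemma complex_deriv_canonical_interpolant:
  assumes \<omega>: "\<omega> \<in> complex_forms \<T> k"
  shows "complex_deriv \<T> (canonical_interpolant \<T> ori P ext g k \<omega>) =
    canonical_interpolant \<T> ori P ext g (k + 1) (complex_deriv \<T> \<omega>)"
proof -
  let ?w = "complex_deriv \<T> \<omega>"
  let ?u = "canonical_interpolant \<T> ori P ext g k \<omega>"
  let ?u' = "canonical_interpolant \<T> ori P ext g (k + 1) ?w"
  let ?v = "complex_deriv \<T> ?u - ?u'"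
  note simplex = complex_simplex
  note convex = is_simplex_convex[OF simplex]
  have w: "?w \<in> complex_forms \<T> (k + 1)" by (rule complex_deriv_complex_forms[OF \<omega>])
  have u: "?u \<in> complex_poly_forms \<T> P k" by (rule canonical_interpolant_complex_poly_forms[OF \<omega>])
  have u': "?u' \<in> complex_poly_forms \<T> P (k + 1)" by (rule canonical_interpolant_complex_poly_forms[OF w])
  note smooth = complex_formsD(1)[OF \<omega>] complex_poly_forms_smooth[OF u]
    complex_formsD(1)[OF w] complex_poly_forms_smooth[OF u']
  have a: "?w F - ?u' F \<in> smooth_forms (k + 1) F" if "F \<in> \<T>" for F
    by (rule subspace_diff[OF subspace_smooth_forms smooth(3,4)[OF that]])
  have b: "\<omega> F - ?u F \<in> smooth_forms k F" if "F \<in> \<T>" for F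
    by (rule subspace_diff[OF subspace_smooth_forms smooth(1,2)[OF that]])
  have db: "ext_deriv F (\<omega> F - ?u F) \<in> smooth_forms (k + 1) F" if "F \<in> \<T>" for F
    by (rule ext_deriv_smooth_forms[OF convex[OF that] b[OF that]])
  \<comment> \<open>The difference of the two sides is a difference of interpolation errors: that of
    the derivative and the derivative of that of \<omega>. Each of them has known vanishing
    data.\<close>
  have v: "?v F = (?w F - ?u' F) - ext_deriv F (\<omega> F - ?u F)" if F: "F \<in> \<T>" for F
    unfolding minus_apply[of _ _ F] complex_deriv_def if_P[OF F] ext_deriv_diff[OF convex[OF F] smooth(1,2)[OF F]] by simp
  have dv: "ext_deriv F (?v F) = ext_deriv F (?w F - ?u' F)" if F: "F \<in> \<T>" for F
    unfolding v[OF F] ext_deriv_diff[OF convex[OF F] a[OF F] db[OF F]] ext_deriv_ext_deriv[OF convex[OF F] b[OF F]]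
    by (rule diff_0_right)
  note diff = L2_inner_diff[OF simplex metric]
  have "?v = 0"
  proof (rule complex_poly_forms_eq_0[where k = "k + 1"])
    show "?v \<in> complex_poly_forms \<T> P (k + 1)"
      by (rule subspace_diff[OF subspace_complex_poly_forms complex_deriv_complex_poly_forms[OF u] u'])
  next
    fix F assume F: "F \<in> \<T>" and dim: "aff_dim F = k + 1"
    have "form_integral ori F (ext_deriv F (\<omega> F - ?u F)) = 0"
    proof (rule form_integral_ext_deriv_eq_0[OF simplex[OF F] b[OF F] dim orientation_subsimplex[OF F]])
      fix G assume G: "G \<in> subsimplices F" and dimG: "aff_dim G = k"
      have GT: "G \<in> \<T>" by (rule complex_subsimplex[OF F G])
      show "form_integral ori G (pullback G (\<omega> F - ?u F)) = 0"
        unfolding pullback_diff complex_formsD(2)[OF \<omega> F G] complex_poly_formsD(2)[OF u F G]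
        by (rule canonical_interpolant_integral[OF \<omega> GT dimG])
    qed
    moreover have "form_integral ori F (?w F - ?u' F) = 0"
      by (rule canonical_interpolant_integral[OF w F dim])
    ultimately show "form_integral ori F (?v F) = 0"
      unfolding v[OF F] form_integral_diff[OF simplex[OF F] a[OF F] db[OF F]] by simp
  next
    fix F \<rho> assume F: "F \<in> \<T>" and dim: "k + 1 \<le> aff_dim F" and \<rho>: "\<rho> \<in> reduced_bubble_forms ori P (k + 1 - 1) F"
    have \<rho>': "\<rho> \<in> reduced_bubble_forms ori P k F" using \<rho> by simp
    have "k \<le> aff_dim F" using dim by simp
    \<comment> \<open>The second orthogonality in degree \<open>k\<close>, tested with \<rho>,
      supplies one half of the first orthogonality in degree \<open>k + 1\<close>.\<close>
    note canonical_interpolant_orthogonal(2)[OF \<omega> F this \<rho>']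
    moreover note canonical_interpolant_orthogonal(1)[OF w F dim \<rho>]
    moreover have "ext_deriv F \<rho> \<in> smooth_forms (k + 1) F"
      by (rule ext_deriv_smooth_forms[OF convex[OF F] reduced_bubble_forms_smooth[OF simplex[OF F] \<rho>']])
    note diff[OF F F a[OF F] db[OF F] this]
    ultimately show "L2_inner F (g F) (?v F) (ext_deriv F \<rho>) = 0" unfolding v[OF F] by simp
  next
    fix F \<beta> assume F: "F \<in> \<T>" and dim: "k + 1 \<le> aff_dim F" and \<beta>: "\<beta> \<in> reduced_bubble_forms ori P (k + 1) F"
    show "L2_inner F (g F) (ext_deriv F (?v F)) (ext_deriv F \<beta>) = 0"
      unfolding dv[OF F] by (rule canonical_interpolant_orthogonal(2)[OF w F dim \<beta>])
  qed
  then show ?thesis by simp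
qed

end

theorem lemma5p15:
  fixes \<T> :: "'a::euclidean_space set set"
    and ori :: "'a set \<Rightarrow> real"
    and P :: "'a set \<Rightarrow> int \<Rightarrow> poly_type"
    and ext :: "int \<Rightarrow> 'a set \<Rightarrow> 'a set \<Rightarrow> 'a form \<Rightarrow> 'a form"
    and g :: "'a set \<Rightarrow> 'a metric"
    and k :: int
    and \<omega> :: "'a set \<Rightarrow> 'a form"
  assumes "finite_complex \<T>"
    and "orientation \<T> ori"
    and "\<And>T. T \<in> \<T> \<Longrightarrow> admissible (P T)"
    and "hierarchy \<T> P"
    and "contains_whitney \<T> P"
    and "extension_operators \<T> P ext"
    and "\<And>T. T \<in> \<T> \<Longrightarrow> riemannian_metric T (g T)"
    and "\<omega> \<in> complex_forms \<T> k"
  shows "complex_deriv \<T> (canonical_interpolant \<T> ori P ext g k \<omega>) =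
    canonical_interpolant \<T> ori P ext g (k + 1) (complex_deriv \<T> \<omega>)"
  by (rule complex_deriv_canonical_interpolant[OF assms(1,2) _ assms(5,6) _ assms(8)])
    (fact assms(3) assms(7))+

end
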